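(* Let $d\ge 1$, $T>0$ and $\epsilon>0$. Let $b:\mathbb{R}^d\to\mathbb{R}^d$ be bounded and Lipschitz continuous, and let $\sigma:\mathbb{R}^d\to\mathbb{R}^{d\times d}$ be bounded, Lipschitz continuous and uniformly nondegenerate, with bounded inverse. Let $h:\mathbb{R}^d\to\mathbb{R}$ be continuous and bounded, and let $\bar u:[0,T]\times\mathbb{R}^d\to\mathbb{R}^d$ be uniformly bounded, continuous in $t$ and Lipschitz continuous in $x$. Assume that the terminal value problem $$\Phi^{\epsilon}_t(t,x)+\mathcal{L}^{\epsilon}_{\bar u}\Phi^{\epsilon}(t,x)+\frac{1}{\epsilon}\|\bar u(t,x)\|^2\,\Phi^{\epsilon}(t,x)=0,\quad (t,x)\in[0,T)\times\mathbb{R}^d,$$ $$\Phi^{\epsilon}(T,x)=e^{-\frac{2}{\epsilon}h(x)},\quad x\in\mathbb{R}^d,$$ has a unique bounded solution $\Phi^{\epsilon}\in\mathcal{C}^{1,2}([0,T]\times\mathbb{R}^d)$, and that for every $\delta\in(0,T)$ the derivatives of $\Phi^{\epsilon}$ up to second order with respect to $x$ and of first order with respect to $t$ are bounded and continuous on $[\delta,T]\times\mathbb{R}^d$. Then $\Phi^{\epsilon}(t,x)=Q^{\epsilon}(t,x;\bar u)$ for all $(t,x)\in[0,T]\times\mathbb{R}^d$, where $\mathcal{L}^{\epsilon}_{\bar u}$ and the second moment $Q^{\epsilon}(t,x;\bar u)$ are as defined in the context.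
   Context: Here $\|\cdot\|$ and $\langle\cdot,\cdot\rangle$ are the Euclidean norm and inner product on $\mathbb{R}^d$, and for matrices $A=[a_{ij}]$, $B=[b_{ij}]$ one writes $A:B=\sum_{i,j}a_{ij}b_{ij}$. Operator. For $f\in\mathcal{C}^2(\mathbb{R}^d)$ (acting in the $x$ variable, with $t$ as a parameter), $$\mathcal{L}^{\epsilon}_{\bar u}f(x)=\langle b(x)-\sigma(x)\bar u(t,x),\nabla_x f(x)\rangle+\frac{\epsilon}{2}\,\sigma(x)\sigma^{T}(x):\nabla_x^2 f(x).$$ Diffusion. For $(t,x)\in[0,T]\times\mathbb{R}^d$, let $W$ be a standard $d$-dimensional Wiener process under a probability measure $\mathbb{P}$, and let $X^{\epsilon}=\{X^{\epsilon}(s):t\le s\le T\}$ be the unique strong solution of $$dX^{\epsilon}(s)=b(X^{\epsilon}(s))\,ds+\sqrt{\epsilon}\,\sigma(X^{\epsilon}(s))\,dW(s),\qquad X^{\epsilon}(t)=x.$$ Change of measure. Given $\bar u$, define the probability measure $\bar{\mathbb{P}}^{\epsilon}$ by $$\frac{d\bar{\mathbb{P}}^{\epsilon}}{d\mathbb{P}}=\exp\left\{-\frac{1}{2\epsilon}\int_t^T\|\bar u(s,X^{\epsilon}(s))\|^2ds+\frac{1}{\sqrt{\epsilon}}\int_t^T\langle\bar u(s,X^{\epsilon}(s)),dW(s)\rangle\right\},$$ and let $\bar{\mathbb{E}}^{\epsilon}$ denote expectation under $\bar{\mathbb{P}}^{\epsilon}$. Second moment. The second moment, under $\bar{\mathbb{P}}^{\epsilon}$,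 of the importance sampling estimator $\exp\{-\frac1\epsilon h(X^{\epsilon}(T))\}\frac{d\mathbb{P}}{d\bar{\mathbb{P}}^{\epsilon}}$ is $$Q^{\epsilon}(t,x;\bar u)=\bar{\mathbb{E}}^{\epsilon}\left[\exp\left\{-\frac{2}{\epsilon}h(X^{\epsilon}(T))\right\}\left(\frac{d\mathbb{P}}{d\bar{\mathbb{P}}^{\epsilon}}\right)^2\right].$$ *)

theory Defs
  imports "HOL-Probability.Probability"
begin

section \<open>Wiener processes and their filtrations\<close>

definition natural_filtration ::
    "'a measure \<Rightarrow> (real \<Rightarrow> 'a \<Rightarrow> real^'d) \<Rightarrow> real \<Rightarrow> 'a measure" where
  "natural_filtration M W s =
     sigma (space M) (\<Union>r\<in>{0..s}. {W r -` A \<inter> space M | A. A \<in> sets borel})"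

definition augmented_filtration ::
    "'a measure \<Rightarrow> (real \<Rightarrow> 'a \<Rightarrow> real^'d) \<Rightarrow> real \<Rightarrow> 'a measure" where
  "augmented_filtration M W s =
     sigma (space M) (sets (natural_filtration M W s) \<union> null_sets M)"

text \<open>The last conjunct says that the increment over \<open>[r, s]\<close> is independent of the past up to
  time \<open>r\<close> and has the law \<open>N(0, (s - r) I)\<close>.\<close>

definition wiener_process :: "'a measure \<Rightarrow> (real \<Rightarrow> 'a \<Rightarrow> real^'d) \<Rightarrow> bool" where
  "wiener_process M W \<longleftrightarrow>
     prob_space M \<and>
     (\<forall>s\<ge>0. W s \<in> borel_measurable M) \<and>
     (AE \<omega> in M. W 0 \<omega> = 0) \<and>
     (\<forall>\<omega>\<in>space M. continuous_on {0..} (\<lambda>s. W s \<omega>)) \<and>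
     (\<forall>r s. 0 \<le> r \<and> r < s \<longrightarrow>
        prob_space.indep_set M (sets (natural_filtration M W r))
          (sets (vimage_algebra (space M) (\<lambda>\<omega>. W s \<omega> - W r \<omega>) borel)) \<and>
        prob_space.indep_vars M (\<lambda>_. borel) (\<lambda>i \<omega>. (W s \<omega> - W r \<omega>) $ i) UNIV \<and>
        (\<forall>i. distributed M lborel (\<lambda>\<omega>. (W s \<omega> - W r \<omega>) $ i)
               (\<lambda>y. ennreal (normal_density 0 (sqrt (s - r)) y))))"


section \<open>The Ito integral\<close>

text \<open>A simple integrand on \<open>[a, b]\<close> is given by a partition \<open>p 0 \<le> \<dots> \<le> p n\<close> and bounded
  random vectors \<open>\<xi> k\<close>, the value on \<open>(p k, p (k + 1)]\<close>, known at time \<open>p k\<close>.\<close>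

definition simple_integrand ::
    "'a measure \<Rightarrow> (real \<Rightarrow> 'a measure) \<Rightarrow> real \<Rightarrow> real \<Rightarrow>
     nat \<Rightarrow> (nat \<Rightarrow> real) \<Rightarrow> (nat \<Rightarrow> 'a \<Rightarrow> real^'d) \<Rightarrow> bool" where
  "simple_integrand M F a b n p \<xi> \<longleftrightarrow>
     p 0 = a \<and> p n = b \<and> (\<forall>k<n. p k \<le> p (Suc k)) \<and>
     (\<forall>k<n. \<xi> k \<in> borel_measurable (F (p k)) \<and> bounded (\<xi> k ` space M))"

definition simple_process ::
    "nat \<Rightarrow> (nat \<Rightarrow> real) \<Rightarrow> (nat \<Rightarrow> 'a \<Rightarrow> real^'d) \<Rightarrow> real \<Rightarrow> 'a \<Rightarrow> real^'d" where
  "simple_process n p \<xi> s \<omega> = (\<Sum>k<n. indicator {p k<..p (Suc k)} s *\<^sub>R \<xi> k \<omega>)"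

definition simple_ito ::
    "(real \<Rightarrow> 'a \<Rightarrow> real^'d) \<Rightarrow> nat \<Rightarrow> (nat \<Rightarrow> real) \<Rightarrow> (nat \<Rightarrow> 'a \<Rightarrow> real^'d) \<Rightarrow> 'a \<Rightarrow> real" where
  "simple_ito W n p \<xi> \<omega> = (\<Sum>k<n. \<xi> k \<omega> \<bullet> (W (p (Suc k)) \<omega> - W (p k) \<omega>))"

text \<open>\<open>J\<close> is a version of the scalar integral of \<open>\<langle>H(s), dW(s)\<rangle>\<close> over \<open>[a, b]\<close>: the integrals
  of some simple integrands converge to \<open>J\<close> in mean square while the integrands converge to
  \<open>H\<close> in mean square on \<open>[a, b] \<times> \<Omega>\<close>. Joint measurability of \<open>H\<close> is required because
  \<open>nn_integral\<close> is only a lower integral for nonmeasurable functions. \<open>J\<close> is unique up to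
  a null set.\<close>

definition has_ito_integral ::
    "'a measure \<Rightarrow> (real \<Rightarrow> 'a \<Rightarrow> real^'d) \<Rightarrow> real \<Rightarrow> real \<Rightarrow>
     (real \<Rightarrow> 'a \<Rightarrow> real^'d) \<Rightarrow> ('a \<Rightarrow> real) \<Rightarrow> bool" where
  "has_ito_integral M W a b H J \<longleftrightarrow>
     J \<in> borel_measurable M \<and>
     (\<lambda>(s, \<omega>). indicator {a..b} s *\<^sub>R H s \<omega>) \<in> borel_measurable (lborel \<Otimes>\<^sub>M M) \<and>
     (\<exists>n p \<xi>.
        (\<forall>m. simple_integrand M (augmented_filtration M W) a b (n m) (p m) (\<xi> m)) \<and>
        (\<lambda>m. \<integral>\<^sup>+\<omega>. (\<integral>\<^sup>+s\<in>{a..b}.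
            ennreal ((norm (simple_process (n m) (p m) (\<xi> m) s \<omega> - H s \<omega>))\<^sup>2) \<partial>lborel) \<partial>M)
          \<longlonglongrightarrow> 0 \<and>
        (\<lambda>m. \<integral>\<^sup>+\<omega>. ennreal ((simple_ito W (n m) (p m) (\<xi> m) \<omega> - J \<omega>)\<^sup>2) \<partial>M)
          \<longlonglongrightarrow> 0)"

definition ito_integral ::
    "'a measure \<Rightarrow> (real \<Rightarrow> 'a \<Rightarrow> real^'d) \<Rightarrow> real \<Rightarrow> real \<Rightarrow>
     (real \<Rightarrow> 'a \<Rightarrow> real^'d) \<Rightarrow> 'a \<Rightarrow> real" where
  "ito_integral M W a b H = (SOME J. has_ito_integral M W a b H J)"


section \<open>The diffusion\<close>

text \<open>Strong solution on \<open>[t, T]\<close> of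
  \<open>dX(s) = b(X(s)) ds + sqrt \<epsilon> \<sigma>(X(s)) dW(s)\<close>, \<open>X(t) = x\<close>. The \<open>i\<close>-th coordinate of
  \<open>\<sigma>(X) dW\<close> is the scalar product of the \<open>i\<close>-th row of \<open>\<sigma>(X)\<close> with \<open>dW\<close>.\<close>

definition strong_solution ::
    "'a measure \<Rightarrow> (real \<Rightarrow> 'a \<Rightarrow> real^'d) \<Rightarrow> (real^'d \<Rightarrow> real^'d) \<Rightarrow> (real^'d \<Rightarrow> real^'d^'d) \<Rightarrow>
     real \<Rightarrow> real \<Rightarrow> real \<Rightarrow> real^'d \<Rightarrow> (real \<Rightarrow> 'a \<Rightarrow> real^'d) \<Rightarrow> bool" where
  "strong_solution M W b \<sigma> \<epsilon> T t x X \<longleftrightarrow>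
     (\<forall>s\<in>{t..T}. X s \<in> borel_measurable (augmented_filtration M W s)) \<and>
     (\<forall>\<omega>\<in>space M. continuous_on {t..T} (\<lambda>s. X s \<omega>)) \<and>
     (AE \<omega> in M. X t \<omega> = x) \<and>
     (\<forall>s\<in>{t..T}. \<exists>J :: 'a \<Rightarrow> real^'d.
        (\<forall>i. has_ito_integral M W t s (\<lambda>r \<omega>. \<sigma> (X r \<omega>) $ i) (\<lambda>\<omega>. J \<omega> $ i)) \<and>
        (AE \<omega> in M. X s \<omega> = x + (LBINT r:{t..s}. b (X r \<omega>)) + sqrt \<epsilon> *\<^sub>R J \<omega>))"


section \<open>Change of measure and second moment\<close>

definition tilted_density ::
    "'a measure \<Rightarrow> (real \<Rightarrow> 'a \<Rightarrow> real^'d) \<Rightarrow> real \<Rightarrow> real \<Rightarrow> (real \<Rightarrow> real^'d \<Rightarrow> real^'d) \<Rightarrow>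
     real \<Rightarrow> (real \<Rightarrow> 'a \<Rightarrow> real^'d) \<Rightarrow> 'a \<Rightarrow> real" where
  "tilted_density M W \<epsilon> T u t X \<omega> =
     exp (- (1 / (2 * \<epsilon>)) * (LBINT s:{t..T}. (norm (u s (X s \<omega>)))\<^sup>2)
          + (1 / sqrt \<epsilon>) * ito_integral M W t T (\<lambda>s \<omega>. u s (X s \<omega>)) \<omega>)"

definition tilted_measure ::
    "'a measure \<Rightarrow> (real \<Rightarrow> 'a \<Rightarrow> real^'d) \<Rightarrow> real \<Rightarrow> real \<Rightarrow> (real \<Rightarrow> real^'d \<Rightarrow> real^'d) \<Rightarrow>
     real \<Rightarrow> (real \<Rightarrow> 'a \<Rightarrow> real^'d) \<Rightarrow> 'a measure" where
  "tilted_measure M W \<epsilon> T u t X =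
     density M (\<lambda>\<omega>. ennreal (tilted_density M W \<epsilon> T u t X \<omega>))"

text \<open>The starting point \<open>x\<close> enters only through the diffusion \<open>X\<close>.\<close>

definition second_moment ::
    "'a measure \<Rightarrow> (real \<Rightarrow> 'a \<Rightarrow> real^'d) \<Rightarrow> real \<Rightarrow> real \<Rightarrow> (real^'d \<Rightarrow> real) \<Rightarrow>
     (real \<Rightarrow> real^'d \<Rightarrow> real^'d) \<Rightarrow> real \<Rightarrow> (real \<Rightarrow> 'a \<Rightarrow> real^'d) \<Rightarrow> real" where
  "second_moment M W \<epsilon> T h u t X =
     (let P = tilted_measure M W \<epsilon> T u t X in
       \<integral>\<omega>. exp (- (2 / \<epsilon>) * h (X T \<omega>)) * (enn2real (RN_deriv P M \<omega>))\<^sup>2 \<partial>P)"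


section \<open>The terminal value problem\<close>

definition gradient :: "(real^'d \<Rightarrow> real) \<Rightarrow> real^'d \<Rightarrow> real^'d" where
  "gradient f x = (\<chi> i. frechet_derivative f (at x) (axis i 1))"

definition hessian :: "(real^'d \<Rightarrow> real) \<Rightarrow> real^'d \<Rightarrow> real^'d^'d" where
  "hessian f x = jacobian (gradient f) (at x)"

text \<open>One-sided at the end points of \<open>[0, T]\<close>.\<close>

definition time_deriv :: "real \<Rightarrow> (real \<Rightarrow> real^'d \<Rightarrow> real) \<Rightarrow> real \<Rightarrow> real^'d \<Rightarrow> real" where
  "time_deriv T f t x = vector_derivative (\<lambda>s. f s x) (at t within {0..T})"

definition C12 :: "real \<Rightarrow> (real \<Rightarrow> real^'d \<Rightarrow> real) \<Rightarrow> bool" where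
  "C12 T f \<longleftrightarrow>
     (\<forall>t\<in>{0..T}. \<forall>x.
        (\<lambda>s. f s x) differentiable (at t within {0..T}) \<and>
        f t differentiable (at x) \<and>
        gradient (f t) differentiable (at x)) \<and>
     continuous_on ({0..T} \<times> UNIV) (\<lambda>(t, x). f t x) \<and>
     continuous_on ({0..T} \<times> UNIV) (\<lambda>(t, x). time_deriv T f t x) \<and>
     continuous_on ({0..T} \<times> UNIV) (\<lambda>(t, x). gradient (f t) x) \<and>
     continuous_on ({0..T} \<times> UNIV) (\<lambda>(t, x). hessian (f t) x)"

definition frobenius_inner :: "real^'d^'d \<Rightarrow> real^'d^'d \<Rightarrow> real" where
  "frobenius_inner A B = (\<Sum>i\<in>UNIV. \<Sum>j\<in>UNIV. A $ i $ j * B $ i $ j)"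

definition generator ::
    "(real^'d \<Rightarrow> real^'d) \<Rightarrow> (real^'d \<Rightarrow> real^'d^'d) \<Rightarrow> real \<Rightarrow> (real \<Rightarrow> real^'d \<Rightarrow> real^'d) \<Rightarrow>
     real \<Rightarrow> (real^'d \<Rightarrow> real) \<Rightarrow> real^'d \<Rightarrow> real" where
  "generator b \<sigma> \<epsilon> u t f x =
     (b x - \<sigma> x *v u t x) \<bullet> gradient f x
     + \<epsilon> / 2 * frobenius_inner (\<sigma> x ** transpose (\<sigma> x)) (hessian f x)"

definition bounded_classical_solution ::
    "(real^'d \<Rightarrow> real^'d) \<Rightarrow> (real^'d \<Rightarrow> real^'d^'d) \<Rightarrow> real \<Rightarrow> real \<Rightarrow> (real^'d \<Rightarrow> real) \<Rightarrow>
     (real \<Rightarrow> real^'d \<Rightarrow> real^'d) \<Rightarrow> (real \<Rightarrow> real^'d \<Rightarrow> real) \<Rightarrow> bool" where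
  "bounded_classical_solution b \<sigma> \<epsilon> T h u \<Phi> \<longleftrightarrow>
     C12 T \<Phi> \<and>
     bounded ((\<lambda>(t, x). \<Phi> t x) ` ({0..T} \<times> UNIV)) \<and>
     (\<forall>t\<in>{0..<T}. \<forall>x.
        time_deriv T \<Phi> t x + generator b \<sigma> \<epsilon> u t (\<Phi> t) x
          + 1 / \<epsilon> * (norm (u t x))\<^sup>2 * \<Phi> t x = 0) \<and>
     (\<forall>x. \<Phi> T x = exp (- (2 / \<epsilon>) * h x))"

definition derivatives_bounded_continuous_on ::
    "real \<Rightarrow> (real \<times> (real^'d)) set \<Rightarrow> (real \<Rightarrow> real^'d \<Rightarrow> real) \<Rightarrow> bool" where
  "derivatives_bounded_continuous_on T S f \<longleftrightarrow>
     (let D\<^sub>t = (\<lambda>(t, x). time_deriv T f t x);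
          D\<^sub>x = (\<lambda>(t, x). gradient (f t) x);
          D\<^sub>x\<^sub>x = (\<lambda>(t, x). hessian (f t) x)
      in bounded (D\<^sub>t ` S) \<and> continuous_on S D\<^sub>t \<and>
         bounded (D\<^sub>x ` S) \<and> continuous_on S D\<^sub>x \<and>
         bounded (D\<^sub>x\<^sub>x ` S) \<and> continuous_on S D\<^sub>x\<^sub>x)"

end

theory Submission
  imports Defs
begin

text \<open>Let \<open>Y(s) = exp (1/(2 \<epsilon>) \<integral>\<^sub>t\<^sup>s |u|\<^sup>2 dr - \<epsilon>\<^sup>-\<^sup>1\<^sup>/\<^sup>2 \<integral>\<^sub>t\<^sup>s u dW)\<close>. Since \<open>Y(T)\<close> is the reciprocal of the
  density of the new measure, the second moment is the expectation of \<open>Y(T) \<Phi>(T, X(T))\<close> under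
  the original measure, and no Girsanov transformation is needed. The function
  \<open>g(s) = E[Y(s) \<Phi>(s, X(s))]\<close> is continuous on \<open>[t, T]\<close>, and \<open>g(t) = \<Phi>(t, x)\<close>. Its right
  derivative vanishes on \<open>(t, T)\<close>, where the derivatives of \<open>\<Phi>\<close> are bounded even if \<open>t = 0\<close>: over a
  step of length \<open>k\<close>, the increments of \<open>log Y\<close> and \<open>X\<close> agree in mean square, up to \<open>o(sqrt k)\<close>, with
  Gaussian increments that are independent of the past, and the second order expansion of
  \<open>e\<^sup>r \<Phi>(s + k, X(s) + d)\<close> turns these into \<open>k\<close> times the left side of the differential equation, up to
  an error \<open>o(k)\<close>. The error is controlled by exponential moments of the normalised increments.
  Hence \<open>g\<close> is constant.\<close>


section \<open>The augmented Wiener filtration\<close>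

text \<open>The stochastic integral is fixed for each end time separately and only up to a null set,
  so continuous paths of \<open>Y\<close> are not at hand. Everything about \<open>Y\<close> is
  therefore proved in mean: continuity in L1, and one step over a short interval at a time.
  Agreement of the increments with Gaussian ones up to o(sqrt k) settles the quadratic terms of the
  expansion, but not the linear ones, which after division by k could still blow up; there the exact
  orthogonality of the stochastic integral to the past is used, so that only the drift remains.
  Expanding in log Y instead of Y puts the weight on the same footing as the coordinates of X. Per
  unit of time, log Y has variance |u|^2 / \<epsilon> and drift |u|^2 / (2 \<epsilon>), which
  together give the potential |u|^2 / \<epsilon>; its covariance with X is -\<sigma> u, which
  changes the drift b into b - \<sigma> u. Only right derivatives can be computed this way, because
  the increment after s is independent of the past up to s; a function that is continuous up to the
  end points and has right derivative zero inside is still constant.\<close>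

locale wiener =
  fixes M :: "'a measure" and W :: "real \<Rightarrow> 'a \<Rightarrow> real^'d"
  assumes wiener: "wiener_process M W"

sublocale wiener \<subseteq> prob_space M
  using wiener by (simp add: wiener_process_def)

context wiener
begin

abbreviation F where "F s \<equiv> augmented_filtration M W s"

lemma W_measurable [measurable]: "0 \<le> s \<Longrightarrow> W s \<in> borel_measurable M"
  using wiener by (simp add: wiener_process_def)

lemma natural_filtration_sets_generator:
  "(\<Union>r\<in>{0..s}. {W r -` A \<inter> space M | A. A \<in> sets borel}) \<subseteq> sets M"
  by (auto intro!: measurable_sets[OF W_measurable])

lemma sets_natural_filtration:
  "sets (natural_filtration M W s) =
     sigma_sets (space M) (\<Union>r\<in>{0..s}. {W r -` A \<inter> space M | A. A \<in> sets borel})"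
  unfolding natural_filtration_def
  using natural_filtration_sets_generator[of s] sets.space_closed[of M]
  by (intro sets_measure_of) blast

lemma natural_filtration_subset: "sets (natural_filtration M W s) \<subseteq> sets M"
  unfolding sets_natural_filtration
  using natural_filtration_sets_generator by (rule sets.sigma_sets_subset)

lemma natural_filtration_mono:
  "r \<le> s \<Longrightarrow> sets (natural_filtration M W r) \<subseteq> sets (natural_filtration M W s)"
  unfolding sets_natural_filtration by (intro sigma_sets_mono') fastforce

lemma space_F [simp]: "space (F s) = space M"
  by (simp add: augmented_filtration_def space_measure_of_conv)

lemma sets_F: "sets (F s) = sigma_sets (space M) (sets (natural_filtration M W s) \<union> null_sets M)"
proof -
  have "sets (natural_filtration M W s) \<union> null_sets M \<subseteq> Pow (space M)"
    using natural_filtration_subset[of s] sets.space_closed[of M] by (auto simp: null_sets_def)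
  then show ?thesis
    unfolding augmented_filtration_def by (rule sets_measure_of)
qed

lemma F_subset: "sets (F s) \<subseteq> sets M"
  unfolding sets_F using natural_filtration_subset
  by (intro sets.sigma_sets_subset) (auto simp: null_sets_def)

lemma F_mono: "r \<le> s \<Longrightarrow> sets (F r) \<subseteq> sets (F s)"
  unfolding sets_F using natural_filtration_mono[of r s]
  by (intro sigma_sets_mono') auto

lemma null_sets_F: "N \<in> null_sets M \<Longrightarrow> N \<in> sets (F s)"
  unfolding sets_F by auto

lemma measurable_F_mono: "f \<in> measurable (F r) N \<Longrightarrow> r \<le> s \<Longrightarrow> f \<in> measurable (F s) N"
  using F_mono[of r s] by (auto simp: measurable_def)

lemma measurable_F_M: "f \<in> measurable (F r) N \<Longrightarrow> f \<in> measurable M N"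
  using F_subset[of r] by (auto simp: measurable_def)

lemma W_measurable_F: "0 \<le> r \<Longrightarrow> r \<le> s \<Longrightarrow> W r \<in> borel_measurable (F s)"
proof (rule measurableI)
  fix A :: "(real^'d) set" assume "0 \<le> r" "r \<le> s" "A \<in> sets borel"
  then have "W r -` A \<inter> space M \<in> sets (natural_filtration M W s)"
    unfolding sets_natural_filtration by (intro sigma_sets.Basic UN_I[of r]) auto
  then show "W r -` A \<inter> space (F s) \<in> sets (F s)"
    unfolding sets_F by (auto intro: sigma_sets.Basic)
qed auto

text \<open>The sets that agree almost everywhere with a naturally measurable set form a
  sigma-algebra, and both kinds of generators of \<open>F s\<close> belong to it. This carries
  independence from the natural filtration, where it is assumed, over to the augmented one.\<close>

lemma F_ae_natural:
  assumes "A \<in> sets (F s)"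
  obtains B where "B \<in> sets (natural_filtration M W s)" "AE \<omega> in M. \<omega> \<in> A \<longleftrightarrow> \<omega> \<in> B"
proof -
  have "\<exists>B\<in>sets (natural_filtration M W s). AE \<omega> in M. \<omega> \<in> A \<longleftrightarrow> \<omega> \<in> B"
    using assms unfolding sets_F
  proof (induction rule: sigma_sets.induct)
    case (Basic A)
    then show ?case
    proof
      assume A: "A \<in> null_sets M"
      have "AE \<omega> in M. \<omega> \<notin> A" by (rule AE_not_in[OF A])
      then show ?case by (intro bexI[of _ "{}"]) auto
    qed auto
  next
    case Empty
    then show ?case by (intro bexI[of _ "{}"]) auto
  next
    case (Compl A)
    then obtain B where B: "B \<in> sets (natural_filtration M W s)" "AE \<omega> in M. \<omega> \<in> A \<longleftrightarrow> \<omega> \<in> B"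
      by auto
    have sp: "space (natural_filtration M W s) = space M"
      by (simp add: natural_filtration_def space_measure_of_conv)
    have "space M - B \<in> sets (natural_filtration M W s)"
      using sets.compl_sets[OF B(1)] sp by simp
    with B(2) show ?case by (intro bexI[of _ "space M - B"]) auto
  next
    case (Union A)
    then have "\<forall>i. \<exists>B. B \<in> sets (natural_filtration M W s) \<and> (AE \<omega> in M. \<omega> \<in> A i \<longleftrightarrow> \<omega> \<in> B)"
      by auto
    then obtain B where B: "\<And>i::nat. B i \<in> sets (natural_filtration M W s)"
        "\<And>i. AE \<omega> in M. \<omega> \<in> A i \<longleftrightarrow> \<omega> \<in> B i"
      by metis
    have "AE \<omega> in M. \<forall>i. \<omega> \<in> A i \<longleftrightarrow> \<omega> \<in> B i"
      using B(2) by (simp add: AE_all_countable)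
    then have "AE \<omega> in M. \<omega> \<in> (\<Union>i. A i) \<longleftrightarrow> \<omega> \<in> (\<Union>i. B i)"
      by eventually_elim auto
    moreover have "(\<Union>i. B i) \<in> sets (natural_filtration M W s)"
      using B(1) by auto
    ultimately show ?case by blast
  qed
  then show ?thesis using that by blast
qed

text \<open>Replacing an event of \<open>F r\<close> by a natural one changes no probability, so
  independence of events survives the augmentation; intersection-stable generators then extend it to
  the generated sigma-algebras. The map \<open>g\<close> brings the increment into the value space
  \<open>N\<close> of \<open>\<xi>\<close>, as \<open>indep_var\<close> wants both variables in one
  type.\<close>

lemma indep_increment:
  assumes rs: "0 \<le> r" "r < s" and \<xi>: "\<xi> \<in> measurable (F r) N" and g: "g \<in> measurable borel N"
  shows "indep_var N \<xi> N (\<lambda>\<omega>. g (W s \<omega> - W r \<omega>))"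
proof -
  let ?D = "\<lambda>\<omega>. W s \<omega> - W r \<omega>"
  let ?I = "{?D -` A \<inter> space M | A. A \<in> sets borel}"
  have D [measurable]: "?D \<in> borel_measurable M" using rs by simp
  have nat: "indep_set (sets (natural_filtration M W r)) (sets (vimage_algebra (space M) ?D borel))"
    using wiener rs unfolding wiener_process_def by blast
  have I: "?I \<subseteq> sets (vimage_algebra (space M) ?D borel)"
    by (subst sets_vimage_algebra2) auto
  have "indep_set (sets (F r)) ?I"
  proof (rule indep_setI)
    show "sets (F r) \<subseteq> events" by (rule F_subset)
    show "?I \<subseteq> events" by (auto intro!: measurable_sets[OF D])
    fix A C assume A: "A \<in> sets (F r)" and C: "C \<in> ?I"
    obtain B where B: "B \<in> sets (natural_filtration M W r)" "AE \<omega> in M. \<omega> \<in> A \<longleftrightarrow> \<omega> \<in> B"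
      using F_ae_natural[OF A] .
    have ev: "A \<in> events" "B \<in> events" "C \<in> events"
      using A F_subset B(1) natural_filtration_subset C by (auto intro!: measurable_sets[OF D])
    have "prob (A \<inter> C) = prob (B \<inter> C)"
      using B(2) ev by (intro measure_eq_AE) auto
    also have "\<dots> = prob B * prob C"
      using indep_setD[OF nat B(1)] C I by blast
    also have "prob B = prob A"
      using B(2) ev by (intro measure_eq_AE) auto
    finally show "prob (A \<inter> C) = prob A * prob C" .
  qed
  then have "indep_set (sigma_sets (space M) {\<xi> -` A \<inter> space M | A. A \<in> sets N})
      (sigma_sets (space M) {(\<lambda>\<omega>. g (?D \<omega>)) -` A \<inter> space M | A. A \<in> sets N})"
  proof -
    assume *: "indep_set (sets (F r)) ?I"
    have "indep_set (sigma_sets (space M) (sets (F r))) (sigma_sets (space M) ?I)"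
    proof (rule indep_set_sigma_sets[OF *])
      show "Int_stable (sets (F r))" by (auto simp: Int_stable_def)
      show "Int_stable ?I"
      proof (rule Int_stableI)
        fix a b assume "a \<in> ?I" "b \<in> ?I"
        then obtain A B where "a = ?D -` A \<inter> space M" "b = ?D -` B \<inter> space M"
            "A \<in> sets borel" "B \<in> sets borel" by auto
        then show "a \<inter> b \<in> ?I" by (intro CollectI exI[of _ "A \<inter> B"]) auto
      qed
    qed
    moreover have "sigma_sets (space M) {\<xi> -` A \<inter> space M | A. A \<in> sets N}
        \<subseteq> sigma_sets (space M) (sets (F r))"
      using measurable_sets[OF \<xi>] by (intro sigma_sets_mono') auto
    moreover have "sigma_sets (space M) {(\<lambda>\<omega>. g (?D \<omega>)) -` A \<inter> space M | A. A \<in> sets N}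
        \<subseteq> sigma_sets (space M) ?I"
    proof (rule sigma_sets_mono', safe)
      fix A assume "A \<in> sets N"
      then have "g -` A \<in> sets borel" using measurable_sets[OF g] by simp
      then show "\<exists>B. (\<lambda>\<omega>. g (?D \<omega>)) -` A \<inter> space M = ?D -` B \<inter> space M \<and> B \<in> sets borel"
        by (intro exI[of _ "g -` A"]) auto
    qed
    ultimately show ?thesis
      unfolding indep_set_def by (elim indep_sets_mono_sets) (auto split: bool.splits)
  qed
  with measurable_F_M[OF \<xi>] measurable_compose[OF D g] show ?thesis
    by (auto simp: indep_var_eq)
qed

end

section \<open>Square integrable functions\<close>

definition square_integrable :: "'a measure \<Rightarrow> ('a \<Rightarrow> 'b::euclidean_space) \<Rightarrow> bool" where
  "square_integrable M f \<longleftrightarrow> f \<in> borel_measurable M \<and> integrable M (\<lambda>x. (norm (f x))\<^sup>2)"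

lemma square_integrable_measurable: "square_integrable M f \<Longrightarrow> f \<in> borel_measurable M"
  by (simp add: square_integrable_def)

lemma norm_add_square_le:
  fixes x y :: "'b::real_normed_vector"
  shows "(norm (x + y))\<^sup>2 \<le> 2 * (norm x)\<^sup>2 + 2 * (norm y)\<^sup>2"
proof -
  have "(norm (x + y))\<^sup>2 \<le> (norm x + norm y)\<^sup>2"
    by (intro power_mono norm_triangle_ineq) auto
  also have "\<dots> \<le> 2 * (norm x)\<^sup>2 + 2 * (norm y)\<^sup>2"
    using zero_le_power2[of "norm x - norm y"] by (simp add: power2_eq_square algebra_simps)
  finally show ?thesis .
qed

lemma square_integrable_add:
  assumes "square_integrable M f" "square_integrable M g"
  shows "square_integrable M (\<lambda>x. f x + g x)"
proof -
  note assms[THEN square_integrable_measurable, measurable]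
  have "integrable M (\<lambda>x. (norm (f x + g x))\<^sup>2)"
    by (rule Bochner_Integration.integrable_bound[of M "\<lambda>x. 2 * (norm (f x))\<^sup>2 + 2 * (norm (g x))\<^sup>2"])
      (use assms in \<open>auto simp: square_integrable_def norm_add_square_le\<close>)
  then show ?thesis by (simp add: square_integrable_def)
qed

lemma square_integrable_minus:
  "square_integrable M f \<Longrightarrow> square_integrable M (\<lambda>x. - f x)"
  by (simp add: square_integrable_def)

lemma square_integrable_diff:
  "square_integrable M f \<Longrightarrow> square_integrable M g \<Longrightarrow> square_integrable M (\<lambda>x. f x - g x)"
  using square_integrable_add[of M f "\<lambda>x. - g x"] square_integrable_minus by auto

lemma square_integrable_sum:
  "(\<And>i. i \<in> I \<Longrightarrow> square_integrable M (f i)) \<Longrightarrow> square_integrable M (\<lambda>x. \<Sum>i\<in>I. f i x)"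
proof (induction I rule: infinite_finite_induct)
  case (insert i I)
  then show ?case by (simp add: square_integrable_add)
qed (simp_all add: square_integrable_def)

lemma borel_measurable_vec_nth [measurable (raw)]:
  "f \<in> borel_measurable N \<Longrightarrow> (\<lambda>x. (f x :: real^'n) $ i) \<in> borel_measurable N"
  by (rule borel_measurable_continuous_on[of "\<lambda>x. x $ i"]) (auto intro!: continuous_intros)

lemma square_integrable_component:
  fixes \<xi> :: "'b \<Rightarrow> real^'n"
  assumes "square_integrable N \<xi>"
  shows "square_integrable N (\<lambda>\<omega>. \<xi> \<omega> $ i)"
  using assms component_le_norm_cart[of _ i] unfolding square_integrable_def
  by (auto intro!: Bochner_Integration.integrable_bound[of N "\<lambda>x. (norm (\<xi> x))\<^sup>2"] power_mono
      simp: abs_le_square_iff[symmetric])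

lemma integrable_inner:
  assumes "square_integrable M f" "square_integrable M g"
  shows "integrable M (\<lambda>x. f x \<bullet> g x)"
proof -
  note assms[THEN square_integrable_measurable, measurable]
  have *: "\<bar>a \<bullet> b\<bar> \<le> (norm a)\<^sup>2 + (norm b)\<^sup>2" for a b :: 'b
  proof -
    have "\<bar>a \<bullet> b\<bar> \<le> norm a * norm b" by (rule Cauchy_Schwarz_ineq2)
    also have "\<dots> \<le> (norm a)\<^sup>2 + (norm b)\<^sup>2"
      using zero_le_power2[of "norm a - norm b"] sum_power2_ge_zero[of "norm a" "norm b"]
      unfolding power2_diff by linarith
    finally show ?thesis .
  qed
  show ?thesis
    by (rule Bochner_Integration.integrable_bound[of M "\<lambda>x. (norm (f x))\<^sup>2 + (norm (g x))\<^sup>2"])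
      (use assms * in \<open>auto simp: square_integrable_def\<close>)
qed

lemma integral_inner_Cauchy_Schwarz:
  assumes f: "square_integrable M f" and g: "square_integrable M g"
  shows "\<bar>\<integral>x. f x \<bullet> g x \<partial>M\<bar> \<le> sqrt (\<integral>x. (norm (f x))\<^sup>2 \<partial>M) * sqrt (\<integral>x. (norm (g x))\<^sup>2 \<partial>M)"
proof -
  note [measurable] = assms[THEN square_integrable_measurable]
  let ?a = "\<integral>x. (norm (f x))\<^sup>2 \<partial>M" and ?b = "\<integral>x. (norm (g x))\<^sup>2 \<partial>M"
  have int: "integrable M (\<lambda>x. norm (f x) * norm (g x))"
    using integrable_inner[of M "\<lambda>x. norm (f x)" "\<lambda>x. norm (g x)"] assms
    by (auto simp: square_integrable_def)
  have "\<bar>\<integral>x. f x \<bullet> g x \<partial>M\<bar> \<le> (\<integral>x. \<bar>f x \<bullet> g x\<bar> \<partial>M)"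
    by (rule integral_abs_bound)
  also have "\<dots> \<le> (\<integral>x. norm (f x) * norm (g x) \<partial>M)"
    by (intro integral_mono integrable_abs integrable_inner assms int Cauchy_Schwarz_ineq2)
  finally have 1: "\<bar>\<integral>x. f x \<bullet> g x \<partial>M\<bar> \<le> (\<integral>x. norm (f x) * norm (g x) \<partial>M)" .
  have "ennreal ((\<integral>x. norm (f x) * norm (g x) \<partial>M)\<^sup>2) = (\<integral>\<^sup>+x. ennreal (norm (f x)) * ennreal (norm (g x)) \<partial>M)\<^sup>2"
    using int by (simp add: nn_integral_eq_integral ennreal_power flip: ennreal_mult)
  also have "\<dots> \<le> (\<integral>\<^sup>+x. (ennreal (norm (f x)))\<^sup>2 \<partial>M) * (\<integral>\<^sup>+x. (ennreal (norm (g x)))\<^sup>2 \<partial>M)"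
    by (intro Cauchy_Schwarz_nn_integral) auto
  also have "\<dots> = ennreal (?a * ?b)"
    using assms by (simp add: nn_integral_eq_integral ennreal_power square_integrable_def flip: ennreal_mult)
  finally have "(\<integral>x. norm (f x) * norm (g x) \<partial>M)\<^sup>2 \<le> ?a * ?b"
    by (subst (asm) ennreal_le_iff) auto
  then have "(\<integral>x. norm (f x) * norm (g x) \<partial>M) \<le> sqrt (?a * ?b)"
    by (rule real_le_rsqrt)
  with 1 show ?thesis by (simp add: real_sqrt_mult)
qed

text \<open>A single member at distance below 1 from \<open>f\<close> already makes \<open>f\<close>
  square integrable; after that the extended integrals are ordinary ones.\<close>

lemma square_integrable_limit:
  assumes f [measurable]: "f \<in> borel_measurable M" and fn: "\<And>n. square_integrable M (fn n)"
    and lim: "(\<lambda>n. \<integral>\<^sup>+x. ennreal ((norm (fn n x - f x))\<^sup>2) \<partial>M) \<longlonglongrightarrow> 0"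
  shows "square_integrable M f" "(\<lambda>n. \<integral>x. (norm (fn n x - f x))\<^sup>2 \<partial>M) \<longlonglongrightarrow> 0"
proof -
  have [measurable]: "\<And>n. fn n \<in> borel_measurable M" using fn by (rule square_integrable_measurable)
  obtain n where "(\<integral>\<^sup>+x. ennreal ((norm (fn n x - f x))\<^sup>2) \<partial>M) < 1"
    using order_tendstoD(2)[OF lim, of 1] by (auto simp: eventually_sequentially)
  then have "(\<integral>\<^sup>+x. ennreal ((norm (fn n x - f x))\<^sup>2) \<partial>M) < \<infinity>"
    by (auto intro: less_trans)
  then have "square_integrable M (\<lambda>x. fn n x - f x)"
    by (auto simp: square_integrable_def intro!: integrableI_bounded)
  from square_integrable_diff[OF fn[of n] this] show si: "square_integrable M f" by simp
  have "integrable M (\<lambda>x. (norm (fn n x - f x))\<^sup>2)" for n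
    using square_integrable_diff[OF fn[of n] si] by (simp add: square_integrable_def)
  then have "(\<lambda>n. ennreal (\<integral>x. (norm (fn n x - f x))\<^sup>2 \<partial>M)) \<longlonglongrightarrow> ennreal 0"
    using lim by (simp add: nn_integral_eq_integral)
  then show "(\<lambda>n. \<integral>x. (norm (fn n x - f x))\<^sup>2 \<partial>M) \<longlonglongrightarrow> 0"
    by (subst (asm) tendsto_ennreal_iff) (auto intro!: always_eventually)
qed

text \<open>The difference of the inner products is written as (f' - f)(g' - g) + (f' - f) g + f (g'
  - g). Only norms of the fixed limits remain as factors, so no uniform bound on the two sequences
  has to be supplied.\<close>

lemma integral_inner_tendsto:
  assumes fn: "\<And>n. square_integrable M (fn n)" and gn: "\<And>n. square_integrable M (gn n)"
    and f: "square_integrable M f" and g: "square_integrable M g"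
    and flim: "(\<lambda>n. \<integral>x. (norm (fn n x - f x))\<^sup>2 \<partial>M) \<longlonglongrightarrow> 0"
    and glim: "(\<lambda>n. \<integral>x. (norm (gn n x - g x))\<^sup>2 \<partial>M) \<longlonglongrightarrow> 0"
  shows "(\<lambda>n. \<integral>x. fn n x \<bullet> gn n x \<partial>M) \<longlonglongrightarrow> (\<integral>x. f x \<bullet> g x \<partial>M)"
proof -
  let ?N = "\<lambda>f. sqrt (\<integral>x. (norm (f x))\<^sup>2 \<partial>M)"
  have df: "square_integrable M (\<lambda>x. fn n x - f x)" and dg: "square_integrable M (\<lambda>x. gn n x - g x)" for n
    using square_integrable_diff fn gn f g by blast+
  let ?B = "\<lambda>n. ?N (\<lambda>x. fn n x - f x) * ?N (\<lambda>x. gn n x - g x)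
        + ?N (\<lambda>x. fn n x - f x) * ?N g + ?N f * ?N (\<lambda>x. gn n x - g x)"
  have "?B \<longlonglongrightarrow> sqrt 0 * sqrt 0 + sqrt 0 * ?N g + ?N f * sqrt 0"
    by (intro tendsto_intros flim glim)
  then have B: "?B \<longlonglongrightarrow> 0" by simp
  have "norm ((\<integral>x. fn n x \<bullet> gn n x \<partial>M) - (\<integral>x. f x \<bullet> g x \<partial>M)) \<le> ?B n" for n
  proof -
    have "(\<integral>x. fn n x \<bullet> gn n x \<partial>M) - (\<integral>x. f x \<bullet> g x \<partial>M)
        = (\<integral>x. fn n x \<bullet> gn n x - f x \<bullet> g x \<partial>M)"
      by (intro Bochner_Integration.integral_diff[symmetric] integrable_inner fn gn f g)
    also have "\<dots> = (\<integral>x. (fn n x - f x) \<bullet> (gn n x - g x) + (fn n x - f x) \<bullet> g x + f x \<bullet> (gn n x - g x) \<partial>M)"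
      by (simp add: algebra_simps)
    also have "\<dots> = (\<integral>x. (fn n x - f x) \<bullet> (gn n x - g x) \<partial>M) + (\<integral>x. (fn n x - f x) \<bullet> g x \<partial>M)
        + (\<integral>x. f x \<bullet> (gn n x - g x) \<partial>M)"
      using integrable_inner[OF df[of n] dg[of n]] integrable_inner[OF df[of n] g] integrable_inner[OF f dg[of n]]
      by (simp add: Bochner_Integration.integral_add Bochner_Integration.integrable_add)
    finally show ?thesis
      using integral_inner_Cauchy_Schwarz[OF df[of n] dg[of n]]
        integral_inner_Cauchy_Schwarz[OF df[of n] g] integral_inner_Cauchy_Schwarz[OF f dg[of n]]
      by (simp add: real_norm_def)
  qed
  then have "(\<lambda>n. (\<integral>x. fn n x \<bullet> gn n x \<partial>M) - (\<integral>x. f x \<bullet> g x \<partial>M)) \<longlonglongrightarrow> 0"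
    by (intro Lim_null_comparison[OF _ B]) auto
  then show ?thesis by (rule LIM_zero_cancel)
qed

lemma (in finite_measure) square_integrable_bounded:
  assumes [measurable]: "f \<in> borel_measurable M" and C: "\<And>x. x \<in> space M \<Longrightarrow> norm (f x) \<le> C"
  shows "square_integrable M f"
  unfolding square_integrable_def
  by (auto intro!: integrable_const_bound[of _ "C\<^sup>2"] AE_I2 power_mono C)

lemma (in finite_measure) square_integrable_integrable:
  assumes "square_integrable M f"
  shows "integrable M f"
proof -
  note [measurable] = square_integrable_measurable[OF assms]
  have *: "a \<le> 1 + a\<^sup>2" for a :: real
    using zero_le_power2[of "a - 1"] zero_le_power2[of a] unfolding power2_diff by (simp; linarith)
  show ?thesis
    by (rule Bochner_Integration.integrable_bound[of M "\<lambda>x. 1 + (norm (f x))\<^sup>2"])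
      (use assms * in \<open>auto simp: square_integrable_def\<close>)
qed


section \<open>Moments of Wiener increments\<close>

lemma (in prob_space) indep_var_expectation_mult:
  fixes X Y :: "'a \<Rightarrow> real"
  assumes "indep_var borel X borel Y" "integrable M X" "integrable M Y"
  shows "integrable M (\<lambda>\<omega>. X \<omega> * Y \<omega>)" "expectation (\<lambda>\<omega>. X \<omega> * Y \<omega>) = expectation X * expectation Y"
proof -
  have "indep_vars (\<lambda>_. borel) (case_bool X Y) UNIV"
    using assms(1) unfolding indep_var_def
    by (rule indep_vars_cong[THEN iffD1, rotated -1]) (auto split: bool.split)
  then have *: "integrable M (\<lambda>\<omega>. \<Prod>i\<in>UNIV. case_bool X Y i \<omega>)"
      "expectation (\<lambda>\<omega>. \<Prod>i\<in>UNIV. case_bool X Y i \<omega>) = (\<Prod>i\<in>UNIV. expectation (case_bool X Y i))"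
    by (auto intro!: indep_vars_integrable indep_vars_lebesgue_integral assms(2,3) split: bool.split)
  then show "integrable M (\<lambda>\<omega>. X \<omega> * Y \<omega>)" "expectation (\<lambda>\<omega>. X \<omega> * Y \<omega>) = expectation X * expectation Y"
    by (auto simp: UNIV_bool mult.commute)
qed

text \<open>Completing the square turns the integrand into a constant times the normal density with
  mean \<open>c * \<sigma>\<^sup>2\<close>, whose integral is 1.\<close>

lemma nn_integral_normal_density_exp:
  assumes "0 < \<sigma>"
  shows "(\<integral>\<^sup>+y. ennreal (normal_density 0 \<sigma> y) * ennreal (exp (c * y)) \<partial>lborel) = ennreal (exp (c\<^sup>2 * \<sigma>\<^sup>2 / 2))"
proof -
  have "normal_density 0 \<sigma> y * exp (c * y) = exp (c\<^sup>2 * \<sigma>\<^sup>2 / 2) * normal_density (c * \<sigma>\<^sup>2) \<sigma> y" for y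
  proof -
    have "- y\<^sup>2 / (2 * \<sigma>\<^sup>2) + c * y = c\<^sup>2 * \<sigma>\<^sup>2 / 2 + - (y - c * \<sigma>\<^sup>2)\<^sup>2 / (2 * \<sigma>\<^sup>2)"
      using assms by (simp add: field_simps power2_eq_square)
    then have "exp (- y\<^sup>2 / (2 * \<sigma>\<^sup>2)) * exp (c * y) = exp (c\<^sup>2 * \<sigma>\<^sup>2 / 2) * exp (- (y - c * \<sigma>\<^sup>2)\<^sup>2 / (2 * \<sigma>\<^sup>2))"
      by (simp only: flip: exp_add)
    then show ?thesis by (simp add: normal_density_def)
  qed
  then have "(\<integral>\<^sup>+y. ennreal (normal_density 0 \<sigma> y) * ennreal (exp (c * y)) \<partial>lborel)
      = (\<integral>\<^sup>+y. ennreal (exp (c\<^sup>2 * \<sigma>\<^sup>2 / 2)) * ennreal (normal_density (c * \<sigma>\<^sup>2) \<sigma> y) \<partial>lborel)"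
    by (simp flip: ennreal_mult)
  also have "\<dots> = ennreal (exp (c\<^sup>2 * \<sigma>\<^sup>2 / 2))"
    using assms by (simp add: nn_integral_cmult nn_integral_eq_integral integral_normal_density)
  finally show ?thesis .
qed

context wiener
begin

lemma increment_component_normal:
  "0 \<le> r \<Longrightarrow> r < s \<Longrightarrow> distributed M lborel (\<lambda>\<omega>. (W s \<omega> - W r \<omega>) $ i)
     (\<lambda>y. ennreal (normal_density 0 (sqrt (s - r)) y))"
  using wiener unfolding wiener_process_def by blast

lemma increment_components_indep:
  "0 \<le> r \<Longrightarrow> r < s \<Longrightarrow> indep_vars (\<lambda>_. borel) (\<lambda>i \<omega>. (W s \<omega> - W r \<omega>) $ i) UNIV"
  using wiener unfolding wiener_process_def by blast

lemma increment_moments: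
  assumes rs: "0 \<le> r" "r < s"
  shows "integrable M (\<lambda>\<omega>. (W s \<omega> - W r \<omega>) $ i)"
    and "expectation (\<lambda>\<omega>. (W s \<omega> - W r \<omega>) $ i) = 0"
    and "integrable M (\<lambda>\<omega>. (W s \<omega> - W r \<omega>) $ i * (W s \<omega> - W r \<omega>) $ j)"
    and "expectation (\<lambda>\<omega>. (W s \<omega> - W r \<omega>) $ i * (W s \<omega> - W r \<omega>) $ j) = (if i = j then s - r else 0)"
proof -
  let ?D = "\<lambda>i \<omega>. (W s \<omega> - W r \<omega>) $ i"
  have pos: "0 < sqrt (s - r)" using rs by simp
  note D = increment_component_normal[OF rs]
  show int: "integrable M (?D i)" for i
    using distributed_integrable[OF D, of "\<lambda>y. y"] integrable_normal_moment_nz_1[OF pos, of 0] by simp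
  show e: "expectation (?D i) = 0" for i
    using distributed_integral[OF D, of "\<lambda>y. y"] integral_normal_moment_nz_1[OF pos, of 0] by simp
  have sq: "integrable M (\<lambda>\<omega>. (?D i \<omega>)\<^sup>2)" for i
    using distributed_integrable[OF D, of "\<lambda>y. y\<^sup>2"] integrable_normal_moment[OF pos, of 0 2] by simp
  have "expectation (\<lambda>\<omega>. (?D i \<omega>)\<^sup>2) = (sqrt (s - r))\<^sup>2" for i
    using normal_distributed_variance[OF pos D] e by simp
  then have sqe: "expectation (\<lambda>\<omega>. (?D i \<omega>)\<^sup>2) = s - r" for i
    using rs by simp
  have "integrable M (\<lambda>\<omega>. ?D i \<omega> * ?D j \<omega>) \<and> expectation (\<lambda>\<omega>. ?D i \<omega> * ?D j \<omega>) = (if i = j then s - r else 0)"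
  proof (cases "i = j")
    case True
    then show ?thesis using sq[of i] sqe[of i] by (simp add: power2_eq_square)
  next
    case False
    have ind: "indep_vars (\<lambda>_. borel) ?D {i, j}"
      by (rule indep_vars_subset[OF increment_components_indep[OF rs]]) auto
    show ?thesis
      using indep_vars_lebesgue_integral[OF _ ind int] indep_vars_integrable[OF _ ind int] False e
      by simp
  qed
  then show "integrable M (\<lambda>\<omega>. ?D i \<omega> * ?D j \<omega>)"
    "expectation (\<lambda>\<omega>. ?D i \<omega> * ?D j \<omega>) = (if i = j then s - r else 0)" by auto
qed

text \<open>Independence of the coordinates reduces this to one-dimensional Gaussian moments, whose
  exponents add up to the squared norm of \<open>v\<close>.\<close>

lemma nn_integral_exp_increment:
  assumes rs: "0 \<le> r" "r < s"
  shows "(\<integral>\<^sup>+\<omega>. ennreal (exp (v \<bullet> (W s \<omega> - W r \<omega>))) \<partial>M) = ennreal (exp ((norm v)\<^sup>2 * (s - r) / 2))"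
proof -
  let ?D = "\<lambda>i \<omega>. (W s \<omega> - W r \<omega>) $ i"
  have "indep_vars (\<lambda>_. borel) (\<lambda>i. (\<lambda>y. ennreal (exp (v $ i * y))) \<circ> ?D i) UNIV"
    by (rule indep_vars_compose[OF increment_components_indep[OF rs]]) auto
  then have ind: "indep_vars (\<lambda>_. borel) (\<lambda>i \<omega>. ennreal (exp (v $ i * ?D i \<omega>))) UNIV"
    by (simp add: o_def)
  have "(\<integral>\<^sup>+\<omega>. ennreal (exp (v \<bullet> (W s \<omega> - W r \<omega>))) \<partial>M) = (\<integral>\<^sup>+\<omega>. (\<Prod>i\<in>UNIV. ennreal (exp (v $ i * ?D i \<omega>))) \<partial>M)"
    by (simp add: inner_vec_def exp_sum prod_ennreal)
  also have "\<dots> = (\<Prod>i\<in>UNIV. \<integral>\<^sup>+\<omega>. ennreal (exp (v $ i * ?D i \<omega>)) \<partial>M)"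
    by (rule indep_vars_nn_integral[OF _ ind]) auto
  also have "\<dots> = (\<Prod>i\<in>UNIV. ennreal (exp ((v $ i)\<^sup>2 * (s - r) / 2)))"
  proof (rule prod.cong[OF refl])
    fix i
    have "(\<integral>\<^sup>+\<omega>. ennreal (exp (v $ i * ?D i \<omega>)) \<partial>M)
        = (\<integral>\<^sup>+y. ennreal (normal_density 0 (sqrt (s - r)) y) * ennreal (exp (v $ i * y)) \<partial>lborel)"
      by (rule distributed_nn_integral[OF increment_component_normal[OF rs], symmetric]) simp
    also have "\<dots> = ennreal (exp ((v $ i)\<^sup>2 * (s - r) / 2))"
      using rs by (subst nn_integral_normal_density_exp) auto
    finally show "(\<integral>\<^sup>+\<omega>. ennreal (exp (v $ i * ?D i \<omega>)) \<partial>M) = ennreal (exp ((v $ i)\<^sup>2 * (s - r) / 2))" .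
  qed
  also have "\<dots> = ennreal (exp ((norm v)\<^sup>2 * (s - r) / 2))"
    by (simp add: prod_ennreal exp_sum[symmetric] norm_vec_def L2_set_def sum_nonneg
        sum_distrib_right sum_divide_distrib)
  finally show ?thesis .
qed

lemma integrable_mult_increment:
  fixes \<xi> :: "'a \<Rightarrow> real"
  assumes rs: "0 \<le> r" "r < s" and \<xi>: "\<xi> \<in> borel_measurable (F r)" "integrable M \<xi>"
  shows "integrable M (\<lambda>\<omega>. \<xi> \<omega> * (W s \<omega> - W r \<omega>) $ i)"
    and "expectation (\<lambda>\<omega>. \<xi> \<omega> * (W s \<omega> - W r \<omega>) $ i) = 0"
    and "integrable M (\<lambda>\<omega>. \<xi> \<omega> * ((W s \<omega> - W r \<omega>) $ i * (W s \<omega> - W r \<omega>) $ j))"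
    and "expectation (\<lambda>\<omega>. \<xi> \<omega> * ((W s \<omega> - W r \<omega>) $ i * (W s \<omega> - W r \<omega>) $ j))
         = (if i = j then (s - r) * expectation \<xi> else 0)"
proof -
  have 1: "indep_var borel \<xi> borel (\<lambda>\<omega>. (W s \<omega> - W r \<omega>) $ i)"
    by (rule indep_increment[OF rs \<xi>(1), of "\<lambda>x. x $ i"]) simp
  have 2: "indep_var borel \<xi> borel (\<lambda>\<omega>. (W s \<omega> - W r \<omega>) $ i * (W s \<omega> - W r \<omega>) $ j)"
    by (rule indep_increment[OF rs \<xi>(1), of "\<lambda>x. x $ i * x $ j"]) simp
  note m = increment_moments[OF rs]
  show "integrable M (\<lambda>\<omega>. \<xi> \<omega> * (W s \<omega> - W r \<omega>) $ i)"
    "expectation (\<lambda>\<omega>. \<xi> \<omega> * (W s \<omega> - W r \<omega>) $ i) = 0"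
    using indep_var_expectation_mult[OF 1 \<xi>(2) m(1)] m(2)[of i] by auto
  show "integrable M (\<lambda>\<omega>. \<xi> \<omega> * ((W s \<omega> - W r \<omega>) $ i * (W s \<omega> - W r \<omega>) $ j))"
    "expectation (\<lambda>\<omega>. \<xi> \<omega> * ((W s \<omega> - W r \<omega>) $ i * (W s \<omega> - W r \<omega>) $ j))
         = (if i = j then (s - r) * expectation \<xi> else 0)"
    using indep_var_expectation_mult[OF 2 \<xi>(2) m(3)] m(4)[of i j] by auto
qed

lemma expectation_inner_increment:
  assumes rs: "0 \<le> r" "r \<le> s"
    and \<xi>: "\<xi> \<in> borel_measurable (F r)" "square_integrable M \<xi>"
    and \<eta>: "\<eta> \<in> borel_measurable (F r)" "square_integrable M \<eta>"
  shows "integrable M (\<lambda>\<omega>. \<eta> \<omega> * (\<xi> \<omega> \<bullet> (W s \<omega> - W r \<omega>)))"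
    and "expectation (\<lambda>\<omega>. \<eta> \<omega> * (\<xi> \<omega> \<bullet> (W s \<omega> - W r \<omega>))) = 0"
proof -
  have "integrable M (\<lambda>\<omega>. \<eta> \<omega> * (\<xi> \<omega> \<bullet> (W s \<omega> - W r \<omega>))) \<and>
      expectation (\<lambda>\<omega>. \<eta> \<omega> * (\<xi> \<omega> \<bullet> (W s \<omega> - W r \<omega>))) = 0"
  proof (cases "r = s")
    case False
    with rs have rs': "0 \<le> r" "r < s" by auto
    note [measurable] = \<xi>(1) \<eta>(1)
    have int: "integrable M (\<lambda>\<omega>. \<eta> \<omega> * \<xi> \<omega> $ i)" for i
    proof -
      have "square_integrable M (\<lambda>\<omega>. \<xi> \<omega> $ i)"
        using \<xi>(2) by (rule square_integrable_component)
      from integrable_inner[OF \<eta>(2) this] show ?thesis by simp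
    qed
    have m: "(\<lambda>\<omega>. \<eta> \<omega> * \<xi> \<omega> $ i) \<in> borel_measurable (F r)" for i by measurable
    have eq: "\<eta> \<omega> * (\<xi> \<omega> \<bullet> (W s \<omega> - W r \<omega>)) = (\<Sum>i\<in>UNIV. (\<eta> \<omega> * \<xi> \<omega> $ i) * (W s \<omega> - W r \<omega>) $ i)" for \<omega>
      by (simp add: inner_vec_def sum_distrib_left mult.assoc)
    show ?thesis
      unfolding eq using integrable_mult_increment(1,2)[OF rs' m int] by simp
  qed simp
  then show "integrable M (\<lambda>\<omega>. \<eta> \<omega> * (\<xi> \<omega> \<bullet> (W s \<omega> - W r \<omega>)))"
    "expectation (\<lambda>\<omega>. \<eta> \<omega> * (\<xi> \<omega> \<bullet> (W s \<omega> - W r \<omega>))) = 0" by auto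
qed

text \<open>Only the diagonal products of coordinates of the increment have nonzero mean, which
  collapses the double sum to the inner product of the two vectors frozen at time \<open>r\<close>.
  All second order limits of the one step estimate come from here. Integrability is asked only of
  the products that actually occur.\<close>

lemma expectation_increment_increment:
  fixes \<eta> :: "'a \<Rightarrow> real"
  assumes rs: "0 \<le> r" "r \<le> s"
    and meas: "\<xi> \<in> borel_measurable (F r)" "\<zeta> \<in> borel_measurable (F r)" "\<eta> \<in> borel_measurable (F r)"
    and int: "\<And>i j. integrable M (\<lambda>\<omega>. \<eta> \<omega> * (\<xi> \<omega> $ i * \<zeta> \<omega> $ j))"
  shows "integrable M (\<lambda>\<omega>. \<eta> \<omega> * ((\<xi> \<omega> \<bullet> (W s \<omega> - W r \<omega>)) * (\<zeta> \<omega> \<bullet> (W s \<omega> - W r \<omega>))))"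
    and "expectation (\<lambda>\<omega>. \<eta> \<omega> * ((\<xi> \<omega> \<bullet> (W s \<omega> - W r \<omega>)) * (\<zeta> \<omega> \<bullet> (W s \<omega> - W r \<omega>))))
       = (s - r) * expectation (\<lambda>\<omega>. \<eta> \<omega> * (\<xi> \<omega> \<bullet> \<zeta> \<omega>))"
proof -
  have "integrable M (\<lambda>\<omega>. \<eta> \<omega> * ((\<xi> \<omega> \<bullet> (W s \<omega> - W r \<omega>)) * (\<zeta> \<omega> \<bullet> (W s \<omega> - W r \<omega>)))) \<and>
     expectation (\<lambda>\<omega>. \<eta> \<omega> * ((\<xi> \<omega> \<bullet> (W s \<omega> - W r \<omega>)) * (\<zeta> \<omega> \<bullet> (W s \<omega> - W r \<omega>))))
       = (s - r) * expectation (\<lambda>\<omega>. \<eta> \<omega> * (\<xi> \<omega> \<bullet> \<zeta> \<omega>))"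
  proof (cases "r = s")
    case False
    with rs have rs': "0 \<le> r" "r < s" by auto
    let ?D = "\<lambda>i \<omega>. (W s \<omega> - W r \<omega>) $ i"
    note [measurable] = meas
    have m: "(\<lambda>\<omega>. \<eta> \<omega> * (\<xi> \<omega> $ i * \<zeta> \<omega> $ j)) \<in> borel_measurable (F r)" for i j by measurable
    have eq: "\<eta> \<omega> * ((\<xi> \<omega> \<bullet> (W s \<omega> - W r \<omega>)) * (\<zeta> \<omega> \<bullet> (W s \<omega> - W r \<omega>))) =
        (\<Sum>i\<in>UNIV. \<Sum>j\<in>UNIV. (\<eta> \<omega> * (\<xi> \<omega> $ i * \<zeta> \<omega> $ j)) * (?D i \<omega> * ?D j \<omega>))" for \<omega>
      unfolding inner_vec_def inner_real_def sum_product unfolding sum_distrib_left by (simp only: ac_simps)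
    have eq2: "\<eta> \<omega> * (\<xi> \<omega> \<bullet> \<zeta> \<omega>) = (\<Sum>i\<in>UNIV. \<eta> \<omega> * (\<xi> \<omega> $ i * \<zeta> \<omega> $ i))" for \<omega>
      by (simp add: inner_vec_def sum_distrib_left)
    note mi = integrable_mult_increment(3,4)[OF rs' m int]
    have "expectation (\<lambda>\<omega>. \<Sum>i\<in>UNIV. \<Sum>j\<in>UNIV. (\<eta> \<omega> * (\<xi> \<omega> $ i * \<zeta> \<omega> $ j)) * (?D i \<omega> * ?D j \<omega>))
      = (\<Sum>i\<in>UNIV. \<Sum>j\<in>UNIV. if i = j then (s - r) * expectation (\<lambda>\<omega>. \<eta> \<omega> * (\<xi> \<omega> $ i * \<zeta> \<omega> $ j)) else 0)"
      using mi by (simp add: Bochner_Integration.integral_sum Bochner_Integration.integrable_sum)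
    also have "\<dots> = (s - r) * (\<Sum>i\<in>UNIV. expectation (\<lambda>\<omega>. \<eta> \<omega> * (\<xi> \<omega> $ i * \<zeta> \<omega> $ i)))"
      by (simp add: sum_distrib_left)
    also have "\<dots> = (s - r) * expectation (\<lambda>\<omega>. \<eta> \<omega> * (\<xi> \<omega> \<bullet> \<zeta> \<omega>))"
      unfolding eq2 using int by (simp add: Bochner_Integration.integral_sum)
    finally show ?thesis unfolding eq using mi(1) by (simp add: Bochner_Integration.integrable_sum)
  qed simp
  then show "integrable M (\<lambda>\<omega>. \<eta> \<omega> * ((\<xi> \<omega> \<bullet> (W s \<omega> - W r \<omega>)) * (\<zeta> \<omega> \<bullet> (W s \<omega> - W r \<omega>))))"
    "expectation (\<lambda>\<omega>. \<eta> \<omega> * ((\<xi> \<omega> \<bullet> (W s \<omega> - W r \<omega>)) * (\<zeta> \<omega> \<bullet> (W s \<omega> - W r \<omega>))))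
       = (s - r) * expectation (\<lambda>\<omega>. \<eta> \<omega> * (\<xi> \<omega> \<bullet> \<zeta> \<omega>))" by auto
qed

text \<open>Given the past, \<open>\<xi>\<close> is a constant vector and the increment is Gaussian.
  Independence makes the joint law a product measure, and integrating out the increment first
  performs this conditioning. As everything is nonnegative, no integrability of
  \<open>\<eta>\<close> has to be known; the induction for exponential moments inserts there the
  exponential of the earlier steps.\<close>

lemma nn_integral_mult_exp_increment:
  assumes rs: "0 \<le> r" "r \<le> s" and [measurable]: "\<xi> \<in> borel_measurable (F r)" "\<eta> \<in> borel_measurable (F r)"
  shows "(\<integral>\<^sup>+\<omega>. \<eta> \<omega> * ennreal (exp (\<xi> \<omega> \<bullet> (W s \<omega> - W r \<omega>))) \<partial>M)
       = (\<integral>\<^sup>+\<omega>. \<eta> \<omega> * ennreal (exp ((norm (\<xi> \<omega>))\<^sup>2 * (s - r) / 2)) \<partial>M)"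
proof (cases "r = s")
  case False
  with rs have rs': "0 \<le> r" "r < s" by auto
  let ?D = "\<lambda>\<omega>. W s \<omega> - W r \<omega>" and ?P = "\<lambda>\<omega>. (\<eta> \<omega>, \<xi> \<omega>)"
  let ?B = "borel \<Otimes>\<^sub>M borel :: (ennreal \<times> (real^'d)) measure"
  have [measurable]: "\<eta> \<in> borel_measurable M" "\<xi> \<in> borel_measurable M"
    by (simp_all add: measurable_F_M[OF assms(3)] measurable_F_M[OF assms(4)])
  have [measurable]: "?D \<in> borel_measurable M" using rs by simp
  have P: "?P \<in> measurable (F r) ?B" by measurable
  then have [measurable]: "?P \<in> measurable M ?B" by (rule measurable_F_M)
  \<comment> \<open>\<open>indep_var\<close> relates variables of equal type, hence the dummy component.\<close>
  let ?E = "\<lambda>\<omega>. (0 :: ennreal, ?D \<omega>)"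
  have joint: "distr M ?B ?P \<Otimes>\<^sub>M distr M ?B ?E = distr M (?B \<Otimes>\<^sub>M ?B) (\<lambda>\<omega>. (?P \<omega>, ?E \<omega>))"
    using indep_increment[OF rs' P, of "\<lambda>y. (0, y)"] by (simp add: indep_var_distribution_eq)
  interpret D: prob_space "distr M ?B ?E" by (rule prob_space_distr) simp
  have "(\<integral>\<^sup>+\<omega>. \<eta> \<omega> * ennreal (exp (\<xi> \<omega> \<bullet> ?D \<omega>)) \<partial>M)
      = (\<integral>\<^sup>+z. fst (fst z) * ennreal (exp (snd (fst z) \<bullet> snd (snd z))) \<partial>distr M (?B \<Otimes>\<^sub>M ?B) (\<lambda>\<omega>. (?P \<omega>, ?E \<omega>)))"
    by (subst nn_integral_distr) auto
  also have "\<dots> = (\<integral>\<^sup>+p. (\<integral>\<^sup>+y. fst p * ennreal (exp (snd p \<bullet> snd y)) \<partial>distr M ?B ?E) \<partial>distr M ?B ?P)"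
    unfolding joint[symmetric] by (subst D.nn_integral_fst[symmetric]) auto
  also have "\<dots> = (\<integral>\<^sup>+p. fst p * ennreal (exp ((norm (snd p))\<^sup>2 * (s - r) / 2)) \<partial>distr M ?B ?P)"
    by (intro nn_integral_cong)
      (simp add: nn_integral_cmult nn_integral_distr nn_integral_exp_increment[OF rs'])
  also have "\<dots> = (\<integral>\<^sup>+\<omega>. \<eta> \<omega> * ennreal (exp ((norm (\<xi> \<omega>))\<^sup>2 * (s - r) / 2)) \<partial>M)"
    by (subst nn_integral_distr) auto
  finally show ?thesis .
qed simp

end


lemma integral_sum_sum:
  fixes f :: "'i \<Rightarrow> 'j \<Rightarrow> 'a \<Rightarrow> real"
  assumes "\<And>i j. i \<in> I \<Longrightarrow> j \<in> J \<Longrightarrow> integrable M (f i j)"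
  shows "(\<integral>x. (\<Sum>i\<in>I. \<Sum>j\<in>J. f i j x) \<partial>M) = (\<Sum>i\<in>I. \<Sum>j\<in>J. \<integral>x. f i j x \<partial>M)"
proof -
  have "(\<integral>x. (\<Sum>i\<in>I. \<Sum>j\<in>J. f i j x) \<partial>M) = (\<Sum>i\<in>I. \<integral>x. (\<Sum>j\<in>J. f i j x) \<partial>M)"
    by (intro Bochner_Integration.integral_sum Bochner_Integration.integrable_sum assms)
  also have "\<dots> = (\<Sum>i\<in>I. \<Sum>j\<in>J. \<integral>x. f i j x \<partial>M)"
    by (intro sum.cong refl Bochner_Integration.integral_sum assms)
  finally show ?thesis .
qed

section \<open>The isometry for families of steps\<close>

context wiener
begin

text \<open>A step \<open>(l, r, \<xi>)\<close> stands for the integrand \<open>\<xi>\<close> on \<open>(l, r]\<close>. The intervals of a list of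
  steps may overlap, so that integrands over different partitions can be added by appending.\<close>

definition adapted_steps :: "(real \<times> real \<times> ('a \<Rightarrow> real^'d)) list \<Rightarrow> bool" where
  "adapted_steps L \<longleftrightarrow> (\<forall>(l, r, \<xi>)\<in>set L.
     0 \<le> l \<and> l \<le> r \<and> \<xi> \<in> borel_measurable (F l) \<and> bounded (\<xi> ` space M))"

definition steps_process :: "(real \<times> real \<times> ('a \<Rightarrow> real^'d)) list \<Rightarrow> real \<Rightarrow> 'a \<Rightarrow> real^'d" where
  "steps_process L s \<omega> = (\<Sum>(l, r, \<xi>)\<leftarrow>L. indicator {l<..r} s *\<^sub>R \<xi> \<omega>)"

definition steps_ito :: "(real \<times> real \<times> ('a \<Rightarrow> real^'d)) list \<Rightarrow> 'a \<Rightarrow> real" where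
  "steps_ito L \<omega> = (\<Sum>(l, r, \<xi>)\<leftarrow>L. \<xi> \<omega> \<bullet> (W r \<omega> - W l \<omega>))"

text \<open>Appending a negated list realises the difference of two integrands whose partitions are
  unrelated, without a common refinement.\<close>

definition neg_steps :: "(real \<times> real \<times> ('a \<Rightarrow> real^'d)) list \<Rightarrow> (real \<times> real \<times> ('a \<Rightarrow> real^'d)) list" where
  "neg_steps L = map (\<lambda>(l, r, \<xi>). (l, r, \<lambda>\<omega>. - \<xi> \<omega>)) L"

lemma steps_append:
  "adapted_steps (L @ L') \<longleftrightarrow> adapted_steps L \<and> adapted_steps L'"
  "steps_process (L @ L') s \<omega> = steps_process L s \<omega> + steps_process L' s \<omega>"
  "steps_ito (L @ L') \<omega> = steps_ito L \<omega> + steps_ito L' \<omega>"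
  by (simp_all add: adapted_steps_def steps_process_def steps_ito_def ball_Un)

lemma steps_neg:
  "adapted_steps L \<Longrightarrow> adapted_steps (neg_steps L)"
  "steps_process (neg_steps L) s \<omega> = - steps_process L s \<omega>"
  "steps_ito (neg_steps L) \<omega> = - steps_ito L \<omega>"
proof -
  have "bounded ((\<lambda>\<omega>. - \<xi> \<omega>) ` space M)" if "bounded (\<xi> ` space M)" for \<xi> :: "'a \<Rightarrow> real^'d"
    using that by (simp add: bounded_iff)
  then show "adapted_steps L \<Longrightarrow> adapted_steps (neg_steps L)"
    by (simp add: adapted_steps_def neg_steps_def case_prod_beta)
  show "steps_process (neg_steps L) s \<omega> = - steps_process L s \<omega>"
    unfolding steps_process_def neg_steps_def by (induction L) auto
  show "steps_ito (neg_steps L) \<omega> = - steps_ito L \<omega>"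
    unfolding steps_ito_def neg_steps_def by (induction L) auto
qed

lemma adapted_bounded_square_integrable:
  fixes \<xi> :: "'a \<Rightarrow> 'b::euclidean_space"
  assumes "\<xi> \<in> borel_measurable (F l)" "bounded (\<xi> ` space M)"
  shows "square_integrable M \<xi>"
proof -
  obtain C where "\<And>\<omega>. \<omega> \<in> space M \<Longrightarrow> norm (\<xi> \<omega>) \<le> C"
    using assms(2) unfolding bounded_iff by auto
  then show ?thesis
    using measurable_F_M[OF assms(1)] by (intro square_integrable_bounded)
qed

lemma square_integrable_inner_increment:
  assumes lr: "0 \<le> l" "l \<le> r" and \<xi>: "\<xi> \<in> borel_measurable (F l)" "square_integrable M \<xi>"
  shows "square_integrable M (\<lambda>\<omega>. \<xi> \<omega> \<bullet> (W r \<omega> - W l \<omega>))"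
proof -
  note [measurable] = \<xi>(1)
  have comp: "square_integrable M (\<lambda>\<omega>. \<xi> \<omega> $ i)" for i
    using \<xi>(2) by (rule square_integrable_component)
  have "integrable M (\<lambda>\<omega>. 1 * ((\<xi> \<omega> \<bullet> (W r \<omega> - W l \<omega>)) * (\<xi> \<omega> \<bullet> (W r \<omega> - W l \<omega>))))"
    using integrable_inner[OF comp comp] by (intro expectation_increment_increment lr \<xi>) auto
  moreover have "(\<lambda>\<omega>. \<xi> \<omega> \<bullet> (W r \<omega> - W l \<omega>)) \<in> borel_measurable M"
    using lr measurable_F_M[OF \<xi>(1)] by (auto intro!: borel_measurable_inner borel_measurable_diff)
  ultimately show ?thesis by (simp add: square_integrable_def power2_eq_square)
qed

lemma inner_increment_measurable_F:
  assumes "0 \<le> l" "l \<le> r" "r \<le> s" "\<xi> \<in> borel_measurable (F l)"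
  shows "(\<lambda>\<omega>. \<xi> \<omega> \<bullet> (W r \<omega> - W l \<omega>)) \<in> borel_measurable (F s)"
proof -
  have [measurable]: "\<xi> \<in> borel_measurable (F s)" "W r \<in> borel_measurable (F s)" "W l \<in> borel_measurable (F s)"
    using assms by (auto intro: W_measurable_F measurable_F_mono)
  show ?thesis by measurable
qed

text \<open>Both intervals are cut at \<open>l'\<close> and at the smaller right end
  \<open>m\<close>. Of the resulting products, only the one with both increments over (l', m] has
  nonzero mean; in every other one, a factor is an increment that begins when all the rest is
  already known.\<close>

lemma expectation_steps_ordered:
  assumes l: "0 \<le> l" "l \<le> l'" and r: "l \<le> r" "l' \<le> r'"
    and \<xi>: "\<xi> \<in> borel_measurable (F l)" "square_integrable M \<xi>"
    and \<xi>': "\<xi>' \<in> borel_measurable (F l')" "square_integrable M \<xi>'"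
  shows "expectation (\<lambda>\<omega>. (\<xi> \<omega> \<bullet> (W r \<omega> - W l \<omega>)) * (\<xi>' \<omega> \<bullet> (W r' \<omega> - W l' \<omega>)))
      = measure lborel ({l<..r} \<inter> {l'<..r'}) * expectation (\<lambda>\<omega>. \<xi> \<omega> \<bullet> \<xi>' \<omega>)"
proof (cases "r \<le> l'")
  case True
  have "expectation (\<lambda>\<omega>. (\<xi> \<omega> \<bullet> (W r \<omega> - W l \<omega>)) * (\<xi>' \<omega> \<bullet> (W r' \<omega> - W l' \<omega>))) = 0"
    using True l r \<xi> \<xi>'
    by (intro expectation_inner_increment inner_increment_measurable_F square_integrable_inner_increment) auto
  moreover have e: "{l<..r} \<inter> {l'<..r'} = {}" using True by auto
  ultimately show ?thesis unfolding e by simp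
next
  case False
  define m where "m = min r r'"
  have m: "l' \<le> m" "m \<le> r" "m \<le> r'" "m = r \<or> m = r'" "0 \<le> l'" "l \<le> m" "0 \<le> m"
    using False r l by (auto simp: m_def min_def)
  let ?A = "\<lambda>\<omega>. \<xi> \<omega> \<bullet> (W l' \<omega> - W l \<omega>)" and ?B = "\<lambda>\<omega>. \<xi> \<omega> \<bullet> (W m \<omega> - W l' \<omega>)"
    and ?C = "\<lambda>\<omega>. \<xi> \<omega> \<bullet> (W r \<omega> - W m \<omega>)" and ?I = "\<lambda>\<omega>. \<xi>' \<omega> \<bullet> (W r' \<omega> - W l' \<omega>)"
    and ?B' = "\<lambda>\<omega>. \<xi>' \<omega> \<bullet> (W m \<omega> - W l' \<omega>)" and ?C' = "\<lambda>\<omega>. \<xi>' \<omega> \<bullet> (W r' \<omega> - W m \<omega>)"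
  \<comment> \<open>Since \<open>m\<close> equals \<open>r\<close> or \<open>r'\<close>, one of
    \<open>?C\<close> and \<open>?C'\<close> is zero, which is why their product is missing. The
    factor 1 gives the middle term the shape expected by
    \<open>expectation_increment_increment\<close>.\<close>
  have eq: "(\<xi> \<omega> \<bullet> (W r \<omega> - W l \<omega>)) * (\<xi>' \<omega> \<bullet> (W r' \<omega> - W l' \<omega>)) =
      ?A \<omega> * ?I \<omega> + 1 * (?B \<omega> * ?B' \<omega>) + ?B \<omega> * ?C' \<omega> + ?B' \<omega> * ?C \<omega>" for \<omega>
    using m(4) by (auto simp: algebra_simps)
  have \<xi>l': "\<xi> \<in> borel_measurable (F l')" using \<xi>(1) l(2) by (rule measurable_F_mono)
  have \<xi>m: "\<xi> \<in> borel_measurable (F m)" "\<xi>' \<in> borel_measurable (F m)"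
    using \<xi>(1) \<xi>'(1) m by (auto intro: measurable_F_mono)
  have 1: "integrable M (\<lambda>\<omega>. ?A \<omega> * ?I \<omega>)" "expectation (\<lambda>\<omega>. ?A \<omega> * ?I \<omega>) = 0"
    using l r m by (auto intro!: expectation_inner_increment inner_increment_measurable_F
        square_integrable_inner_increment \<xi> \<xi>')
  have 2: "integrable M (\<lambda>\<omega>. 1 * (?B \<omega> * ?B' \<omega>))"
      "expectation (\<lambda>\<omega>. 1 * (?B \<omega> * ?B' \<omega>)) = (m - l') * expectation (\<lambda>\<omega>. 1 * (\<xi> \<omega> \<bullet> \<xi>' \<omega>))"
  proof -
    have "integrable M (\<lambda>\<omega>. 1 * (\<xi> \<omega> $ i * \<xi>' \<omega> $ j))" for i j
      using integrable_inner[OF square_integrable_component[OF \<xi>(2)] square_integrable_component[OF \<xi>'(2)], of i j]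
      by simp
    then show "integrable M (\<lambda>\<omega>. 1 * (?B \<omega> * ?B' \<omega>))"
      "expectation (\<lambda>\<omega>. 1 * (?B \<omega> * ?B' \<omega>)) = (m - l') * expectation (\<lambda>\<omega>. 1 * (\<xi> \<omega> \<bullet> \<xi>' \<omega>))"
      using m \<xi>l' \<xi>'(1) by (intro expectation_increment_increment; simp)+
  qed
  have 3: "integrable M (\<lambda>\<omega>. ?B \<omega> * ?C' \<omega>)" "expectation (\<lambda>\<omega>. ?B \<omega> * ?C' \<omega>) = 0"
    using l r m(1-3,5-) by (auto intro!: expectation_inner_increment inner_increment_measurable_F
        square_integrable_inner_increment \<xi>l' \<xi> \<xi>' \<xi>m)
  have 4: "integrable M (\<lambda>\<omega>. ?B' \<omega> * ?C \<omega>)" "expectation (\<lambda>\<omega>. ?B' \<omega> * ?C \<omega>) = 0"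
    using l r m(1-3,5-) by (auto intro!: expectation_inner_increment inner_increment_measurable_F
        square_integrable_inner_increment \<xi>l' \<xi> \<xi>' \<xi>m)
  have e: "{l<..r} \<inter> {l'<..r'} = {l'<..m}" using l by (auto simp: m_def)
  show ?thesis unfolding eq e using 1 2 3 4 m by simp
qed

lemma expectation_steps:
  assumes "0 \<le> l" "0 \<le> l'" "l \<le> r" "l' \<le> r'"
    and "\<xi> \<in> borel_measurable (F l)" "square_integrable M \<xi>"
    and "\<xi>' \<in> borel_measurable (F l')" "square_integrable M \<xi>'"
  shows "expectation (\<lambda>\<omega>. (\<xi> \<omega> \<bullet> (W r \<omega> - W l \<omega>)) * (\<xi>' \<omega> \<bullet> (W r' \<omega> - W l' \<omega>)))
      = measure lborel ({l<..r} \<inter> {l'<..r'}) * expectation (\<lambda>\<omega>. \<xi> \<omega> \<bullet> \<xi>' \<omega>)"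
proof (cases "l \<le> l'")
  case True
  then show ?thesis using expectation_steps_ordered assms by blast
next
  case False
  then have "l' \<le> l" by simp
  from expectation_steps_ordered[OF assms(2) this assms(4,3,7,8,5,6)]
  show ?thesis by (simp add: mult.commute inner_commute Int_commute)
qed

lemma adapted_steps_nth:
  assumes "adapted_steps L" "k < length L" "L ! k = (l, r, \<xi>)"
  shows "0 \<le> l" "l \<le> r" "\<xi> \<in> borel_measurable (F l)" "square_integrable M \<xi>"
proof -
  have "(l, r, \<xi>) \<in> set L" using assms(2,3) by (metis nth_mem)
  then have *: "0 \<le> l \<and> l \<le> r \<and> \<xi> \<in> borel_measurable (F l) \<and> bounded (\<xi> ` space M)"
    using assms(1) unfolding adapted_steps_def by fast
  then show "0 \<le> l" "l \<le> r" "\<xi> \<in> borel_measurable (F l)" "square_integrable M \<xi>"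
    by (auto intro: adapted_bounded_square_integrable)
qed

lemma steps_ito_square_integrable:
  assumes "adapted_steps L"
  shows "square_integrable M (steps_ito L)"
proof -
  have "square_integrable M (\<lambda>\<omega>. \<Sum>k<length L. case L ! k of (l, r, \<xi>) \<Rightarrow> \<xi> \<omega> \<bullet> (W r \<omega> - W l \<omega>))"
  proof (rule square_integrable_sum)
    fix k assume k: "k \<in> {..<length L}"
    obtain l r \<xi> where lr: "L ! k = (l, r, \<xi>)" by (cases "L ! k") auto
    show "square_integrable M (\<lambda>\<omega>. case L ! k of (l, r, \<xi>) \<Rightarrow> \<xi> \<omega> \<bullet> (W r \<omega> - W l \<omega>))"
      using adapted_steps_nth[OF assms _ lr] k lr by (auto intro!: square_integrable_inner_increment)
  qed
  then show ?thesis
    by (simp add: steps_ito_def[abs_def] sum_list_sum_nth atLeast0LessThan case_prod_beta)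
qed

text \<open>Squares on both sides expand into double sums over pairs of steps. A pair contributes
  the length of the overlap of its intervals times the mean of the inner product of its vectors: on
  the left by \<open>expectation_steps\<close>, on the right by integrating a product of indicators.
  Overlapping steps are thus no obstacle.\<close>

theorem steps_isometry:
  assumes L: "adapted_steps L"
  shows "(\<integral>\<^sup>+\<omega>. ennreal ((steps_ito L \<omega>)\<^sup>2) \<partial>M) =
    (\<integral>\<^sup>+\<omega>. (\<integral>\<^sup>+s. ennreal ((norm (steps_process L s \<omega>))\<^sup>2) \<partial>lborel) \<partial>M)"
proof -
  define n where "n = length L"
  define l r \<xi> where "l k = fst (L ! k)" and "r k = fst (snd (L ! k))" and "\<xi> k = snd (snd (L ! k))" for k
  have nth: "L ! k = (l k, r k, \<xi> k)" for k by (simp add: l_def r_def \<xi>_def)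
  note ok = adapted_steps_nth[OF L, folded n_def, OF _ nth]
  let ?I = "\<lambda>k \<omega>. \<xi> k \<omega> \<bullet> (W (r k) \<omega> - W (l k) \<omega>)"
  let ?m = "\<lambda>i j. measure lborel ({l i<..r i} \<inter> {l j<..r j})"
  have ito: "steps_ito L \<omega> = (\<Sum>k<n. ?I k \<omega>)" for \<omega>
    by (simp add: steps_ito_def sum_list_sum_nth atLeast0LessThan nth n_def)
  have proc: "steps_process L s \<omega> = (\<Sum>k<n. indicator {l k<..r k} s *\<^sub>R \<xi> k \<omega>)" for s \<omega>
    by (simp add: steps_process_def sum_list_sum_nth atLeast0LessThan nth n_def)
  have si: "square_integrable M (?I k)" if "k < n" for k
    using ok[OF that] by (intro square_integrable_inner_increment)
  have int: "integrable M (\<lambda>\<omega>. ?I i \<omega> * ?I j \<omega>)" if "i < n" "j < n" for i j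
    using integrable_inner[OF si[OF that(1)] si[OF that(2)]] by simp
  have int\<xi>: "integrable M (\<lambda>\<omega>. \<xi> i \<omega> \<bullet> \<xi> j \<omega>)" if "i < n" "j < n" for i j
    using integrable_inner ok(4)[OF that(1)] ok(4)[OF that(2)] .
  have sq: "(steps_ito L \<omega>)\<^sup>2 = (\<Sum>i<n. \<Sum>j<n. ?I i \<omega> * ?I j \<omega>)" for \<omega>
    unfolding ito power2_eq_square sum_product ..
  have isq: "integrable M (\<lambda>\<omega>. (steps_ito L \<omega>)\<^sup>2)"
    unfolding sq by (intro Bochner_Integration.integrable_sum int) auto
  have "expectation (\<lambda>\<omega>. (steps_ito L \<omega>)\<^sup>2) = (\<Sum>i<n. \<Sum>j<n. expectation (\<lambda>\<omega>. ?I i \<omega> * ?I j \<omega>))"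
    unfolding sq by (intro integral_sum_sum int) auto
  also have "\<dots> = (\<Sum>i<n. \<Sum>j<n. ?m i j * expectation (\<lambda>\<omega>. \<xi> i \<omega> \<bullet> \<xi> j \<omega>))"
    using ok by (intro sum.cong refl expectation_steps) auto
  also have "\<dots> = expectation (\<lambda>\<omega>. \<Sum>i<n. \<Sum>j<n. ?m i j * (\<xi> i \<omega> \<bullet> \<xi> j \<omega>))"
    using int\<xi> by (subst integral_sum_sum) auto
  finally have E: "expectation (\<lambda>\<omega>. (steps_ito L \<omega>)\<^sup>2) = expectation (\<lambda>\<omega>. \<Sum>i<n. \<Sum>j<n. ?m i j * (\<xi> i \<omega> \<bullet> \<xi> j \<omega>))" .
  have inner: "has_bochner_integral lborel (\<lambda>s. (norm (steps_process L s \<omega>))\<^sup>2) (\<Sum>i<n. \<Sum>j<n. ?m i j * (\<xi> i \<omega> \<bullet> \<xi> j \<omega>))" for \<omega>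
  proof -
    have "(norm (steps_process L s \<omega>))\<^sup>2 = (\<Sum>i<n. \<Sum>j<n. indicator ({l i<..r i} \<inter> {l j<..r j}) s * (\<xi> i \<omega> \<bullet> \<xi> j \<omega>))" for s
    proof -
      have "(norm (steps_process L s \<omega>))\<^sup>2 = (\<Sum>i<n. (indicator {l i<..r i} s *\<^sub>R \<xi> i \<omega>) \<bullet> (\<Sum>j<n. indicator {l j<..r j} s *\<^sub>R \<xi> j \<omega>))"
        unfolding power2_norm_eq_inner proc by (rule inner_sum_left)
      also have "\<dots> = (\<Sum>i<n. \<Sum>j<n. indicator ({l i<..r i} \<inter> {l j<..r j}) s * (\<xi> i \<omega> \<bullet> \<xi> j \<omega>))"
        by (simp only: inner_sum_right inner_scaleR_left inner_scaleR_right indicator_inter_arith mult.assoc mult.left_commute)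
      finally show ?thesis .
    qed
    moreover have "has_bochner_integral lborel (indicator ({l i<..r i} \<inter> {l j<..r j}) :: real \<Rightarrow> real) (?m i j)" for i j
    proof (rule has_bochner_integral_real_indicator)
      show "emeasure lborel ({l i<..r i} \<inter> {l j<..r j}) < \<infinity>"
        by (rule emeasure_bounded_finite, rule bounded_subset[OF bounded_closed_interval[of "l i" "r i"]]) auto
    qed simp
    ultimately show ?thesis
      by (simp only:) (intro has_bochner_integral_sum has_bochner_integral_mult_left, simp)
  qed
  have "(\<integral>\<^sup>+s. ennreal ((norm (steps_process L s \<omega>))\<^sup>2) \<partial>lborel) = ennreal (\<Sum>i<n. \<Sum>j<n. ?m i j * (\<xi> i \<omega> \<bullet> \<xi> j \<omega>))" for \<omega>
    using inner[of \<omega>] by (subst nn_integral_eq_integral) (auto simp: has_bochner_integral_iff)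
  \<comment> \<open>Single terms of the sum may be negative; its sign is visible only because it is
    the time integral of a squared norm.\<close>
  moreover have "0 \<le> (\<Sum>i<n. \<Sum>j<n. ?m i j * (\<xi> i \<omega> \<bullet> \<xi> j \<omega>))" for \<omega>
    using has_bochner_integral_integral_eq[OF inner[of \<omega>], symmetric] by simp
  moreover have "integrable M (\<lambda>\<omega>. \<Sum>i<n. \<Sum>j<n. ?m i j * (\<xi> i \<omega> \<bullet> \<xi> j \<omega>))"
    by (intro Bochner_Integration.integrable_sum integrable_mult_right int\<xi>) auto
  ultimately have "(\<integral>\<^sup>+\<omega>. (\<integral>\<^sup>+s. ennreal ((norm (steps_process L s \<omega>))\<^sup>2) \<partial>lborel) \<partial>M)
     = ennreal (expectation (\<lambda>\<omega>. \<Sum>i<n. \<Sum>j<n. ?m i j * (\<xi> i \<omega> \<bullet> \<xi> j \<omega>)))"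
    by (simp only: nn_integral_eq_integral AE_I2)
  also have "\<dots> = (\<integral>\<^sup>+\<omega>. ennreal ((steps_ito L \<omega>)\<^sup>2) \<partial>M)"
    using isq by (simp add: nn_integral_eq_integral E)
  finally show ?thesis by simp
qed

end


section \<open>Mean square convergence\<close>

text \<open>The value is extended, so that bounds, convergence and completeness can be stated before
  integrability is known.\<close>

definition mean_square :: "'a measure \<Rightarrow> ('a \<Rightarrow> 'b::euclidean_space) \<Rightarrow> ennreal" where
  "mean_square M f = (\<integral>\<^sup>+x. ennreal ((norm (f x))\<^sup>2) \<partial>M)"

lemma mean_square_add_le:
  assumes [measurable]: "f \<in> borel_measurable M" "g \<in> borel_measurable M"
  shows "mean_square M (\<lambda>x. f x + g x) \<le> 2 * mean_square M f + 2 * mean_square M g"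
proof -
  have "mean_square M (\<lambda>x. f x + g x) \<le> (\<integral>\<^sup>+x. 2 * ennreal ((norm (f x))\<^sup>2) + 2 * ennreal ((norm (g x))\<^sup>2) \<partial>M)"
    unfolding mean_square_def
  proof (rule nn_integral_mono)
    fix x
    have "ennreal ((norm (f x + g x))\<^sup>2) \<le> ennreal (2 * (norm (f x))\<^sup>2 + 2 * (norm (g x))\<^sup>2)"
      using norm_add_square_le by (rule ennreal_leI)
    then show "ennreal ((norm (f x + g x))\<^sup>2) \<le> 2 * ennreal ((norm (f x))\<^sup>2) + 2 * ennreal ((norm (g x))\<^sup>2)"
      by (simp add: ennreal_plus ennreal_mult)
  qed
  also have "\<dots> = 2 * mean_square M f + 2 * mean_square M g"
    by (simp add: mean_square_def nn_integral_add nn_integral_cmult)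
  finally show ?thesis .
qed

lemma mean_square_minus: "mean_square M (\<lambda>x. - f x) = mean_square M f"
  by (simp add: mean_square_def)

lemma mean_square_commute: "mean_square M (\<lambda>x. f x - g x) = mean_square M (\<lambda>x. g x - f x)"
  by (simp add: mean_square_def norm_minus_commute)

lemma mean_square_diff_le:
  assumes [measurable]: "f \<in> borel_measurable M" "g \<in> borel_measurable M"
  shows "mean_square M (\<lambda>x. f x - g x) \<le> 2 * mean_square M f + 2 * mean_square M g"
  using mean_square_add_le[of f M "\<lambda>x. - g x"] by (simp add: mean_square_minus)

lemma mean_square_cong_AE:
  assumes "AE x in M. f x = g x"
  shows "mean_square M f = mean_square M g"
  unfolding mean_square_def using assms by (intro nn_integral_cong_AE) auto

lemma mean_square_eq_0_AE:
  assumes [measurable]: "f \<in> borel_measurable M" and "mean_square M f = 0"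
  shows "AE x in M. f x = 0"
  using assms(2) by (simp add: mean_square_def nn_integral_0_iff_AE ennreal_eq_0_iff)

lemma mean_square_eq_integral:
  "square_integrable M f \<Longrightarrow> mean_square M f = ennreal (\<integral>x. (norm (f x))\<^sup>2 \<partial>M)"
  by (simp add: mean_square_def square_integrable_def nn_integral_eq_integral)

lemma square_integrable_iff_mean_square:
  "square_integrable M f \<longleftrightarrow> f \<in> borel_measurable M \<and> mean_square M f < \<infinity>"
proof
  assume *: "square_integrable M f"
  then show "f \<in> borel_measurable M \<and> mean_square M f < \<infinity>"
    by (simp add: mean_square_eq_integral square_integrable_measurable)
next
  assume *: "f \<in> borel_measurable M \<and> mean_square M f < \<infinity>"
  then have [measurable]: "f \<in> borel_measurable M" by simp
  show "square_integrable M f"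
    using * unfolding square_integrable_def mean_square_def by (auto intro!: integrableI_bounded)
qed

lemma tendsto_0_ennreal_le:
  fixes f g :: "nat \<Rightarrow> ennreal"
  assumes "g \<longlonglongrightarrow> 0" "\<And>n. f n \<le> g n"
  shows "f \<longlonglongrightarrow> 0"
  using tendsto_sandwich[of "\<lambda>_. 0" f sequentially g 0] assms by auto

lemma tendsto_0_ennreal_two_sum:
  fixes f g :: "nat \<Rightarrow> ennreal"
  assumes "f \<longlonglongrightarrow> 0" "g \<longlonglongrightarrow> 0"
  shows "(\<lambda>n. 2 * f n + 2 * g n) \<longlonglongrightarrow> 0"
proof -
  have "(\<lambda>n. 2 * f n + 2 * g n) \<longlonglongrightarrow> 2 * 0 + 2 * 0"
    by (intro tendsto_add ennreal_tendsto_cmult assms) auto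
  then show ?thesis by simp
qed

lemma mean_square_tendsto_AE_subseq:
  fixes f :: "nat \<Rightarrow> 'a \<Rightarrow> real"
  assumes fn: "\<And>n. f n \<in> borel_measurable M" and g: "g \<in> borel_measurable M"
    and lim: "(\<lambda>n. mean_square M (\<lambda>x. f n x - g x)) \<longlonglongrightarrow> 0"
  shows "\<exists>r::nat\<Rightarrow>nat. strict_mono r \<and> (AE x in M. (\<lambda>n. f (r n) x) \<longlonglongrightarrow> g x)"
proof -
  note [measurable] = fn g
  have "eventually (\<lambda>n. mean_square M (\<lambda>x. f n x - g x) < 1) sequentially"
    using order_tendstoD(2)[OF lim, of 1] by simp
  then obtain N where N: "\<And>n. n \<ge> N \<Longrightarrow> mean_square M (\<lambda>x. f n x - g x) < 1"
    by (auto simp: eventually_sequentially)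
  let ?u = "\<lambda>n x. (f (n + N) x - g x)\<^sup>2"
  have si: "square_integrable M (\<lambda>x. f (n + N) x - g x)" for n
    unfolding square_integrable_iff_mean_square using N[of "n + N"] by (auto intro: less_trans)
  then have int: "integrable M (?u n)" for n
    by (simp add: square_integrable_def)
  have "(\<lambda>n. mean_square M (\<lambda>x. f (n + N) x - g x)) \<longlonglongrightarrow> 0"
    using lim by (rule LIMSEQ_ignore_initial_segment)
  then have "(\<lambda>n. ennreal (\<integral>x. norm (?u n x) \<partial>M)) \<longlonglongrightarrow> ennreal 0"
    using si by (simp add: mean_square_eq_integral)
  then have "(\<lambda>n. \<integral>x. norm (?u n x) \<partial>M) \<longlonglongrightarrow> 0"
    by (subst (asm) tendsto_ennreal_iff) (auto intro!: always_eventually)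
  from tendsto_L1_AE_subseq[OF int this]
  obtain r :: "nat \<Rightarrow> nat" where r: "strict_mono r" "AE x in M. (\<lambda>n. ?u (r n) x) \<longlonglongrightarrow> 0"
    by auto
  have "AE x in M. (\<lambda>n. f (r n + N) x) \<longlonglongrightarrow> g x"
    using r(2)
  proof eventually_elim
    case (elim x)
    from tendsto_real_sqrt[OF elim] have "(\<lambda>n. \<bar>f (r n + N) x - g x\<bar>) \<longlonglongrightarrow> 0" by simp
    then show ?case by (simp add: tendsto_rabs_zero_iff LIM_zero_iff)
  qed
  moreover have "strict_mono (\<lambda>n. r n + N)" using r(1) by (simp add: strict_mono_def)
  ultimately show ?thesis by blast
qed

text \<open>Completeness of \<open>L\<^sup>2\<close>: along a subsequence with \<open>\<parallel>f (r (k + 1)) - f (r k)\<parallel>\<^sup>2 \<le> 4\<^sup>-\<^sup>k\<close> the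
  series \<open>\<Sum>k. 2\<^sup>k (f (r (k + 1)) - f (r k))\<^sup>2\<close> converges almost everywhere, hence so does
  \<open>f (r k)\<close>.\<close>

lemma mean_square_complete:
  fixes f :: "nat \<Rightarrow> 'a \<Rightarrow> real"
  assumes fn: "\<And>n. f n \<in> borel_measurable M" and e: "e \<longlonglongrightarrow> 0"
    and cauchy: "\<And>m n. mean_square M (\<lambda>x. f m x - f n x) \<le> e m + e n"
  shows "\<exists>g\<in>borel_measurable M. (\<lambda>n. mean_square M (\<lambda>x. f n x - g x)) \<longlonglongrightarrow> 0"
proof -
  note [measurable] = fn
  have "\<exists>N. \<forall>n\<ge>N. e n < ennreal ((1/4)^k)" for k
    using order_tendstoD(2)[OF e, of "ennreal ((1/4)^k)"] by (simp add: eventually_sequentially)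
  then obtain r where r: "\<And>k n. r k \<le> n \<Longrightarrow> e n < ennreal ((1/4)^k)" by metis
  \<comment> \<open>Partial sums of \<open>r\<close> are monotone and dominate it, so both
    \<open>q k\<close> and \<open>q (Suc k)\<close> lie beyond \<open>r k\<close>, where
    \<open>e\<close> is below 1/4^k.\<close>
  define q where "q k = (\<Sum>i\<le>k. r i)" for k
  have q1: "r k \<le> q k" for k by (simp add: q_def member_le_sum)
  have q2: "r k \<le> q (Suc k)" for k using q1[of k] by (simp add: q_def)
  let ?d = "\<lambda>k x. f (q (Suc k)) x - f (q k) x"
  have "(\<integral>\<^sup>+x. (\<Sum>k. ennreal (2^k * (?d k x)\<^sup>2)) \<partial>M) = (\<Sum>k. \<integral>\<^sup>+x. ennreal (2^k * (?d k x)\<^sup>2) \<partial>M)"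
    by (rule nn_integral_suminf) auto
  also have "\<dots> \<le> (\<Sum>k. ennreal (2 * (1/2)^k))"
  proof (rule suminf_le)
    fix k
    have "(\<integral>\<^sup>+x. ennreal (2^k * (?d k x)\<^sup>2) \<partial>M) = ennreal (2^k) * mean_square M (?d k)"
      by (simp add: mean_square_def ennreal_mult nn_integral_cmult)
    also have "\<dots> \<le> ennreal (2^k) * (ennreal ((1/4)^k) + ennreal ((1/4)^k))"
      using cauchy[of "q (Suc k)" "q k"] r[OF q2[of k]] r[OF q1[of k]]
      by (intro mult_left_mono order_trans[OF cauchy] add_mono) (auto intro: less_imp_le)
    also have "\<dots> = ennreal (2^k * ((1/4)^k + (1/4)^k))"
      by (subst ennreal_plus[symmetric]) (auto simp: ennreal_mult)
    also have "2^k * ((1/4)^k + (1/4)^k) = (2 * (1/2)^k :: real)"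
      by (simp add: power_divide power_mult_distrib[symmetric] field_simps)
    finally show "(\<integral>\<^sup>+x. ennreal (2^k * (?d k x)\<^sup>2) \<partial>M) \<le> ennreal (2 * (1/2)^k)" .
  qed auto
  also have "\<dots> = ennreal (\<Sum>k. 2 * (1/2)^k)"
    by (intro suminf_ennreal2 summable_mult summable_geometric) auto
  finally have "(\<integral>\<^sup>+x. (\<Sum>k. ennreal (2^k * (?d k x)\<^sup>2)) \<partial>M) \<noteq> \<infinity>"
    by (auto simp: top_unique)
  then have "AE x in M. (\<Sum>k. ennreal (2^k * (?d k x)\<^sup>2)) \<noteq> \<infinity>"
    by (intro nn_integral_PInf_AE) auto
  then have conv: "AE x in M. convergent (\<lambda>k. f (q k) x)"
  proof eventually_elim
    case (elim x)
    then have s: "summable (\<lambda>k. 2^k * (?d k x)\<^sup>2)"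
      by (intro summable_suminf_not_top) auto
    have "summable (\<lambda>k. ?d k x)"
    proof (rule summable_comparison_test')
      show "summable (\<lambda>k. (1/2)^k + 2^k * (?d k x)\<^sup>2)"
        by (intro summable_add s summable_geometric) auto
      fix k
      \<comment> \<open>From a \<le> 1 + a^2 with a = 2^k |d|: dividing by 2^k bounds |d| by a
        geometric term plus a term of the series known to converge.\<close>
      have "0 \<le> (1 - 2^k * \<bar>?d k x\<bar>)\<^sup>2 + 2^k * \<bar>?d k x\<bar>" by simp
      then have "2^k * \<bar>?d k x\<bar> \<le> 1 + (2^k * \<bar>?d k x\<bar>)\<^sup>2" by (simp add: power2_diff)
      also have "\<dots> = 2^k * ((1/2)^k + 2^k * (?d k x)\<^sup>2)"
        by (simp add: algebra_simps power_mult_distrib power2_eq_square power_divide)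
      finally show "norm (?d k x) \<le> (1/2)^k + 2^k * (?d k x)\<^sup>2"
        by (simp add: mult_le_cancel_left)
    qed
    then have "summable (\<lambda>k. f (q (Suc k)) x - f (q k) x)" .
    then have "convergent (\<lambda>n. \<Sum>k<n. f (q (Suc k)) x - f (q k) x)"
      by (simp add: summable_iff_convergent)
    then obtain c where "(\<lambda>n. f (q n) x - f (q 0) x) \<longlonglongrightarrow> c"
      using sum_lessThan_telescope[of "\<lambda>n. f (q n) x"] by (auto simp: convergent_def)
    then have "(\<lambda>n. (f (q n) x - f (q 0) x) + f (q 0) x) \<longlonglongrightarrow> c + f (q 0) x"
      by (intro tendsto_intros)
    then show ?case by (auto simp: convergent_def)
  qed
  define g where "g x = lim (\<lambda>k. f (q k) x)" for x
  have [measurable]: "g \<in> borel_measurable M" unfolding g_def by measurable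
  have eq: "(\<lambda>k. e (q k)) \<longlonglongrightarrow> 0"
  proof (rule tendsto_0_ennreal_le)
    have "(\<lambda>k. ennreal ((1/4)^k)) \<longlonglongrightarrow> ennreal 0"
      by (intro tendsto_ennrealI LIMSEQ_power_zero) auto
    then show "(\<lambda>k. ennreal ((1/4)^k)) \<longlonglongrightarrow> 0" by simp
    show "e (q k) \<le> ennreal ((1/4)^k)" for k using r[OF q1] by (rule less_imp_le)
  qed
  \<comment> \<open>Fatou's lemma along \<open>q\<close>; the second error \<open>e (q k)\<close>
    disappears in the limit and \<open>e n\<close> alone is left.\<close>
  have "mean_square M (\<lambda>x. f n x - g x) \<le> e n" for n
  proof -
    have "mean_square M (\<lambda>x. f n x - g x) = (\<integral>\<^sup>+x. liminf (\<lambda>k. ennreal ((norm (f n x - f (q k) x))\<^sup>2)) \<partial>M)"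
      unfolding mean_square_def
    proof (rule nn_integral_cong_AE, use conv in eventually_elim)
      case (elim x)
      then have "(\<lambda>k. f (q k) x) \<longlonglongrightarrow> g x" by (simp add: g_def convergent_LIMSEQ_iff)
      then have "(\<lambda>k. ennreal ((norm (f n x - f (q k) x))\<^sup>2)) \<longlonglongrightarrow> ennreal ((norm (f n x - g x))\<^sup>2)"
        by (intro tendsto_intros tendsto_ennrealI)
      then show ?case by (intro lim_imp_Liminf[symmetric]) auto
    qed
    also have "\<dots> \<le> liminf (\<lambda>k. mean_square M (\<lambda>x. f n x - f (q k) x))"
      unfolding mean_square_def by (rule nn_integral_liminf) auto
    also have "\<dots> \<le> liminf (\<lambda>k. e n + e (q k))"
      by (intro Liminf_mono always_eventually allI cauchy)
    also have "\<dots> = e n + 0"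
      by (intro lim_imp_Liminf tendsto_add tendsto_const eq) auto
    finally show ?thesis by simp
  qed
  then have "(\<lambda>n. mean_square M (\<lambda>x. f n x - g x)) \<longlonglongrightarrow> 0"
    by (intro tendsto_0_ennreal_le[OF e])
  then show ?thesis by (intro bexI[of _ g]) auto
qed


section \<open>Uniqueness and additivity of the Ito integral\<close>

lemma partition_le:
  fixes p :: "nat \<Rightarrow> real"
  assumes "\<forall>k<n. p k \<le> p (Suc k)" "i \<le> j" "j \<le> n"
  shows "p i \<le> p j"
  using assms(2,3)
proof (induction j)
  case (Suc j)
  then show ?case using assms(1) by (cases "i = Suc j") (auto intro: order_trans)
qed simp

context wiener
begin

definition steps_within :: "real \<Rightarrow> real \<Rightarrow> (real \<times> real \<times> ('a \<Rightarrow> real^'d)) list \<Rightarrow> bool" where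
  "steps_within a b L \<longleftrightarrow> (\<forall>(l, r, \<xi>)\<in>set L. a \<le> l \<and> r \<le> b)"

abbreviation steps_fun :: "(real \<times> real \<times> ('a \<Rightarrow> real^'d)) list \<Rightarrow> 'a \<times> real \<Rightarrow> real^'d" where
  "steps_fun L \<equiv> \<lambda>(\<omega>, s). steps_process L s \<omega>"

text \<open>The integral over \<open>[0, \<infinity>)\<close> of an integrand \<open>K\<close> that vanishes outside \<open>[a, b]\<close>; this makes
  integrals over different intervals comparable.\<close>

definition ito_limit :: "real \<Rightarrow> real \<Rightarrow> ('a \<times> real \<Rightarrow> real^'d) \<Rightarrow> ('a \<Rightarrow> real) \<Rightarrow> bool" where
  "ito_limit a b K J \<longleftrightarrow>
     J \<in> borel_measurable M \<and> K \<in> borel_measurable (M \<Otimes>\<^sub>M lborel) \<and>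
     (\<exists>L. (\<forall>m. adapted_steps (L m) \<and> steps_within a b (L m)) \<and>
        (\<lambda>m. mean_square (M \<Otimes>\<^sub>M lborel) (\<lambda>z. steps_fun (L m) z - K z)) \<longlonglongrightarrow> 0 \<and>
        (\<lambda>m. mean_square M (\<lambda>\<omega>. steps_ito (L m) \<omega> - J \<omega>)) \<longlonglongrightarrow> 0)"

lemma steps_fun_measurable [measurable]:
  assumes "adapted_steps L"
  shows "steps_fun L \<in> borel_measurable (M \<Otimes>\<^sub>M lborel)"
proof -
  have "(\<lambda>z. \<Sum>k<length L. case L ! k of (l, r, \<xi>) \<Rightarrow> indicator {l<..r} (snd z) *\<^sub>R \<xi> (fst z))
      \<in> borel_measurable (M \<Otimes>\<^sub>M lborel)"
  proof (rule borel_measurable_sum)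
    fix k assume k: "k \<in> {..<length L}"
    obtain l r \<xi> where lr: "L ! k = (l, r, \<xi>)" by (cases "L ! k") auto
    have [measurable]: "\<xi> \<in> borel_measurable M"
      using adapted_steps_nth(3)[OF assms _ lr] k by (auto intro: measurable_F_M)
    show "(\<lambda>z. case L ! k of (l, r, \<xi>) \<Rightarrow> indicator {l<..r} (snd z) *\<^sub>R \<xi> (fst z))
      \<in> borel_measurable (M \<Otimes>\<^sub>M lborel)"
      unfolding lr by simp
  qed
  then show ?thesis
    by (simp add: steps_process_def sum_list_sum_nth atLeast0LessThan case_prod_beta split_beta')
qed

lemma steps_ito_measurable [measurable]: "adapted_steps L \<Longrightarrow> steps_ito L \<in> borel_measurable M"
  by (intro square_integrable_measurable steps_ito_square_integrable)

lemma mean_square_steps: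
  assumes "adapted_steps L"
  shows "mean_square M (steps_ito L) = mean_square (M \<Otimes>\<^sub>M lborel) (steps_fun L)"
proof -
  note [measurable] = steps_fun_measurable[OF assms]
  have "mean_square (M \<Otimes>\<^sub>M lborel) (steps_fun L) = (\<integral>\<^sup>+\<omega>. \<integral>\<^sup>+s. ennreal ((norm (steps_process L s \<omega>))\<^sup>2) \<partial>lborel \<partial>M)"
    unfolding mean_square_def by (subst lborel.nn_integral_fst[symmetric]) auto
  then show ?thesis
    using steps_isometry[OF assms] by (simp add: mean_square_def)
qed

lemma ito_limit_mono: "ito_limit a b K J \<Longrightarrow> a' \<le> a \<Longrightarrow> b \<le> b' \<Longrightarrow> ito_limit a' b' K J"
  unfolding ito_limit_def steps_within_def by fastforce

text \<open>The approximating lists of the two integrals need not share a partition; appending one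
  to the negation of the other approximates the difference at once.\<close>

lemma ito_limit_diff:
  assumes "ito_limit a b K J" "ito_limit a b K' J'"
  shows "ito_limit a b (\<lambda>z. K z - K' z) (\<lambda>\<omega>. J \<omega> - J' \<omega>)"
proof -
  obtain L L' where L: "\<And>m. adapted_steps (L m)" "\<And>m. steps_within a b (L m)"
      "(\<lambda>m. mean_square (M \<Otimes>\<^sub>M lborel) (\<lambda>z. steps_fun (L m) z - K z)) \<longlonglongrightarrow> 0"
      "(\<lambda>m. mean_square M (\<lambda>\<omega>. steps_ito (L m) \<omega> - J \<omega>)) \<longlonglongrightarrow> 0"
    and L': "\<And>m. adapted_steps (L' m)" "\<And>m. steps_within a b (L' m)"
      "(\<lambda>m. mean_square (M \<Otimes>\<^sub>M lborel) (\<lambda>z. steps_fun (L' m) z - K' z)) \<longlonglongrightarrow> 0"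
      "(\<lambda>m. mean_square M (\<lambda>\<omega>. steps_ito (L' m) \<omega> - J' \<omega>)) \<longlonglongrightarrow> 0"
    using assms unfolding ito_limit_def by blast
  have [measurable]: "K \<in> borel_measurable (M \<Otimes>\<^sub>M lborel)" "K' \<in> borel_measurable (M \<Otimes>\<^sub>M lborel)"
      "J \<in> borel_measurable M" "J' \<in> borel_measurable M"
    using assms unfolding ito_limit_def by blast+
  note [measurable] = steps_fun_measurable[OF L(1)] steps_fun_measurable[OF L'(1)]
      steps_ito_measurable[OF L(1)] steps_ito_measurable[OF L'(1)]
  define N where "N m = L m @ neg_steps (L' m)" for m
  have N: "adapted_steps (N m)" "steps_within a b (N m)" for m
    using L(1,2)[of m] L'(1,2)[of m] steps_neg(1)[of "L' m"]
    by (auto simp: N_def steps_append steps_within_def neg_steps_def ball_Un)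
  have f: "steps_fun (N m) z = steps_fun (L m) z - steps_fun (L' m) z" for m z
    by (cases z) (simp add: N_def steps_append steps_neg)
  have i: "steps_ito (N m) \<omega> = steps_ito (L m) \<omega> - steps_ito (L' m) \<omega>" for m \<omega>
    by (simp add: N_def steps_append steps_neg)
  have "(\<lambda>m. mean_square (M \<Otimes>\<^sub>M lborel) (\<lambda>z. steps_fun (N m) z - (K z - K' z))) \<longlonglongrightarrow> 0"
  proof (rule tendsto_0_ennreal_le[OF tendsto_0_ennreal_two_sum[OF L(3) L'(3)]])
    fix m
    have "(\<lambda>z. steps_fun (N m) z - (K z - K' z)) = (\<lambda>z. (steps_fun (L m) z - K z) - (steps_fun (L' m) z - K' z))"
      unfolding f by (simp add: fun_eq_iff)
    then show "mean_square (M \<Otimes>\<^sub>M lborel) (\<lambda>z. steps_fun (N m) z - (K z - K' z))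
        \<le> 2 * mean_square (M \<Otimes>\<^sub>M lborel) (\<lambda>z. steps_fun (L m) z - K z)
          + 2 * mean_square (M \<Otimes>\<^sub>M lborel) (\<lambda>z. steps_fun (L' m) z - K' z)"
      by (simp only:) (rule mean_square_diff_le; measurable)
  qed
  moreover have "(\<lambda>m. mean_square M (\<lambda>\<omega>. steps_ito (N m) \<omega> - (J \<omega> - J' \<omega>))) \<longlonglongrightarrow> 0"
  proof (rule tendsto_0_ennreal_le[OF tendsto_0_ennreal_two_sum[OF L(4) L'(4)]])
    fix m
    have "(\<lambda>\<omega>. steps_ito (N m) \<omega> - (J \<omega> - J' \<omega>)) = (\<lambda>\<omega>. (steps_ito (L m) \<omega> - J \<omega>) - (steps_ito (L' m) \<omega> - J' \<omega>))"
      unfolding i by (simp add: fun_eq_iff)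
    then show "mean_square M (\<lambda>\<omega>. steps_ito (N m) \<omega> - (J \<omega> - J' \<omega>))
        \<le> 2 * mean_square M (\<lambda>\<omega>. steps_ito (L m) \<omega> - J \<omega>)
          + 2 * mean_square M (\<lambda>\<omega>. steps_ito (L' m) \<omega> - J' \<omega>)"
      by (simp only:) (rule mean_square_diff_le; measurable)
  qed
  ultimately show ?thesis
    unfolding ito_limit_def using N by (intro conjI exI[of _ N]) auto
qed

text \<open>The constant \<open>4\<close>, instead of the \<open>1\<close> of the isometry, is all that is needed.\<close>

lemma ito_limit_mean_square_le:
  assumes "ito_limit a b K J"
  shows "mean_square M J \<le> 4 * mean_square (M \<Otimes>\<^sub>M lborel) K"
proof -
  obtain L where L: "\<And>m. adapted_steps (L m)"
      "(\<lambda>m. mean_square (M \<Otimes>\<^sub>M lborel) (\<lambda>z. steps_fun (L m) z - K z)) \<longlonglongrightarrow> 0"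
      "(\<lambda>m. mean_square M (\<lambda>\<omega>. steps_ito (L m) \<omega> - J \<omega>)) \<longlonglongrightarrow> 0"
    using assms unfolding ito_limit_def by blast
  have [measurable]: "K \<in> borel_measurable (M \<Otimes>\<^sub>M lborel)" "J \<in> borel_measurable M"
    using assms unfolding ito_limit_def by blast+
  note [measurable] = steps_fun_measurable[OF L(1)] steps_ito_measurable[OF L(1)]
  let ?p = "\<lambda>m. mean_square (M \<Otimes>\<^sub>M lborel) (\<lambda>z. steps_fun (L m) z - K z)"
    and ?q = "\<lambda>m. mean_square M (\<lambda>\<omega>. steps_ito (L m) \<omega> - J \<omega>)"
    and ?k = "mean_square (M \<Otimes>\<^sub>M lborel) K"
  \<comment> \<open>The squared triangle inequality is used twice, once between \<open>J\<close> and
    its approximating sums and once between their integrands and \<open>K\<close>, with the isometry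
    in between. This is where 4 = 2 * 2 comes from.\<close>
  have "mean_square M J \<le> 2 * (2 * ?p m + 2 * ?k) + 2 * ?q m" for m
  proof -
    have "mean_square M (steps_ito (L m)) \<le> 2 * ?p m + 2 * ?k"
      using mean_square_add_le[of "\<lambda>z. steps_fun (L m) z - K z" "M \<Otimes>\<^sub>M lborel" K]
      by (simp add: mean_square_steps[OF L(1)])
    then have "2 * mean_square M (steps_ito (L m)) + 2 * ?q m \<le> 2 * (2 * ?p m + 2 * ?k) + 2 * ?q m"
      by (intro add_mono mult_left_mono order_refl) auto
    moreover have "mean_square M J \<le> 2 * mean_square M (steps_ito (L m)) + 2 * ?q m"
      using mean_square_diff_le[of "steps_ito (L m)" M "\<lambda>\<omega>. steps_ito (L m) \<omega> - J \<omega>"] by simp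
    ultimately show ?thesis by (rule order_trans[rotated])
  qed
  moreover have "(\<lambda>m. 2 * (2 * ?p m + 2 * ?k) + 2 * ?q m) \<longlonglongrightarrow> 2 * (2 * 0 + 2 * ?k) + 2 * 0"
    by (intro tendsto_add ennreal_tendsto_cmult tendsto_const L(2,3)) auto
  ultimately have "mean_square M J \<le> 2 * (2 * 0 + 2 * ?k) + 2 * 0"
    by (intro LIMSEQ_le_const) auto
  then show ?thesis by (simp add: mult.assoc[symmetric])
qed

text \<open>The mean square estimate for the difference of the two integrals has a vanishing right
  side. Thus integrals obtained from different approximations, in particular the one picked by
  \<open>ito_integral\<close>, can be identified.\<close>

lemma ito_limit_unique:
  assumes "ito_limit a b K J" "ito_limit a b K' J'"
    and "AE z in M \<Otimes>\<^sub>M lborel. K z = K' z"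
  shows "AE \<omega> in M. J \<omega> = J' \<omega>"
proof -
  have "mean_square (M \<Otimes>\<^sub>M lborel) (\<lambda>z. K z - K' z) = mean_square (M \<Otimes>\<^sub>M lborel) (\<lambda>_ :: 'a \<times> real. 0 :: real^'d)"
    by (rule mean_square_cong_AE) (use assms(3) in eventually_elim, simp)
  with ito_limit_mean_square_le[OF ito_limit_diff[OF assms(1,2)]]
  have "mean_square M (\<lambda>\<omega>. J \<omega> - J' \<omega>) = 0" by (simp add: mean_square_def)
  then have "AE \<omega> in M. J \<omega> - J' \<omega> = 0"
    using assms(1,2) by (intro mean_square_eq_0_AE) (auto simp: ito_limit_def)
  then show ?thesis by eventually_elim simp
qed

lemma AE_pair_lborel_neq: "AE z in M \<Otimes>\<^sub>M lborel. snd z \<noteq> (c :: real)"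
proof -
  interpret pair_sigma_finite M lborel ..
  have "{z \<in> space (M \<Otimes>\<^sub>M lborel). snd z \<noteq> c} \<in> sets (M \<Otimes>\<^sub>M lborel)" by measurable
  then show ?thesis by (rule AE_pair_measure) (auto intro: AE_lborel_singleton)
qed

abbreviation restricted :: "real \<Rightarrow> real \<Rightarrow> (real \<Rightarrow> 'a \<Rightarrow> real^'d) \<Rightarrow> 'a \<times> real \<Rightarrow> real^'d" where
  "restricted a b H \<equiv> \<lambda>(\<omega>, s). indicator {a..b} s *\<^sub>R H s \<omega>"

text \<open>Off the single time \<open>b\<close>, the integrand cut to [a, c] minus the one cut to
  [a, b] is the one cut to [b, c]. After all three are regarded as integrands on [a, c], uniqueness
  applies.\<close>

lemma ito_limit_additive:
  assumes "a \<le> b" "b \<le> c"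
    and J: "ito_limit a b (restricted a b H) J" "ito_limit b c (restricted b c H) J'"
    and J'': "ito_limit a c (restricted a c H) J''"
  shows "AE \<omega> in M. J'' \<omega> = J \<omega> + J' \<omega>"
proof -
  have "ito_limit a c (\<lambda>z. restricted a c H z - restricted a b H z) (\<lambda>\<omega>. J'' \<omega> - J \<omega>)"
    using assms by (intro ito_limit_diff J'' ito_limit_mono[OF J(1)]) auto
  moreover have "ito_limit a c (restricted b c H) J'"
    using assms by (intro ito_limit_mono[OF J(2)]) auto
  moreover have "AE z in M \<Otimes>\<^sub>M lborel. restricted a c H z - restricted a b H z = restricted b c H z"
    using AE_pair_lborel_neq[of b] by eventually_elim (use assms(1,2) in \<open>auto simp: indicator_def\<close>)
  ultimately have "AE \<omega> in M. J'' \<omega> - J \<omega> = J' \<omega>" by (rule ito_limit_unique)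
  then show ?thesis by eventually_elim simp
qed

definition simple_steps ::
    "nat \<Rightarrow> (nat \<Rightarrow> real) \<Rightarrow> (nat \<Rightarrow> 'a \<Rightarrow> real^'d) \<Rightarrow> (real \<times> real \<times> ('a \<Rightarrow> real^'d)) list" where
  "simple_steps n p \<xi> = map (\<lambda>k. (p k, p (Suc k), \<xi> k)) [0..<n]"

lemma steps_process_simple_steps: "steps_process (simple_steps n p \<xi>) s \<omega> = simple_process n p \<xi> s \<omega>"
  by (simp add: simple_process_def steps_process_def simple_steps_def o_def
      interv_sum_list_conv_sum_set_nat atLeast0LessThan)

lemma steps_ito_simple_steps: "steps_ito (simple_steps n p \<xi>) \<omega> = simple_ito W n p \<xi> \<omega>"
  by (simp add: simple_ito_def steps_ito_def simple_steps_def o_def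
      interv_sum_list_conv_sum_set_nat atLeast0LessThan)

lemma simple_integrand_steps:
  assumes simp: "simple_integrand M F a b n p \<xi>" and a: "0 \<le> a"
  shows "adapted_steps (simple_steps n p \<xi>)" "steps_within a b (simple_steps n p \<xi>)"
    and "s \<notin> {a..b} \<Longrightarrow> simple_process n p \<xi> s \<omega> = 0"
proof -
  have mono: "\<forall>k<n. p k \<le> p (Suc k)" and ends: "p 0 = a" "p n = b"
    using simp by (auto simp: simple_integrand_def)
  have pk: "a \<le> p k" "p k \<le> b" if "k \<le> n" for k
    using partition_le[OF mono, of 0 k] partition_le[OF mono, of k n] ends that by auto
  show "adapted_steps (simple_steps n p \<xi>)"
    unfolding adapted_steps_def simple_steps_def
  proof (clarsimp, intro conjI)
    fix k assume k: "k < n"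
    show "0 \<le> p k" using pk(1)[of k] k a by simp
    show "p k \<le> p (Suc k)" using mono k by blast
    show "\<xi> k \<in> borel_measurable (F (p k))" "bounded (\<xi> k ` space M)"
      using simp k by (auto simp: simple_integrand_def)
  qed
  show "steps_within a b (simple_steps n p \<xi>)"
    unfolding steps_within_def simple_steps_def using pk by auto
  assume "s \<notin> {a..b}"
  then have "indicator {p k<..p (Suc k)} s = (0::real)" if "k < n" for k
    using pk[of k] pk[of "Suc k"] that by (auto simp: indicator_def)
  then show "simple_process n p \<xi> s \<omega> = 0" unfolding simple_process_def by simp
qed

lemma mean_square_simple_steps:
  assumes "simple_integrand M F a b n p \<xi>" "0 \<le> a"
    and [measurable]: "restricted a b H \<in> borel_measurable (M \<Otimes>\<^sub>M lborel)"
  shows "mean_square (M \<Otimes>\<^sub>M lborel) (\<lambda>z. steps_fun (simple_steps n p \<xi>) z - restricted a b H z) =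
      (\<integral>\<^sup>+\<omega>. (\<integral>\<^sup>+s\<in>{a..b}. ennreal ((norm (simple_process n p \<xi> s \<omega> - H s \<omega>))\<^sup>2) \<partial>lborel) \<partial>M)"
proof -
  note [measurable] = steps_fun_measurable[OF simple_integrand_steps(1)[OF assms(1,2)]]
  have "mean_square (M \<Otimes>\<^sub>M lborel) (\<lambda>z. steps_fun (simple_steps n p \<xi>) z - restricted a b H z) =
    (\<integral>\<^sup>+\<omega>. \<integral>\<^sup>+s. ennreal ((norm (steps_process (simple_steps n p \<xi>) s \<omega> - indicator {a..b} s *\<^sub>R H s \<omega>))\<^sup>2) \<partial>lborel \<partial>M)"
    unfolding mean_square_def by (subst lborel.nn_integral_fst[symmetric]) auto
  also have "\<dots> = (\<integral>\<^sup>+\<omega>. (\<integral>\<^sup>+s\<in>{a..b}. ennreal ((norm (simple_process n p \<xi> s \<omega> - H s \<omega>))\<^sup>2) \<partial>lborel) \<partial>M)"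
    by (intro nn_integral_cong)
      (auto simp: steps_process_simple_steps simple_integrand_steps(3)[OF assms(1,2)] indicator_def)
  finally show ?thesis .
qed

lemma has_ito_integral_ito_limit:
  assumes "has_ito_integral M W a b H J" "0 \<le> a"
  shows "ito_limit a b (restricted a b H) J"
proof -
  have [measurable]: "J \<in> borel_measurable M"
    and H: "(\<lambda>(s, \<omega>). indicator {a..b} s *\<^sub>R H s \<omega>) \<in> borel_measurable (lborel \<Otimes>\<^sub>M M)"
    using assms(1) unfolding has_ito_integral_def by blast+
  obtain n p \<xi> where simp: "\<And>m. simple_integrand M F a b (n m) (p m) (\<xi> m)"
    and 1: "(\<lambda>m. \<integral>\<^sup>+\<omega>. (\<integral>\<^sup>+s\<in>{a..b}.
            ennreal ((norm (simple_process (n m) (p m) (\<xi> m) s \<omega> - H s \<omega>))\<^sup>2) \<partial>lborel) \<partial>M) \<longlonglongrightarrow> 0"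
    and 2: "(\<lambda>m. \<integral>\<^sup>+\<omega>. ennreal ((simple_ito W (n m) (p m) (\<xi> m) \<omega> - J \<omega>)\<^sup>2) \<partial>M) \<longlonglongrightarrow> 0"
    using assms(1) unfolding has_ito_integral_def by blast
  let ?L = "\<lambda>m. simple_steps (n m) (p m) (\<xi> m)"
  have K [measurable]: "restricted a b H \<in> borel_measurable (M \<Otimes>\<^sub>M lborel)"
    using measurable_pair_swap[OF H] by (simp add: case_prod_beta)
  have "(\<lambda>m. mean_square (M \<Otimes>\<^sub>M lborel) (\<lambda>z. steps_fun (?L m) z - restricted a b H z)) \<longlonglongrightarrow> 0"
    using 1 unfolding mean_square_simple_steps[OF simp assms(2) K] .
  moreover have "(\<lambda>m. mean_square M (\<lambda>\<omega>. steps_ito (?L m) \<omega> - J \<omega>)) \<longlonglongrightarrow> 0"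
    using 2 by (simp add: steps_ito_simple_steps mean_square_def)
  ultimately show ?thesis
    unfolding ito_limit_def using simple_integrand_steps(1,2)[OF simp assms(2)]
    by (intro conjI exI[of _ ?L] allI) auto
qed

section \<open>Adaptedness of the integral and its orthogonality to the past\<close>

lemma steps_ito_measurable_F:
  assumes L: "adapted_steps L" "steps_within a b L"
  shows "steps_ito L \<in> borel_measurable (F b)"
proof -
  have "(\<lambda>\<omega>. \<Sum>k<length L. case L ! k of (l, r, \<xi>) \<Rightarrow> \<xi> \<omega> \<bullet> (W r \<omega> - W l \<omega>)) \<in> borel_measurable (F b)"
  proof (rule borel_measurable_sum)
    fix k assume k: "k \<in> {..<length L}"
    obtain l r \<xi> where lr: "L ! k = (l, r, \<xi>)" by (cases "L ! k") auto
    have "(l, r, \<xi>) \<in> set L" using k lr by (metis lessThan_iff nth_mem)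
    then have "r \<le> b" using L(2) by (auto simp: steps_within_def)
    with adapted_steps_nth[OF L(1) _ lr] k lr
    show "(\<lambda>\<omega>. case L ! k of (l, r, \<xi>) \<Rightarrow> \<xi> \<omega> \<bullet> (W r \<omega> - W l \<omega>)) \<in> borel_measurable (F b)"
      by (auto intro!: inner_increment_measurable_F)
  qed
  then show ?thesis
    by (simp add: steps_ito_def[abs_def] sum_list_sum_nth atLeast0LessThan case_prod_beta)
qed

text \<open>A preimage under \<open>f\<close> differs from the one under \<open>g\<close> by subsets
  of the set where they disagree, and null sets of \<open>M\<close> belong to \<open>F s\<close>.
  This is what the augmentation is for.\<close>

lemma measurable_F_AE:
  fixes f :: "'a \<Rightarrow> real"
  assumes f: "f \<in> borel_measurable M" and g: "g \<in> borel_measurable (F s)"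
    and ae: "AE \<omega> in M. f \<omega> = g \<omega>"
  shows "f \<in> borel_measurable (F s)"
proof (rule measurableI)
  fix A :: "real set" assume A: "A \<in> sets borel"
  have gM: "g \<in> borel_measurable M" using g by (rule measurable_F_M)
  note [measurable] = f gM A
  let ?N = "{\<omega>\<in>space M. f \<omega> \<noteq> g \<omega>}"
  have N: "?N \<in> null_sets M"
    using ae by (subst (asm) AE_iff_null) auto
  have N': "?N \<inter> (f -` A \<inter> space M) \<in> null_sets M"
    using N by (rule null_set_Int2) measurable
  have "f -` A \<inter> space M = ((g -` A \<inter> space M) - ?N) \<union> (?N \<inter> (f -` A \<inter> space M))" by auto
  also have "\<dots> \<in> sets (F s)"
    using measurable_sets[OF g A] null_sets_F[OF N, of s] null_sets_F[OF N', of s] by auto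
  finally show "f -` A \<inter> space (F s) \<in> sets (F s)" by simp
qed auto

text \<open>The approximating sums are measurable at time \<open>b\<close> and converge to
  \<open>J\<close> almost everywhere along a subsequence. \<open>J\<close> is only almost everywhere
  equal to their limit, so the null sets in \<open>F b\<close> are essential.\<close>

lemma ito_limit_measurable_F:
  assumes "ito_limit a b K J"
  shows "J \<in> borel_measurable (F b)"
proof -
  obtain L where L: "\<And>m. adapted_steps (L m)" "\<And>m. steps_within a b (L m)"
      "(\<lambda>m. mean_square M (\<lambda>\<omega>. steps_ito (L m) \<omega> - J \<omega>)) \<longlonglongrightarrow> 0"
    using assms unfolding ito_limit_def by blast
  have J: "J \<in> borel_measurable M" using assms unfolding ito_limit_def by blast
  obtain r where r: "strict_mono r" "AE \<omega> in M. (\<lambda>m. steps_ito (L (r m)) \<omega>) \<longlonglongrightarrow> J \<omega>"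
    using mean_square_tendsto_AE_subseq[OF steps_ito_measurable[OF L(1)] J L(3)] by blast
  have "(\<lambda>\<omega>. lim (\<lambda>m. steps_ito (L (r m)) \<omega>)) \<in> borel_measurable (F b)"
    by (intro borel_measurable_lim_metric steps_ito_measurable_F[OF L(1,2)])
  moreover have "AE \<omega> in M. J \<omega> = lim (\<lambda>m. steps_ito (L (r m)) \<omega>)"
    using r(2) by eventually_elim (simp add: limI)
  ultimately show ?thesis by (rule measurable_F_AE[OF J])
qed

text \<open>Every step begins at or after \<open>a\<close>, when \<open>G\<close> is known;
  \<open>G\<close> can thus be joined to the vector of each step, and the increment that follows has
  mean zero.\<close>

lemma expectation_steps_ito_eq_0:
  assumes L: "adapted_steps L" "steps_within a b L" and a: "0 \<le> a"
    and G: "G \<in> borel_measurable (F a)" "square_integrable M G"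
  shows "expectation (\<lambda>\<omega>. G \<omega> * steps_ito L \<omega>) = 0"
proof -
  have "expectation (\<lambda>\<omega>. G \<omega> * (case L ! k of (l, r, \<xi>) \<Rightarrow> \<xi> \<omega> \<bullet> (W r \<omega> - W l \<omega>))) = 0 \<and>
      integrable M (\<lambda>\<omega>. G \<omega> * (case L ! k of (l, r, \<xi>) \<Rightarrow> \<xi> \<omega> \<bullet> (W r \<omega> - W l \<omega>)))"
    if k: "k < length L" for k
  proof -
    obtain l r \<xi> where lr: "L ! k = (l, r, \<xi>)" by (cases "L ! k") auto
    have "(l, r, \<xi>) \<in> set L" using k lr by (metis nth_mem)
    then have "a \<le> l" using L(2) by (auto simp: steps_within_def)
    then have Gl: "G \<in> borel_measurable (F l)" using G(1) by (rule measurable_F_mono[rotated])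
    from adapted_steps_nth[OF L(1) k lr] show ?thesis
      unfolding lr using expectation_inner_increment[of l r \<xi> G] Gl G(2) by simp
  qed
  moreover have "G \<omega> * steps_ito L \<omega>
      = (\<Sum>k<length L. G \<omega> * (case L ! k of (l, r, \<xi>) \<Rightarrow> \<xi> \<omega> \<bullet> (W r \<omega> - W l \<omega>)))" for \<omega>
    by (simp add: steps_ito_def sum_list_sum_nth atLeast0LessThan case_prod_beta sum_distrib_left)
  ultimately show ?thesis
    by (simp only:) (subst Bochner_Integration.integral_sum, auto)
qed

lemma ito_limit_square_integrable:
  assumes "ito_limit a b K J"
  shows "square_integrable M J"
proof -
  obtain L where L: "\<And>m. adapted_steps (L m)"
      "(\<lambda>m. mean_square M (\<lambda>\<omega>. steps_ito (L m) \<omega> - J \<omega>)) \<longlonglongrightarrow> 0"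
    using assms unfolding ito_limit_def by blast
  have J: "J \<in> borel_measurable M" using assms unfolding ito_limit_def by blast
  show ?thesis
    by (rule square_integrable_limit[OF J steps_ito_square_integrable[OF L(1)]])
      (use L(2) in \<open>simp add: mean_square_def\<close>)
qed

text \<open>Orthogonality holds for the approximating sums and survives mean square limits. In the
  one step estimate this removes the stochastic integral from the linear terms exactly, not just to
  leading order.\<close>

lemma ito_limit_expectation_eq_0:
  assumes J: "ito_limit a b K J" and a: "0 \<le> a"
    and G: "G \<in> borel_measurable (F a)" "square_integrable M G"
  shows "expectation (\<lambda>\<omega>. G \<omega> * J \<omega>) = 0"
proof -
  obtain L where L: "\<And>m. adapted_steps (L m)" "\<And>m. steps_within a b (L m)"
      "(\<lambda>m. mean_square M (\<lambda>\<omega>. steps_ito (L m) \<omega> - J \<omega>)) \<longlonglongrightarrow> 0"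
    using J unfolding ito_limit_def by blast
  have Jm: "J \<in> borel_measurable M" using J unfolding ito_limit_def by blast
  have "(\<lambda>m. expectation (\<lambda>\<omega>. (norm (steps_ito (L m) \<omega> - J \<omega>))\<^sup>2)) \<longlonglongrightarrow> 0"
    by (rule square_integrable_limit[OF Jm steps_ito_square_integrable[OF L(1)]])
      (use L(3) in \<open>simp add: mean_square_def\<close>)
  then have "(\<lambda>m. expectation (\<lambda>\<omega>. G \<omega> \<bullet> steps_ito (L m) \<omega>)) \<longlonglongrightarrow> expectation (\<lambda>\<omega>. G \<omega> \<bullet> J \<omega>)"
    by (intro integral_inner_tendsto G(2) steps_ito_square_integrable L ito_limit_square_integrable[OF J]) auto
  then have "(\<lambda>m. 0) \<longlonglongrightarrow> expectation (\<lambda>\<omega>. G \<omega> * J \<omega>)"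
    using expectation_steps_ito_eq_0[OF L(1,2) a G] by simp
  then show ?thesis by (simp add: LIMSEQ_const_iff)
qed

end


section \<open>Integrals of bounded continuous adapted integrands\<close>

text \<open>Exactly one of the half-open cells contains a point of (p 0, p n]. The vanishing outside
  is part of the statement because the induction needs it for the cells already passed.\<close>

lemma partition_sum:
  fixes p :: "nat \<Rightarrow> real" and x :: "nat \<Rightarrow> 'b::real_vector"
  assumes "\<forall>k<n. p k \<le> p (Suc k)"
  shows "(s \<le> p 0 \<or> p n < s \<longrightarrow> (\<Sum>k<n. indicator {p k<..p (Suc k)} s *\<^sub>R x k) = 0) \<and>
    (p 0 < s \<and> s \<le> p n \<longrightarrow>
      (\<exists>k<n. s \<in> {p k<..p (Suc k)} \<and> (\<Sum>k<n. indicator {p k<..p (Suc k)} s *\<^sub>R x k) = x k))"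
  using assms
proof (induction n)
  case (Suc n)
  have IH: "(s \<le> p 0 \<or> p n < s \<longrightarrow> (\<Sum>k<n. indicator {p k<..p (Suc k)} s *\<^sub>R x k) = 0) \<and>
    (p 0 < s \<and> s \<le> p n \<longrightarrow>
      (\<exists>k<n. s \<in> {p k<..p (Suc k)} \<and> (\<Sum>k<n. indicator {p k<..p (Suc k)} s *\<^sub>R x k) = x k))"
    using Suc by auto
  have le: "p n \<le> p (Suc n)" using Suc.prems by simp
  have p0: "p 0 \<le> p n" using partition_le[of n p 0 n] Suc.prems by simp
  consider "s \<le> p 0" | "p 0 < s" "s \<le> p n" | "p n < s" "s \<le> p (Suc n)" | "p (Suc n) < s" by linarith
  then show ?case
  proof cases
    case 2
    then obtain k where "k < n" "s \<in> {p k<..p (Suc k)}" "(\<Sum>k<n. indicator {p k<..p (Suc k)} s *\<^sub>R x k) = x k"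
      using IH by blast
    then show ?thesis using 2 le by (auto intro!: exI[of _ k])
  next
    case 3
    then show ?thesis using IH p0 by (auto intro!: exI[of _ n])
  qed (use IH le p0 in auto)
qed simp

text \<open>With \<open>Suc m\<close> cells the mesh (b - a) / (m + 1) is defined for every
  \<open>m\<close> and tends to 0.\<close>

definition grid :: "real \<Rightarrow> real \<Rightarrow> nat \<Rightarrow> nat \<Rightarrow> real" where
  "grid a b m k = a + (b - a) * (real k / real (Suc m))"

lemma grid_ends [simp]: "grid a b m 0 = a" "grid a b m (Suc m) = b"
proof -
  show "grid a b m (Suc m) = b" unfolding grid_def by (subst divide_self) auto
qed (simp add: grid_def)

lemma grid_step: "grid a b m (Suc k) - grid a b m k = (b - a) / real (Suc m)"
proof -
  have "grid a b m (Suc k) - grid a b m k = (b - a) * ((real (Suc k) - real k) / real (Suc m))"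
    unfolding grid_def diff_divide_distrib right_diff_distrib by (rule add_diff_cancel_left)
  then show ?thesis by simp
qed

lemma grid_mono: "a \<le> b \<Longrightarrow> grid a b m k \<le> grid a b m (Suc k)"
  using grid_step[of a b m k] divide_nonneg_nonneg[of "b - a" "real (Suc m)"] by linarith

lemma grid_in: "a \<le> b \<Longrightarrow> k \<le> Suc m \<Longrightarrow> grid a b m k \<in> {a..b}"
proof -
  assume "a \<le> b" "k \<le> Suc m"
  moreover have "(b - a) * (real k / real (Suc m)) \<le> (b - a) * 1"
    using calculation by (intro mult_left_mono) (auto simp del: of_nat_Suc)
  ultimately show ?thesis by (simp add: grid_def del: of_nat_Suc)
qed

text \<open>Sampling at the left end of each grid cell gives jointly measurable step functions,
  which converge at every point of (a, b] because paths are continuous. The half-open cells miss the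
  time \<open>a\<close>, so its slice is added separately at the end.\<close>

lemma continuous_process_jointly_measurable:
  fixes q :: "real \<Rightarrow> 'a \<Rightarrow> 'b::euclidean_space"
  assumes ab: "a \<le> b" and q: "\<And>r. r \<in> {a..b} \<Longrightarrow> q r \<in> borel_measurable N"
    and cont: "\<And>\<omega>. \<omega> \<in> space N \<Longrightarrow> continuous_on {a..b} (\<lambda>r. q r \<omega>)"
  shows "(\<lambda>(\<omega>, r). indicator {a..b} r *\<^sub>R q r \<omega>) \<in> borel_measurable (N \<Otimes>\<^sub>M lborel)"
proof -
  let ?f = "\<lambda>m (\<omega>, r). \<Sum>k<Suc m. indicator {grid a b m k<..grid a b m (Suc k)} r *\<^sub>R q (grid a b m k) \<omega>"
  have fm: "?f m \<in> borel_measurable (N \<Otimes>\<^sub>M lborel)" for m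
  proof -
    have "(\<lambda>z. \<Sum>k<Suc m. indicator {grid a b m k<..grid a b m (Suc k)} (snd z) *\<^sub>R q (grid a b m k) (fst z))
        \<in> borel_measurable (N \<Otimes>\<^sub>M lborel)"
    proof (rule borel_measurable_sum)
      fix k assume "k \<in> {..<Suc m}"
      then have [measurable]: "q (grid a b m k) \<in> borel_measurable N"
        using grid_in[OF ab, of k m] by (intro q) auto
      show "(\<lambda>z. indicator {grid a b m k<..grid a b m (Suc k)} (snd z) *\<^sub>R q (grid a b m k) (fst z))
          \<in> borel_measurable (N \<Otimes>\<^sub>M lborel)" by measurable
    qed
    then show ?thesis by (simp add: case_prod_beta)
  qed
  have lim: "(\<lambda>m. ?f m (\<omega>, r)) \<longlonglongrightarrow> indicator {a<..b} r *\<^sub>R q r \<omega>" if \<omega>: "\<omega> \<in> space N" for \<omega> r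
  proof (cases "a < r \<and> r \<le> b")
    case True
    show ?thesis
    proof (rule metric_LIMSEQ_I)
      fix e :: real assume "e > 0"
      then obtain d where d: "d > 0" "\<And>r'. r' \<in> {a..b} \<Longrightarrow> dist r' r < d \<Longrightarrow> dist (q r' \<omega>) (q r \<omega>) < e"
        using True cont[OF \<omega>] unfolding continuous_on_iff by (metis atLeastAtMost_iff less_imp_le)
      have "(\<lambda>m. (b - a) * inverse (real (Suc m))) \<longlonglongrightarrow> (b - a) * 0"
        by (intro tendsto_intros LIMSEQ_inverse_real_of_nat)
      then have "eventually (\<lambda>m. (b - a) * inverse (real (Suc m)) < d) sequentially"
        using d(1) by (intro order_tendstoD) auto
      then obtain m0 where m0: "\<And>m. m \<ge> m0 \<Longrightarrow> (b - a) / real (Suc m) < d"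
        by (auto simp: eventually_sequentially divide_inverse)
      have "dist (?f m (\<omega>, r)) (indicator {a<..b} r *\<^sub>R q r \<omega>) < e" if "m \<ge> m0" for m
      proof -
        obtain k where k: "k < Suc m" "r \<in> {grid a b m k<..grid a b m (Suc k)}" "?f m (\<omega>, r) = q (grid a b m k) \<omega>"
          using partition_sum[of "Suc m" "grid a b m" r "\<lambda>k. q (grid a b m k) \<omega>"] grid_mono[OF ab] True by auto
        have "dist (grid a b m k) r < d"
          using k(2) grid_step[of a b m k] m0[OF that] by (auto simp: dist_real_def)
        moreover have "grid a b m k \<in> {a..b}" using k ab by (intro grid_in) auto
        ultimately show ?thesis using d(2) k(3) True by simp
      qed
      then show "\<exists>m0. \<forall>m\<ge>m0. dist (?f m (\<omega>, r)) (indicator {a<..b} r *\<^sub>R q r \<omega>) < e" by blast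
    qed
  next
    case False
    then have "?f m (\<omega>, r) = 0" for m
      using partition_sum[of "Suc m" "grid a b m" r "\<lambda>k. q (grid a b m k) \<omega>"] grid_mono[OF ab] by auto
    then show ?thesis using False by (simp only:) (auto simp: indicator_def)
  qed
  have [measurable]: "(\<lambda>(\<omega>, r). indicator {a<..b} r *\<^sub>R q r \<omega>) \<in> borel_measurable (N \<Otimes>\<^sub>M lborel)"
  proof (rule borel_measurable_LIMSEQ_metric[of ?f])
    show "?f m \<in> borel_measurable (N \<Otimes>\<^sub>M lborel)" for m by (rule fm)
    fix z assume "z \<in> space (N \<Otimes>\<^sub>M (lborel :: real measure))"
    then obtain \<omega> r where "z = (\<omega>, r)" "\<omega> \<in> space N" by (auto simp: space_pair_measure)
    then show "(\<lambda>m. ?f m z) \<longlonglongrightarrow> (\<lambda>(\<omega>, r). indicator {a<..b} r *\<^sub>R q r \<omega>) z"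
      using lim[of \<omega> r] by (simp only: prod.case)
  qed
  have [measurable]: "q a \<in> borel_measurable N" using ab by (intro q) auto
  have "(\<lambda>(\<omega>, r). indicator {a..b} r *\<^sub>R q r \<omega>) =
      (\<lambda>z. (\<lambda>(\<omega>, r). indicator {a<..b} r *\<^sub>R q r \<omega>) z + indicator {a} (snd z) *\<^sub>R q a (fst z))"
    using ab by (auto simp: fun_eq_iff indicator_def)
  also have "\<dots> \<in> borel_measurable (N \<Otimes>\<^sub>M lborel)" by measurable
  finally show ?thesis .
qed

context wiener
begin

text \<open>Both u(s, X(s)) and the rows of \<sigma>(X(s)) are of this kind. Continuity of paths
  makes Riemann sums converge, and the bound \<open>C\<close>, uniform in time and
  \<open>\<omega>\<close>, provides domination as well as Gaussian exponential moments.\<close>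

definition tame :: "real \<Rightarrow> real \<Rightarrow> real \<Rightarrow> (real \<Rightarrow> 'a \<Rightarrow> real^'d) \<Rightarrow> bool" where
  "tame a b C H \<longleftrightarrow> 0 \<le> a \<and> a \<le> b \<and> 0 \<le> C \<and>
     (\<forall>s\<in>{a..b}. H s \<in> borel_measurable (F s)) \<and>
     (\<forall>\<omega>\<in>space M. continuous_on {a..b} (\<lambda>s. H s \<omega>)) \<and>
     (\<forall>s\<in>{a..b}. \<forall>\<omega>\<in>space M. norm (H s \<omega>) \<le> C)"

lemma tame_subinterval:
  "tame a b C H \<Longrightarrow> a \<le> a' \<Longrightarrow> a' \<le> b' \<Longrightarrow> b' \<le> b \<Longrightarrow> tame a' b' C H"
  unfolding tame_def by (auto intro: continuous_on_subset)

abbreviation riemann :: "real \<Rightarrow> real \<Rightarrow> (real \<Rightarrow> 'a \<Rightarrow> real^'d) \<Rightarrow> nat \<Rightarrow> (real \<times> real \<times> ('a \<Rightarrow> real^'d)) list" where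
  "riemann a b H m \<equiv> simple_steps (Suc m) (grid a b m) (\<lambda>k. H (grid a b m k))"

lemma riemann_simple_integrand:
  assumes "tame a b C H"
  shows "simple_integrand M F a b (Suc m) (grid a b m) (\<lambda>k. H (grid a b m k))"
  unfolding simple_integrand_def
proof (intro conjI allI impI)
  fix k assume "k < Suc m"
  then have k: "grid a b m k \<in> {a..b}" using assms by (intro grid_in) (auto simp: tame_def)
  show "grid a b m k \<le> grid a b m (Suc k)" using assms by (intro grid_mono) (auto simp: tame_def)
  show "H (grid a b m k) \<in> borel_measurable (F (grid a b m k))" using assms k by (auto simp: tame_def)
  show "bounded (H (grid a b m k) ` space M)"
    using assms k unfolding bounded_iff tame_def by blast
qed simp_all

lemma riemann_process:
  assumes "tame a b C H" "a < s" "s \<le> b"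
  obtains k where "grid a b m k \<in> {a..b}" "\<bar>s - grid a b m k\<bar> \<le> (b - a) / real (Suc m)"
    "\<And>\<omega>. steps_process (riemann a b H m) s \<omega> = H (grid a b m k) \<omega>"
proof -
  have ab: "a \<le> b" using assms(1) by (simp add: tame_def)
  \<comment> \<open>The zero vectors serve only to locate the cell of \<open>s\<close>. The index is
    thus chosen before \<open>\<omega>\<close>; disjointness of the cells identifies it below with
    the index found for each \<open>\<omega>\<close>.\<close>
  obtain k where k: "k < Suc m" "s \<in> {grid a b m k<..grid a b m (Suc k)}"
    using partition_sum[of "Suc m" "grid a b m" s "\<lambda>_. 0 :: real"] grid_mono[OF ab] assms by auto
  have eq: "steps_process (riemann a b H m) s \<omega> = H (grid a b m k) \<omega>" for \<omega>
  proof -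
    obtain j where j: "j < Suc m" "s \<in> {grid a b m j<..grid a b m (Suc j)}"
      "steps_process (riemann a b H m) s \<omega> = H (grid a b m j) \<omega>"
      using partition_sum[of "Suc m" "grid a b m" s "\<lambda>k. H (grid a b m k) \<omega>"] grid_mono[OF ab] assms
      by (auto simp: steps_process_simple_steps simple_process_def)
    have "j = k"
    proof (rule ccontr)
      assume "j \<noteq> k"
      then have "Suc j \<le> k \<or> Suc k \<le> j" by auto
      then show False
        using j k partition_le[of "Suc m" "grid a b m" "Suc j" k] partition_le[of "Suc m" "grid a b m" "Suc k" j]
          grid_mono[OF ab] by auto
    qed
    with j show ?thesis by simp
  qed
  moreover have "grid a b m k \<in> {a..b}" using k ab by (intro grid_in) auto
  moreover have "\<bar>s - grid a b m k\<bar> \<le> (b - a) / real (Suc m)"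
    using k(2) grid_step[of a b m k] by auto
  ultimately show ?thesis using that by blast
qed

lemma riemann_process_bound:
  assumes H: "tame a b C H" and \<omega>: "\<omega> \<in> space M"
  shows "norm (steps_process (riemann a b H m) s \<omega>) \<le> C * indicator {a..b} s"
proof (cases "a < s \<and> s \<le> b")
  case True
  then obtain k where "grid a b m k \<in> {a..b}" "steps_process (riemann a b H m) s \<omega> = H (grid a b m k) \<omega>"
    using riemann_process[OF H] by metis
  then show ?thesis using H \<omega> True by (auto simp: tame_def)
next
  case False
  then have "steps_process (riemann a b H m) s \<omega> = 0"
    using partition_sum[of "Suc m" "grid a b m" s "\<lambda>k. H (grid a b m k) \<omega>"] grid_mono[of a b m] H
    by (auto simp: steps_process_simple_steps simple_process_def tame_def)
  then show ?thesis using H by (auto simp: tame_def)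
qed

lemma riemann_process_tendsto:
  assumes H: "tame a b C H" and \<omega>: "\<omega> \<in> space M"
  shows "(\<lambda>m. steps_process (riemann a b H m) s \<omega>) \<longlonglongrightarrow> indicator {a<..b} s *\<^sub>R H s \<omega>"
proof (cases "a < s \<and> s \<le> b")
  case True
  show ?thesis
  proof (rule metric_LIMSEQ_I)
    fix e :: real assume "e > 0"
    have "continuous_on {a..b} (\<lambda>s. H s \<omega>)" using H \<omega> by (auto simp: tame_def)
    then obtain d where d: "d > 0" "\<And>r. r \<in> {a..b} \<Longrightarrow> dist r s < d \<Longrightarrow> dist (H r \<omega>) (H s \<omega>) < e"
      using True \<open>e > 0\<close> by (fastforce simp: continuous_on_iff)
    have "(\<lambda>m. (b - a) * inverse (real (Suc m))) \<longlonglongrightarrow> (b - a) * 0"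
      by (intro tendsto_intros LIMSEQ_inverse_real_of_nat)
    then have "eventually (\<lambda>m. (b - a) * inverse (real (Suc m)) < d) sequentially"
      using d(1) by (intro order_tendstoD) auto
    then obtain N where N: "\<And>m. m \<ge> N \<Longrightarrow> (b - a) / real (Suc m) < d"
      by (auto simp: eventually_sequentially divide_inverse)
    have "dist (steps_process (riemann a b H m) s \<omega>) (indicator {a<..b} s *\<^sub>R H s \<omega>) < e" if "m \<ge> N" for m
    proof -
      obtain k where "grid a b m k \<in> {a..b}" "\<bar>s - grid a b m k\<bar> \<le> (b - a) / real (Suc m)"
        "steps_process (riemann a b H m) s \<omega> = H (grid a b m k) \<omega>"
        using riemann_process[OF H] True by metis
      then show ?thesis using d(2)[of "grid a b m k"] N[OF that] True by (auto simp: dist_real_def)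
    qed
    then show "\<exists>N. \<forall>m\<ge>N. dist (steps_process (riemann a b H m) s \<omega>) (indicator {a<..b} s *\<^sub>R H s \<omega>) < e"
      by blast
  qed
next
  case False
  then have "steps_process (riemann a b H m) s \<omega> = 0" for m
    using partition_sum[of "Suc m" "grid a b m" s "\<lambda>k. H (grid a b m k) \<omega>"] grid_mono[of a b m] H
    by (auto simp: steps_process_simple_steps simple_process_def tame_def)
  then show ?thesis using False by (auto simp: indicator_def)
qed

lemma riemann_adapted:
  assumes "tame a b C H"
  shows "adapted_steps (riemann a b H m)" "steps_within a b (riemann a b H m)"
  using simple_integrand_steps[OF riemann_simple_integrand[OF assms]] assms by (auto simp: tame_def)

lemma tame_jointly_measurable:
  assumes H: "tame a b C H"
  shows "restricted a b H \<in> borel_measurable (M \<Otimes>\<^sub>M lborel)"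
  using H by (intro continuous_process_jointly_measurable) (auto simp: tame_def intro: measurable_F_M)

lemma mean_square_bounded_pair_le:
  assumes C: "\<And>\<omega> s. \<omega> \<in> space M \<Longrightarrow> norm (f (\<omega>, s)) \<le> C * indicator {a..b} s" and "a \<le> b"
  shows "mean_square (M \<Otimes>\<^sub>M lborel) f \<le> ennreal (C\<^sup>2 * (b - a))"
proof -
  have "mean_square (M \<Otimes>\<^sub>M lborel) f \<le> (\<integral>\<^sup>+z. ennreal (C\<^sup>2) * indicator {a..b} (snd z) \<partial>(M \<Otimes>\<^sub>M lborel))"
    unfolding mean_square_def
  proof (rule nn_integral_mono)
    fix z assume "z \<in> space (M \<Otimes>\<^sub>M (lborel :: real measure))"
    then have "norm (f z) \<le> C * indicator {a..b} (snd z)"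
      using C[of "fst z" "snd z"] by (auto simp: space_pair_measure)
    then show "ennreal ((norm (f z))\<^sup>2) \<le> ennreal (C\<^sup>2) * indicator {a..b} (snd z)"
      by (auto simp: indicator_def power_mono intro!: ennreal_leI split: if_splits)
  qed
  also have "\<dots> = (\<integral>\<^sup>+\<omega>. \<integral>\<^sup>+s. ennreal (C\<^sup>2) * indicator {a..b} s \<partial>lborel \<partial>M)"
    by (subst lborel.nn_integral_fst[symmetric]) auto
  also have "\<dots> = ennreal (C\<^sup>2 * (b - a))"
    using \<open>a \<le> b\<close> by (simp add: nn_integral_cmult_indicator emeasure_space_1 ennreal_mult)
  finally show ?thesis .
qed

text \<open>Dominated convergence on the product space, with domination by 2 C on [a, b]. At time
  \<open>a\<close> the step functions are zero while the integrand need not be; that slice is a null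
  set.\<close>

lemma riemann_mean_square_tendsto:
  assumes H: "tame a b C H"
  shows "(\<lambda>m. mean_square (M \<Otimes>\<^sub>M lborel) (\<lambda>z. steps_fun (riemann a b H m) z - restricted a b H z)) \<longlonglongrightarrow> 0"
proof -
  note [measurable] = steps_fun_measurable[OF riemann_adapted(1)[OF H]] tame_jointly_measurable[OF H]
  have ab: "a \<le> b" using H by (simp add: tame_def)
  have "(\<lambda>m. \<integral>\<^sup>+z. ennreal ((norm (steps_fun (riemann a b H m) z - restricted a b H z))\<^sup>2) \<partial>(M \<Otimes>\<^sub>M lborel))
     \<longlonglongrightarrow> (\<integral>\<^sup>+(z :: 'a \<times> real). 0 \<partial>(M \<Otimes>\<^sub>M lborel))"
  proof (rule nn_integral_dominated_convergence[where w="\<lambda>z. ennreal ((norm (2 * C * indicator {a..b} (snd z)))\<^sup>2)"])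
    show "AE z in M \<Otimes>\<^sub>M lborel. ennreal ((norm (steps_fun (riemann a b H m) z - restricted a b H z))\<^sup>2)
        \<le> ennreal ((norm (2 * C * indicator {a..b} (snd z)))\<^sup>2)" for m
    proof (rule AE_I2)
      fix z assume "z \<in> space (M \<Otimes>\<^sub>M (lborel :: real measure))"
      then have z: "fst z \<in> space M" by (auto simp: space_pair_measure)
      have "norm (restricted a b H z) \<le> C * indicator {a..b} (snd z)"
        using H z by (auto simp: tame_def indicator_def case_prod_beta)
      moreover have "norm (steps_fun (riemann a b H m) z) \<le> C * indicator {a..b} (snd z)"
        using riemann_process_bound[OF H z] by (simp add: case_prod_beta)
      ultimately have "norm (steps_fun (riemann a b H m) z - restricted a b H z) \<le> 2 * C * indicator {a..b} (snd z)"
        by (intro order_trans[OF norm_triangle_ineq4]) simp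
      then show "ennreal ((norm (steps_fun (riemann a b H m) z - restricted a b H z))\<^sup>2)
        \<le> ennreal ((norm (2 * C * indicator {a..b} (snd z)))\<^sup>2)"
        by (intro ennreal_leI power_mono) auto
    qed
    have "mean_square (M \<Otimes>\<^sub>M lborel) (\<lambda>z. 2 * C * indicator {a..b} (snd z)) \<le> ennreal ((2 * C)\<^sup>2 * (b - a))"
      using H ab by (intro mean_square_bounded_pair_le) (auto simp: tame_def)
    then show "(\<integral>\<^sup>+z. ennreal ((norm (2 * C * indicator {a..b} (snd z)))\<^sup>2) \<partial>(M \<Otimes>\<^sub>M lborel)) < \<infinity>"
      unfolding mean_square_def by (rule le_less_trans) simp
    show "AE z in M \<Otimes>\<^sub>M lborel. (\<lambda>m. ennreal ((norm (steps_fun (riemann a b H m) z - restricted a b H z))\<^sup>2)) \<longlonglongrightarrow> 0"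
      using AE_pair_lborel_neq[of a] AE_space
    proof eventually_elim
      case (elim z)
      then have z: "fst z \<in> space M" by (auto simp: space_pair_measure)
      have "indicator {a<..b} (snd z) = (indicator {a..b} (snd z) :: real)"
        using elim by (auto simp: indicator_def)
      with riemann_process_tendsto[OF H z, of "snd z"]
      have "(\<lambda>m. steps_fun (riemann a b H m) z) \<longlonglongrightarrow> restricted a b H z"
        by (simp add: case_prod_beta)
      then have "(\<lambda>m. ennreal ((norm (steps_fun (riemann a b H m) z - restricted a b H z))\<^sup>2))
          \<longlonglongrightarrow> ennreal ((norm (restricted a b H z - restricted a b H z))\<^sup>2)"
        by (intro tendsto_ennrealI tendsto_intros)
      then show ?case by simp
    qed
  qed measurable
  then show ?thesis by (simp add: mean_square_def)
qed

text \<open>By the isometry for appended lists, the Riemann sums are a Cauchy sequence in mean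
  square, and completeness yields \<open>J\<close>. Their convergence to \<open>J\<close> is
  recorded as well, because bounds for exponential moments are transported along these particular
  sums.\<close>

lemma tame_ito_exists:
  assumes H: "tame a b C H"
  shows "\<exists>J. has_ito_integral M W a b H J \<and>
    (\<lambda>m. mean_square M (\<lambda>\<omega>. steps_ito (riemann a b H m) \<omega> - J \<omega>)) \<longlonglongrightarrow> 0"
proof -
  note R = riemann_adapted(1)[OF H]
  note K = tame_jointly_measurable[OF H]
  note [measurable] = steps_fun_measurable[OF R] K steps_ito_measurable[OF R]
  let ?e = "\<lambda>m. mean_square (M \<Otimes>\<^sub>M lborel) (\<lambda>z. steps_fun (riemann a b H m) z - restricted a b H z)"
  have e: "(\<lambda>m. 2 * ?e m) \<longlonglongrightarrow> 0"
    using tendsto_0_ennreal_two_sum[OF riemann_mean_square_tendsto[OF H], of "\<lambda>_. 0"] by simp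
  have "mean_square M (\<lambda>\<omega>. steps_ito (riemann a b H m) \<omega> - steps_ito (riemann a b H n) \<omega>) \<le> 2 * ?e m + 2 * ?e n" for m n
  proof -
    let ?N = "riemann a b H m @ neg_steps (riemann a b H n)"
    have N: "adapted_steps ?N" using R steps_neg(1)[OF R] by (simp add: steps_append)
    have "mean_square M (\<lambda>\<omega>. steps_ito (riemann a b H m) \<omega> - steps_ito (riemann a b H n) \<omega>) = mean_square M (steps_ito ?N)"
      by (simp add: steps_append steps_neg mean_square_def)
    also have "\<dots> = mean_square (M \<Otimes>\<^sub>M lborel) (steps_fun ?N)" by (rule mean_square_steps[OF N])
    also have "steps_fun ?N = (\<lambda>z. (steps_fun (riemann a b H m) z - restricted a b H z)
        - (steps_fun (riemann a b H n) z - restricted a b H z))"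
      by (auto simp: fun_eq_iff steps_append steps_neg)
    also have "mean_square (M \<Otimes>\<^sub>M lborel) \<dots> \<le> 2 * ?e m + 2 * ?e n"
      by (rule mean_square_diff_le; measurable)
    finally show ?thesis .
  qed
  from mean_square_complete[OF steps_ito_measurable[OF R] e this]
  obtain J where J [measurable]: "J \<in> borel_measurable M"
    and lim: "(\<lambda>m. mean_square M (\<lambda>\<omega>. steps_ito (riemann a b H m) \<omega> - J \<omega>)) \<longlonglongrightarrow> 0"
    by blast
  have a: "0 \<le> a" using H by (simp add: tame_def)
  note simp = riemann_simple_integrand[OF H]
  have "has_ito_integral M W a b H J"
    unfolding has_ito_integral_def
  proof (intro conjI exI allI)
    show "J \<in> borel_measurable M" by simp
    show "(\<lambda>(s, \<omega>). indicator {a..b} s *\<^sub>R H s \<omega>) \<in> borel_measurable (lborel \<Otimes>\<^sub>M M)"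
      using measurable_pair_swap[OF K] by (simp add: case_prod_beta)
    show "simple_integrand M F a b (Suc m) (grid a b m) (\<lambda>k. H (grid a b m k))" for m by (rule simp)
    show "(\<lambda>m. \<integral>\<^sup>+\<omega>. (\<integral>\<^sup>+s\<in>{a..b}. ennreal ((norm (simple_process (Suc m) (grid a b m) (\<lambda>k. H (grid a b m k)) s \<omega> - H s \<omega>))\<^sup>2) \<partial>lborel) \<partial>M) \<longlonglongrightarrow> 0"
      using riemann_mean_square_tendsto[OF H] unfolding mean_square_simple_steps[OF simp a K] .
    show "(\<lambda>m. \<integral>\<^sup>+\<omega>. ennreal ((simple_ito W (Suc m) (grid a b m) (\<lambda>k. H (grid a b m k)) \<omega> - J \<omega>)\<^sup>2) \<partial>M) \<longlonglongrightarrow> 0"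
      using lim by (simp add: steps_ito_simple_steps mean_square_def)
  qed
  with lim show ?thesis by blast
qed

text \<open>Induction over the cells: conditionally on the past, the last increment multiplies the
  exponential moment by at most the Gaussian factor with variance C^2 times the length of the cell.
  Measurability is proved in the same induction, as the conditioning relies on it.\<close>

lemma simple_ito_exp_moment:
  assumes "\<forall>k<n. p k \<le> p (Suc k)" "0 \<le> p 0"
    and "\<forall>k<n. \<xi> k \<in> borel_measurable (F (p k)) \<and> (\<forall>\<omega>\<in>space M. norm (\<xi> k \<omega>) \<le> C)"
  shows "simple_ito W n p \<xi> \<in> borel_measurable (F (p n)) \<and>
    (\<integral>\<^sup>+\<omega>. ennreal (exp (c * simple_ito W n p \<xi> \<omega>)) \<partial>M) \<le> ennreal (exp (c\<^sup>2 * C\<^sup>2 * (p n - p 0) / 2))"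
  using assms
proof (induction n)
  case 0
  then show ?case by (simp add: simple_ito_def[abs_def] emeasure_space_1)
next
  case (Suc n)
  have IH: "simple_ito W n p \<xi> \<in> borel_measurable (F (p n))"
    "(\<integral>\<^sup>+\<omega>. ennreal (exp (c * simple_ito W n p \<xi> \<omega>)) \<partial>M) \<le> ennreal (exp (c\<^sup>2 * C\<^sup>2 * (p n - p 0) / 2))"
    using Suc by auto
  have pn: "p n \<le> p (Suc n)" "0 \<le> p n"
    using Suc.prems partition_le[of "Suc n" p 0 n] by auto
  have \<xi>: "\<xi> n \<in> borel_measurable (F (p n))" "\<And>\<omega>. \<omega> \<in> space M \<Longrightarrow> norm (\<xi> n \<omega>) \<le> C"
    using Suc.prems by auto
  have eq: "simple_ito W (Suc n) p \<xi> \<omega> = simple_ito W n p \<xi> \<omega> + \<xi> n \<omega> \<bullet> (W (p (Suc n)) \<omega> - W (p n) \<omega>)" for \<omega>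
    by (simp add: simple_ito_def)
  have meas: "simple_ito W (Suc n) p \<xi> \<in> borel_measurable (F (p (Suc n)))"
    unfolding eq using pn \<xi>(1) measurable_F_mono[OF IH(1) pn(1)]
    by (auto intro!: borel_measurable_add inner_increment_measurable_F)
  let ?h = "p (Suc n) - p n"
  have [measurable]: "simple_ito W n p \<xi> \<in> borel_measurable (F (p n))" "\<xi> n \<in> borel_measurable (F (p n))"
    using IH(1) \<xi>(1) .
  have [measurable]: "simple_ito W n p \<xi> \<in> borel_measurable M" using IH(1) by (rule measurable_F_M)
  have "(\<integral>\<^sup>+\<omega>. ennreal (exp (c * simple_ito W (Suc n) p \<xi> \<omega>)) \<partial>M) =
    (\<integral>\<^sup>+\<omega>. ennreal (exp (c * simple_ito W n p \<xi> \<omega>)) * ennreal (exp ((c *\<^sub>R \<xi> n \<omega>) \<bullet> (W (p (Suc n)) \<omega> - W (p n) \<omega>))) \<partial>M)"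
    unfolding eq by (simp add: exp_add ennreal_mult distrib_left)
  also have "\<dots> = (\<integral>\<^sup>+\<omega>. ennreal (exp (c * simple_ito W n p \<xi> \<omega>)) * ennreal (exp ((norm (c *\<^sub>R \<xi> n \<omega>))\<^sup>2 * ?h / 2)) \<partial>M)"
    using pn by (intro nn_integral_mult_exp_increment) measurable
  also have "\<dots> \<le> (\<integral>\<^sup>+\<omega>. ennreal (exp (c * simple_ito W n p \<xi> \<omega>)) * ennreal (exp (c\<^sup>2 * C\<^sup>2 * ?h / 2)) \<partial>M)"
  proof (intro nn_integral_mono mult_left_mono ennreal_leI)
    fix \<omega> assume "\<omega> \<in> space M"
    then have "(norm (\<xi> n \<omega>))\<^sup>2 \<le> C\<^sup>2" using \<xi>(2) by (intro power_mono) auto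
    then have "c\<^sup>2 * (norm (\<xi> n \<omega>))\<^sup>2 * ?h \<le> c\<^sup>2 * C\<^sup>2 * ?h"
      using pn by (intro mult_right_mono mult_left_mono) auto
    then show "exp ((norm (c *\<^sub>R \<xi> n \<omega>))\<^sup>2 * ?h / 2) \<le> exp (c\<^sup>2 * C\<^sup>2 * ?h / 2)"
      by (simp add: power_mult_distrib)
  qed simp
  also have "\<dots> \<le> ennreal (exp (c\<^sup>2 * C\<^sup>2 * (p n - p 0) / 2)) * ennreal (exp (c\<^sup>2 * C\<^sup>2 * ?h / 2))"
    by (simp add: nn_integral_multc mult_right_mono IH(2))
  also have "\<dots> = ennreal (exp (c\<^sup>2 * C\<^sup>2 * (p (Suc n) - p 0) / 2))"
    by (simp add: ennreal_mult[symmetric] exp_add[symmetric] field_simps)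
  finally show ?case using meas by blast
qed

text \<open>The bound for Riemann sums does not depend on the partition, so Fatou's lemma along an
  almost everywhere convergent subsequence passes it to their limit \<open>I\<close>. An arbitrary
  version \<open>J\<close> agrees with \<open>I\<close> by uniqueness; its own approximating
  integrands might exceed \<open>C\<close>, hence the detour.\<close>

lemma ito_exp_moment:
  assumes H: "tame a b C H" and J: "has_ito_integral M W a b H J"
  shows "(\<integral>\<^sup>+\<omega>. ennreal (exp (c * J \<omega>)) \<partial>M) \<le> ennreal (exp (c\<^sup>2 * C\<^sup>2 * (b - a) / 2))"
proof -
  note R = riemann_adapted(1)[OF H]
  note [measurable] = steps_ito_measurable[OF R]
  obtain I where I: "has_ito_integral M W a b H I"
    and lim: "(\<lambda>m. mean_square M (\<lambda>\<omega>. steps_ito (riemann a b H m) \<omega> - I \<omega>)) \<longlonglongrightarrow> 0"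
    using tame_ito_exists[OF H] by blast
  have [measurable]: "I \<in> borel_measurable M" using I by (simp add: has_ito_integral_def)
  have a: "0 \<le> a" "a \<le> b" using H by (auto simp: tame_def)
  have IJ: "AE \<omega> in M. J \<omega> = I \<omega>"
    by (rule ito_limit_unique[OF has_ito_integral_ito_limit[OF J a(1)] has_ito_integral_ito_limit[OF I a(1)]]) simp
  obtain r :: "nat \<Rightarrow> nat" where r: "AE \<omega> in M. (\<lambda>m. steps_ito (riemann a b H (r m)) \<omega>) \<longlonglongrightarrow> I \<omega>"
    using mean_square_tendsto_AE_subseq[OF _ _ lim] by auto
  have bound: "(\<integral>\<^sup>+\<omega>. ennreal (exp (c * steps_ito (riemann a b H m) \<omega>)) \<partial>M) \<le> ennreal (exp (c\<^sup>2 * C\<^sup>2 * (b - a) / 2))" for m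
  proof -
    have "\<forall>k<Suc m. H (grid a b m k) \<in> borel_measurable (F (grid a b m k)) \<and> (\<forall>\<omega>\<in>space M. norm (H (grid a b m k) \<omega>) \<le> C)"
      using H grid_in[OF a(2)] by (auto simp: tame_def)
    then show ?thesis
      using simple_ito_exp_moment[of "Suc m" "grid a b m" "\<lambda>k. H (grid a b m k)" C c] grid_mono[OF a(2)] a
      by (simp add: steps_ito_simple_steps)
  qed
  have "(\<integral>\<^sup>+\<omega>. ennreal (exp (c * J \<omega>)) \<partial>M) =
      (\<integral>\<^sup>+\<omega>. liminf (\<lambda>m. ennreal (exp (c * steps_ito (riemann a b H (r m)) \<omega>))) \<partial>M)"
  proof (rule nn_integral_cong_AE, use r IJ in eventually_elim)
    case (elim \<omega>)
    have "(\<lambda>m. ennreal (exp (c * steps_ito (riemann a b H (r m)) \<omega>))) \<longlonglongrightarrow> ennreal (exp (c * I \<omega>))"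
      by (intro tendsto_ennrealI tendsto_intros elim)
    then show ?case using elim by (subst lim_imp_Liminf) auto
  qed
  also have "\<dots> \<le> liminf (\<lambda>m. \<integral>\<^sup>+\<omega>. ennreal (exp (c * steps_ito (riemann a b H (r m)) \<omega>)) \<partial>M)"
    by (rule nn_integral_liminf) measurable
  also have "\<dots> \<le> liminf (\<lambda>m::nat. ennreal (exp (c\<^sup>2 * C\<^sup>2 * (b - a) / 2)))"
    by (intro Liminf_mono always_eventually allI bound)
  also have "\<dots> = ennreal (exp (c\<^sup>2 * C\<^sup>2 * (b - a) / 2))"
    by (simp add: Liminf_const)
  finally show ?thesis .
qed

lemma ito_mean_square_le:
  assumes H: "tame a b C H" and J: "has_ito_integral M W a b H J"
  shows "mean_square M J \<le> ennreal (4 * (C\<^sup>2 * (b - a)))"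
proof -
  have a: "0 \<le> a" "a \<le> b" using H by (auto simp: tame_def)
  have "mean_square M J \<le> 4 * mean_square (M \<Otimes>\<^sub>M lborel) (restricted a b H)"
    by (rule ito_limit_mean_square_le[OF has_ito_integral_ito_limit[OF J a(1)]])
  also have "\<dots> \<le> 4 * ennreal (C\<^sup>2 * (b - a))"
    using H a by (intro mult_left_mono mean_square_bounded_pair_le) (auto simp: tame_def indicator_def)
  also have "\<dots> = ennreal (4 * (C\<^sup>2 * (b - a)))"
    using a by (simp add: ennreal_mult)
  finally show ?thesis .
qed

text \<open>The integrand frozen at its initial value is a single step, whose integral is the inner
  product with the Wiener increment. The general mean square estimate is applied to the
  difference.\<close>

lemma ito_frozen_mean_square_le:
  assumes H: "tame a b C H" and J: "has_ito_integral M W a b H J"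
  shows "mean_square M (\<lambda>\<omega>. J \<omega> - H a \<omega> \<bullet> (W b \<omega> - W a \<omega>))
    \<le> 4 * (\<integral>\<^sup>+\<omega>. (\<integral>\<^sup>+s. indicator {a..b} s * ennreal ((norm (H s \<omega> - H a \<omega>))\<^sup>2) \<partial>lborel) \<partial>M)"
proof -
  have a: "0 \<le> a" "a \<le> b" using H by (auto simp: tame_def)
  let ?L = "[(a, b, H a)]"
  have L: "adapted_steps ?L" "steps_within a b ?L"
    using H unfolding adapted_steps_def steps_within_def bounded_iff tame_def
    by (auto intro!: exI[of _ C])
  note [measurable] = steps_fun_measurable[OF L(1)] steps_ito_measurable[OF L(1)] tame_jointly_measurable[OF H]
  have "ito_limit a b (steps_fun ?L) (steps_ito ?L)"
    unfolding ito_limit_def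
    by (intro conjI exI[of _ "\<lambda>_. ?L"]) (use L in \<open>auto simp: mean_square_def\<close>)
  from ito_limit_mean_square_le[OF ito_limit_diff[OF has_ito_integral_ito_limit[OF J a(1)] this]]
  have "mean_square M (\<lambda>\<omega>. J \<omega> - steps_ito ?L \<omega>) \<le> 4 * mean_square (M \<Otimes>\<^sub>M lborel) (\<lambda>z. restricted a b H z - steps_fun ?L z)" .
  also have "mean_square (M \<Otimes>\<^sub>M lborel) (\<lambda>z. restricted a b H z - steps_fun ?L z) =
    (\<integral>\<^sup>+\<omega>. (\<integral>\<^sup>+s. ennreal ((norm (indicator {a..b} s *\<^sub>R H s \<omega> - steps_process ?L s \<omega>))\<^sup>2) \<partial>lborel) \<partial>M)"
    unfolding mean_square_def by (subst lborel.nn_integral_fst[symmetric]) auto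
  also have "\<dots> = (\<integral>\<^sup>+\<omega>. (\<integral>\<^sup>+s. indicator {a..b} s * ennreal ((norm (H s \<omega> - H a \<omega>))\<^sup>2) \<partial>lborel) \<partial>M)"
  proof (rule nn_integral_cong, rule nn_integral_cong_AE)
    fix \<omega>
    show "AE s in lborel. ennreal ((norm (indicator {a..b} s *\<^sub>R H s \<omega> - steps_process ?L s \<omega>))\<^sup>2)
       = indicator {a..b} s * ennreal ((norm (H s \<omega> - H a \<omega>))\<^sup>2)"
      using AE_lborel_singleton[of a] by eventually_elim (auto simp: steps_process_def indicator_def)
  qed
  finally show ?thesis by (simp add: steps_ito_def)
qed

end


section \<open>Diffusive increments over short times\<close>

lemma ennreal_tendsto_0I:
  fixes f :: "nat \<Rightarrow> ennreal"
  assumes "\<And>e. e > 0 \<Longrightarrow> eventually (\<lambda>n. f n \<le> ennreal e) sequentially"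
  shows "f \<longlonglongrightarrow> 0"
proof (rule order_tendstoI)
  fix a :: ennreal assume "0 < a"
  then obtain z where z: "0 < z" "z < a" using dense by blast
  then obtain e where e: "z = ennreal e" "e > 0"
    by (cases z) auto
  have "eventually (\<lambda>n. f n \<le> z) sequentially" using assms[OF e(2)] e(1) by simp
  then show "eventually (\<lambda>n. f n < a) sequentially"
    by eventually_elim (use z in auto)
qed simp

lemma exp_abs_le: "exp \<bar>x\<bar> \<le> exp x + exp (- x)" for x :: real
  by (cases "0 \<le> x") auto

lemma mean_square_divide:
  fixes f :: "'a \<Rightarrow> real"
  assumes [measurable]: "f \<in> borel_measurable M"
  shows "mean_square M (\<lambda>x. f x / c) = ennreal (1 / c\<^sup>2) * mean_square M f"
  unfolding mean_square_def
  by (subst nn_integral_cmult[symmetric]) (auto simp: power_divide ennreal_mult[symmetric])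

text \<open>Step lengths form a sequence so that dominated convergence can be used directly. The
  bound \<open>k n \<le> 1\<close> keeps terms of order k below a constant after division by sqrt
  k.\<close>

locale short_time = wiener M W for M :: "'a measure" and W :: "real \<Rightarrow> 'a \<Rightarrow> real^'d" +
  fixes s T :: real and k :: "nat \<Rightarrow> real"
  assumes s: "0 \<le> s" and k_pos: "\<And>n. 0 < k n" and k_le: "\<And>n. s + k n \<le> T" and k_le_1: "\<And>n. k n \<le> 1"
    and k_lim: "k \<longlonglongrightarrow> 0"
begin

abbreviation dW :: "nat \<Rightarrow> 'a \<Rightarrow> real^'d" where
  "dW n \<omega> \<equiv> W (s + k n) \<omega> - W s \<omega>"

text \<open>The leading part of \<open>A n\<close> is the Gaussian variable
  \<open>\<alpha> \<omega> \<bullet> dW n \<omega>\<close>, with an error o(sqrt k) in mean square.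
  The exponential moments after scaling by sqrt k, uniform in \<open>n\<close>, control the higher
  order terms that the mean square does not see. Adding a drift of order k changes neither
  property.\<close>

definition diffusive :: "('a \<Rightarrow> real^'d) \<Rightarrow> (nat \<Rightarrow> 'a \<Rightarrow> real) \<Rightarrow> bool" where
  "diffusive \<alpha> A \<longleftrightarrow> (\<forall>n. A n \<in> borel_measurable M) \<and>
     (\<lambda>n. mean_square M (\<lambda>\<omega>. (A n \<omega> - \<alpha> \<omega> \<bullet> dW n \<omega>) / sqrt (k n))) \<longlonglongrightarrow> 0 \<and>
     (\<forall>c\<ge>0. \<exists>K. \<forall>n. (\<integral>\<^sup>+\<omega>. ennreal (exp (c * \<bar>A n \<omega>\<bar> / sqrt (k n))) \<partial>M) \<le> ennreal K)"

lemma dW_measurable [measurable]: "dW n \<in> borel_measurable M"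
  using s k_pos[of n] by simp

lemma sqrt_k_pos [simp]: "0 < sqrt (k n)" "sqrt (k n) \<noteq> 0" "(sqrt (k n))\<^sup>2 = k n" "sqrt (k n) * sqrt (k n) = k n"
  using k_pos[of n] by simp_all

lemma k_nonneg [simp]: "0 \<le> k n"
  using k_pos[of n] by simp

lemma diffusive_cong_AE:
  assumes A: "diffusive \<alpha> A" and B: "\<And>n. B n \<in> borel_measurable M" and AB: "\<And>n. AE \<omega> in M. A n \<omega> = B n \<omega>"
  shows "diffusive \<alpha> B"
proof -
  have 1: "mean_square M (\<lambda>\<omega>. (B n \<omega> - \<alpha> \<omega> \<bullet> dW n \<omega>) / sqrt (k n)) = mean_square M (\<lambda>\<omega>. (A n \<omega> - \<alpha> \<omega> \<bullet> dW n \<omega>) / sqrt (k n))" for n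
    by (rule mean_square_cong_AE) (use AB[of n] in eventually_elim, simp)
  have 2: "(\<integral>\<^sup>+\<omega>. ennreal (exp (c * \<bar>B n \<omega>\<bar> / sqrt (k n))) \<partial>M) = (\<integral>\<^sup>+\<omega>. ennreal (exp (c * \<bar>A n \<omega>\<bar> / sqrt (k n))) \<partial>M)" for n c
    by (rule nn_integral_cong_AE) (use AB[of n] in eventually_elim, simp)
  show ?thesis using A B unfolding diffusive_def 1 2 by blast
qed

text \<open>The exponent in the hypothesis is proportional to c^2 k, so replacing c by c / sqrt k
  removes the step length. The factor 2 accounts for both signs of \<open>A\<close>.\<close>

lemma exp_moment_abs:
  fixes A :: "'a \<Rightarrow> real"
  assumes [measurable]: "A \<in> borel_measurable M"
    and "\<And>c. (\<integral>\<^sup>+\<omega>. ennreal (exp (c * A \<omega>)) \<partial>M) \<le> ennreal (exp (c\<^sup>2 * D * k n))"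
  shows "(\<integral>\<^sup>+\<omega>. ennreal (exp (c * \<bar>A \<omega>\<bar> / sqrt (k n))) \<partial>M) \<le> ennreal (2 * exp (c\<^sup>2 * D))"
proof -
  let ?c = "c / sqrt (k n)"
  have "(\<integral>\<^sup>+\<omega>. ennreal (exp (c * \<bar>A \<omega>\<bar> / sqrt (k n))) \<partial>M) \<le> (\<integral>\<^sup>+\<omega>. ennreal (exp (?c * A \<omega>)) + ennreal (exp (- ?c * A \<omega>)) \<partial>M)"
  proof (rule nn_integral_mono)
    fix \<omega>
    have "exp (c * \<bar>A \<omega>\<bar> / sqrt (k n)) \<le> exp \<bar>?c * A \<omega>\<bar>"
      using abs_ge_self[of "c * \<bar>A \<omega>\<bar> / sqrt (k n)"] by (simp add: abs_mult)
    also have "\<dots> \<le> exp (?c * A \<omega>) + exp (- (?c * A \<omega>))" by (rule exp_abs_le)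
    finally show "ennreal (exp (c * \<bar>A \<omega>\<bar> / sqrt (k n))) \<le> ennreal (exp (?c * A \<omega>)) + ennreal (exp (- ?c * A \<omega>))"
      by (simp flip: ennreal_plus)
  qed
  also have "\<dots> = (\<integral>\<^sup>+\<omega>. ennreal (exp (?c * A \<omega>)) \<partial>M) + (\<integral>\<^sup>+\<omega>. ennreal (exp (- ?c * A \<omega>)) \<partial>M)"
    by (rule nn_integral_add) measurable
  also have "\<dots> \<le> ennreal (exp (?c\<^sup>2 * D * k n)) + ennreal (exp ((- ?c)\<^sup>2 * D * k n))"
    by (intro add_mono assms(2))
  also have "?c\<^sup>2 * D * k n = c\<^sup>2 * D" using k_pos[of n] by (simp add: power_divide)
  also have "(- ?c)\<^sup>2 * D * k n = c\<^sup>2 * D" using k_pos[of n] by (simp add: power_divide)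
  finally show ?thesis by (simp flip: ennreal_plus)
qed

text \<open>For fixed \<open>\<omega>\<close> this is the average over [s, s + k] of the squared
  deviation from the value at s. It tends to 0 by continuity of the path and is dominated by (2
  C)^2.\<close>

lemma ito_frozen_tendsto:
  assumes H: "tame s T C H"
  shows "(\<lambda>n. \<integral>\<^sup>+\<omega>. ennreal (1 / k n) *
      (\<integral>\<^sup>+r. indicator {s..s + k n} r * ennreal ((norm (H r \<omega> - H s \<omega>))\<^sup>2) \<partial>lborel) \<partial>M) \<longlonglongrightarrow> 0"
proof -
  have Hn: "tame s (s + k n) C H" for n
    using k_pos[of n] k_le[of n] by (intro tame_subinterval[OF H]) auto
  have C: "0 \<le> C" and sT: "s \<le> T" using H by (auto simp: tame_def)
  have Hs [measurable]: "H s \<in> borel_measurable M"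
    using H by (auto simp: tame_def intro: measurable_F_M)
  let ?f = "\<lambda>n \<omega>. ennreal (1 / k n) * (\<integral>\<^sup>+r. indicator {s..s + k n} r * ennreal ((norm (H r \<omega> - H s \<omega>))\<^sup>2) \<partial>lborel)"
  have upper: "?f n \<omega> \<le> ennreal e"
    if e: "0 \<le> e" "\<And>r. r \<in> {s..s + k n} \<Longrightarrow> (norm (H r \<omega> - H s \<omega>))\<^sup>2 \<le> e" for n \<omega> e
  proof -
    have "?f n \<omega> \<le> ennreal (1 / k n) * (\<integral>\<^sup>+r. ennreal e * indicator {s..s + k n} r \<partial>lborel)"
      using e by (intro mult_left_mono nn_integral_mono) (auto simp: indicator_def intro!: ennreal_leI)
    also have "\<dots> = ennreal e"
      using k_pos[of n] e(1) by (simp add: nn_integral_cmult_indicator ennreal_mult[symmetric])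
    finally show ?thesis .
  qed
  have meas: "?f n \<in> borel_measurable M" for n
  proof -
    note [measurable] = tame_jointly_measurable[OF Hn[of n]]
    have [measurable]: "(\<lambda>(\<omega>, r). restricted s (s + k n) H (\<omega>, r) - indicator {s..s + k n} r *\<^sub>R H s \<omega>)
        \<in> borel_measurable (M \<Otimes>\<^sub>M lborel)" by measurable
    have "?f n = (\<lambda>\<omega>. ennreal (1 / k n) * (\<integral>\<^sup>+r. ennreal ((norm (restricted s (s + k n) H (\<omega>, r) - indicator {s..s + k n} r *\<^sub>R H s \<omega>))\<^sup>2) \<partial>lborel))"
      by (intro ext arg_cong2[where f="(*)"] refl nn_integral_cong) (auto simp: indicator_def)
    then show ?thesis by simp
  qed
  have "(\<lambda>n. \<integral>\<^sup>+\<omega>. ?f n \<omega> \<partial>M) \<longlonglongrightarrow> (\<integral>\<^sup>+\<omega>. 0 \<partial>M)"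
  proof (rule nn_integral_dominated_convergence[where w="\<lambda>_. ennreal ((2 * C)\<^sup>2)"])
    show "AE \<omega> in M. ?f n \<omega> \<le> ennreal ((2 * C)\<^sup>2)" for n
    proof (rule AE_I2, rule upper)
      fix \<omega> r assume *: "\<omega> \<in> space M" "r \<in> {s..s + k n}"
      then have "norm (H r \<omega>) \<le> C" "norm (H s \<omega>) \<le> C"
        using H k_le[of n] by (auto simp: tame_def)
      then have "norm (H r \<omega> - H s \<omega>) \<le> 2 * C"
        using norm_triangle_ineq4[of "H r \<omega>" "H s \<omega>"] by simp
      then show "(norm (H r \<omega> - H s \<omega>))\<^sup>2 \<le> (2 * C)\<^sup>2" by (intro power_mono) auto
    qed simp
    show "(\<integral>\<^sup>+\<omega>. ennreal ((2 * C)\<^sup>2) \<partial>M) < \<infinity>" by (simp add: emeasure_space_1)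
    show "AE \<omega> in M. (\<lambda>n. ?f n \<omega>) \<longlonglongrightarrow> 0"
    proof (rule AE_I2, rule ennreal_tendsto_0I)
      fix \<omega> and e :: real assume \<omega>: "\<omega> \<in> space M" and e: "0 < e"
      have "continuous_on {s..T} (\<lambda>r. H r \<omega>)" using H \<omega> by (auto simp: tame_def)
      then obtain d where d: "d > 0" "\<And>r. r \<in> {s..T} \<Longrightarrow> dist r s < d \<Longrightarrow> dist (H r \<omega>) (H s \<omega>) < sqrt e"
        using e sT unfolding continuous_on_iff by (metis atLeastAtMost_iff order_refl real_sqrt_gt_0_iff)
      have "eventually (\<lambda>n. k n < d) sequentially" using k_lim d(1) by (rule order_tendstoD)
      then show "eventually (\<lambda>n. ?f n \<omega> \<le> ennreal e) sequentially"
      proof eventually_elim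
        case (elim n)
        show ?case
        proof (rule upper)
          fix r assume r: "r \<in> {s..s + k n}"
          then have "norm (H r \<omega> - H s \<omega>) < sqrt e"
            using d(2)[of r] elim k_le[of n] by (auto simp: dist_real_def dist_norm)
          then have "(norm (H r \<omega> - H s \<omega>))\<^sup>2 \<le> (sqrt e)\<^sup>2" by (intro power_mono) auto
          then show "(norm (H r \<omega> - H s \<omega>))\<^sup>2 \<le> e" using e by simp
        qed (use e in simp)
      qed
    qed
  qed (use meas in auto)
  then show ?thesis by simp
qed

lemma diffusive_ito:
  assumes H: "tame s T C H" and J: "\<And>n. has_ito_integral M W s (s + k n) H (J n)"
  shows "diffusive (H s) J"
  unfolding diffusive_def
proof (intro conjI allI impI)
  have Hn: "tame s (s + k n) C H" for n
    using k_pos[of n] k_le[of n] by (intro tame_subinterval[OF H]) auto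
  have Hs [measurable]: "H s \<in> borel_measurable M"
    using Hn[of 0] by (auto simp: tame_def intro: measurable_F_M)
  show Jm [measurable]: "J n \<in> borel_measurable M" for n using J[of n] by (simp add: has_ito_integral_def)
  show "\<exists>K. \<forall>n. (\<integral>\<^sup>+\<omega>. ennreal (exp (c * \<bar>J n \<omega>\<bar> / sqrt (k n))) \<partial>M) \<le> ennreal K" for c
    using ito_exp_moment[OF Hn J]
    by (intro exI[of _ "2 * exp (c\<^sup>2 * (C\<^sup>2 / 2))"] allI exp_moment_abs) (auto simp: field_simps)
  let ?g = "\<lambda>n. \<integral>\<^sup>+\<omega>. (\<integral>\<^sup>+r. indicator {s..s + k n} r * ennreal ((norm (H r \<omega> - H s \<omega>))\<^sup>2) \<partial>lborel) \<partial>M"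
  let ?f = "\<lambda>n. \<integral>\<^sup>+\<omega>. ennreal (1 / k n) * (\<integral>\<^sup>+r. indicator {s..s + k n} r * ennreal ((norm (H r \<omega> - H s \<omega>))\<^sup>2) \<partial>lborel) \<partial>M"
  have le: "mean_square M (\<lambda>\<omega>. (J n \<omega> - H s \<omega> \<bullet> dW n \<omega>) / sqrt (k n)) \<le> 4 * ?f n" for n
  proof -
    note [measurable] = tame_jointly_measurable[OF Hn[of n]]
    have [measurable]: "(\<lambda>(\<omega>, r). restricted s (s + k n) H (\<omega>, r) - indicator {s..s + k n} r *\<^sub>R H s \<omega>)
        \<in> borel_measurable (M \<Otimes>\<^sub>M lborel)" by measurable
    have "(\<lambda>\<omega>. \<integral>\<^sup>+r. indicator {s..s + k n} r * ennreal ((norm (H r \<omega> - H s \<omega>))\<^sup>2) \<partial>lborel) =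
      (\<lambda>\<omega>. \<integral>\<^sup>+r. ennreal ((norm (restricted s (s + k n) H (\<omega>, r) - indicator {s..s + k n} r *\<^sub>R H s \<omega>))\<^sup>2) \<partial>lborel)"
      by (intro ext nn_integral_cong) (auto simp: indicator_def)
    then have "(\<lambda>\<omega>. \<integral>\<^sup>+r. indicator {s..s + k n} r * ennreal ((norm (H r \<omega> - H s \<omega>))\<^sup>2) \<partial>lborel) \<in> borel_measurable M"
      by simp
    then have f: "?f n = ennreal (1 / k n) * ?g n" by (rule nn_integral_cmult)
    have "mean_square M (\<lambda>\<omega>. (J n \<omega> - H s \<omega> \<bullet> dW n \<omega>) / sqrt (k n))
        = ennreal (1 / k n) * mean_square M (\<lambda>\<omega>. J n \<omega> - H s \<omega> \<bullet> dW n \<omega>)"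
      by (subst mean_square_divide) auto
    also have "\<dots> \<le> ennreal (1 / k n) * (4 * ?g n)"
      by (intro mult_left_mono ito_frozen_mean_square_le[OF Hn J]) auto
    also have "\<dots> = 4 * ?f n" unfolding f by (simp add: ac_simps)
    finally show ?thesis .
  qed
  have "(\<lambda>n. 4 * ?f n) \<longlonglongrightarrow> 4 * 0"
    by (intro ennreal_tendsto_cmult ito_frozen_tendsto[OF H]) auto
  then have "(\<lambda>n. 4 * ?f n) \<longlonglongrightarrow> 0" by simp
  then show "(\<lambda>n. mean_square M (\<lambda>\<omega>. (J n \<omega> - H s \<omega> \<bullet> dW n \<omega>) / sqrt (k n))) \<longlonglongrightarrow> 0"
    by (rule tendsto_0_ennreal_le[OF _ le])
qed

text \<open>Here the mean square error is exactly zero. The point is the exponential moments of the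
  comparison variable itself, from which its fourth moments are obtained later.\<close>

lemma diffusive_gaussian:
  assumes \<alpha>: "\<alpha> \<in> borel_measurable (F s)" and C: "\<And>\<omega>. \<omega> \<in> space M \<Longrightarrow> norm (\<alpha> \<omega>) \<le> C"
  shows "diffusive \<alpha> (\<lambda>n \<omega>. \<alpha> \<omega> \<bullet> dW n \<omega>)"
  unfolding diffusive_def
proof (intro conjI allI impI)
  have [measurable]: "\<alpha> \<in> borel_measurable M" using \<alpha> by (rule measurable_F_M)
  show m: "(\<lambda>\<omega>. \<alpha> \<omega> \<bullet> dW n \<omega>) \<in> borel_measurable M" for n by measurable
  have "(\<integral>\<^sup>+\<omega>. ennreal (exp (c * (\<alpha> \<omega> \<bullet> dW n \<omega>))) \<partial>M) \<le> ennreal (exp (c\<^sup>2 * (C\<^sup>2 / 2) * k n))" for c n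
  proof -
    have "(\<integral>\<^sup>+\<omega>. ennreal (exp (c * (\<alpha> \<omega> \<bullet> dW n \<omega>))) \<partial>M) = (\<integral>\<^sup>+\<omega>. 1 * ennreal (exp ((c *\<^sub>R \<alpha> \<omega>) \<bullet> dW n \<omega>)) \<partial>M)"
      by simp
    also have "\<dots> = (\<integral>\<^sup>+\<omega>. 1 * ennreal (exp ((norm (c *\<^sub>R \<alpha> \<omega>))\<^sup>2 * (s + k n - s) / 2)) \<partial>M)"
      using s k_pos[of n] \<alpha> by (intro nn_integral_mult_exp_increment) auto
    also have "\<dots> \<le> (\<integral>\<^sup>+\<omega>. ennreal (exp (c\<^sup>2 * (C\<^sup>2 / 2) * k n)) \<partial>M)"
    proof (rule nn_integral_mono)
      fix \<omega> assume "\<omega> \<in> space M"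
      then have "(norm (\<alpha> \<omega>))\<^sup>2 \<le> C\<^sup>2" using C by (intro power_mono) auto
      then have "c\<^sup>2 * (norm (\<alpha> \<omega>))\<^sup>2 * k n \<le> c\<^sup>2 * C\<^sup>2 * k n"
        using k_pos[of n] by (intro mult_right_mono mult_left_mono) auto
      then show "1 * ennreal (exp ((norm (c *\<^sub>R \<alpha> \<omega>))\<^sup>2 * (s + k n - s) / 2)) \<le> ennreal (exp (c\<^sup>2 * (C\<^sup>2 / 2) * k n))"
        by (simp add: power_mult_distrib)
    qed
    also have "\<dots> = ennreal (exp (c\<^sup>2 * (C\<^sup>2 / 2) * k n))" by (simp add: emeasure_space_1)
    finally show ?thesis .
  qed
  then show "\<exists>K. \<forall>n. (\<integral>\<^sup>+\<omega>. ennreal (exp (c * \<bar>\<alpha> \<omega> \<bullet> dW n \<omega>\<bar> / sqrt (k n))) \<partial>M) \<le> ennreal K" for c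
    by (intro exI[of _ "2 * exp (c\<^sup>2 * (C\<^sup>2 / 2))"] allI exp_moment_abs m)
qed (simp add: mean_square_def)

text \<open>A drift of order k becomes of order sqrt k after scaling: it vanishes in mean square and
  multiplies exponential moments by a bounded factor.\<close>

lemma diffusive_affine:
  assumes A: "diffusive \<alpha> A" and \<alpha>: "\<alpha> \<in> borel_measurable (F s)"
    and Dm: "\<And>n. D n \<in> borel_measurable M" and D: "\<And>n \<omega>. \<omega> \<in> space M \<Longrightarrow> \<bar>D n \<omega>\<bar> \<le> C * k n"
  shows "diffusive (\<lambda>\<omega>. c *\<^sub>R \<alpha> \<omega>) (\<lambda>n \<omega>. c * A n \<omega> + D n \<omega>)"
  unfolding diffusive_def
proof (intro conjI allI impI)
  note [measurable] = Dm
  have Am [measurable]: "A n \<in> borel_measurable M" for n using A by (simp add: diffusive_def)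
  have [measurable]: "\<alpha> \<in> borel_measurable M" using \<alpha> by (rule measurable_F_M)
  show "(\<lambda>\<omega>. c * A n \<omega> + D n \<omega>) \<in> borel_measurable M" for n by measurable
  \<comment> \<open>The sign of \<open>C\<close> is read off from the bound at one sample point; a
    probability space has one.\<close>
  obtain \<omega>0 where "\<omega>0 \<in> space M" using not_empty by blast
  then have "0 \<le> C * k 0" using D[of \<omega>0 0] by (meson abs_ge_zero order_trans)
  then have C: "0 \<le> C" using k_pos[of 0] by (simp add: zero_le_mult_iff)
  have k_le_sqrt: "k n \<le> sqrt (k n)" for n
    using k_pos[of n] k_le_1[of n] by (simp add: real_le_rsqrt power2_eq_square mult_left_le)
  have Dk: "\<bar>D n \<omega>\<bar> / sqrt (k n) \<le> C * sqrt (k n)" if "\<omega> \<in> space M" for n \<omega>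
  proof -
    have "\<bar>D n \<omega>\<bar> / sqrt (k n) \<le> C * k n / sqrt (k n)" using D[OF that] by (intro divide_right_mono) auto
    also have "\<dots> = C * sqrt (k n)" by (metis k_nonneg real_div_sqrt times_divide_eq_right)
    finally show ?thesis .
  qed
  have sq1: "sqrt (k n) \<le> 1" for n using k_le_1[of n] by simp
  show "\<exists>K. \<forall>n. (\<integral>\<^sup>+\<omega>. ennreal (exp (c' * \<bar>c * A n \<omega> + D n \<omega>\<bar> / sqrt (k n))) \<partial>M) \<le> ennreal K" if c': "0 \<le> c'" for c'
  proof -
    obtain K where K: "\<And>n. (\<integral>\<^sup>+\<omega>. ennreal (exp ((c' * \<bar>c\<bar>) * \<bar>A n \<omega>\<bar> / sqrt (k n))) \<partial>M) \<le> ennreal K"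
      using A c' unfolding diffusive_def by (metis abs_ge_zero mult_nonneg_nonneg)
    have "(\<integral>\<^sup>+\<omega>. ennreal (exp (c' * \<bar>c * A n \<omega> + D n \<omega>\<bar> / sqrt (k n))) \<partial>M) \<le> ennreal (exp (c' * C) * K)" for n
    proof -
      have "(\<integral>\<^sup>+\<omega>. ennreal (exp (c' * \<bar>c * A n \<omega> + D n \<omega>\<bar> / sqrt (k n))) \<partial>M)
        \<le> (\<integral>\<^sup>+\<omega>. ennreal (exp (c' * C)) * ennreal (exp ((c' * \<bar>c\<bar>) * \<bar>A n \<omega>\<bar> / sqrt (k n))) \<partial>M)"
      proof (rule nn_integral_mono)
        fix \<omega> assume \<omega>: "\<omega> \<in> space M"
        have "\<bar>D n \<omega>\<bar> / sqrt (k n) \<le> C * 1"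
          using Dk[OF \<omega>, of n] mult_left_mono[OF sq1[of n] C] by linarith
        moreover have "\<bar>c * A n \<omega> + D n \<omega>\<bar> / sqrt (k n) \<le> \<bar>c\<bar> * \<bar>A n \<omega>\<bar> / sqrt (k n) + \<bar>D n \<omega>\<bar> / sqrt (k n)"
          unfolding add_divide_distrib[symmetric]
          by (intro divide_right_mono order_trans[OF abs_triangle_ineq]) (auto simp: abs_mult)
        ultimately have "c' * (\<bar>c * A n \<omega> + D n \<omega>\<bar> / sqrt (k n)) \<le> c' * (C + \<bar>c\<bar> * \<bar>A n \<omega>\<bar> / sqrt (k n))"
          by (intro mult_left_mono c') linarith
        then have "exp (c' * \<bar>c * A n \<omega> + D n \<omega>\<bar> / sqrt (k n)) \<le> exp (c' * C) * exp ((c' * \<bar>c\<bar>) * \<bar>A n \<omega>\<bar> / sqrt (k n))"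
          by (simp add: exp_add[symmetric] distrib_left mult.assoc)
        then show "ennreal (exp (c' * \<bar>c * A n \<omega> + D n \<omega>\<bar> / sqrt (k n))) \<le> ennreal (exp (c' * C)) * ennreal (exp ((c' * \<bar>c\<bar>) * \<bar>A n \<omega>\<bar> / sqrt (k n)))"
          by (simp add: ennreal_mult[symmetric] ennreal_leI)
      qed
      also have "\<dots> \<le> ennreal (exp (c' * C)) * ennreal K"
        by (subst nn_integral_cmult) (auto intro!: mult_left_mono K)
      finally show ?thesis by (simp add: ennreal_mult')
    qed
    then show ?thesis by blast
  qed
  let ?a = "\<lambda>n. mean_square M (\<lambda>\<omega>. c * ((A n \<omega> - \<alpha> \<omega> \<bullet> dW n \<omega>) / sqrt (k n)))"
    and ?d = "\<lambda>n. mean_square M (\<lambda>\<omega>. D n \<omega> / sqrt (k n))"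
  have "?a n = ennreal (c\<^sup>2) * mean_square M (\<lambda>\<omega>. (A n \<omega> - \<alpha> \<omega> \<bullet> dW n \<omega>) / sqrt (k n))" for n
    unfolding mean_square_def
    by (subst nn_integral_cmult[symmetric]) (auto simp: power_mult_distrib ennreal_mult[symmetric] power_divide)
  moreover have "(\<lambda>n. ennreal (c\<^sup>2) * mean_square M (\<lambda>\<omega>. (A n \<omega> - \<alpha> \<omega> \<bullet> dW n \<omega>) / sqrt (k n))) \<longlonglongrightarrow> ennreal (c\<^sup>2) * 0"
    using A unfolding diffusive_def by (intro ennreal_tendsto_cmult) auto
  ultimately have a0: "?a \<longlonglongrightarrow> 0" by simp
  have le: "?d n \<le> ennreal (C\<^sup>2 * k n)" for n
  proof -
    have "?d n \<le> (\<integral>\<^sup>+\<omega>. ennreal (C\<^sup>2 * k n) \<partial>M)"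
      unfolding mean_square_def
    proof (rule nn_integral_mono, rule ennreal_leI)
      fix \<omega> assume "\<omega> \<in> space M"
      then have "(\<bar>D n \<omega>\<bar> / sqrt (k n))\<^sup>2 \<le> (C * sqrt (k n))\<^sup>2" using Dk by (intro power_mono) auto
      then show "(norm (D n \<omega> / sqrt (k n)))\<^sup>2 \<le> C\<^sup>2 * k n"
        by (simp add: power_mult_distrib power_divide)
    qed
    then show ?thesis by (simp add: emeasure_space_1)
  qed
  have "(\<lambda>n. ennreal (C\<^sup>2 * k n)) \<longlonglongrightarrow> ennreal (C\<^sup>2 * 0)"
    by (intro tendsto_ennrealI tendsto_intros k_lim)
  then have "(\<lambda>n. ennreal (C\<^sup>2 * k n)) \<longlonglongrightarrow> 0" by simp
  then have d0: "?d \<longlonglongrightarrow> 0" by (rule tendsto_0_ennreal_le[OF _ le])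
  show "(\<lambda>n. mean_square M (\<lambda>\<omega>. (c * A n \<omega> + D n \<omega> - c *\<^sub>R \<alpha> \<omega> \<bullet> dW n \<omega>) / sqrt (k n))) \<longlonglongrightarrow> 0"
  proof (rule tendsto_0_ennreal_le[OF tendsto_0_ennreal_two_sum[OF a0 d0]])
    fix n
    have "(\<lambda>\<omega>. (c * A n \<omega> + D n \<omega> - c *\<^sub>R \<alpha> \<omega> \<bullet> dW n \<omega>) / sqrt (k n)) =
      (\<lambda>\<omega>. c * ((A n \<omega> - \<alpha> \<omega> \<bullet> dW n \<omega>) / sqrt (k n)) + D n \<omega> / sqrt (k n))"
      by (simp add: fun_eq_iff add_divide_distrib diff_divide_distrib right_diff_distrib)
    then show "mean_square M (\<lambda>\<omega>. (c * A n \<omega> + D n \<omega> - c *\<^sub>R \<alpha> \<omega> \<bullet> dW n \<omega>) / sqrt (k n)) \<le> 2 * ?a n + 2 * ?d n"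
      by (simp only:) (rule mean_square_add_le; measurable)
  qed
qed

end


section \<open>Products in L2 and fourth moments\<close>

lemma square_integrable_mult_bounded:
  fixes f g :: "'a \<Rightarrow> real"
  assumes f: "square_integrable M f" and [measurable]: "g \<in> borel_measurable M"
    and g: "\<And>x. x \<in> space M \<Longrightarrow> \<bar>g x\<bar> \<le> C"
  shows "square_integrable M (\<lambda>x. f x * g x)"
proof -
  note [measurable] = square_integrable_measurable[OF f]
  have "integrable M (\<lambda>x. (norm (f x * g x))\<^sup>2)"
  proof (rule Bochner_Integration.integrable_bound)
    show "integrable M (\<lambda>x. C\<^sup>2 * (norm (f x))\<^sup>2)"
      using f by (auto simp: square_integrable_def)
    show "AE x in M. norm ((norm (f x * g x))\<^sup>2) \<le> norm (C\<^sup>2 * (norm (f x))\<^sup>2)"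
    proof (rule AE_I2)
      fix x assume "x \<in> space M"
      then have "\<bar>g x\<bar>\<^sup>2 \<le> C\<^sup>2" using g by (intro power_mono) auto
      then have "(f x)\<^sup>2 * (g x)\<^sup>2 \<le> (f x)\<^sup>2 * C\<^sup>2" by (intro mult_left_mono) auto
      then show "norm ((norm (f x * g x))\<^sup>2) \<le> norm (C\<^sup>2 * (norm (f x))\<^sup>2)"
        by (simp add: power_mult_distrib abs_mult mult.commute)
    qed
  qed measurable
  then show ?thesis by (simp add: square_integrable_def)
qed

lemma integral_square_tendsto_0:
  fixes f :: "nat \<Rightarrow> 'a \<Rightarrow> real"
  assumes g: "square_integrable M g" and [measurable]: "\<And>n. f n \<in> borel_measurable M"
    and B: "\<And>n x. x \<in> space M \<Longrightarrow> \<bar>f n x\<bar> \<le> B" and lim: "\<And>x. x \<in> space M \<Longrightarrow> (\<lambda>n. f n x) \<longlonglongrightarrow> 0"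
  shows "(\<lambda>n. \<integral>x. (g x * f n x)\<^sup>2 \<partial>M) \<longlonglongrightarrow> 0"
proof -
  note [measurable] = square_integrable_measurable[OF g]
  have "(\<lambda>n. \<integral>x. (g x * f n x)\<^sup>2 \<partial>M) \<longlonglongrightarrow> (\<integral>x. 0 \<partial>M)"
  proof (rule integral_dominated_convergence[where w="\<lambda>x. (g x)\<^sup>2 * B\<^sup>2"])
    show "integrable M (\<lambda>x. (g x)\<^sup>2 * B\<^sup>2)" using g by (simp add: square_integrable_def)
    show "AE x in M. (\<lambda>n. (g x * f n x)\<^sup>2) \<longlonglongrightarrow> 0"
    proof (rule AE_I2)
      fix x assume "x \<in> space M"
      then have "(\<lambda>n. (g x * f n x)\<^sup>2) \<longlonglongrightarrow> (g x * 0)\<^sup>2" by (intro tendsto_intros lim)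
      then show "(\<lambda>n. (g x * f n x)\<^sup>2) \<longlonglongrightarrow> 0" by simp
    qed
    show "AE x in M. norm ((g x * f n x)\<^sup>2) \<le> (g x)\<^sup>2 * B\<^sup>2" for n
    proof (rule AE_I2)
      fix x assume "x \<in> space M"
      then have "\<bar>f n x\<bar>\<^sup>2 \<le> B\<^sup>2" using B by (intro power_mono) auto
      then show "norm ((g x * f n x)\<^sup>2) \<le> (g x)\<^sup>2 * B\<^sup>2"
        by (simp add: power_mult_distrib mult_left_mono)
    qed
  qed measurable
  then show ?thesis by simp
qed

lemma mult_square_le_power4: "(a * b)\<^sup>2 \<le> a^4 + b^4" for a b :: real
proof -
  have "0 \<le> (a\<^sup>2 - b\<^sup>2)\<^sup>2" by simp
  then have "2 * (a\<^sup>2 * b\<^sup>2) \<le> a^4 + b^4"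
    unfolding power2_diff by (simp flip: power_mult)
  moreover have "0 \<le> a\<^sup>2 * b\<^sup>2" by simp
  ultimately have "a\<^sup>2 * b\<^sup>2 \<le> a^4 + b^4" by linarith
  then show ?thesis by (simp only: power_mult_distrib)
qed

lemma power_le_fact_exp: "0 \<le> x \<Longrightarrow> x^m \<le> fact m * exp x" for x :: real
proof -
  assume x: "0 \<le> x"
  have "(\<Sum>k\<in>{m}. x^k /\<^sub>R fact k) \<le> exp x"
    unfolding exp_def using x by (intro sum_le_suminf summable_exp_generic) auto
  then show ?thesis by (simp add: field_simps)
qed

lemma power4_le_exp: "x^4 \<le> 24 * exp \<bar>x\<bar>" for x :: real
  using power_le_fact_exp[of "\<bar>x\<bar>" 4] by (simp add: fact_numeral)

text \<open>Products of a weight and an increment must lie in L2; this is why fourth powers of both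
  are tracked. The pointwise inequality behind it is (ab)^2 \<le> a^4 + b^4.\<close>

lemma square_integrable_mult_power4:
  fixes f g :: "'a \<Rightarrow> real"
  assumes [measurable]: "f \<in> borel_measurable M" "g \<in> borel_measurable M"
    and f: "integrable M (\<lambda>x. (f x)^4)" and g: "integrable M (\<lambda>x. (g x)^4)"
  shows "square_integrable M (\<lambda>x. f x * g x)"
    and "(\<integral>x. (f x * g x)\<^sup>2 \<partial>M) \<le> (\<integral>x. (f x)^4 \<partial>M) + (\<integral>x. (g x)^4 \<partial>M)"
proof -
  have int: "integrable M (\<lambda>x. (f x * g x)\<^sup>2)"
    by (rule Bochner_Integration.integrable_bound[of M "\<lambda>x. (f x)^4 + (g x)^4"])
      (use f g mult_square_le_power4 in auto)
  then show "square_integrable M (\<lambda>x. f x * g x)" by (simp add: square_integrable_def)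
  have "(\<integral>x. (f x * g x)\<^sup>2 \<partial>M) \<le> (\<integral>x. (f x)^4 + (g x)^4 \<partial>M)"
    using int f g by (intro integral_mono) (auto simp: mult_square_le_power4)
  then show "(\<integral>x. (f x * g x)\<^sup>2 \<partial>M) \<le> (\<integral>x. (f x)^4 \<partial>M) + (\<integral>x. (g x)^4 \<partial>M)"
    using f g by simp
qed

lemma integral_mult_tendsto_0:
  fixes f g :: "nat \<Rightarrow> 'a \<Rightarrow> real"
  assumes f: "\<And>n. square_integrable M (f n)" and g: "\<And>n. square_integrable M (g n)"
    and flim: "(\<lambda>n. \<integral>x. (f n x)\<^sup>2 \<partial>M) \<longlonglongrightarrow> 0" and K: "\<And>n. (\<integral>x. (g n x)\<^sup>2 \<partial>M) \<le> K"
  shows "(\<lambda>n. \<integral>x. f n x * g n x \<partial>M) \<longlonglongrightarrow> 0"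
proof (rule Lim_null_comparison)
  have "(\<lambda>n. sqrt (\<integral>x. (f n x)\<^sup>2 \<partial>M) * sqrt K) \<longlonglongrightarrow> sqrt 0 * sqrt K"
    by (intro tendsto_intros flim)
  then show "(\<lambda>n. sqrt (\<integral>x. (f n x)\<^sup>2 \<partial>M) * sqrt K) \<longlonglongrightarrow> 0" by simp
  have "norm (\<integral>x. f n x * g n x \<partial>M) \<le> sqrt (\<integral>x. (f n x)\<^sup>2 \<partial>M) * sqrt K" for n
  proof -
    have "norm (\<integral>x. f n x * g n x \<partial>M) \<le> sqrt (\<integral>x. (f n x)\<^sup>2 \<partial>M) * sqrt (\<integral>x. (g n x)\<^sup>2 \<partial>M)"
      using integral_inner_Cauchy_Schwarz[OF f[of n] g[of n]] by simp
    also have "\<dots> \<le> sqrt (\<integral>x. (f n x)\<^sup>2 \<partial>M) * sqrt K"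
      by (intro mult_left_mono real_sqrt_le_mono K) auto
    finally show ?thesis .
  qed
  then show "eventually (\<lambda>n. norm (\<integral>x. f n x * g n x \<partial>M) \<le> sqrt (\<integral>x. (f n x)\<^sup>2 \<partial>M) * sqrt K) sequentially"
    by simp
qed

context short_time
begin

text \<open>One term of the exponential series gives x^4 \<le> 4! exp |x|, so a single exponential
  moment suffices.\<close>

lemma diffusive_power4:
  assumes "diffusive \<alpha> A"
  shows "\<exists>K. \<forall>n. integrable M (\<lambda>\<omega>. (A n \<omega> / sqrt (k n))^4) \<and>
    expectation (\<lambda>\<omega>. (A n \<omega> / sqrt (k n))^4) \<le> K"
proof -
  have [measurable]: "A n \<in> borel_measurable M" for n using assms by (simp add: diffusive_def)
  obtain K where K: "\<And>n. (\<integral>\<^sup>+\<omega>. ennreal (exp (1 * \<bar>A n \<omega>\<bar> / sqrt (k n))) \<partial>M) \<le> ennreal K"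
    using assms unfolding diffusive_def by (metis zero_le_one)
  \<comment> \<open>\<open>ennreal K\<close> is 0 for negative \<open>K\<close>; the maximum with 0
    makes the bound usable for real expectations.\<close>
  have le: "(\<integral>\<^sup>+\<omega>. ennreal ((A n \<omega> / sqrt (k n))^4) \<partial>M) \<le> ennreal (24 * max K 0)" for n
  proof -
    have "(\<integral>\<^sup>+\<omega>. ennreal ((A n \<omega> / sqrt (k n))^4) \<partial>M) \<le> (\<integral>\<^sup>+\<omega>. ennreal 24 * ennreal (exp (1 * \<bar>A n \<omega>\<bar> / sqrt (k n))) \<partial>M)"
    proof (rule nn_integral_mono)
      fix \<omega>
      have "(A n \<omega> / sqrt (k n))^4 \<le> 24 * exp \<bar>A n \<omega> / sqrt (k n)\<bar>" by (rule power4_le_exp)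
      also have "\<bar>A n \<omega> / sqrt (k n)\<bar> = 1 * \<bar>A n \<omega>\<bar> / sqrt (k n)" by simp
      finally show "ennreal ((A n \<omega> / sqrt (k n))^4) \<le> ennreal 24 * ennreal (exp (1 * \<bar>A n \<omega>\<bar> / sqrt (k n)))"
        by (simp only: ennreal_mult[symmetric] exp_ge_zero zero_le_numeral ennreal_leI)
    qed
    also have "\<dots> = ennreal 24 * (\<integral>\<^sup>+\<omega>. ennreal (exp (1 * \<bar>A n \<omega>\<bar> / sqrt (k n))) \<partial>M)"
      by (rule nn_integral_cmult) measurable
    also have "\<dots> \<le> ennreal 24 * ennreal (max K 0)"
      by (intro mult_left_mono order_trans[OF K] ennreal_leI) auto
    also have "\<dots> = ennreal (24 * max K 0)" by (rule ennreal_mult[symmetric]) auto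
    finally show ?thesis .
  qed
  have int: "integrable M (\<lambda>\<omega>. (A n \<omega> / sqrt (k n))^4)" for n
  proof (rule integrableI_bounded)
    have "(\<integral>\<^sup>+\<omega>. ennreal (norm ((A n \<omega> / sqrt (k n))^4)) \<partial>M) = (\<integral>\<^sup>+\<omega>. ennreal ((A n \<omega> / sqrt (k n))^4) \<partial>M)"
      by (intro nn_integral_cong) simp
    then show "(\<integral>\<^sup>+\<omega>. ennreal (norm ((A n \<omega> / sqrt (k n))^4)) \<partial>M) < \<infinity>"
      using le_less_trans[OF le[of n], of \<infinity>] by simp
  qed measurable
  have "expectation (\<lambda>\<omega>. (A n \<omega> / sqrt (k n))^4) \<le> 24 * max K 0" for n
  proof -
    have "ennreal (expectation (\<lambda>\<omega>. (A n \<omega> / sqrt (k n))^4)) = (\<integral>\<^sup>+\<omega>. ennreal ((A n \<omega> / sqrt (k n))^4) \<partial>M)"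
      by (rule nn_integral_eq_integral[OF int, symmetric]) simp
    then have "ennreal (expectation (\<lambda>\<omega>. (A n \<omega> / sqrt (k n))^4)) \<le> ennreal (24 * max K 0)"
      using le[of n] by (simp only:)
    then show ?thesis by (subst (asm) ennreal_le_iff) auto
  qed
  with int show ?thesis by blast
qed

lemma diffusive_error_tendsto:
  assumes A: "diffusive \<alpha> A" and \<alpha>: "\<alpha> \<in> borel_measurable (F s)"
    and C: "\<And>\<omega>. \<omega> \<in> space M \<Longrightarrow> norm (\<alpha> \<omega>) \<le> C"
  shows "square_integrable M (\<lambda>\<omega>. A n \<omega> / sqrt (k n))"
    and "square_integrable M (\<lambda>\<omega>. (A n \<omega> - \<alpha> \<omega> \<bullet> dW n \<omega>) / sqrt (k n))"
    and "(\<lambda>n. expectation (\<lambda>\<omega>. ((A n \<omega> - \<alpha> \<omega> \<bullet> dW n \<omega>) / sqrt (k n))\<^sup>2)) \<longlonglongrightarrow> 0"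
proof -
  have L2: "square_integrable M (\<lambda>\<omega>. B n \<omega> / sqrt (k n))" if B: "diffusive \<beta> B" for B \<beta> n
  proof -
    have [measurable]: "B n \<in> borel_measurable M" using B by (simp add: diffusive_def)
    have "integrable M (\<lambda>\<omega>. (B n \<omega> / sqrt (k n))^4)" using diffusive_power4[OF B] by blast
    then have "square_integrable M (\<lambda>\<omega>. (B n \<omega> / sqrt (k n)) * 1)"
      by (intro square_integrable_mult_power4) auto
    then show ?thesis by simp
  qed
  show "square_integrable M (\<lambda>\<omega>. A n \<omega> / sqrt (k n))" using L2[OF A] .
  show si: "square_integrable M (\<lambda>\<omega>. (A n \<omega> - \<alpha> \<omega> \<bullet> dW n \<omega>) / sqrt (k n))" for n
    using square_integrable_diff[OF L2[OF A, of n] L2[OF diffusive_gaussian[OF \<alpha> C], of n]]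
    by (simp add: diff_divide_distrib)
  have "(\<lambda>n. mean_square M (\<lambda>\<omega>. (A n \<omega> - \<alpha> \<omega> \<bullet> dW n \<omega>) / sqrt (k n))) \<longlonglongrightarrow> 0"
    using A by (simp add: diffusive_def)
  then have "(\<lambda>n. ennreal (expectation (\<lambda>\<omega>. (norm ((A n \<omega> - \<alpha> \<omega> \<bullet> dW n \<omega>) / sqrt (k n)))\<^sup>2))) \<longlonglongrightarrow> ennreal 0"
    by (simp only: mean_square_eq_integral[OF si] ennreal_0)
  then have "(\<lambda>n. expectation (\<lambda>\<omega>. (norm ((A n \<omega> - \<alpha> \<omega> \<bullet> dW n \<omega>) / sqrt (k n)))\<^sup>2)) \<longlonglongrightarrow> 0"
    by (subst (asm) tendsto_ennreal_iff) (auto intro!: always_eventually)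
  then show "(\<lambda>n. expectation (\<lambda>\<omega>. ((A n \<omega> - \<alpha> \<omega> \<bullet> dW n \<omega>) / sqrt (k n))\<^sup>2)) \<longlonglongrightarrow> 0"
    by (simp only: real_norm_def power2_abs)
qed

text \<open>After scaling, the product of the increments is compared with that of their Gaussian
  parts, whose weighted mean is known exactly and does not depend on \<open>n\<close>. The two
  differences vanish by Cauchy-Schwarz: the errors tend to 0 in L2, and the other factors stay
  bounded in L2 thanks to the fourth moments of \<open>G\<close> and of the scaled
  increments.\<close>

theorem diffusive_covariance:
  assumes A: "diffusive \<alpha> A" and \<alpha>: "\<alpha> \<in> borel_measurable (F s)"
    and B: "diffusive \<beta> B" and \<beta>: "\<beta> \<in> borel_measurable (F s)"
    and C: "\<And>\<omega>. \<omega> \<in> space M \<Longrightarrow> norm (\<alpha> \<omega>) \<le> C" "\<And>\<omega>. \<omega> \<in> space M \<Longrightarrow> norm (\<beta> \<omega>) \<le> C"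
    and G: "G \<in> borel_measurable (F s)" "integrable M (\<lambda>\<omega>. (G \<omega>)^4)"
  shows "integrable M (\<lambda>\<omega>. G \<omega> * (A n \<omega> * B n \<omega>))"
    and "(\<lambda>n. expectation (\<lambda>\<omega>. G \<omega> * (A n \<omega> * B n \<omega>)) / k n) \<longlonglongrightarrow> expectation (\<lambda>\<omega>. G \<omega> * (\<alpha> \<omega> \<bullet> \<beta> \<omega>))"
proof -
  let ?a = "\<lambda>n \<omega>. A n \<omega> / sqrt (k n)" and ?b = "\<lambda>n \<omega>. B n \<omega> / sqrt (k n)"
  let ?ga = "\<lambda>n \<omega>. (\<alpha> \<omega> \<bullet> dW n \<omega>) / sqrt (k n)" and ?gb = "\<lambda>n \<omega>. (\<beta> \<omega> \<bullet> dW n \<omega>) / sqrt (k n)"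
  let ?da = "\<lambda>n \<omega>. (A n \<omega> - \<alpha> \<omega> \<bullet> dW n \<omega>) / sqrt (k n)" and ?db = "\<lambda>n \<omega>. (B n \<omega> - \<beta> \<omega> \<bullet> dW n \<omega>) / sqrt (k n)"
  have [measurable]: "G \<in> borel_measurable M" "\<alpha> \<in> borel_measurable M" "\<beta> \<in> borel_measurable M"
    using G(1) \<alpha> \<beta> by (auto intro: measurable_F_M)
  have [measurable]: "A n \<in> borel_measurable M" "B n \<in> borel_measurable M" for n
    using A B by (auto simp: diffusive_def)
  obtain Kb where Kb: "\<And>n. integrable M (\<lambda>\<omega>. (?b n \<omega>)^4)" "\<And>n. expectation (\<lambda>\<omega>. (?b n \<omega>)^4) \<le> Kb"
    using diffusive_power4[OF B] by blast
  obtain Ka where Ka: "\<And>n. integrable M (\<lambda>\<omega>. (?ga n \<omega>)^4)" "\<And>n. expectation (\<lambda>\<omega>. (?ga n \<omega>)^4) \<le> Ka"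
    using diffusive_power4[OF diffusive_gaussian[OF \<alpha> C(1)]] by blast
  note ea = diffusive_error_tendsto[OF A \<alpha> C(1)] and eb = diffusive_error_tendsto[OF B \<beta> C(2)]
  have Gb: "square_integrable M (\<lambda>\<omega>. G \<omega> * ?b n \<omega>)"
      "expectation (\<lambda>\<omega>. (G \<omega> * ?b n \<omega>)\<^sup>2) \<le> expectation (\<lambda>\<omega>. (G \<omega>)^4) + Kb" for n
    using square_integrable_mult_power4[OF _ _ G(2) Kb(1)[of n]] Kb(2)[of n] by auto
  have Ga: "square_integrable M (\<lambda>\<omega>. G \<omega> * ?ga n \<omega>)"
      "expectation (\<lambda>\<omega>. (G \<omega> * ?ga n \<omega>)\<^sup>2) \<le> expectation (\<lambda>\<omega>. (G \<omega>)^4) + Ka" for n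
    using square_integrable_mult_power4[OF _ _ G(2) Ka(1)[of n]] Ka(2)[of n] by auto
  have int1: "integrable M (\<lambda>\<omega>. ?da n \<omega> * (G \<omega> * ?b n \<omega>))" for n
    using integrable_inner[OF ea(2)[of n] Gb(1)[of n]] by (simp only: inner_real_def)
  have int2: "integrable M (\<lambda>\<omega>. ?db n \<omega> * (G \<omega> * ?ga n \<omega>))" for n
    using integrable_inner[OF eb(2)[of n] Ga(1)[of n]] by (simp only: inner_real_def)
  have G1: "integrable M G"
  proof -
    have "square_integrable M (\<lambda>\<omega>. G \<omega> * 1)"
      using G by (intro square_integrable_mult_power4) auto
    then show ?thesis by (auto intro: square_integrable_integrable)
  qed
  have intG: "integrable M (\<lambda>\<omega>. G \<omega> * (\<alpha> \<omega> $ i * \<beta> \<omega> $ j))" for i j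
  proof (rule Bochner_Integration.integrable_bound)
    show "integrable M (\<lambda>\<omega>. C\<^sup>2 * G \<omega>)" using G1 by simp
    show "AE \<omega> in M. norm (G \<omega> * (\<alpha> \<omega> $ i * \<beta> \<omega> $ j)) \<le> norm (C\<^sup>2 * G \<omega>)"
    proof (rule AE_I2)
      fix \<omega> assume \<omega>: "\<omega> \<in> space M"
      have "\<bar>\<alpha> \<omega> $ i * \<beta> \<omega> $ j\<bar> \<le> C * C"
        unfolding abs_mult using component_le_norm_cart[of "\<alpha> \<omega>" i] component_le_norm_cart[of "\<beta> \<omega>" j] C[OF \<omega>]
        by (intro mult_mono) auto
      then show "norm (G \<omega> * (\<alpha> \<omega> $ i * \<beta> \<omega> $ j)) \<le> norm (C\<^sup>2 * G \<omega>)"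
        by (simp add: abs_mult power2_eq_square mult.commute[of "\<bar>G \<omega>\<bar>"] mult_right_mono)
    qed
  qed measurable
  have sk: "0 \<le> s" "s \<le> s + k n" for n using s by auto
  have int3: "integrable M (\<lambda>\<omega>. G \<omega> * (?ga n \<omega> * ?gb n \<omega>))"
    and e3: "expectation (\<lambda>\<omega>. G \<omega> * (?ga n \<omega> * ?gb n \<omega>)) = expectation (\<lambda>\<omega>. G \<omega> * (\<alpha> \<omega> \<bullet> \<beta> \<omega>))" for n
  proof -
    note m = expectation_increment_increment[OF sk \<alpha> \<beta> G(1) intG, of n]
    have eq: "G \<omega> * (?ga n \<omega> * ?gb n \<omega>) = (G \<omega> * ((\<alpha> \<omega> \<bullet> dW n \<omega>) * (\<beta> \<omega> \<bullet> dW n \<omega>))) / k n" for \<omega>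
      by simp
    show "integrable M (\<lambda>\<omega>. G \<omega> * (?ga n \<omega> * ?gb n \<omega>))"
      unfolding eq using m(1) by simp
    show "expectation (\<lambda>\<omega>. G \<omega> * (?ga n \<omega> * ?gb n \<omega>)) = expectation (\<lambda>\<omega>. G \<omega> * (\<alpha> \<omega> \<bullet> \<beta> \<omega>))"
      unfolding eq using m(2) k_pos[of n] by simp
  qed
  \<comment> \<open>With a', b' the Gaussian parts, ab = (a - a') b + (b - b') a' + a' b'. The
    second factor is the full \<open>?b\<close> in the first term and the Gaussian
    \<open>?ga\<close> in the second, hence the two bounds \<open>Kb\<close> and
    \<open>Ka\<close>.\<close>
  have split: "G \<omega> * (A n \<omega> * B n \<omega>) / k n = ?da n \<omega> * (G \<omega> * ?b n \<omega>) + ?db n \<omega> * (G \<omega> * ?ga n \<omega>)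
      + G \<omega> * (?ga n \<omega> * ?gb n \<omega>)" for n \<omega>
  proof -
    have ab: "A n \<omega> * B n \<omega> / k n = ?a n \<omega> * ?b n \<omega>" by simp
    have "?da n \<omega> = ?a n \<omega> - ?ga n \<omega>" "?db n \<omega> = ?b n \<omega> - ?gb n \<omega>" by (simp_all add: diff_divide_distrib)
    moreover have "G \<omega> * (A n \<omega> * B n \<omega>) / k n = G \<omega> * (?a n \<omega> * ?b n \<omega>)" using ab by (metis times_divide_eq_right)
    moreover have "g * (a * b) = (a - a') * (g * b) + (b - b') * (g * a') + g * (a' * b')" for g a b a' b' :: real
      by (simp add: algebra_simps)
    ultimately show ?thesis by (simp only:)
  qed
  have intd: "integrable M (\<lambda>\<omega>. G \<omega> * (A n \<omega> * B n \<omega>) / k n)" for n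
    unfolding split by (intro Bochner_Integration.integrable_add int1 int2 int3)
  from integrable_mult_left[OF this[of n], of "k n"] k_pos[of n]
  show "integrable M (\<lambda>\<omega>. G \<omega> * (A n \<omega> * B n \<omega>))" by simp
  have "expectation (\<lambda>\<omega>. G \<omega> * (A n \<omega> * B n \<omega>)) / k n = expectation (\<lambda>\<omega>. ?da n \<omega> * (G \<omega> * ?b n \<omega>))
      + expectation (\<lambda>\<omega>. ?db n \<omega> * (G \<omega> * ?ga n \<omega>)) + expectation (\<lambda>\<omega>. G \<omega> * (\<alpha> \<omega> \<bullet> \<beta> \<omega>))" for n
  proof -
    have "expectation (\<lambda>\<omega>. G \<omega> * (A n \<omega> * B n \<omega>)) / k n = expectation (\<lambda>\<omega>. G \<omega> * (A n \<omega> * B n \<omega>) / k n)" by simp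
    also have "\<dots> = expectation (\<lambda>\<omega>. ?da n \<omega> * (G \<omega> * ?b n \<omega>) + ?db n \<omega> * (G \<omega> * ?ga n \<omega>))
        + expectation (\<lambda>\<omega>. G \<omega> * (?ga n \<omega> * ?gb n \<omega>))"
      unfolding split by (intro Bochner_Integration.integral_add Bochner_Integration.integrable_add int1 int2 int3)
    also have "expectation (\<lambda>\<omega>. ?da n \<omega> * (G \<omega> * ?b n \<omega>) + ?db n \<omega> * (G \<omega> * ?ga n \<omega>))
        = expectation (\<lambda>\<omega>. ?da n \<omega> * (G \<omega> * ?b n \<omega>)) + expectation (\<lambda>\<omega>. ?db n \<omega> * (G \<omega> * ?ga n \<omega>))"
      by (intro Bochner_Integration.integral_add int1 int2)
    finally show ?thesis unfolding e3 .
  qed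
  moreover have "(\<lambda>n. expectation (\<lambda>\<omega>. ?da n \<omega> * (G \<omega> * ?b n \<omega>))
      + expectation (\<lambda>\<omega>. ?db n \<omega> * (G \<omega> * ?ga n \<omega>)) + expectation (\<lambda>\<omega>. G \<omega> * (\<alpha> \<omega> \<bullet> \<beta> \<omega>)))
    \<longlonglongrightarrow> 0 + 0 + expectation (\<lambda>\<omega>. G \<omega> * (\<alpha> \<omega> \<bullet> \<beta> \<omega>))"
    by (intro tendsto_add tendsto_const integral_mult_tendsto_0[OF ea(2) Gb(1) ea(3) Gb(2)]
        integral_mult_tendsto_0[OF eb(2) Ga(1) eb(3) Ga(2)])
  ultimately show "(\<lambda>n. expectation (\<lambda>\<omega>. G \<omega> * (A n \<omega> * B n \<omega>)) / k n) \<longlonglongrightarrow> expectation (\<lambda>\<omega>. G \<omega> * (\<alpha> \<omega> \<bullet> \<beta> \<omega>))"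
    by simp
qed

text \<open>A mean square error o(sqrt k) would be too coarse for an expectation divided by k. The
  stochastic integral drops out exactly, being orthogonal to the past, and the quotient
  \<open>D n \<omega> / k n\<close> converges by domination.\<close>

lemma drift_limit:
  assumes G: "G \<in> borel_measurable (F s)" "square_integrable M G"
    and J: "\<And>n. has_ito_integral M W s (s + k n) H (J n)"
    and Dm: "\<And>n. D n \<in> borel_measurable M" and D: "\<And>n \<omega>. \<omega> \<in> space M \<Longrightarrow> \<bar>D n \<omega>\<bar> \<le> C * k n"
    and d: "\<And>\<omega>. \<omega> \<in> space M \<Longrightarrow> (\<lambda>n. D n \<omega> / k n) \<longlonglongrightarrow> d \<omega>"
  shows "integrable M (\<lambda>\<omega>. G \<omega> * (c * J n \<omega> + D n \<omega>))"
    and "(\<lambda>n. expectation (\<lambda>\<omega>. G \<omega> * (c * J n \<omega> + D n \<omega>)) / k n) \<longlonglongrightarrow> expectation (\<lambda>\<omega>. G \<omega> * d \<omega>)"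
proof -
  note [measurable] = Dm square_integrable_measurable[OF G(2)]
  note lim = has_ito_integral_ito_limit[OF J s]
  have GJ: "integrable M (\<lambda>\<omega>. G \<omega> * J n \<omega>)" "expectation (\<lambda>\<omega>. G \<omega> * J n \<omega>) = 0" for n
    using integrable_inner[OF G(2) ito_limit_square_integrable[OF lim]]
      ito_limit_expectation_eq_0[OF lim s G] by auto
  have GD: "integrable M (\<lambda>\<omega>. G \<omega> * D n \<omega>)" for n
    using square_integrable_mult_bounded[OF G(2) Dm D] by (rule square_integrable_integrable)
  have eq: "G \<omega> * (c * J n \<omega> + D n \<omega>) = c * (G \<omega> * J n \<omega>) + G \<omega> * D n \<omega>" for n \<omega>
    by (simp add: algebra_simps)
  show "integrable M (\<lambda>\<omega>. G \<omega> * (c * J n \<omega> + D n \<omega>))"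
    unfolding eq using GJ GD by simp
  have E: "expectation (\<lambda>\<omega>. G \<omega> * (c * J n \<omega> + D n \<omega>)) / k n = expectation (\<lambda>\<omega>. G \<omega> * (D n \<omega> / k n))" for n
    unfolding eq using GJ[of n] GD[of n] by simp
  have "(\<lambda>n. expectation (\<lambda>\<omega>. G \<omega> * (D n \<omega> / k n))) \<longlonglongrightarrow> expectation (\<lambda>\<omega>. G \<omega> * d \<omega>)"
  proof (rule integral_dominated_convergence[where w="\<lambda>\<omega>. \<bar>G \<omega>\<bar> * C"])
    have "d \<in> borel_measurable M"
      by (rule borel_measurable_LIMSEQ_real[OF d]) auto
    then show "(\<lambda>\<omega>. G \<omega> * d \<omega>) \<in> borel_measurable M" by simp
    show "(\<lambda>\<omega>. G \<omega> * (D n \<omega> / k n)) \<in> borel_measurable M" for n by measurable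
    show "integrable M (\<lambda>\<omega>. \<bar>G \<omega>\<bar> * C)"
      using square_integrable_integrable[OF G(2)] by simp
    show "AE \<omega> in M. (\<lambda>n. G \<omega> * (D n \<omega> / k n)) \<longlonglongrightarrow> G \<omega> * d \<omega>"
      by (intro AE_I2 tendsto_intros d)
    show "AE \<omega> in M. norm (G \<omega> * (D n \<omega> / k n)) \<le> \<bar>G \<omega>\<bar> * C" for n
    proof (rule AE_I2)
      fix \<omega> assume "\<omega> \<in> space M"
      then have "\<bar>D n \<omega>\<bar> / k n \<le> C" using D[of \<omega> n] k_pos[of n] by (simp add: divide_le_eq)
      then have "\<bar>G \<omega>\<bar> * (\<bar>D n \<omega>\<bar> / k n) \<le> \<bar>G \<omega>\<bar> * C" by (intro mult_left_mono) auto
      then show "norm (G \<omega> * (D n \<omega> / k n)) \<le> \<bar>G \<omega>\<bar> * C" by (simp add: abs_mult)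
    qed
  qed
  then show "(\<lambda>n. expectation (\<lambda>\<omega>. G \<omega> * (c * J n \<omega> + D n \<omega>)) / k n) \<longlonglongrightarrow> expectation (\<lambda>\<omega>. G \<omega> * d \<omega>)"
    unfolding E .
qed

text \<open>The weight \<open>V n\<close> varies with \<open>n\<close>, so it cannot serve as a
  dominating function. Instead \<open>Z n\<close> is factored as (Z n / V n) V n: the quotient times
  \<open>G\<close> tends to 0 in L2 by domination, and \<open>V n\<close> is bounded in L2.\<close>

lemma remainder_tendsto_0:
  fixes G :: "'a \<Rightarrow> real" and Z V :: "nat \<Rightarrow> 'a \<Rightarrow> real"
  assumes G: "square_integrable M G"
    and [measurable]: "\<And>n. Z n \<in> borel_measurable M"
    and V: "\<And>n. square_integrable M (V n)" "\<And>n. expectation (\<lambda>\<omega>. (V n \<omega>)\<^sup>2) \<le> K" "\<And>n \<omega>. 0 < V n \<omega>"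
    and B: "\<And>n \<omega>. \<omega> \<in> space M \<Longrightarrow> \<bar>Z n \<omega>\<bar> \<le> B * V n \<omega>"
    and lim: "\<And>\<omega>. \<omega> \<in> space M \<Longrightarrow> (\<lambda>n. Z n \<omega> / V n \<omega>) \<longlonglongrightarrow> 0"
  shows "integrable M (\<lambda>\<omega>. G \<omega> * Z n \<omega>)"
    and "(\<lambda>n. expectation (\<lambda>\<omega>. G \<omega> * Z n \<omega>)) \<longlonglongrightarrow> 0"
proof -
  note [measurable] = square_integrable_measurable[OF V(1)] square_integrable_measurable[OF G]
  have b: "\<bar>Z n \<omega> / V n \<omega>\<bar> \<le> B" if "\<omega> \<in> space M" for n \<omega>
  proof -
    have "\<bar>Z n \<omega> / V n \<omega>\<bar> = \<bar>Z n \<omega>\<bar> / V n \<omega>" using V(3)[of n \<omega>] by (simp add: abs_divide)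
    then show ?thesis using B[OF that, of n] V(3)[of n \<omega>] by (simp only: pos_divide_le_eq)
  qed
  have GZ: "square_integrable M (\<lambda>\<omega>. G \<omega> * (Z n \<omega> / V n \<omega>))" for n
    by (rule square_integrable_mult_bounded[OF G _ b]) auto
  have eq: "G \<omega> * Z n \<omega> = (G \<omega> * (Z n \<omega> / V n \<omega>)) * V n \<omega>" for n \<omega>
    using V(3)[of n \<omega>] by simp
  show "integrable M (\<lambda>\<omega>. G \<omega> * Z n \<omega>)"
    unfolding eq using integrable_inner[OF GZ[of n] V(1)[of n]] by simp
  show "(\<lambda>n. expectation (\<lambda>\<omega>. G \<omega> * Z n \<omega>)) \<longlonglongrightarrow> 0"
    unfolding eq
    by (intro integral_mult_tendsto_0[OF GZ V(1) _ V(2)] integral_square_tendsto_0[OF G _ b lim]) auto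
qed

end


section \<open>Second order expansion\<close>

lemma exp_expansion_error:
  fixes r :: real
  shows "\<bar>exp r - 1 - r\<bar> \<le> r\<^sup>2 * exp \<bar>r\<bar>" and "\<bar>exp r - 1 - r - r\<^sup>2 / 2\<bar> \<le> \<bar>r\<bar>^3 * exp \<bar>r\<bar>"
proof -
  obtain t where t: "\<bar>t\<bar> \<le> \<bar>r\<bar>" "exp r = (\<Sum>m<2. r^m / fact m) + exp t / fact 2 * r^2"
    using Maclaurin_exp_le by blast
  have "\<bar>exp r - 1 - r\<bar> = exp t / 2 * r\<^sup>2" unfolding t(2) by (simp add: numeral_2_eq_2)
  also have "\<dots> \<le> exp \<bar>r\<bar> * r\<^sup>2" using t(1) exp_le_cancel_iff[of t "\<bar>r\<bar>"] exp_gt_zero[of "\<bar>r\<bar>"]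
    by (intro mult_right_mono) (linarith | simp)+
  finally show "\<bar>exp r - 1 - r\<bar> \<le> r\<^sup>2 * exp \<bar>r\<bar>" by (simp add: mult.commute)
  obtain t where t: "\<bar>t\<bar> \<le> \<bar>r\<bar>" "exp r = (\<Sum>m<3. r^m / fact m) + exp t / fact 3 * r^3"
    using Maclaurin_exp_le by blast
  have "\<bar>exp r - 1 - r - r\<^sup>2 / 2\<bar> = exp t / fact 3 * \<bar>r\<bar>^3"
    unfolding t(2) by (simp add: numeral_3_eq_3 power2_eq_square abs_mult power_abs)
  also have "\<dots> \<le> exp \<bar>r\<bar> * \<bar>r\<bar>^3"
  proof (rule mult_right_mono)
    have "exp t \<le> exp \<bar>r\<bar>" "fact 3 = (6 :: real)" using t(1) by (auto simp: fact_numeral)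
    then show "exp t / fact 3 \<le> exp \<bar>r\<bar>" using exp_gt_zero[of "\<bar>r\<bar>"] by (simp, linarith)
  qed simp
  finally show "\<bar>exp r - 1 - r - r\<^sup>2 / 2\<bar> \<le> \<bar>r\<bar>^3 * exp \<bar>r\<bar>" by (simp add: mult.commute)
qed

text \<open>The number of coordinates enters because the norm of \<open>A *v d\<close> is bounded by
  the sum of its entries, each of which is at most norm A times norm d.\<close>

lemma quadratic_form_le:
  fixes A :: "real^'d^'d" and d :: "real^'d"
  shows "\<bar>d \<bullet> (A *v d)\<bar> \<le> real CARD('d) * norm A * (norm d)\<^sup>2"
proof -
  have "norm (A *v d) \<le> (\<Sum>i\<in>UNIV. \<bar>(A *v d) $ i\<bar>)" by (rule norm_le_l1_cart)
  also have "\<dots> \<le> (\<Sum>i\<in>(UNIV :: 'd set). norm A * norm d)"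
  proof (rule sum_mono)
    fix i
    have "\<bar>(A *v d) $ i\<bar> \<le> norm (A $ i) * norm d"
      unfolding matrix_vector_mul_component by (rule Cauchy_Schwarz_ineq2)
    also have "\<dots> \<le> norm A * norm d" by (intro mult_right_mono Finite_Cartesian_Product.norm_nth_le) auto
    finally show "\<bar>(A *v d) $ i\<bar> \<le> norm A * norm d" .
  qed
  finally have "norm (A *v d) \<le> real CARD('d) * norm A * norm d" by simp
  then have "norm d * norm (A *v d) \<le> norm d * (real CARD('d) * norm A * norm d)"
    by (intro mult_left_mono) auto
  with Cauchy_Schwarz_ineq2[of d "A *v d"] show ?thesis
    by (simp add: power2_eq_square algebra_simps)
qed

lemma gradient_has_derivative:
  fixes f :: "real^'d \<Rightarrow> real"
  assumes "f differentiable at x"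
  shows "(f has_derivative (\<lambda>v. gradient f x \<bullet> v)) (at x)"
proof -
  let ?f' = "frechet_derivative f (at x)"
  have d: "(f has_derivative ?f') (at x)" using assms by (simp add: frechet_derivative_works)
  then interpret linear ?f' by (rule has_derivative_linear)
  have "?f' = (\<lambda>v. gradient f x \<bullet> v)"
  proof (rule ext)
    fix v
    have "?f' v = ?f' (\<Sum>i\<in>UNIV. v $ i *\<^sub>R axis i 1)"
      using basis_expansion[of v] by (simp add: scalar_mult_eq_scaleR)
    also have "\<dots> = (\<Sum>i\<in>UNIV. v $ i * ?f' (axis i 1))" by (simp add: sum scaleR)
    also have "\<dots> = gradient f x \<bullet> v" by (simp add: gradient_def inner_vec_def mult.commute)
    finally show "?f' v = gradient f x \<bullet> v" .
  qed
  with d show ?thesis by simp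
qed

lemma hessian_has_derivative:
  fixes f :: "real^'d \<Rightarrow> real"
  assumes "gradient f differentiable at x"
  shows "(gradient f has_derivative (\<lambda>v. hessian f x *v v)) (at x)"
  using assms unfolding hessian_def by (simp add: jacobian_works)

text \<open>The restriction of \<open>f\<close> to the segment from x to x + d is a function of one
  real variable; the Lagrange form of its second order remainder gives the intermediate
  \<open>\<theta>\<close>.\<close>

lemma Taylor_space:
  fixes f :: "real^'d \<Rightarrow> real"
  assumes f: "\<And>x. f differentiable at x" and g: "\<And>x. gradient f differentiable at x"
  shows "\<exists>\<theta>\<in>{0..1}. f (x + d) - f x = gradient f x \<bullet> d + (d \<bullet> (hessian f (x + \<theta> *\<^sub>R d) *v d)) / 2"
proof -
  define diff where "diff m \<theta> = (if m = 0 then f (x + \<theta> *\<^sub>R d)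
    else if m = 1 then gradient f (x + \<theta> *\<^sub>R d) \<bullet> d
    else d \<bullet> (hessian f (x + \<theta> *\<^sub>R d) *v d))" for m :: nat and \<theta> :: real
  have line: "((\<lambda>\<theta>. x + \<theta> *\<^sub>R d) has_derivative (\<lambda>h. h *\<^sub>R d)) (at \<theta>)" for \<theta>
    by (auto intro!: derivative_eq_intros)
  have diff: "diff 0 = (\<lambda>\<theta>. f (x + \<theta> *\<^sub>R d))" "diff 1 = (\<lambda>\<theta>. gradient f (x + \<theta> *\<^sub>R d) \<bullet> d)"
      "diff 2 = (\<lambda>\<theta>. d \<bullet> (hessian f (x + \<theta> *\<^sub>R d) *v d))"
    by (simp_all add: diff_def fun_eq_iff)
  have "DERIV (diff 0) \<theta> :> diff 1 \<theta>" for \<theta>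
  proof -
    have "((\<lambda>\<theta>. f (x + \<theta> *\<^sub>R d)) has_derivative (\<lambda>h. gradient f (x + \<theta> *\<^sub>R d) \<bullet> (h *\<^sub>R d))) (at \<theta>)"
      by (rule has_derivative_compose[OF line gradient_has_derivative[OF f]])
    moreover have "(\<lambda>h. gradient f (x + \<theta> *\<^sub>R d) \<bullet> (h *\<^sub>R d)) = (*) (gradient f (x + \<theta> *\<^sub>R d) \<bullet> d)"
      by (simp add: fun_eq_iff mult.commute)
    ultimately show ?thesis by (simp only: diff has_field_derivative_def)
  qed
  moreover have "DERIV (diff 1) \<theta> :> diff 2 \<theta>" for \<theta>
  proof -
    have "((\<lambda>\<theta>. gradient f (x + \<theta> *\<^sub>R d) \<bullet> d) has_derivative (\<lambda>h. (hessian f (x + \<theta> *\<^sub>R d) *v (h *\<^sub>R d)) \<bullet> d)) (at \<theta>)"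
      by (intro has_derivative_inner_left has_derivative_compose[OF line hessian_has_derivative[OF g]])
    moreover have "(\<lambda>h. (hessian f (x + \<theta> *\<^sub>R d) *v (h *\<^sub>R d)) \<bullet> d) = (*) (d \<bullet> (hessian f (x + \<theta> *\<^sub>R d) *v d))"
      by (simp add: fun_eq_iff matrix_vector_mult_scaleR inner_commute mult.commute)
    ultimately show ?thesis by (simp only: diff has_field_derivative_def)
  qed
  ultimately have D: "DERIV (diff 0) \<theta> :> diff 1 \<theta>" "DERIV (diff 1) \<theta> :> diff 2 \<theta>" for \<theta>
    by blast+
  have "\<forall>m t. m < 2 \<and> 0 \<le> t \<and> t \<le> 1 \<longrightarrow> DERIV (diff m) t :> diff (Suc m) t"
    using D by (metis One_nat_def Suc_1 less_2_cases_iff)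
  from Maclaurin2[OF zero_less_one refl this]
  obtain t where t: "0 < t" "t \<le> 1" "diff 0 1 = (\<Sum>m<2. diff m 0 / fact m * 1^m) + diff 2 t / fact 2 * 1^2"
    by blast
  then show ?thesis
    by (intro bexI[of _ t]) (auto simp: diff_def numeral_2_eq_2)
qed

lemma time_mvt:
  assumes "C12 T \<Phi>" "0 \<le> s" "s < s'" "s' \<le> T"
  shows "\<exists>\<theta>\<in>{s..s'}. \<Phi> s' y - \<Phi> s y = (s' - s) * time_deriv T \<Phi> \<theta> y"
proof -
  have "((\<lambda>s. \<Phi> s y) has_derivative (\<lambda>h. h * time_deriv T \<Phi> \<theta> y)) (at \<theta> within {s..s'})" if "s \<le> \<theta>" "\<theta> \<le> s'" for \<theta>
  proof -
    have "(\<lambda>s. \<Phi> s y) differentiable (at \<theta> within {0..T})"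
      using assms that by (auto simp: C12_def)
    then have "((\<lambda>s. \<Phi> s y) has_vector_derivative time_deriv T \<Phi> \<theta> y) (at \<theta> within {0..T})"
      unfolding time_deriv_def by (simp add: vector_derivative_works)
    then have "((\<lambda>s. \<Phi> s y) has_vector_derivative time_deriv T \<Phi> \<theta> y) (at \<theta> within {s..s'})"
      by (rule has_vector_derivative_within_subset) (use assms in auto)
    then show ?thesis by (simp add: has_vector_derivative_def)
  qed
  from mvt_simple[OF assms(3) this]
  show ?thesis by (auto intro: less_imp_le)
qed

text \<open>The exponential weight absorbs all powers of the normalised increments \<open>\<bar>r\<bar> / sqrt h\<close> and
  \<open>\<bar>d\<^sub>i\<bar> / sqrt h\<close>.\<close>

lemma weighted_expansion_error:
  fixes \<Phi> :: "real \<Rightarrow> real^'d \<Rightarrow> real"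
  defines "N \<equiv> real CARD('d)"
  assumes C12: "C12 T \<Phi>" and s: "0 \<le> \<delta>" "\<delta> \<le> s" and h: "0 < h" "h \<le> 1" "s + h \<le> T"
    and B: "\<And>\<tau> y. \<tau> \<in> {\<delta>..T} \<Longrightarrow> \<bar>\<Phi> \<tau> y\<bar> \<le> B" "\<And>\<tau> y. \<tau> \<in> {\<delta>..T} \<Longrightarrow> \<bar>time_deriv T \<Phi> \<tau> y\<bar> \<le> B"
      "\<And>\<tau> y. \<tau> \<in> {\<delta>..T} \<Longrightarrow> norm (gradient (\<Phi> \<tau>) y) \<le> B" "\<And>\<tau> y. \<tau> \<in> {\<delta>..T} \<Longrightarrow> norm (hessian (\<Phi> \<tau>) y) \<le> B"
  shows "\<exists>\<theta>\<in>{s..s + h}. \<exists>\<theta>'\<in>{0..1}.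
    \<bar>exp r * \<Phi> (s + h) (x + d) - \<Phi> s x
      - (\<Phi> s x * r + \<Phi> s x * r\<^sup>2 / 2 + h * time_deriv T \<Phi> s x + gradient (\<Phi> s) x \<bullet> d
         + (d \<bullet> (hessian (\<Phi> s) x *v d)) / 2 + r * (gradient (\<Phi> s) x \<bullet> d))\<bar>
    \<le> h * exp (2 * (\<bar>r\<bar> / sqrt h) + 2 * (\<Sum>i\<in>UNIV. \<bar>d $ i\<bar> / sqrt h)) *
       (14 * N * B * sqrt h + \<bar>time_deriv T \<Phi> \<theta> (x + d) - time_deriv T \<Phi> s x\<bar>
        + N * norm (hessian (\<Phi> s) (x + \<theta>' *\<^sub>R d) - hessian (\<Phi> s) x))"
proof -
  define g t D H where "g = \<Phi> s x" and "t = time_deriv T \<Phi> s x" and "D = gradient (\<Phi> s) x" and "H = hessian (\<Phi> s) x"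
  have sT: "s \<in> {\<delta>..T}" "0 \<le> s" using s h by auto
  have B0: "0 \<le> B" using B(1)[OF sT(1), of x] by linarith
  have N1: "1 \<le> N" unfolding N_def by (simp add: Suc_leI)
  obtain \<theta> where \<theta>: "\<theta> \<in> {s..s + h}" "\<Phi> (s + h) (x + d) - \<Phi> s (x + d) = h * time_deriv T \<Phi> \<theta> (x + d)"
    using time_mvt[OF C12, of s "s + h" "x + d"] sT(2) h by auto
  have diff: "\<Phi> s differentiable at y" "gradient (\<Phi> s) differentiable at y" for y
    using C12 sT(2) h by (auto simp: C12_def)
  obtain \<theta>' where \<theta>': "\<theta>' \<in> {0..1}"
    "\<Phi> s (x + d) - \<Phi> s x = D \<bullet> d + (d \<bullet> (hessian (\<Phi> s) (x + \<theta>' *\<^sub>R d) *v d)) / 2"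
    using Taylor_space[OF diff, of x d] unfolding D_def by blast
  define e1 E2 where "e1 = time_deriv T \<Phi> \<theta> (x + d) - t" and "E2 = hessian (\<Phi> s) (x + \<theta>' *\<^sub>R d) - H"
  \<comment> \<open>\<open>P\<close> is the whole increment of \<Phi> in time and space.
    \<open>e1\<close> and \<open>E2\<close> measure how far the derivatives at the intermediate
    points are from those at the base point; they are the only error terms without an extra factor
    sqrt h.\<close>
  define P where "P = \<Phi> (s + h) (x + d) - g"
  define q where "q = sqrt h"
  have q: "0 < q" "q \<le> 1" "q\<^sup>2 = h" using h by (auto simp: q_def)
  define \<rho> \<eta> where "\<rho> = \<bar>r\<bar> / q" and "\<eta> = (\<Sum>i\<in>UNIV. \<bar>d $ i\<bar> / q)"
  have \<rho>\<eta>: "0 \<le> \<rho>" "0 \<le> \<eta>" using q by (auto simp: \<rho>_def \<eta>_def intro: sum_nonneg)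
  have r: "\<bar>r\<bar> = q * \<rho>" using q by (simp add: \<rho>_def)
  have d: "norm d \<le> q * \<eta>" using norm_le_l1_cart[of d] q by (simp add: \<eta>_def sum_divide_distrib[symmetric])
  have d2: "(norm d)\<^sup>2 \<le> h * \<eta>\<^sup>2" using power_mono[OF d, of 2] q by (simp add: power_mult_distrib)
  have hq: "h \<le> q" using q by (metis mult_left_le power2_eq_square less_imp_le)
  have e\<eta>: "1 + \<eta> + \<eta>\<^sup>2 / 2 \<le> exp \<eta>" using exp_lower_Taylor_quadratic[OF \<rho>\<eta>(2)] .
  have e\<rho>: "\<rho> \<le> exp \<rho>" "\<rho>\<^sup>2 \<le> 2 * exp \<rho>" "\<rho>^3 \<le> 6 * exp \<rho>"
    using power_le_fact_exp[OF \<rho>\<eta>(1), of 1] power_le_fact_exp[OF \<rho>\<eta>(1), of 2] power_le_fact_exp[OF \<rho>\<eta>(1), of 3]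
    by (auto simp: fact_numeral)
  have er: "exp \<bar>r\<bar> \<le> exp \<rho>" unfolding r using q \<rho>\<eta> by (simp add: mult_left_le_one_le)
  have P: "P = h * (t + e1) + D \<bullet> d + (d \<bullet> (H *v d)) / 2 + (d \<bullet> (E2 *v d)) / 2"
    using \<theta>(2) \<theta>'(2) unfolding P_def e1_def E2_def g_def
    by (simp add: matrix_vector_mult_diff_rdistrib inner_diff_right diff_divide_distrib distrib_left right_diff_distrib)
  \<comment> \<open>Without its linear part in d, the increment of \<Phi> is of order h. Here the
    derivatives at the intermediate points are simply bounded by \<open>B\<close>.\<close>
  have Q: "\<bar>P - D \<bullet> d\<bar> \<le> h * (2 * N * B * exp \<eta>)"
  proof -
    have "P - D \<bullet> d = h * time_deriv T \<Phi> \<theta> (x + d) + (d \<bullet> (hessian (\<Phi> s) (x + \<theta>' *\<^sub>R d) *v d)) / 2"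
      using \<theta>(2) \<theta>'(2) unfolding P_def g_def by simp
    then have "\<bar>P - D \<bullet> d\<bar> \<le> h * \<bar>time_deriv T \<Phi> \<theta> (x + d)\<bar> + \<bar>d \<bullet> (hessian (\<Phi> s) (x + \<theta>' *\<^sub>R d) *v d)\<bar> / 2"
      using h by (simp add: abs_mult order_trans[OF abs_triangle_ineq])
    also have "\<dots> \<le> h * B + (N * B * (h * \<eta>\<^sup>2)) / 2"
    proof (intro add_mono mult_left_mono divide_right_mono)
      show "\<bar>time_deriv T \<Phi> \<theta> (x + d)\<bar> \<le> B" using \<theta>(1) s h by (intro B) auto
      have "\<bar>d \<bullet> (hessian (\<Phi> s) (x + \<theta>' *\<^sub>R d) *v d)\<bar> \<le> N * norm (hessian (\<Phi> s) (x + \<theta>' *\<^sub>R d)) * (norm d)\<^sup>2"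
        unfolding N_def by (rule quadratic_form_le)
      also have "\<dots> \<le> N * B * (h * \<eta>\<^sup>2)"
        using B0 N1 by (intro mult_mono B sT d2) auto
      finally show "\<bar>d \<bullet> (hessian (\<Phi> s) (x + \<theta>' *\<^sub>R d) *v d)\<bar> \<le> N * B * (h * \<eta>\<^sup>2)" .
    qed (use h in auto)
    also have "\<dots> = h * (B * 1 + B * N * (\<eta>\<^sup>2 / 2))" by (simp add: algebra_simps)
    also have "\<dots> \<le> h * (B * N * exp \<eta> + B * N * exp \<eta>)"
    proof (intro mult_left_mono add_mono)
      have "1 * 1 \<le> N * exp \<eta>" using N1 \<rho>\<eta> by (intro mult_mono) auto
      then show "B * 1 \<le> B * N * exp \<eta>" using B0 mult_left_mono[of 1 "N * exp \<eta>" B] by (simp add: mult.assoc)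
      show "\<eta>\<^sup>2 / 2 \<le> exp \<eta>" using e\<eta> \<rho>\<eta> by linarith
    qed (use h B0 N1 in auto)
    finally show ?thesis by (simp add: algebra_simps)
  qed
  \<comment> \<open>The linear part lowers the order to sqrt h; the constant is 3 = 2 + 1, from
    \<open>Q\<close> and from \<open>D \<bullet> d\<close>.\<close>
  have P_le: "\<bar>P\<bar> \<le> q * (3 * N * B * exp \<eta>)"
  proof -
    have "\<bar>D \<bullet> d\<bar> \<le> B * (q * \<eta>)"
      unfolding D_def by (intro order_trans[OF Cauchy_Schwarz_ineq2] mult_mono B sT d) (use B0 in auto)
    also have "\<dots> \<le> q * (N * B * exp \<eta>)"
    proof -
      have "\<eta> \<le> exp \<eta>" using e\<eta> zero_le_power2[of \<eta>] by linarith
      then have "1 * \<eta> \<le> N * exp \<eta>" using N1 \<rho>\<eta> by (intro mult_mono) auto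
      then have "(q * B) * (1 * \<eta>) \<le> (q * B) * (N * exp \<eta>)" using q B0 by (intro mult_left_mono) auto
      then show ?thesis by (simp only: mult_1 ac_simps)
    qed
    finally have "\<bar>D \<bullet> d\<bar> \<le> q * (N * B * exp \<eta>)" .
    moreover have "h * (2 * N * B * exp \<eta>) \<le> q * (2 * N * B * exp \<eta>)"
      using hq B0 N1 by (intro mult_right_mono) auto
    ultimately show ?thesis using Q by (simp add: algebra_simps)
  qed
  let ?V = "exp (2 * \<rho> + 2 * \<eta>)"
  \<comment> \<open>All products of exponentials met in the four estimates below are absorbed by
    this one weight, which explains the factors 2 in its exponent.\<close>
  have V: "exp \<rho> * exp \<rho> * exp \<eta> \<le> ?V" "exp \<rho> * exp \<rho> \<le> ?V" "exp \<rho> * exp \<eta> \<le> ?V" "exp \<eta> \<le> ?V" "1 \<le> ?V"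
    using \<rho>\<eta> by (auto simp: exp_add[symmetric])
  have qh: "q * h = h * q" "q\<^sup>2 = h" "q ^ 3 = h * q" using q by (auto simp: power2_eq_square power3_eq_cube)
  \<comment> \<open>The constant 6 is 3!, from the bound of the cube of \<rho> by 6 exp \<rho>. In
    \<open>T2\<close>, 6 is the product of 2! and the 3 of \<open>P_le\<close>; in
    \<open>T3\<close>, 2 comes from \<open>Q\<close>.\<close>
  have T1: "\<bar>g * (exp r - 1 - r - r\<^sup>2 / 2)\<bar> \<le> h * ?V * (6 * N * B * q)"
  proof -
    have "\<bar>g * (exp r - 1 - r - r\<^sup>2 / 2)\<bar> \<le> B * (\<bar>r\<bar>^3 * exp \<bar>r\<bar>)"
      unfolding abs_mult g_def by (intro mult_mono B sT exp_expansion_error) (use B0 in auto)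
    also have "\<dots> \<le> B * ((h * q * (6 * exp \<rho>)) * exp \<rho>)"
    proof (intro mult_left_mono mult_mono er B0)
      show "\<bar>r\<bar>^3 \<le> h * q * (6 * exp \<rho>)"
        unfolding r power_mult_distrib qh using e\<rho>(3) h q by (intro mult_left_mono) auto
    qed (use h q in auto)
    also have "\<dots> = (h * (6 * B * q)) * (exp \<rho> * exp \<rho>)" by (simp add: algebra_simps)
    also have "\<dots> \<le> (h * (6 * N * B * q)) * ?V"
    proof (rule mult_mono)
      show "exp \<rho> * exp \<rho> \<le> ?V" by (rule V)
      show "h * (6 * B * q) \<le> h * (6 * N * B * q)"
      proof -
        have "1 * (h * (6 * B * q)) \<le> N * (h * (6 * B * q))" using h q B0 by (intro mult_right_mono N1) auto
        then show ?thesis by (simp only: mult_1 ac_simps)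
      qed
    qed (use h q B0 N1 in auto)
    finally show ?thesis by (simp add: algebra_simps)
  qed
  have T2: "\<bar>(exp r - 1 - r) * P\<bar> \<le> h * ?V * (6 * N * B * q)"
  proof -
    have "\<bar>(exp r - 1 - r) * P\<bar> \<le> (r\<^sup>2 * exp \<bar>r\<bar>) * (q * (3 * N * B * exp \<eta>))"
      unfolding abs_mult by (intro mult_mono exp_expansion_error P_le) auto
    also have "\<dots> \<le> ((h * (2 * exp \<rho>)) * exp \<rho>) * (q * (3 * N * B * exp \<eta>))"
    proof (intro mult_right_mono mult_mono er)
      have "r\<^sup>2 = h * \<rho>\<^sup>2" using r q(3) by (metis power2_abs power_mult_distrib)
      then show "r\<^sup>2 \<le> h * (2 * exp \<rho>)" using e\<rho>(2) h by simp
    qed (use h q B0 N1 in auto)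
    also have "\<dots> = (h * (6 * N * B * q)) * (exp \<rho> * exp \<rho> * exp \<eta>)" by (simp add: algebra_simps)
    also have "\<dots> \<le> (h * (6 * N * B * q)) * ?V"
      using h q B0 N1 by (intro mult_left_mono V) auto
    finally show ?thesis by (simp add: algebra_simps)
  qed
  have T3: "\<bar>r * (P - D \<bullet> d)\<bar> \<le> h * ?V * (2 * N * B * q)"
  proof -
    have "\<bar>r * (P - D \<bullet> d)\<bar> \<le> (q * exp \<rho>) * (h * (2 * N * B * exp \<eta>))"
      unfolding abs_mult r using q e\<rho>(1) \<rho>\<eta>(1) by (intro mult_mono Q) auto
    also have "\<dots> = (h * (2 * N * B * q)) * (exp \<rho> * exp \<eta>)" by (simp add: algebra_simps)
    also have "\<dots> \<le> (h * (2 * N * B * q)) * ?V"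
      using h q B0 N1 by (intro mult_left_mono V) auto
    finally show ?thesis by (simp add: algebra_simps)
  qed
  have T4: "\<bar>h * e1 + (d \<bullet> (E2 *v d)) / 2\<bar> \<le> h * ?V * (\<bar>e1\<bar> + N * norm E2)"
  proof -
    have "\<bar>h * e1 + (d \<bullet> (E2 *v d)) / 2\<bar> \<le> h * \<bar>e1\<bar> + \<bar>d \<bullet> (E2 *v d)\<bar> / 2"
      using h by (simp add: abs_mult order_trans[OF abs_triangle_ineq])
    also have "\<dots> \<le> h * \<bar>e1\<bar> + (N * norm E2 * (h * \<eta>\<^sup>2)) / 2"
    proof -
      have "\<bar>d \<bullet> (E2 *v d)\<bar> \<le> N * norm E2 * (norm d)\<^sup>2" unfolding N_def by (rule quadratic_form_le)
      also have "\<dots> \<le> N * norm E2 * (h * \<eta>\<^sup>2)" using N1 by (intro mult_left_mono d2) auto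
      finally show ?thesis by simp
    qed
    also have "\<dots> = h * (\<bar>e1\<bar> * 1 + N * norm E2 * (\<eta>\<^sup>2 / 2))" by (simp add: algebra_simps)
    also have "\<dots> \<le> h * (\<bar>e1\<bar> * ?V + N * norm E2 * ?V)"
    proof (intro mult_left_mono add_mono V)
      show "\<eta>\<^sup>2 / 2 \<le> ?V" using e\<eta> \<rho>\<eta> V(4) by linarith
    qed (use h N1 in auto)
    finally show ?thesis by (simp add: algebra_simps)
  qed
  \<comment> \<open>Multiplying out, exp r \<Phi>(new) - g = (exp r - 1) g + P + (exp r - 1) P. In
    each product the Taylor polynomial of exp r - 1 of the needed degree is split off, and of r P
    only the part r (D \<bullet> d) is kept in the expansion.\<close>
  have eq: "exp r * \<Phi> (s + h) (x + d) - g
      - (g * r + g * r\<^sup>2 / 2 + h * t + D \<bullet> d + (d \<bullet> (H *v d)) / 2 + r * (D \<bullet> d))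
    = g * (exp r - 1 - r - r\<^sup>2 / 2) + (exp r - 1 - r) * P + r * (P - D \<bullet> d) + (h * e1 + (d \<bullet> (E2 *v d)) / 2)"
  proof -
    have "exp r * \<Phi> (s + h) (x + d) - g = (exp r - 1) * g + P + (exp r - 1) * P"
      by (simp add: P_def algebra_simps)
    moreover have "P - (h * t + D \<bullet> d + (d \<bullet> (H *v d)) / 2) = h * e1 + (d \<bullet> (E2 *v d)) / 2"
      unfolding P by (simp add: algebra_simps)
    moreover have "a - (g * r + g * r\<^sup>2 / 2 + c + D' + H' + r * D') =
        g * (e - 1 - r - r\<^sup>2 / 2) + (e - 1 - r) * P + r * (P - D') + E"
      if "a = (e - 1) * g + P + (e - 1) * P" "P - (c + D' + H') = E" for a e c D' H' E :: real
      using that by (simp add: field_simps)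
    ultimately show ?thesis by blast
  qed
  have abs4: "\<bar>a + b + c + e\<bar> \<le> \<bar>a\<bar> + \<bar>b\<bar> + \<bar>c\<bar> + \<bar>e\<bar>" for a b c e :: real
    by linarith
  have "\<bar>exp r * \<Phi> (s + h) (x + d) - g
      - (g * r + g * r\<^sup>2 / 2 + h * t + D \<bullet> d + (d \<bullet> (H *v d)) / 2 + r * (D \<bullet> d))\<bar>
    \<le> h * ?V * (6 * N * B * q) + h * ?V * (6 * N * B * q) + h * ?V * (2 * N * B * q) + h * ?V * (\<bar>e1\<bar> + N * norm E2)"
    unfolding eq by (rule order_trans[OF abs4]) (intro add_mono T1 T2 T3 T4)
  \<comment> \<open>This is the constant 14 = 6 + 6 + 2 of the statement.\<close>
  also have "\<dots> = h * ?V * (14 * N * B * q + \<bar>e1\<bar> + N * norm E2)" by (simp add: algebra_simps)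
  finally have main: "\<bar>exp r * \<Phi> (s + h) (x + d) - g
      - (g * r + g * r\<^sup>2 / 2 + h * t + D \<bullet> d + (d \<bullet> (H *v d)) / 2 + r * (D \<bullet> d))\<bar>
    \<le> h * ?V * (14 * N * B * q + \<bar>e1\<bar> + N * norm E2)" .
  show ?thesis
    by (rule bexI[OF _ \<theta>(1)], rule bexI[OF _ \<theta>'(1)],
      rule main[unfolded g_def t_def D_def H_def e1_def E2_def q_def \<rho>_def \<eta>_def])
qed


section \<open>Time integrals of continuous processes\<close>

lemma time_integral_measurable:
  fixes q :: "real \<Rightarrow> 'a \<Rightarrow> 'b::euclidean_space"
  assumes "a \<le> b" "\<And>r. r \<in> {a..b} \<Longrightarrow> q r \<in> borel_measurable N"
    and "\<And>\<omega>. \<omega> \<in> space N \<Longrightarrow> continuous_on {a..b} (\<lambda>r. q r \<omega>)"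
  shows "(\<lambda>\<omega>. LBINT r:{a..b}. q r \<omega>) \<in> borel_measurable N"
  unfolding set_lebesgue_integral_def
  using continuous_process_jointly_measurable[OF assms] by (rule lborel.borel_measurable_lebesgue_integral)

lemma LBINT_eq_integral:
  fixes f :: "real \<Rightarrow> 'b::euclidean_space"
  assumes "continuous_on {a..b} f"
  shows "(LBINT r:{a..b}. f r) = integral {a..b} f"
  by (rule set_borel_integral_eq_integral) (rule borel_integrable_atLeastAtMost'[OF assms])

lemma norm_LBINT_le:
  fixes f :: "real \<Rightarrow> 'b::euclidean_space"
  assumes "a \<le> b" "continuous_on {a..b} f" "\<And>r. r \<in> {a..b} \<Longrightarrow> norm (f r) \<le> C"
  shows "norm (LBINT r:{a..b}. f r) \<le> C * (b - a)"
  unfolding LBINT_eq_integral[OF assms(2)] by (rule integral_bound) (use assms in auto)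

lemma LBINT_combine:
  fixes f :: "real \<Rightarrow> 'b::euclidean_space"
  assumes "a \<le> b" "b \<le> c" "continuous_on {a..c} f"
  shows "(LBINT r:{a..c}. f r) = (LBINT r:{a..b}. f r) + (LBINT r:{b..c}. f r)"
proof -
  have "continuous_on {a..b} f" "continuous_on {b..c} f"
    using assms by (auto elim: continuous_on_subset)
  then show ?thesis
    using Henstock_Kurzweil_Integration.integral_combine[OF assms(1,2) integrable_continuous_real[OF assms(3)]]
    by (simp add: LBINT_eq_integral assms(3))
qed

text \<open>The fundamental theorem of calculus at the left end point, along the sequence of step
  lengths: f deviates from f(s) by at most e / 2 on a short interval.\<close>

lemma LBINT_quotient_tendsto:
  fixes f :: "real \<Rightarrow> 'b::euclidean_space"
  assumes k: "\<And>n. 0 < k n" "\<And>n. s + k n \<le> T" "k \<longlonglongrightarrow> 0" and f: "continuous_on {s..T} f"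
  shows "(\<lambda>n. (LBINT r:{s..s + k n}. f r) /\<^sub>R k n) \<longlonglongrightarrow> f s"
proof (rule metric_LIMSEQ_I)
  fix e :: real assume e: "e > 0"
  have sT: "s \<le> T" using k(1,2)[of 0] by linarith
  obtain d where d: "d > 0" "\<And>r. r \<in> {s..T} \<Longrightarrow> dist r s < d \<Longrightarrow> dist (f r) (f s) < e / 2"
    using f e sT unfolding continuous_on_iff by (metis atLeastAtMost_iff half_gt_zero order_refl)
  obtain n0 where n0: "\<And>n. n \<ge> n0 \<Longrightarrow> k n < d"
    using order_tendstoD(2)[OF k(3) d(1)] by (auto simp: eventually_sequentially)
  have "dist ((LBINT r:{s..s + k n}. f r) /\<^sub>R k n) (f s) < e" if "n \<ge> n0" for n
  proof -
    have c: "continuous_on {s..s + k n} f" using k(2)[of n] by (intro continuous_on_subset[OF f]) auto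
    have "integral {s..s + k n} (\<lambda>r. f r - f s) = integral {s..s + k n} f - k n *\<^sub>R f s"
      using k(1)[of n] by (subst Henstock_Kurzweil_Integration.integral_diff) (auto intro: integrable_continuous_real c)
    moreover have "norm (integral {s..s + k n} (\<lambda>r. f r - f s)) \<le> e / 2 * (s + k n - s)"
    proof (rule integral_bound)
      show "continuous_on {s..s + k n} (\<lambda>r. f r - f s)" by (intro continuous_intros c)
      fix r assume "r \<in> {s..s + k n}"
      then have "dist (f r) (f s) < e / 2" using k(2)[of n] n0[OF that] by (intro d) (auto simp: dist_real_def)
      then show "norm (f r - f s) \<le> e / 2" by (simp add: dist_norm)
    qed (use k(1)[of n] in simp)
    ultimately have "norm ((LBINT r:{s..s + k n}. f r) - k n *\<^sub>R f s) \<le> e / 2 * k n"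
      by (simp add: LBINT_eq_integral[OF c])
    moreover have "norm (v /\<^sub>R k n) = norm v / k n" for v :: 'b
      using k(1)[of n] by (simp add: divide_inverse mult.commute)
    ultimately have "norm (((LBINT r:{s..s + k n}. f r) - k n *\<^sub>R f s) /\<^sub>R k n) \<le> e / 2"
      using k(1)[of n] by (simp only: pos_divide_le_eq)
    moreover have "((LBINT r:{s..s + k n}. f r) - k n *\<^sub>R f s) /\<^sub>R k n = (LBINT r:{s..s + k n}. f r) /\<^sub>R k n - f s"
      using k(1)[of n] by (simp add: scaleR_diff_right)
    ultimately show ?thesis using e by (simp add: dist_norm)
  qed
  then show "\<exists>n0. \<forall>n\<ge>n0. dist ((LBINT r:{s..s + k n}. f r) /\<^sub>R k n) (f s) < e" by blast
qed

section \<open>The weighted diffusion\<close>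

text \<open>One constant \<open>C\<close> bounds b, \<sigma> and u. The terminal function h does not
  occur: the locale expresses \<Phi>(t, x) through \<Phi>(T, X(T)), and the terminal value is
  substituted only at the very end.\<close>

locale feynman_kac = wiener M W for M :: "'a measure" and W :: "real \<Rightarrow> 'a \<Rightarrow> real^'d" +
  fixes T \<epsilon> :: real and b :: "real^'d \<Rightarrow> real^'d" and \<sigma> :: "real^'d \<Rightarrow> real^'d^'d"
    and u :: "real \<Rightarrow> real^'d \<Rightarrow> real^'d" and \<Phi> :: "real \<Rightarrow> real^'d \<Rightarrow> real"
    and t :: real and x :: "real^'d" and X :: "real \<Rightarrow> 'a \<Rightarrow> real^'d" and C B\<^sub>\<Phi> :: real
  assumes t: "0 \<le> t" "t \<le> T" and \<epsilon>: "0 < \<epsilon>" and C: "0 \<le> C"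
    and b_bound: "\<And>y. norm (b y) \<le> C" and b_cont: "continuous_on UNIV b"
    and \<sigma>_bound: "\<And>y. norm (\<sigma> y) \<le> C" and \<sigma>_cont: "continuous_on UNIV \<sigma>"
    and u_bound: "\<And>s y. s \<in> {0..T} \<Longrightarrow> norm (u s y) \<le> C"
    and u_cont: "continuous_on ({0..T} \<times> UNIV) (\<lambda>(s, y). u s y)"
    and C12: "C12 T \<Phi>" and \<Phi>_bound: "\<And>s y. s \<in> {0..T} \<Longrightarrow> \<bar>\<Phi> s y\<bar> \<le> B\<^sub>\<Phi>"
    and pde: "\<And>s y. s \<in> {0..<T} \<Longrightarrow> time_deriv T \<Phi> s y + generator b \<sigma> \<epsilon> u s (\<Phi> s) y
          + 1 / \<epsilon> * (norm (u s y))\<^sup>2 * \<Phi> s y = 0"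
    and deriv_bound: "\<And>\<delta>. 0 < \<delta> \<Longrightarrow> \<delta> < T \<Longrightarrow> derivatives_bounded_continuous_on T ({\<delta>..T} \<times> UNIV) \<Phi>"
    and X: "strong_solution M W b \<sigma> \<epsilon> T t x X"
begin

lemma continuous_on_slice:
  assumes "continuous_on ({0..T} \<times> (UNIV :: (real^'d) set)) (\<lambda>(s, y). f s y)" "s \<in> {0..T}"
  shows "continuous_on UNIV (f s)"
proof -
  have "continuous_on UNIV ((\<lambda>(s, y). f s y) \<circ> (\<lambda>y. (s, y)))"
    using assms(2)
    by (intro continuous_on_compose continuous_intros continuous_on_subset[OF assms(1)]) auto
  then show ?thesis by (simp add: o_def)
qed

lemma slice_measurable:
  fixes f :: "real \<Rightarrow> real^'d \<Rightarrow> 'b::euclidean_space"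
  assumes "continuous_on ({0..T} \<times> UNIV) (\<lambda>(s, y). f s y)" "s \<in> {t..T}"
  shows "(\<lambda>\<omega>. f s (X s \<omega>)) \<in> borel_measurable (F s)"
proof (rule borel_measurable_continuous_on[of "f s"])
  show "continuous_on UNIV (f s)" using assms t by (intro continuous_on_slice) auto
  show "X s \<in> borel_measurable (F s)" using X assms(2) by (auto simp: strong_solution_def)
qed

lemma path_continuous:
  assumes "continuous_on ({0..T} \<times> (UNIV :: (real^'d) set)) (\<lambda>(s, y). f s y)" "\<omega> \<in> space M"
  shows "continuous_on {t..T} (\<lambda>s. f s (X s \<omega>))"
proof -
  have "continuous_on {t..T} (\<lambda>s. X s \<omega>)" using X assms(2) by (auto simp: strong_solution_def)
  then have "continuous_on {t..T} ((\<lambda>(s, y). f s y) \<circ> (\<lambda>s. (s, X s \<omega>)))"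
    using t by (intro continuous_on_compose continuous_intros continuous_on_subset[OF assms(1)]) auto
  then show ?thesis by (simp add: o_def)
qed

lemma tame_compose:
  assumes "continuous_on ({0..T} \<times> (UNIV :: (real^'d) set)) (\<lambda>(s, y). f s y)"
    and "\<And>s y. s \<in> {0..T} \<Longrightarrow> norm (f s y) \<le> C"
  shows "tame t T C (\<lambda>s \<omega>. f s (X s \<omega>))"
  unfolding tame_def
proof (intro conjI ballI)
  show "(\<lambda>\<omega>. f s (X s \<omega>)) \<in> borel_measurable (F s)" if "s \<in> {t..T}" for s
    by (rule slice_measurable[OF assms(1) that])
  show "continuous_on {t..T} (\<lambda>s. f s (X s \<omega>))" if "\<omega> \<in> space M" for \<omega>
    by (rule path_continuous[OF assms(1) that])
  show "norm (f s (X s \<omega>)) \<le> C" if "s \<in> {t..T}" for s \<omega>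
    using that t by (intro assms(2)) auto
qed (use t C in auto)

lemma tame_u: "tame t T C (\<lambda>s \<omega>. u s (X s \<omega>))"
  by (rule tame_compose[OF u_cont u_bound])

text \<open>Coefficients without time dependence are viewed as functions of (s, y), so that the
  facts about paths f(s, X(s)) cover them too.\<close>

lemma b_cont2: "continuous_on ({0..T} \<times> UNIV) (\<lambda>(s :: real, y). b y)"
  unfolding case_prod_beta by (rule continuous_on_compose2[OF b_cont]) (auto intro!: continuous_intros)

lemma \<sigma>_cont2: "continuous_on ({0..T} \<times> UNIV) (\<lambda>(s :: real, y). \<sigma> y $ i)"
  unfolding case_prod_beta
  by (intro continuous_intros continuous_on_compose2[OF \<sigma>_cont]) (auto intro!: continuous_intros)

lemma tame_\<sigma>: "tame t T C (\<lambda>s \<omega>. \<sigma> (X s \<omega>) $ i)"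
proof (rule tame_compose[where f="\<lambda>s y. \<sigma> y $ i", OF \<sigma>_cont2])
  show "norm (\<sigma> y $ i) \<le> C" for y
    using \<sigma>_bound[of y] Finite_Cartesian_Product.norm_nth_le[of "\<sigma> y" i] by linarith
qed

abbreviation J\<^sub>u :: "real \<Rightarrow> 'a \<Rightarrow> real" where
  "J\<^sub>u s \<equiv> ito_integral M W t s (\<lambda>s \<omega>. u s (X s \<omega>))"

lemma has_ito_J\<^sub>u:
  assumes "s \<in> {t..T}"
  shows "has_ito_integral M W t s (\<lambda>s \<omega>. u s (X s \<omega>)) (J\<^sub>u s)"
proof -
  have "tame t s C (\<lambda>s \<omega>. u s (X s \<omega>))"
    using assms by (intro tame_subinterval[OF tame_u]) auto
  \<comment> \<open>Existence is what gives the choice in \<open>ito_integral\<close> its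
    meaning.\<close>
  from tame_ito_exists[OF this] show ?thesis
    unfolding ito_integral_def by (metis (mono_tags, lifting) someI_ex)
qed

definition A\<^sub>u :: "real \<Rightarrow> 'a \<Rightarrow> real" where
  "A\<^sub>u s \<omega> = (LBINT r:{t..s}. (norm (u r (X r \<omega>)))\<^sup>2)"

definition Y :: "real \<Rightarrow> 'a \<Rightarrow> real" where
  "Y s \<omega> = exp (A\<^sub>u s \<omega> / (2 * \<epsilon>) - J\<^sub>u s \<omega> / sqrt \<epsilon>)"

lemma norm_u_cont: "continuous_on ({0..T} \<times> UNIV) (\<lambda>(s, y). (norm (u s y))\<^sup>2)"
  using u_cont unfolding case_prod_beta by (intro continuous_intros)

lemma norm_u_path: "\<omega> \<in> space M \<Longrightarrow> continuous_on {t..T} (\<lambda>r. (norm (u r (X r \<omega>)))\<^sup>2)"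
  by (rule path_continuous[OF norm_u_cont])

lemma norm_u_bound: "r \<in> {t..T} \<Longrightarrow> norm ((norm (u r (X r \<omega>)))\<^sup>2) \<le> C\<^sup>2"
  using u_bound[of r "X r \<omega>"] t by (auto intro!: power_mono)

lemma A\<^sub>u_measurable_F: "s \<in> {t..T} \<Longrightarrow> A\<^sub>u s \<in> borel_measurable (F s)"
  unfolding A\<^sub>u_def[abs_def]
proof (rule time_integral_measurable)
  assume s: "s \<in> {t..T}"
  show "(\<lambda>\<omega>. (norm (u r (X r \<omega>)))\<^sup>2) \<in> borel_measurable (F s)" if "r \<in> {t..s}" for r
    using slice_measurable[OF norm_u_cont, of r] that s by (auto intro: measurable_F_mono)
  show "continuous_on {t..s} (\<lambda>r. (norm (u r (X r \<omega>)))\<^sup>2)" if "\<omega> \<in> space (F s)" for \<omega>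
    using norm_u_path[of \<omega>] that s by (auto elim: continuous_on_subset)
qed auto

lemma A\<^sub>u_bound:
  assumes "s \<in> {t..T}" "\<omega> \<in> space M"
  shows "\<bar>A\<^sub>u s \<omega>\<bar> \<le> C\<^sup>2 * T"
proof -
  have "norm (A\<^sub>u s \<omega>) \<le> C\<^sup>2 * (s - t)"
    unfolding A\<^sub>u_def using assms norm_u_bound
    by (intro norm_LBINT_le) (auto intro: continuous_on_subset[OF norm_u_path])
  also have "\<dots> \<le> C\<^sup>2 * T" using assms t by (intro mult_left_mono) auto
  finally show ?thesis by simp
qed

lemma Y_measurable_F: "s \<in> {t..T} \<Longrightarrow> Y s \<in> borel_measurable (F s)"
  unfolding Y_def[abs_def]
  using A\<^sub>u_measurable_F[of s] ito_limit_measurable_F[OF has_ito_integral_ito_limit[OF has_ito_J\<^sub>u[of s] t(1)]]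
  by auto

lemma Y_measurable [measurable]: "s \<in> {t..T} \<Longrightarrow> Y s \<in> borel_measurable M"
  using Y_measurable_F by (rule measurable_F_M)

lemma Y_pos: "0 < Y s \<omega>"
  by (simp add: Y_def)

text \<open>The time integral in the exponent is bounded, and the stochastic part is covered by the
  exponential moment with factor -m / sqrt \<epsilon>. Since the interval has length at most T, one
  \<open>K\<close> serves all times.\<close>

lemma Y_power_integral:
  "\<exists>K. \<forall>s\<in>{t..T}. integrable M (\<lambda>\<omega>. (Y s \<omega>)^m) \<and> expectation (\<lambda>\<omega>. (Y s \<omega>)^m) \<le> K"
proof -
  define K where "K = exp (real m * (C\<^sup>2 * T / (2 * \<epsilon>))) * exp ((- real m / sqrt \<epsilon>)\<^sup>2 * C\<^sup>2 * T / 2)"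
  have "integrable M (\<lambda>\<omega>. (Y s \<omega>)^m) \<and> expectation (\<lambda>\<omega>. (Y s \<omega>)^m) \<le> K" if s: "s \<in> {t..T}" for s
  proof -
    note [measurable] = Y_measurable[OF s]
    have tame: "tame t s C (\<lambda>s \<omega>. u s (X s \<omega>))" using s by (intro tame_subinterval[OF tame_u]) auto
    have J: "J\<^sub>u s \<in> borel_measurable M" using has_ito_J\<^sub>u[OF s] by (simp add: has_ito_integral_def)
    have "(\<integral>\<^sup>+\<omega>. ennreal (norm ((Y s \<omega>)^m)) \<partial>M)
      \<le> (\<integral>\<^sup>+\<omega>. ennreal (exp (real m * (C\<^sup>2 * T / (2 * \<epsilon>)))) * ennreal (exp (- real m / sqrt \<epsilon> * J\<^sub>u s \<omega>)) \<partial>M)"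
    proof (rule nn_integral_mono)
      fix \<omega> assume \<omega>: "\<omega> \<in> space M"
      have "A\<^sub>u s \<omega> / (2 * \<epsilon>) \<le> C\<^sup>2 * T / (2 * \<epsilon>)"
        using A\<^sub>u_bound[OF s \<omega>] \<epsilon> by (intro divide_right_mono) auto
      then have "real m * (A\<^sub>u s \<omega> / (2 * \<epsilon>)) \<le> real m * (C\<^sup>2 * T / (2 * \<epsilon>))" by (intro mult_left_mono) auto
      moreover have "(Y s \<omega>)^m = exp (real m * (A\<^sub>u s \<omega> / (2 * \<epsilon>)) + (- real m / sqrt \<epsilon> * J\<^sub>u s \<omega>))"
        unfolding Y_def exp_of_nat_mult[symmetric] by (simp add: right_diff_distrib)
      ultimately have "(Y s \<omega>)^m \<le> exp (real m * (C\<^sup>2 * T / (2 * \<epsilon>))) * exp (- real m / sqrt \<epsilon> * J\<^sub>u s \<omega>)"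
        by (simp add: exp_add[symmetric])
      moreover have "norm ((Y s \<omega>)^m) = (Y s \<omega>)^m" using Y_pos[of s \<omega>] by simp
      ultimately show "ennreal (norm ((Y s \<omega>)^m)) \<le> ennreal (exp (real m * (C\<^sup>2 * T / (2 * \<epsilon>)))) * ennreal (exp (- real m / sqrt \<epsilon> * J\<^sub>u s \<omega>))"
        by (simp only: ennreal_mult[symmetric] exp_ge_zero ennreal_leI)
    qed
    also have "\<dots> = ennreal (exp (real m * (C\<^sup>2 * T / (2 * \<epsilon>)))) * (\<integral>\<^sup>+\<omega>. ennreal (exp (- real m / sqrt \<epsilon> * J\<^sub>u s \<omega>)) \<partial>M)"
      using J by (intro nn_integral_cmult) measurable
    also have "\<dots> \<le> ennreal (exp (real m * (C\<^sup>2 * T / (2 * \<epsilon>)))) * ennreal (exp ((- real m / sqrt \<epsilon>)\<^sup>2 * C\<^sup>2 * (s - t) / 2))"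
      by (intro mult_left_mono ito_exp_moment[OF tame has_ito_J\<^sub>u[OF s]]) auto
    also have "\<dots> \<le> ennreal (exp (real m * (C\<^sup>2 * T / (2 * \<epsilon>)))) * ennreal (exp ((- real m / sqrt \<epsilon>)\<^sup>2 * C\<^sup>2 * T / 2))"
    proof -
      have "(- real m / sqrt \<epsilon>)\<^sup>2 * C\<^sup>2 * (s - t) \<le> (- real m / sqrt \<epsilon>)\<^sup>2 * C\<^sup>2 * T"
        using s t by (intro mult_left_mono) auto
      then show ?thesis by (intro mult_left_mono ennreal_leI) auto
    qed
    also have "\<dots> = ennreal K" unfolding K_def by (rule ennreal_mult[symmetric]) auto
    finally have le: "(\<integral>\<^sup>+\<omega>. ennreal (norm ((Y s \<omega>)^m)) \<partial>M) \<le> ennreal K" .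
    have int: "integrable M (\<lambda>\<omega>. (Y s \<omega>)^m)"
      using le_less_trans[OF le, of \<infinity>] by (intro integrableI_bounded) auto
    have "ennreal (expectation (\<lambda>\<omega>. norm ((Y s \<omega>)^m))) \<le> ennreal K"
      using le by (subst nn_integral_eq_integral[symmetric]) (use int in auto)
    then have "expectation (\<lambda>\<omega>. norm ((Y s \<omega>)^m)) \<le> K"
      by (subst (asm) ennreal_le_iff) (auto simp: K_def)
    moreover have "(\<lambda>\<omega>. norm ((Y s \<omega>)^m)) = (\<lambda>\<omega>. (Y s \<omega>)^m)"
      using less_imp_le[OF Y_pos] by (auto simp: fun_eq_iff)
    ultimately show ?thesis using int by simp
  qed
  then show ?thesis by blast
qed

text \<open>The diffusion and the weight are given through integrals starting at \<open>t\<close>.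
  Integrals over [s, s'] exist because the integrands are tame, and additivity identifies them with
  the differences, coordinate by coordinate and up to null sets.\<close>

lemma increment_representation:
  assumes "t \<le> s" "s < s'" "s' \<le> T"
  obtains V :: "'d \<Rightarrow> 'a \<Rightarrow> real" and J where
    "\<And>i. has_ito_integral M W s s' (\<lambda>r \<omega>. \<sigma> (X r \<omega>) $ i) (V i)"
    "has_ito_integral M W s s' (\<lambda>r \<omega>. u r (X r \<omega>)) J"
    "\<And>i. AE \<omega> in M. (X s' \<omega> - X s \<omega>) $ i = sqrt \<epsilon> * V i \<omega> + (LBINT r:{s..s'}. b (X r \<omega>)) $ i"
    "AE \<omega> in M. J\<^sub>u s' \<omega> = J\<^sub>u s \<omega> + J \<omega>"
proof -
  have s: "s \<in> {t..T}" "s' \<in> {t..T}" "0 \<le> s" using assms t by auto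
  have tame: "tame s s' C (\<lambda>r \<omega>. \<sigma> (X r \<omega>) $ i)" "tame s s' C (\<lambda>r \<omega>. u r (X r \<omega>))" for i
    using assms by (auto intro: tame_subinterval[OF tame_\<sigma>] tame_subinterval[OF tame_u])
  have "\<forall>i. \<exists>V. has_ito_integral M W s s' (\<lambda>r \<omega>. \<sigma> (X r \<omega>) $ i) V"
    using tame_ito_exists[OF tame(1)] by blast
  then obtain V :: "'d \<Rightarrow> 'a \<Rightarrow> real" where V: "\<And>i. has_ito_integral M W s s' (\<lambda>r \<omega>. \<sigma> (X r \<omega>) $ i) (V i)"
    by metis
  obtain J where J: "has_ito_integral M W s s' (\<lambda>r \<omega>. u r (X r \<omega>)) J"
    using tame_ito_exists[OF tame(2)] by blast
  note lim = has_ito_integral_ito_limit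
  have "AE \<omega> in M. J\<^sub>u s' \<omega> = J\<^sub>u s \<omega> + J \<omega>"
    by (rule ito_limit_additive[OF assms(1) less_imp_le[OF assms(2)] lim[OF has_ito_J\<^sub>u[OF s(1)] t(1)]
          lim[OF J s(3)] lim[OF has_ito_J\<^sub>u[OF s(2)] t(1)]])
  moreover
  obtain J1 J2 :: "'a \<Rightarrow> real^'d" where
    J1: "\<And>i. has_ito_integral M W t s (\<lambda>r \<omega>. \<sigma> (X r \<omega>) $ i) (\<lambda>\<omega>. J1 \<omega> $ i)"
      "AE \<omega> in M. X s \<omega> = x + (LBINT r:{t..s}. b (X r \<omega>)) + sqrt \<epsilon> *\<^sub>R J1 \<omega>"
    and J2: "\<And>i. has_ito_integral M W t s' (\<lambda>r \<omega>. \<sigma> (X r \<omega>) $ i) (\<lambda>\<omega>. J2 \<omega> $ i)"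
      "AE \<omega> in M. X s' \<omega> = x + (LBINT r:{t..s'}. b (X r \<omega>)) + sqrt \<epsilon> *\<^sub>R J2 \<omega>"
    using X s(1,2) unfolding strong_solution_def by meson
  have "AE \<omega> in M. (X s' \<omega> - X s \<omega>) $ i = sqrt \<epsilon> * V i \<omega> + (LBINT r:{s..s'}. b (X r \<omega>)) $ i" for i
  proof -
    have "AE \<omega> in M. J2 \<omega> $ i = J1 \<omega> $ i + V i \<omega>"
      by (rule ito_limit_additive[OF assms(1) less_imp_le[OF assms(2)] lim[OF J1(1) t(1)] lim[OF V s(3)] lim[OF J2(1) t(1)]])
    with J1(2) J2(2) AE_space show ?thesis
    proof eventually_elim
      case (elim \<omega>)
      have "(LBINT r:{t..s'}. b (X r \<omega>)) = (LBINT r:{t..s}. b (X r \<omega>)) + (LBINT r:{s..s'}. b (X r \<omega>))"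
        using assms elim path_continuous[OF b_cont2, of \<omega>]
        by (intro LBINT_combine) (auto elim: continuous_on_subset)
      then show ?case using elim by (simp add: algebra_simps)
    qed
  qed
  ultimately show ?thesis using that V J by blast
qed

end


section \<open>The one step estimate\<close>

text \<open>A sum is at most its number of terms times its largest term. This replaces an
  exponential of dependent variables by single exponentials, for which moment bounds are
  available.\<close>

lemma exp_sum_le:
  fixes f :: "'i \<Rightarrow> real"
  assumes "finite I" "I \<noteq> {}"
  shows "exp (\<Sum>i\<in>I. f i) \<le> (\<Sum>i\<in>I. exp (real (card I) * f i))"
proof -
  have "Max (f ` I) \<in> f ` I" using assms by (intro Max_in) auto
  then obtain j where "j \<in> I" "f j = Max (f ` I)" by (metis imageE)
  then have j: "j \<in> I" "\<And>i. i \<in> I \<Longrightarrow> f i \<le> f j"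
    using assms(1) by auto
  have "exp (\<Sum>i\<in>I. f i) \<le> exp (real (card I) * f j)"
    using sum_bounded_above[of I f "f j"] j(2) by simp
  also have "\<dots> \<le> (\<Sum>i\<in>I. exp (real (card I) * f i))"
    using assms(1) j(1) by (intro member_le_sum) auto
  finally show ?thesis .
qed

text \<open>This is the weight of the expansion error. The increments in its exponent are not
  independent, so the joint exponential is decoupled into a sum of exponentials of single
  increments, each uniformly integrable by the definition of \<open>diffusive\<close>.\<close>

lemma (in short_time) diffusive_weight_bound:
  fixes \<Delta> :: "'i::finite \<Rightarrow> nat \<Rightarrow> 'a \<Rightarrow> real"
  assumes R: "diffusive \<alpha> R" and D: "\<And>i. diffusive (\<beta> i) (\<Delta> i)"
  defines "V \<equiv> \<lambda>n \<omega>. exp (2 * (\<bar>R n \<omega>\<bar> / sqrt (k n)) + 2 * (\<Sum>i\<in>UNIV. \<bar>\<Delta> i n \<omega>\<bar> / sqrt (k n)))"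
  shows "\<exists>K. \<forall>n. square_integrable M (V n) \<and> expectation (\<lambda>\<omega>. (V n \<omega>)\<^sup>2) \<le> K"
proof -
  have [measurable]: "R n \<in> borel_measurable M" "\<Delta> i n \<in> borel_measurable M" for i n
    using R D by (auto simp: diffusive_def)
  define N where "N = real CARD('i)"
  have "\<exists>K. \<forall>n. (\<integral>\<^sup>+\<omega>. ennreal (exp (8 * \<bar>R n \<omega>\<bar> / sqrt (k n))) \<partial>M) \<le> ennreal K"
    using R unfolding diffusive_def by (meson zero_le_numeral)
  then obtain K\<^sub>R where KR: "\<And>n. (\<integral>\<^sup>+\<omega>. ennreal (exp (8 * \<bar>R n \<omega>\<bar> / sqrt (k n))) \<partial>M) \<le> ennreal K\<^sub>R" by blast
  have "\<forall>i. \<exists>K. \<forall>n. (\<integral>\<^sup>+\<omega>. ennreal (exp (8 * N * \<bar>\<Delta> i n \<omega>\<bar> / sqrt (k n))) \<partial>M) \<le> ennreal K"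
    using D unfolding diffusive_def N_def by (meson mult_nonneg_nonneg of_nat_0_le_iff zero_le_numeral)
  then obtain K\<^sub>D where KD: "\<And>i n. (\<integral>\<^sup>+\<omega>. ennreal (exp (8 * N * \<bar>\<Delta> i n \<omega>\<bar> / sqrt (k n))) \<partial>M) \<le> ennreal (K\<^sub>D i)"
    by metis
  define K where "K = \<bar>K\<^sub>R\<bar> + (\<Sum>i\<in>UNIV. \<bar>K\<^sub>D i\<bar>)"
  have K: "0 \<le> K" by (simp add: K_def sum_nonneg)
  have "square_integrable M (V n) \<and> expectation (\<lambda>\<omega>. (V n \<omega>)\<^sup>2) \<le> K" for n
  proof -
    have [measurable]: "V n \<in> borel_measurable M" unfolding V_def by measurable
    have "mean_square M (V n) \<le> (\<integral>\<^sup>+\<omega>. ennreal (exp (8 * \<bar>R n \<omega>\<bar> / sqrt (k n))) + (\<Sum>i\<in>UNIV. ennreal (exp (8 * N * \<bar>\<Delta> i n \<omega>\<bar> / sqrt (k n)))) \<partial>M)"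
      unfolding mean_square_def
    proof (rule nn_integral_mono)
      fix \<omega>
      define a c where "a = \<bar>R n \<omega>\<bar> / sqrt (k n)" and "c i = \<bar>\<Delta> i n \<omega>\<bar> / sqrt (k n)" for i
      have "(norm (V n \<omega>))\<^sup>2 = exp (4 * a + 4 * (\<Sum>i\<in>UNIV. c i))"
        by (simp add: V_def a_def c_def exp_double[symmetric] distrib_left)
      \<comment> \<open>Squaring doubled the factor 2 to 4, and 4 a + 4 c is at most 8 times the
        larger of the two; this is the origin of 8 and, after \<open>exp_sum_le\<close>, of 8
        N.\<close>
      also have "\<dots> \<le> exp (8 * a) + exp (\<Sum>i\<in>UNIV. 8 * c i)"
      proof (cases "a \<le> (\<Sum>i\<in>UNIV. c i)")
        case True
        then have "exp (4 * a + 4 * (\<Sum>i\<in>UNIV. c i)) \<le> exp (8 * (\<Sum>i\<in>UNIV. c i))" by simp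
        then show ?thesis by (simp add: sum_distrib_left add_increasing)
      next
        case False
        then have "exp (4 * a + 4 * (\<Sum>i\<in>UNIV. c i)) \<le> exp (8 * a)" by simp
        then show ?thesis by (simp add: add_increasing2)
      qed
      also have "exp (\<Sum>i\<in>UNIV. 8 * c i) \<le> (\<Sum>i\<in>UNIV. exp (N * (8 * c i)))"
        unfolding N_def by (rule exp_sum_le) auto
      finally have "(norm (V n \<omega>))\<^sup>2 \<le> exp (8 * a) + (\<Sum>i\<in>UNIV. exp (N * (8 * c i)))" by simp
      then have "ennreal ((norm (V n \<omega>))\<^sup>2) \<le> ennreal (exp (8 * a) + (\<Sum>i\<in>UNIV. exp (N * (8 * c i))))"
        by (rule ennreal_leI)
      also have "\<dots> = ennreal (exp (8 * a)) + (\<Sum>i\<in>UNIV. ennreal (exp (N * (8 * c i))))"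
        by (simp add: sum_nonneg ennreal_plus sum_ennreal)
      also have "\<dots> = ennreal (exp (8 * \<bar>R n \<omega>\<bar> / sqrt (k n))) + (\<Sum>i\<in>UNIV. ennreal (exp (8 * N * \<bar>\<Delta> i n \<omega>\<bar> / sqrt (k n))))"
        by (simp add: a_def c_def ac_simps)
      finally show "ennreal ((norm (V n \<omega>))\<^sup>2) \<le> ennreal (exp (8 * \<bar>R n \<omega>\<bar> / sqrt (k n))) + (\<Sum>i\<in>UNIV. ennreal (exp (8 * N * \<bar>\<Delta> i n \<omega>\<bar> / sqrt (k n))))" .
    qed
    also have "\<dots> = (\<integral>\<^sup>+\<omega>. ennreal (exp (8 * \<bar>R n \<omega>\<bar> / sqrt (k n))) \<partial>M)
        + (\<Sum>i\<in>UNIV. \<integral>\<^sup>+\<omega>. ennreal (exp (8 * N * \<bar>\<Delta> i n \<omega>\<bar> / sqrt (k n))) \<partial>M)"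
      by (simp add: nn_integral_add nn_integral_sum del: sum_ennreal)
    also have "\<dots> \<le> ennreal \<bar>K\<^sub>R\<bar> + (\<Sum>i\<in>UNIV. ennreal \<bar>K\<^sub>D i\<bar>)"
      by (intro add_mono sum_mono order_trans[OF KR] order_trans[OF KD] ennreal_leI) auto
    also have "\<dots> = ennreal K" by (simp add: K_def sum_nonneg ennreal_plus sum_ennreal)
    finally have le: "mean_square M (V n) \<le> ennreal K" .
    then have si: "square_integrable M (V n)"
      using le_less_trans[OF le, of \<infinity>] by (simp add: square_integrable_iff_mean_square)
    have "expectation (\<lambda>\<omega>. (norm (V n \<omega>))\<^sup>2) \<le> K"
      using le unfolding mean_square_eq_integral[OF si] by (simp only: ennreal_le_iff[OF K])
    then show ?thesis using si by simp
  qed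
  then show ?thesis by blast
qed

context feynman_kac
begin

text \<open>The expansion of exp r \<Phi>(s + h, y + d) - \<Phi>(s, y) to second order, where r and
  d count as first order quantities and h as second order.\<close>

definition main_part :: "real \<Rightarrow> real \<Rightarrow> 'a \<Rightarrow> real \<Rightarrow> real^'d \<Rightarrow> real" where
  "main_part s h \<omega> r d = (let y = X s \<omega> in
     \<Phi> s y * r + \<Phi> s y * r\<^sup>2 / 2 + h * time_deriv T \<Phi> s y + gradient (\<Phi> s) y \<bullet> d
         + (d \<bullet> (hessian (\<Phi> s) y *v d)) / 2 + r * (gradient (\<Phi> s) y \<bullet> d))"

text \<open>Such products are the factors \<open>G\<close> of the limit theorems: measurability at
  time \<open>s\<close> is needed for independence, and the fourth power for the
  covariances.\<close>

lemma weight: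
  assumes s: "s \<in> {t..T}" and w: "w \<in> borel_measurable (F s)" "\<And>\<omega>. \<omega> \<in> space M \<Longrightarrow> \<bar>w \<omega>\<bar> \<le> K"
  shows "(\<lambda>\<omega>. Y s \<omega> * w \<omega>) \<in> borel_measurable (F s)"
    and "square_integrable M (\<lambda>\<omega>. Y s \<omega> * w \<omega>)"
    and "integrable M (\<lambda>\<omega>. (Y s \<omega> * w \<omega>)^4)"
    and "integrable M (\<lambda>\<omega>. Y s \<omega> * w \<omega>)"
proof -
  note [measurable] = Y_measurable_F[OF s] w(1)
  have wM [measurable]: "w \<in> borel_measurable M" using w(1) by (rule measurable_F_M)
  note YM [measurable] = Y_measurable[OF s]
  show "(\<lambda>\<omega>. Y s \<omega> * w \<omega>) \<in> borel_measurable (F s)" by measurable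
  have "integrable M (\<lambda>\<omega>. (Y s \<omega>)^2)" "integrable M (\<lambda>\<omega>. (Y s \<omega>)^4)"
    using Y_power_integral[of 2] Y_power_integral[of 4] s by blast+
  then have "square_integrable M (Y s)" by (simp add: square_integrable_def)
  then show si: "square_integrable M (\<lambda>\<omega>. Y s \<omega> * w \<omega>)" using wM w(2) by (rule square_integrable_mult_bounded)
  then show "integrable M (\<lambda>\<omega>. Y s \<omega> * w \<omega>)" by (rule square_integrable_integrable)
  show "integrable M (\<lambda>\<omega>. (Y s \<omega> * w \<omega>)^4)"
  proof (rule Bochner_Integration.integrable_bound)
    show "integrable M (\<lambda>\<omega>. K^4 * (Y s \<omega>)^4)" using \<open>integrable M (\<lambda>\<omega>. (Y s \<omega>)^4)\<close> by simp
    show "AE \<omega> in M. norm ((Y s \<omega> * w \<omega>)^4) \<le> norm (K^4 * (Y s \<omega>)^4)"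
    proof (rule AE_I2)
      fix \<omega> assume "\<omega> \<in> space M"
      then have "\<bar>w \<omega>\<bar>^4 \<le> K^4" using w(2) by (intro power_mono) auto
      then have "(Y s \<omega>)^4 * (w \<omega>)^4 \<le> (Y s \<omega>)^4 * K^4" by (intro mult_left_mono) auto
      then show "norm ((Y s \<omega> * w \<omega>)^4) \<le> norm (K^4 * (Y s \<omega>)^4)"
        by (simp add: power_mult_distrib mult.commute)
    qed
  qed measurable
qed

lemma deriv_cont:
  "continuous_on ({0..T} \<times> UNIV) (\<lambda>(s, y). time_deriv T \<Phi> s y)"
  "continuous_on ({0..T} \<times> UNIV) (\<lambda>(s, y). gradient (\<Phi> s) y)"
  "continuous_on ({0..T} \<times> UNIV) (\<lambda>(s, y). hessian (\<Phi> s) y)"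
  "continuous_on ({0..T} \<times> UNIV) (\<lambda>(s, y). \<Phi> s y)"
  using C12 by (auto simp: C12_def)

text \<open>Bounds are available only away from time 0; for this reason the one step estimate is
  carried out at times s > 0 and later uses \<delta> = s.\<close>

lemma deriv_bounds:
  assumes "0 < \<delta>" "\<delta> < T"
  obtains K where "0 \<le> K" "\<And>\<tau> y. \<tau> \<in> {\<delta>..T} \<Longrightarrow> \<bar>\<Phi> \<tau> y\<bar> \<le> K"
    "\<And>\<tau> y. \<tau> \<in> {\<delta>..T} \<Longrightarrow> \<bar>time_deriv T \<Phi> \<tau> y\<bar> \<le> K"
    "\<And>\<tau> y. \<tau> \<in> {\<delta>..T} \<Longrightarrow> norm (gradient (\<Phi> \<tau>) y) \<le> K" "\<And>\<tau> y. \<tau> \<in> {\<delta>..T} \<Longrightarrow> norm (hessian (\<Phi> \<tau>) y) \<le> K"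
proof -
  have bd: "bounded ((\<lambda>(t, x). time_deriv T \<Phi> t x) ` ({\<delta>..T} \<times> UNIV))"
    "bounded ((\<lambda>(t, x). gradient (\<Phi> t) x) ` ({\<delta>..T} \<times> UNIV))"
    "bounded ((\<lambda>(t, x). hessian (\<Phi> t) x) ` ({\<delta>..T} \<times> UNIV))"
    using deriv_bound[OF assms] by (auto simp: derivatives_bounded_continuous_on_def Let_def)
  have ex: "\<exists>K. \<forall>\<tau>\<in>{\<delta>..T}. \<forall>y. norm (f \<tau> y) \<le> K"
    if "bounded ((\<lambda>(\<tau>, y). f \<tau> y) ` ({\<delta>..T} \<times> UNIV))" for f :: "real \<Rightarrow> real^'d \<Rightarrow> 'b::real_normed_vector"
    using that unfolding bounded_iff by fastforce
  obtain K1 K2 K3 where K: "\<And>\<tau> y. \<tau> \<in> {\<delta>..T} \<Longrightarrow> \<bar>time_deriv T \<Phi> \<tau> y\<bar> \<le> K1"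
    "\<And>\<tau> y. \<tau> \<in> {\<delta>..T} \<Longrightarrow> norm (gradient (\<Phi> \<tau>) y) \<le> K2" "\<And>\<tau> y. \<tau> \<in> {\<delta>..T} \<Longrightarrow> norm (hessian (\<Phi> \<tau>) y) \<le> K3"
    using ex[OF bd(1)] ex[OF bd(2)] ex[OF bd(3)] by (metis real_norm_def)
  define K where "K = Max {0, B\<^sub>\<Phi>, K1, K2, K3}"
  have "0 \<le> K" "B\<^sub>\<Phi> \<le> K" "K1 \<le> K" "K2 \<le> K" "K3 \<le> K" by (auto simp: K_def)
  moreover have "\<bar>\<Phi> \<tau> y\<bar> \<le> K" if "\<tau> \<in> {\<delta>..T}" for \<tau> y
    using \<Phi>_bound[of \<tau> y] that assms \<open>B\<^sub>\<Phi> \<le> K\<close> by auto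
  ultimately show ?thesis by (intro that[of K]) (blast intro: order_trans[OF K(1)] order_trans[OF K(2)] order_trans[OF K(3)])+
qed

end

text \<open>\<open>V n\<close> and \<open>J n\<close> are versions of the stochastic integrals over
  [s, s + k n], chosen beforehand. With \<open>t < s\<close> one has s > 0, so the derivatives of
  \<Phi> are bounded on [s, T].\<close>

locale one_step = feynman_kac M W T \<epsilon> b \<sigma> u \<Phi> t x X C B\<^sub>\<Phi> + short_time M W s T k
  for M :: "'a measure" and W :: "real \<Rightarrow> 'a \<Rightarrow> real^'d" and T \<epsilon> b \<sigma> u \<Phi> t x X C B\<^sub>\<Phi> s k +
  fixes V :: "nat \<Rightarrow> 'd \<Rightarrow> 'a \<Rightarrow> real" and J :: "nat \<Rightarrow> 'a \<Rightarrow> real"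
  assumes ts: "t < s"
    and V: "\<And>n i. has_ito_integral M W s (s + k n) (\<lambda>r \<omega>. \<sigma> (X r \<omega>) $ i) (V n i)"
    and J: "\<And>n. has_ito_integral M W s (s + k n) (\<lambda>r \<omega>. u r (X r \<omega>)) (J n)"
    and XV: "\<And>n i. AE \<omega> in M. (X (s + k n) \<omega> - X s \<omega>) $ i = sqrt \<epsilon> * V n i \<omega> + (LBINT r:{s..s + k n}. b (X r \<omega>)) $ i"
    and YJ: "\<And>n. AE \<omega> in M. J\<^sub>u (s + k n) \<omega> = J\<^sub>u s \<omega> + J n \<omega>"
begin

lemma times: "s \<in> {t..T}" "s < T" "0 < s" "s + k n \<in> {t..T}" "s \<in> {0..T}"
  using ts t k_pos[of 0] k_le[of 0] k_pos[of n] k_le[of n] by auto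

definition \<Delta> :: "nat \<Rightarrow> 'a \<Rightarrow> real^'d" where
  "\<Delta> n \<omega> = X (s + k n) \<omega> - X s \<omega>"

text \<open>Almost everywhere this is the increment of log Y over the step; it is written with the
  integral over the short interval so that the short time results apply.\<close>

definition R :: "nat \<Rightarrow> 'a \<Rightarrow> real" where
  "R n \<omega> = - (1 / sqrt \<epsilon>) * J n \<omega> + (LBINT r:{s..s + k n}. (norm (u r (X r \<omega>)))\<^sup>2) / (2 * \<epsilon>)"

lemma time_integral:
  fixes f :: "real \<Rightarrow> real^'d \<Rightarrow> 'b::euclidean_space"
  assumes f: "continuous_on ({0..T} \<times> UNIV) (\<lambda>(s, y). f s y)" and K: "\<And>s y. s \<in> {0..T} \<Longrightarrow> norm (f s y) \<le> K"
  shows "(\<lambda>\<omega>. LBINT r:{s..s + k n}. f r (X r \<omega>)) \<in> borel_measurable M"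
    and "\<omega> \<in> space M \<Longrightarrow> norm (LBINT r:{s..s + k n}. f r (X r \<omega>)) \<le> K * k n"
    and "\<omega> \<in> space M \<Longrightarrow> (\<lambda>n. (LBINT r:{s..s + k n}. f r (X r \<omega>)) /\<^sub>R k n) \<longlonglongrightarrow> f s (X s \<omega>)"
proof -
  have sub: "{s..s + k n} \<subseteq> {t..T}" "{s..T} \<subseteq> {t..T}" for n using times(1) times(4)[of n] by auto
  show "(\<lambda>\<omega>. LBINT r:{s..s + k n}. f r (X r \<omega>)) \<in> borel_measurable M"
  proof (rule time_integral_measurable)
    show "(\<lambda>\<omega>. f r (X r \<omega>)) \<in> borel_measurable M" if "r \<in> {s..s + k n}" for r
      using slice_measurable[OF f, of r] sub(1)[of n] that by (auto intro: measurable_F_M)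
    show "continuous_on {s..s + k n} (\<lambda>r. f r (X r \<omega>))" if "\<omega> \<in> space M" for \<omega>
      by (rule continuous_on_subset[OF path_continuous[OF f that] sub(1)])
  qed simp
  assume \<omega>: "\<omega> \<in> space M"
  have "norm (LBINT r:{s..s + k n}. f r (X r \<omega>)) \<le> K * (s + k n - s)"
  proof (rule norm_LBINT_le)
    show "continuous_on {s..s + k n} (\<lambda>r. f r (X r \<omega>))"
      by (rule continuous_on_subset[OF path_continuous[OF f \<omega>] sub(1)])
    show "norm (f r (X r \<omega>)) \<le> K" if "r \<in> {s..s + k n}" for r
      using K[of r "X r \<omega>"] that sub(1)[of n] t by auto
  qed simp
  then show "norm (LBINT r:{s..s + k n}. f r (X r \<omega>)) \<le> K * k n" by simp
  show "(\<lambda>n. (LBINT r:{s..s + k n}. f r (X r \<omega>)) /\<^sub>R k n) \<longlonglongrightarrow> f s (X s \<omega>)"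
    by (rule LBINT_quotient_tendsto[OF k_pos k_le k_lim])
      (rule continuous_on_subset[OF path_continuous[OF f \<omega>] sub(2)])
qed

abbreviation drift_R where "drift_R n \<omega> \<equiv> (LBINT r:{s..s + k n}. (norm (u r (X r \<omega>)))\<^sup>2) / (2 * \<epsilon>)"
abbreviation drift_\<Delta> where "drift_\<Delta> i n \<omega> \<equiv> (LBINT r:{s..s + k n}. b (X r \<omega>)) $ i"

lemma drift_R:
  "drift_R n \<in> borel_measurable M"
  "\<omega> \<in> space M \<Longrightarrow> \<bar>drift_R n \<omega>\<bar> \<le> C\<^sup>2 / (2 * \<epsilon>) * k n"
  "\<omega> \<in> space M \<Longrightarrow> (\<lambda>n. drift_R n \<omega> / k n) \<longlonglongrightarrow> (norm (u s (X s \<omega>)))\<^sup>2 / (2 * \<epsilon>)"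
proof -
  have bound: "norm ((norm (u s y))\<^sup>2) \<le> C\<^sup>2" if "s \<in> {0..T}" for s y
    using u_bound[OF that, of y] by (auto intro!: power_mono)
  note ti = time_integral[OF norm_u_cont bound]
  show "drift_R n \<in> borel_measurable M" using ti(1)[of n] by simp
  assume \<omega>: "\<omega> \<in> space M"
  show "\<bar>drift_R n \<omega>\<bar> \<le> C\<^sup>2 / (2 * \<epsilon>) * k n"
    using divide_right_mono[OF ti(2)[OF _ \<omega>, of n], of "2 * \<epsilon>"] \<epsilon> by (simp add: abs_mult)
  have "(\<lambda>n. (LBINT r:{s..s + k n}. (norm (u r (X r \<omega>)))\<^sup>2) /\<^sub>R k n / (2 * \<epsilon>)) \<longlonglongrightarrow> (norm (u s (X s \<omega>)))\<^sup>2 / (2 * \<epsilon>)"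
    using \<epsilon> by (intro tendsto_divide ti(3) \<omega> tendsto_const) auto
  then show "(\<lambda>n. drift_R n \<omega> / k n) \<longlonglongrightarrow> (norm (u s (X s \<omega>)))\<^sup>2 / (2 * \<epsilon>)"
    using \<epsilon> k_pos by (simp add: field_simps)
qed

lemma drift_\<Delta>:
  "drift_\<Delta> i n \<in> borel_measurable M"
  "\<omega> \<in> space M \<Longrightarrow> \<bar>drift_\<Delta> i n \<omega>\<bar> \<le> C * k n"
  "\<omega> \<in> space M \<Longrightarrow> (\<lambda>n. drift_\<Delta> i n \<omega> / k n) \<longlonglongrightarrow> b (X s \<omega>) $ i"
proof -
  note ti = time_integral[OF b_cont2 b_bound]
  show "drift_\<Delta> i n \<in> borel_measurable M" using ti(1)[of n] by simp
  assume \<omega>: "\<omega> \<in> space M"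
  show "\<bar>drift_\<Delta> i n \<omega>\<bar> \<le> C * k n"
    using ti(2)[OF \<omega>, of n] component_le_norm_cart[of "LBINT r:{s..s + k n}. b (X r \<omega>)" i] by linarith
  have "(\<lambda>n. ((LBINT r:{s..s + k n}. b (X r \<omega>)) /\<^sub>R k n) $ i) \<longlonglongrightarrow> b (X s \<omega>) $ i"
    by (intro tendsto_vec_nth ti(3) \<omega>)
  then show "(\<lambda>n. drift_\<Delta> i n \<omega> / k n) \<longlonglongrightarrow> b (X s \<omega>) $ i"
    by (simp add: divide_inverse mult.commute)
qed

lemma tame_s: "tame s T C (\<lambda>r \<omega>. \<sigma> (X r \<omega>) $ i)" "tame s T C (\<lambda>r \<omega>. u r (X r \<omega>))"
  using times(1) by (auto intro: tame_subinterval[OF tame_\<sigma>] tame_subinterval[OF tame_u])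

text \<open>These are the diffusion coefficients at time s of log Y and, for
  \<open>\<beta> i\<close>, of the i-th coordinate of X.\<close>

abbreviation \<alpha> where "\<alpha> \<equiv> \<lambda>\<omega>. (- (1 / sqrt \<epsilon>)) *\<^sub>R u s (X s \<omega>)"
abbreviation \<beta> where "\<beta> i \<equiv> \<lambda>\<omega>. sqrt \<epsilon> *\<^sub>R (\<sigma> (X s \<omega>) $ i)"

lemma coefficients_measurable:
  "(\<lambda>\<omega>. u s (X s \<omega>)) \<in> borel_measurable (F s)" "(\<lambda>\<omega>. \<sigma> (X s \<omega>) $ i) \<in> borel_measurable (F s)"
  using tame_s times(1) by (auto simp: tame_def)

lemma diffusive_R: "diffusive \<alpha> R"
  unfolding R_def[abs_def]
  by (rule diffusive_affine[OF diffusive_ito[OF tame_s(2) J] coefficients_measurable(1) drift_R(1,2)])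

lemma \<Delta>_measurable [measurable]: "\<Delta> n \<in> borel_measurable M"
proof -
  have "X r \<in> borel_measurable M" if "r \<in> {t..T}" for r
    using X that by (auto simp: strong_solution_def intro: measurable_F_M)
  then show ?thesis using times(1) times(4)[of n] unfolding \<Delta>_def[abs_def] by (intro borel_measurable_diff) auto
qed

lemma diffusive_\<Delta>: "diffusive (\<beta> i) (\<lambda>n \<omega>. \<Delta> n \<omega> $ i)"
proof (rule diffusive_cong_AE)
  show "diffusive (\<beta> i) (\<lambda>n \<omega>. sqrt \<epsilon> * V n i \<omega> + drift_\<Delta> i n \<omega>)"
    by (rule diffusive_affine[OF diffusive_ito[OF tame_s(1) V] coefficients_measurable(2) drift_\<Delta>(1,2)])
  show "(\<lambda>\<omega>. \<Delta> n \<omega> $ i) \<in> borel_measurable M" for n by measurable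
  show "AE \<omega> in M. sqrt \<epsilon> * V n i \<omega> + drift_\<Delta> i n \<omega> = \<Delta> n \<omega> $ i" for n
    using XV[of n i] by eventually_elim (simp add: \<Delta>_def)
qed

lemma R_measurable [measurable]: "R n \<in> borel_measurable M"
  using diffusive_R by (simp add: diffusive_def)

text \<open>The time integral splits for every path, the stochastic integral only up to a null set.
  From here on \<open>Y (s + k n)\<close> enters only through \<open>Y s\<close> and
  \<open>R n\<close>.\<close>

lemma Y_step: "AE \<omega> in M. Y (s + k n) \<omega> = Y s \<omega> * exp (R n \<omega>)"
  using YJ[of n] AE_space
proof eventually_elim
  case (elim \<omega>)
  have "A\<^sub>u (s + k n) \<omega> = A\<^sub>u s \<omega> + (LBINT r:{s..s + k n}. (norm (u r (X r \<omega>)))\<^sup>2)"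
    unfolding A\<^sub>u_def
  proof (rule LBINT_combine)
    show "continuous_on {t..s + k n} (\<lambda>r. (norm (u r (X r \<omega>)))\<^sup>2)"
      using elim(2) times(4)[of n] by (intro continuous_on_subset[OF norm_u_path]) auto
  qed (use times(1) in auto)
  then show ?case
    using elim by (simp add: Y_def R_def exp_add[symmetric] add_divide_distrib diff_divide_distrib algebra_simps)
qed

lemma coefficient_bounds:
  assumes "\<omega> \<in> space M"
  shows "norm (\<alpha> \<omega>) \<le> \<bar>1 / sqrt \<epsilon>\<bar> * C" "norm (\<beta> i \<omega>) \<le> \<bar>sqrt \<epsilon>\<bar> * C"
  using u_bound[OF times(5), of "X s \<omega>"] \<sigma>_bound[of "X s \<omega>"] Finite_Cartesian_Product.norm_nth_le[of "\<sigma> (X s \<omega>)" i]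
  by (auto simp: mult_left_mono divide_right_mono intro!: mult_left_mono order_trans[of _ "norm (\<sigma> (X s \<omega>))" C])

end


section \<open>Limits of the terms of the expansion\<close>

context one_step
begin

text \<open>The coefficients of the expansion, taken at (s, X(s)), are of this kind. The class is
  closed under products and, multiplied by \<open>Y s\<close>, satisfies the integrability
  requirements of all limits.\<close>

definition bounded_adapted :: "('a \<Rightarrow> real) \<Rightarrow> bool" where
  "bounded_adapted w \<longleftrightarrow> w \<in> borel_measurable (F s) \<and> (\<exists>K. \<forall>\<omega>\<in>space M. \<bar>w \<omega>\<bar> \<le> K)"

lemma bounded_adapted_mult:
  assumes "bounded_adapted v" "bounded_adapted w"
  shows "bounded_adapted (\<lambda>\<omega>. v \<omega> * w \<omega>)"
proof -
  obtain K L where "\<forall>\<omega>\<in>space M. \<bar>v \<omega>\<bar> \<le> K" "\<forall>\<omega>\<in>space M. \<bar>w \<omega>\<bar> \<le> L"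
    using assms by (auto simp: bounded_adapted_def)
  then have "\<forall>\<omega>\<in>space M. \<bar>v \<omega> * w \<omega>\<bar> \<le> K * L"
    by (auto simp: abs_mult intro!: mult_mono' elim!: bspec)
  then show ?thesis using assms unfolding bounded_adapted_def by auto
qed

lemma bounded_adapted_weight:
  assumes "bounded_adapted w"
  shows "(\<lambda>\<omega>. Y s \<omega> * w \<omega>) \<in> borel_measurable (F s)"
    and "square_integrable M (\<lambda>\<omega>. Y s \<omega> * w \<omega>)"
    and "integrable M (\<lambda>\<omega>. (Y s \<omega> * w \<omega>)^4)"
    and "integrable M (\<lambda>\<omega>. Y s \<omega> * w \<omega>)"
proof -
  obtain K where "w \<in> borel_measurable (F s)" "\<And>\<omega>. \<omega> \<in> space M \<Longrightarrow> \<bar>w \<omega>\<bar> \<le> K"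
    using assms by (auto simp: bounded_adapted_def)
  note w = weight[OF times(1) this]
  show "(\<lambda>\<omega>. Y s \<omega> * w \<omega>) \<in> borel_measurable (F s)" "square_integrable M (\<lambda>\<omega>. Y s \<omega> * w \<omega>)"
    "integrable M (\<lambda>\<omega>. (Y s \<omega> * w \<omega>)^4)" "integrable M (\<lambda>\<omega>. Y s \<omega> * w \<omega>)"
    by (rule w; assumption)+
qed

lemma bounded_adapted_slice:
  assumes "continuous_on ({0..T} \<times> UNIV) (\<lambda>(s, y). f s y)" "\<And>y. \<bar>f s y\<bar> \<le> K"
  shows "bounded_adapted (\<lambda>\<omega>. f s (X s \<omega>))"
  unfolding bounded_adapted_def using slice_measurable[OF assms(1) times(1)] assms(2) by auto

lemma derivative_weights:
  "bounded_adapted (\<lambda>\<omega>. \<Phi> s (X s \<omega>))"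
  "bounded_adapted (\<lambda>\<omega>. time_deriv T \<Phi> s (X s \<omega>))"
  "bounded_adapted (\<lambda>\<omega>. gradient (\<Phi> s) (X s \<omega>) $ i)"
  "bounded_adapted (\<lambda>\<omega>. hessian (\<Phi> s) (X s \<omega>) $ i $ j / 2)"
proof -
  obtain K where K: "0 \<le> K" "\<And>\<tau> y. \<tau> \<in> {s..T} \<Longrightarrow> \<bar>\<Phi> \<tau> y\<bar> \<le> K"
    "\<And>\<tau> y. \<tau> \<in> {s..T} \<Longrightarrow> \<bar>time_deriv T \<Phi> \<tau> y\<bar> \<le> K"
    "\<And>\<tau> y. \<tau> \<in> {s..T} \<Longrightarrow> norm (gradient (\<Phi> \<tau>) y) \<le> K" "\<And>\<tau> y. \<tau> \<in> {s..T} \<Longrightarrow> norm (hessian (\<Phi> \<tau>) y) \<le> K"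
    using deriv_bounds[OF times(3,2)] by blast
  have s: "s \<in> {s..T}" using times(2) by simp
  show "bounded_adapted (\<lambda>\<omega>. \<Phi> s (X s \<omega>))"
    by (rule bounded_adapted_slice[OF deriv_cont(4) K(2)[OF s]])
  show "bounded_adapted (\<lambda>\<omega>. time_deriv T \<Phi> s (X s \<omega>))"
    by (rule bounded_adapted_slice[OF deriv_cont(1) K(3)[OF s]])
  show "bounded_adapted (\<lambda>\<omega>. gradient (\<Phi> s) (X s \<omega>) $ i)"
  proof (rule bounded_adapted_slice)
    show "continuous_on ({0..T} \<times> UNIV) (\<lambda>(s, y). gradient (\<Phi> s) y $ i)"
      using deriv_cont(2) unfolding case_prod_beta by (intro continuous_intros)
    show "\<bar>gradient (\<Phi> s) y $ i\<bar> \<le> K" for y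
      using component_le_norm_cart[of "gradient (\<Phi> s) y" i] K(4)[OF s, of y] by linarith
  qed
  show "bounded_adapted (\<lambda>\<omega>. hessian (\<Phi> s) (X s \<omega>) $ i $ j / 2)"
  proof (rule bounded_adapted_slice)
    show "continuous_on ({0..T} \<times> UNIV) (\<lambda>(s, y). hessian (\<Phi> s) y $ i $ j / 2)"
      using deriv_cont(3) unfolding case_prod_beta by (intro continuous_intros) auto
    show "\<bar>hessian (\<Phi> s) y $ i $ j / 2\<bar> \<le> K" for y
      using component_le_norm_cart[of "hessian (\<Phi> s) y $ i" j]
        Finite_Cartesian_Product.norm_nth_le[of "hessian (\<Phi> s) y" i] K(5)[OF s, of y] K(1) by simp
  qed
qed

lemma inner_weight:
  fixes v w :: "'a \<Rightarrow> real^'d"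
  assumes "v \<in> borel_measurable (F s)" "w \<in> borel_measurable (F s)"
    and "\<And>\<omega>. \<omega> \<in> space M \<Longrightarrow> norm (v \<omega>) \<le> K" "\<And>\<omega>. \<omega> \<in> space M \<Longrightarrow> norm (w \<omega>) \<le> L"
  shows "bounded_adapted (\<lambda>\<omega>. v \<omega> \<bullet> w \<omega>)"
  unfolding bounded_adapted_def
proof (intro conjI exI ballI)
  fix \<omega> assume "\<omega> \<in> space M"
  then show "\<bar>v \<omega> \<bullet> w \<omega>\<bar> \<le> K * L"
    using assms(3,4) by (intro order_trans[OF Cauchy_Schwarz_ineq2] mult_mono') auto
qed (use assms(1,2) in auto)

lemma \<alpha>\<beta>_measurable: "\<alpha> \<in> borel_measurable (F s)" "\<beta> i \<in> borel_measurable (F s)"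
  using coefficients_measurable by auto

lemma covariance_weights:
  "bounded_adapted (\<lambda>\<omega>. \<alpha> \<omega> \<bullet> \<alpha> \<omega>)" "bounded_adapted (\<lambda>\<omega>. \<alpha> \<omega> \<bullet> \<beta> i \<omega>)" "bounded_adapted (\<lambda>\<omega>. \<beta> i \<omega> \<bullet> \<beta> j \<omega>)"
  by (rule inner_weight[OF \<alpha>\<beta>_measurable(1) \<alpha>\<beta>_measurable(1) coefficient_bounds(1) coefficient_bounds(1)]
      inner_weight[OF \<alpha>\<beta>_measurable(1) \<alpha>\<beta>_measurable(2) coefficient_bounds(1) coefficient_bounds(2)]
      inner_weight[OF \<alpha>\<beta>_measurable(2) \<alpha>\<beta>_measurable(2) coefficient_bounds(2) coefficient_bounds(2)]; assumption)+

lemma drift_weights: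
  "bounded_adapted (\<lambda>\<omega>. (norm (u s (X s \<omega>)))\<^sup>2 / (2 * \<epsilon>))" "bounded_adapted (\<lambda>\<omega>. b (X s \<omega>) $ i)"
proof -
  have "bounded_adapted (\<lambda>\<omega>. (norm (u s (X s \<omega>)))\<^sup>2 / (2 * \<epsilon>))"
    unfolding bounded_adapted_def
  proof (intro conjI exI ballI)
    show "(\<lambda>\<omega>. (norm (u s (X s \<omega>)))\<^sup>2 / (2 * \<epsilon>)) \<in> borel_measurable (F s)"
      using coefficients_measurable(1) by measurable
    show "\<bar>(norm (u s (X s \<omega>)))\<^sup>2 / (2 * \<epsilon>)\<bar> \<le> C\<^sup>2 / (2 * \<epsilon>)" for \<omega>
      using u_bound[OF times(5), of "X s \<omega>"] \<epsilon> by (auto intro!: divide_right_mono power_mono)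
  qed
  then show "bounded_adapted (\<lambda>\<omega>. (norm (u s (X s \<omega>)))\<^sup>2 / (2 * \<epsilon>))" .
  show "bounded_adapted (\<lambda>\<omega>. b (X s \<omega>) $ i)"
  proof (rule bounded_adapted_slice)
    show "continuous_on ({0..T} \<times> UNIV) (\<lambda>(s :: real, y). b y $ i)"
      using b_cont2 unfolding case_prod_beta by (intro continuous_intros)
    show "\<bar>b y $ i\<bar> \<le> C" for y using component_le_norm_cart[of "b y" i] b_bound[of y] by linarith
  qed
qed

text \<open>In coordinates every term is a coefficient known at time s times a monomial in
  \<open>r\<close> and the \<open>d $ i\<close>, or times h, as the limit theorems require.\<close>

lemma main_part_expand:
  "main_part s h \<omega> r d = \<Phi> s (X s \<omega>) * r + (\<Phi> s (X s \<omega>) * (1 / 2)) * (r * r) + h * time_deriv T \<Phi> s (X s \<omega>)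
    + (\<Sum>i\<in>UNIV. gradient (\<Phi> s) (X s \<omega>) $ i * d $ i)
    + (\<Sum>i\<in>UNIV. \<Sum>j\<in>UNIV. (hessian (\<Phi> s) (X s \<omega>) $ i $ j / 2) * (d $ i * d $ j))
    + (\<Sum>i\<in>UNIV. gradient (\<Phi> s) (X s \<omega>) $ i * (r * d $ i))"
proof -
  let ?H = "hessian (\<Phi> s) (X s \<omega>)"
  have "(d \<bullet> (?H *v d)) / 2 = (\<Sum>i\<in>UNIV. d $ i * (\<Sum>j\<in>UNIV. ?H $ i $ j * d $ j)) / 2"
    by (simp add: inner_vec_def matrix_vector_mult_def)
  also have "\<dots> = (\<Sum>i\<in>UNIV. \<Sum>j\<in>UNIV. (?H $ i $ j / 2) * (d $ i * d $ j))"
    unfolding sum_distrib_left sum_divide_distrib by (intro sum.cong refl) simp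
  finally have 1: "(d \<bullet> (?H *v d)) / 2 = (\<Sum>i\<in>UNIV. \<Sum>j\<in>UNIV. (?H $ i $ j / 2) * (d $ i * d $ j))" .
  have 2: "r * (gradient (\<Phi> s) (X s \<omega>) \<bullet> d) = (\<Sum>i\<in>UNIV. gradient (\<Phi> s) (X s \<omega>) $ i * (r * d $ i))"
    by (simp add: inner_vec_def sum_distrib_left ac_simps)
  show ?thesis
    unfolding main_part_def Let_def 1 2 by (simp add: inner_vec_def power2_eq_square)
qed

text \<open>This is where the differential equation enters. Here \<alpha> \<bullet> \<alpha> = |u|^2
  / \<epsilon>, whose half joins the drift |u|^2 / (2 \<epsilon>) of log Y to form the potential;
  the products of the \<beta>'s are \<epsilon> times the entries of \<sigma> \<sigma>^T; and
  \<alpha> \<bullet> \<beta> i is minus the i-th coordinate of \<sigma> u, the correction of the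
  drift b in the generator.\<close>

lemma generator_terms:
  "\<Phi> s (X s \<omega>) * ((norm (u s (X s \<omega>)))\<^sup>2 / (2 * \<epsilon>)) + (\<Phi> s (X s \<omega>) * (1 / 2)) * (\<alpha> \<omega> \<bullet> \<alpha> \<omega>)
    + time_deriv T \<Phi> s (X s \<omega>)
    + (\<Sum>i\<in>UNIV. gradient (\<Phi> s) (X s \<omega>) $ i * b (X s \<omega>) $ i)
    + (\<Sum>i\<in>UNIV. \<Sum>j\<in>UNIV. (hessian (\<Phi> s) (X s \<omega>) $ i $ j / 2) * (\<beta> i \<omega> \<bullet> \<beta> j \<omega>))
    + (\<Sum>i\<in>UNIV. gradient (\<Phi> s) (X s \<omega>) $ i * (\<alpha> \<omega> \<bullet> \<beta> i \<omega>)) = 0"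
proof -
  define y where "y = X s \<omega>"
  let ?D = "gradient (\<Phi> s) y" and ?H = "hessian (\<Phi> s) y"
  have sq: "sqrt \<epsilon> * sqrt \<epsilon> = \<epsilon>" "sqrt \<epsilon> \<noteq> 0" using \<epsilon> by auto
  have 1: "\<Phi> s y * ((norm (u s y))\<^sup>2 / (2 * \<epsilon>)) + (\<Phi> s y * (1 / 2)) * (((- (1 / sqrt \<epsilon>)) *\<^sub>R u s y) \<bullet> ((- (1 / sqrt \<epsilon>)) *\<^sub>R u s y))
      = 1 / \<epsilon> * (norm (u s y))\<^sup>2 * \<Phi> s y"
    using sq by (simp add: power2_norm_eq_inner field_simps)
  have 2: "(\<Sum>i\<in>UNIV. ?D $ i * b y $ i) = b y \<bullet> ?D"
    by (simp add: inner_vec_def mult.commute)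
  have 3: "(\<Sum>i\<in>UNIV. \<Sum>j\<in>UNIV. (?H $ i $ j / 2) * ((sqrt \<epsilon> *\<^sub>R (\<sigma> y $ i)) \<bullet> (sqrt \<epsilon> *\<^sub>R (\<sigma> y $ j))))
      = \<epsilon> / 2 * frobenius_inner (\<sigma> y ** transpose (\<sigma> y)) ?H"
  proof -
    have "(\<sigma> y ** transpose (\<sigma> y)) $ i $ j = \<sigma> y $ i \<bullet> \<sigma> y $ j" for i j
      by (simp add: matrix_matrix_mult_def transpose_def inner_vec_def)
    moreover have "(sqrt \<epsilon> *\<^sub>R (\<sigma> y $ i)) \<bullet> (sqrt \<epsilon> *\<^sub>R (\<sigma> y $ j)) = \<epsilon> * (\<sigma> y $ i \<bullet> \<sigma> y $ j)" for i j
      using sq(1) by (simp add: mult.assoc[symmetric])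
    ultimately show ?thesis
      unfolding frobenius_inner_def sum_distrib_left by (intro sum.cong refl) simp
  qed
  have 4: "(\<Sum>i\<in>UNIV. ?D $ i * (((- (1 / sqrt \<epsilon>)) *\<^sub>R u s y) \<bullet> (sqrt \<epsilon> *\<^sub>R (\<sigma> y $ i)))) = - ((\<sigma> y *v u s y) \<bullet> ?D)"
  proof -
    have "((- (1 / sqrt \<epsilon>)) *\<^sub>R u s y) \<bullet> (sqrt \<epsilon> *\<^sub>R (\<sigma> y $ i)) = - (\<sigma> y *v u s y) $ i" for i
      using sq by (simp add: matrix_vector_mul_component inner_commute)
    then show ?thesis by (simp add: inner_vec_def sum_negf mult.commute)
  qed
  have "time_deriv T \<Phi> s y + generator b \<sigma> \<epsilon> u s (\<Phi> s) y + 1 / \<epsilon> * (norm (u s y))\<^sup>2 * \<Phi> s y = 0"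
    using times(2,3) by (intro pde) auto
  then show ?thesis
    unfolding y_def[symmetric] 1 2 3 4 generator_def by (simp add: inner_diff_left)
qed

text \<open>Each factor is the increment of log Y or a coordinate of the increment of X; pairing a
  process with its coefficient lets one statement cover every combination.\<close>

lemma quadratic_limit:
  assumes w: "bounded_adapted w" and P: "(\<gamma>, P) = (\<alpha>, R) \<or> (\<exists>i. (\<gamma>, P) = (\<beta> i, \<lambda>n \<omega>. \<Delta> n \<omega> $ i))"
    and Q: "(\<eta>, Q) = (\<alpha>, R) \<or> (\<exists>i. (\<eta>, Q) = (\<beta> i, \<lambda>n \<omega>. \<Delta> n \<omega> $ i))"
  shows "integrable M (\<lambda>\<omega>. Y s \<omega> * w \<omega> * (P n \<omega> * Q n \<omega>))"
    and "(\<lambda>n. expectation (\<lambda>\<omega>. Y s \<omega> * w \<omega> * (P n \<omega> * Q n \<omega>)) / k n) \<longlonglongrightarrow> expectation (\<lambda>\<omega>. Y s \<omega> * (w \<omega> * (\<gamma> \<omega> \<bullet> \<eta> \<omega>)))"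
proof -
  define K where "K = \<bar>1 / sqrt \<epsilon>\<bar> * C + \<bar>sqrt \<epsilon>\<bar> * C"
  have K: "norm (\<alpha> \<omega>) \<le> K" "norm (\<beta> i \<omega>) \<le> K" if "\<omega> \<in> space M" for \<omega> i
    using coefficient_bounds(1)[OF that] coefficient_bounds(2)[OF that, of i] C
      mult_nonneg_nonneg[of "\<bar>1 / sqrt \<epsilon>\<bar>" C] mult_nonneg_nonneg[of "\<bar>sqrt \<epsilon>\<bar>" C]
    unfolding K_def by linarith+
  have p: "diffusive \<gamma> P \<and> \<gamma> \<in> borel_measurable (F s) \<and> (\<forall>\<omega>\<in>space M. norm (\<gamma> \<omega>) \<le> K)"
    if "(\<gamma>, P) = (\<alpha>, R) \<or> (\<exists>i. (\<gamma>, P) = (\<beta> i, \<lambda>n \<omega>. \<Delta> n \<omega> $ i))" for \<gamma> P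
    using that
  proof (elim disjE exE)
    assume "(\<gamma>, P) = (\<alpha>, R)"
    then have "\<gamma> = \<alpha>" "P = R" by simp_all
    then show ?thesis using diffusive_R \<alpha>\<beta>_measurable(1) K(1) by (intro conjI ballI) (simp_all only:)
  next
    fix i assume "(\<gamma>, P) = (\<beta> i, \<lambda>n \<omega>. \<Delta> n \<omega> $ i)"
    then have "\<gamma> = \<beta> i" "P = (\<lambda>n \<omega>. \<Delta> n \<omega> $ i)" by simp_all
    then show ?thesis using diffusive_\<Delta> \<alpha>\<beta>_measurable(2) K(2) by (intro conjI ballI) (simp_all only:)
  qed
  note P' = p[OF P] and Q' = p[OF Q]
  note cov = diffusive_covariance[where C=K, OF conjunct1[OF P'] conjunct1[OF conjunct2[OF P']]
      conjunct1[OF Q'] conjunct1[OF conjunct2[OF Q']] _ _ bounded_adapted_weight(1,3)[OF w]]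
  show "integrable M (\<lambda>\<omega>. Y s \<omega> * w \<omega> * (P n \<omega> * Q n \<omega>))"
    using P' Q' by (intro cov(1)) auto
  have "(\<lambda>n. expectation (\<lambda>\<omega>. Y s \<omega> * w \<omega> * (P n \<omega> * Q n \<omega>)) / k n) \<longlonglongrightarrow> expectation (\<lambda>\<omega>. Y s \<omega> * w \<omega> * (\<gamma> \<omega> \<bullet> \<eta> \<omega>))"
    using P' Q' by (intro cov(2)) auto
  then show "(\<lambda>n. expectation (\<lambda>\<omega>. Y s \<omega> * w \<omega> * (P n \<omega> * Q n \<omega>)) / k n) \<longlonglongrightarrow> expectation (\<lambda>\<omega>. Y s \<omega> * (w \<omega> * (\<gamma> \<omega> \<bullet> \<eta> \<omega>)))"
    by (simp only: mult.assoc)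
qed

lemma linear_limit_R:
  assumes w: "bounded_adapted w"
  shows "integrable M (\<lambda>\<omega>. Y s \<omega> * w \<omega> * R n \<omega>)"
    and "(\<lambda>n. expectation (\<lambda>\<omega>. Y s \<omega> * w \<omega> * R n \<omega>) / k n) \<longlonglongrightarrow> expectation (\<lambda>\<omega>. Y s \<omega> * (w \<omega> * ((norm (u s (X s \<omega>)))\<^sup>2 / (2 * \<epsilon>))))"
proof -
  note lim = drift_limit[OF bounded_adapted_weight(1,2)[OF w] J drift_R(1) drift_R(2) drift_R(3),
    where c="- (1 / sqrt \<epsilon>)", folded R_def]
  show "integrable M (\<lambda>\<omega>. Y s \<omega> * w \<omega> * R n \<omega>)" by (rule lim(1); assumption)
  show "(\<lambda>n. expectation (\<lambda>\<omega>. Y s \<omega> * w \<omega> * R n \<omega>) / k n) \<longlonglongrightarrow> expectation (\<lambda>\<omega>. Y s \<omega> * (w \<omega> * ((norm (u s (X s \<omega>)))\<^sup>2 / (2 * \<epsilon>))))"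
    unfolding mult.assoc[of "Y s _" "w _" "(norm _)\<^sup>2 / _", symmetric] by (rule lim(2); assumption)
qed

text \<open>The representation of the increment of X by a stochastic integral and a drift holds only
  almost everywhere, so \<open>drift_limit\<close> is applied to the representation and
  transferred.\<close>

lemma linear_limit_\<Delta>:
  assumes w: "bounded_adapted w"
  shows "integrable M (\<lambda>\<omega>. Y s \<omega> * w \<omega> * \<Delta> n \<omega> $ i)"
    and "(\<lambda>n. expectation (\<lambda>\<omega>. Y s \<omega> * w \<omega> * \<Delta> n \<omega> $ i) / k n) \<longlonglongrightarrow> expectation (\<lambda>\<omega>. Y s \<omega> * (w \<omega> * b (X s \<omega>) $ i))"
proof -
  note lim = drift_limit[OF bounded_adapted_weight(1,2)[OF w] V[where i=i] drift_\<Delta>(1)[where i=i]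
    drift_\<Delta>(2)[where i=i] drift_\<Delta>(3)[where i=i], where c="sqrt \<epsilon>"]
  have [measurable]: "(\<lambda>\<omega>. Y s \<omega> * w \<omega>) \<in> borel_measurable M"
    using bounded_adapted_weight(1)[OF w] by (rule measurable_F_M)
  note [measurable] = drift_\<Delta>(1)
  have Vm [measurable]: "V n i \<in> borel_measurable M" for n using V by (simp add: has_ito_integral_def)
  have eq: "AE \<omega> in M. Y s \<omega> * w \<omega> * (sqrt \<epsilon> * V n i \<omega> + drift_\<Delta> i n \<omega>) = Y s \<omega> * w \<omega> * \<Delta> n \<omega> $ i" for n
    using XV[of n i] by eventually_elim (simp add: \<Delta>_def)
  show "integrable M (\<lambda>\<omega>. Y s \<omega> * w \<omega> * \<Delta> n \<omega> $ i)"
    by (rule integrable_cong_AE_imp[OF lim(1)]; (assumption | use eq[of n] in measurable | rule eq)?)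
  have E: "expectation (\<lambda>\<omega>. Y s \<omega> * w \<omega> * \<Delta> n \<omega> $ i) = expectation (\<lambda>\<omega>. Y s \<omega> * w \<omega> * (sqrt \<epsilon> * V n i \<omega> + drift_\<Delta> i n \<omega>))" for n
    by (rule integral_cong_AE) (use eq[of n] in auto)
  have "(\<lambda>n. expectation (\<lambda>\<omega>. Y s \<omega> * w \<omega> * (sqrt \<epsilon> * V n i \<omega> + drift_\<Delta> i n \<omega>)) / k n)
      \<longlonglongrightarrow> expectation (\<lambda>\<omega>. Y s \<omega> * w \<omega> * b (X s \<omega>) $ i)"
    by (rule lim(2); assumption)
  then show "(\<lambda>n. expectation (\<lambda>\<omega>. Y s \<omega> * w \<omega> * \<Delta> n \<omega> $ i) / k n) \<longlonglongrightarrow> expectation (\<lambda>\<omega>. Y s \<omega> * (w \<omega> * b (X s \<omega>) $ i))"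
    unfolding E by (simp only: mult.assoc)
qed

end


text \<open>The shape copies the six groups of terms in \<open>main_part_expand\<close>. It is used
  in both directions: to split the expectation for each \<open>n\<close>, and to recombine the
  limits.\<close>

lemma integral_sums:
  fixes a b c :: "'a \<Rightarrow> real" and d f :: "'i::finite \<Rightarrow> 'a \<Rightarrow> real" and e :: "'i \<Rightarrow> 'i \<Rightarrow> 'a \<Rightarrow> real"
  assumes "integrable M a" "integrable M b" "integrable M c"
    and d: "\<And>i. integrable M (d i)" and e: "\<And>i j. integrable M (e i j)" and f: "\<And>i. integrable M (f i)"
  shows "integrable M (\<lambda>x. a x + b x + c x + (\<Sum>i\<in>UNIV. d i x) + (\<Sum>i\<in>UNIV. \<Sum>j\<in>UNIV. e i j x) + (\<Sum>i\<in>UNIV. f i x))"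
    and "(\<integral>x. a x + b x + c x + (\<Sum>i\<in>UNIV. d i x) + (\<Sum>i\<in>UNIV. \<Sum>j\<in>UNIV. e i j x) + (\<Sum>i\<in>UNIV. f i x) \<partial>M)
      = (\<integral>x. a x \<partial>M) + (\<integral>x. b x \<partial>M) + (\<integral>x. c x \<partial>M) + (\<Sum>i\<in>UNIV. \<integral>x. d i x \<partial>M)
        + (\<Sum>i\<in>UNIV. \<Sum>j\<in>UNIV. \<integral>x. e i j x \<partial>M) + (\<Sum>i\<in>UNIV. \<integral>x. f i x \<partial>M)"
proof -
  have sums: "integrable M (\<lambda>x. \<Sum>i\<in>UNIV. d i x)" "integrable M (\<lambda>x. \<Sum>i\<in>UNIV. \<Sum>j\<in>UNIV. e i j x)"
    "integrable M (\<lambda>x. \<Sum>i\<in>UNIV. f i x)"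
    by (intro Bochner_Integration.integrable_sum d e f)+
  show "integrable M (\<lambda>x. a x + b x + c x + (\<Sum>i\<in>UNIV. d i x) + (\<Sum>i\<in>UNIV. \<Sum>j\<in>UNIV. e i j x) + (\<Sum>i\<in>UNIV. f i x))"
    by (intro Bochner_Integration.integrable_add sums assms(1-3))
  have "(\<integral>x. (\<Sum>i\<in>UNIV. \<Sum>j\<in>UNIV. e i j x) \<partial>M) = (\<Sum>i\<in>UNIV. \<Sum>j\<in>UNIV. \<integral>x. e i j x \<partial>M)"
    by (rule integral_sum_sum) (rule e)
  moreover have "(\<integral>x. (\<Sum>i\<in>UNIV. d i x) \<partial>M) = (\<Sum>i\<in>UNIV. \<integral>x. d i x \<partial>M)"
    "(\<integral>x. (\<Sum>i\<in>UNIV. f i x) \<partial>M) = (\<Sum>i\<in>UNIV. \<integral>x. f i x \<partial>M)"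
    by (rule Bochner_Integration.integral_sum, rule d f)+
  moreover note s1 = Bochner_Integration.integrable_add[OF assms(1,2)]
  moreover note s2 = Bochner_Integration.integrable_add[OF s1 assms(3)]
  moreover note s3 = Bochner_Integration.integrable_add[OF s2 sums(1)]
  moreover note s4 = Bochner_Integration.integrable_add[OF s3 sums(2)]
  ultimately show "(\<integral>x. a x + b x + c x + (\<Sum>i\<in>UNIV. d i x) + (\<Sum>i\<in>UNIV. \<Sum>j\<in>UNIV. e i j x) + (\<Sum>i\<in>UNIV. f i x) \<partial>M)
      = (\<integral>x. a x \<partial>M) + (\<integral>x. b x \<partial>M) + (\<integral>x. c x \<partial>M) + (\<Sum>i\<in>UNIV. \<integral>x. d i x \<partial>M)
        + (\<Sum>i\<in>UNIV. \<Sum>j\<in>UNIV. \<integral>x. e i j x \<partial>M) + (\<Sum>i\<in>UNIV. \<integral>x. f i x \<partial>M)"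
    by (simp only: Bochner_Integration.integral_add[OF s4 sums(3)] Bochner_Integration.integral_add[OF s3 sums(2)]
        Bochner_Integration.integral_add[OF s2 sums(1)] Bochner_Integration.integral_add[OF s1 assms(3)]
        Bochner_Integration.integral_add[OF assms(1,2)])
qed

context one_step
begin

lemma bounded_adapted_half: "bounded_adapted v \<Longrightarrow> bounded_adapted (\<lambda>\<omega>. v \<omega> * (1 / 2))"
proof (rule bounded_adapted_mult)
  show "bounded_adapted (\<lambda>_. 1 / 2)"
    unfolding bounded_adapted_def by (intro conjI exI[of _ "1 / 2"]) auto
qed

lemma main_part_limit:
  shows "integrable M (\<lambda>\<omega>. Y s \<omega> * main_part s (k n) \<omega> (R n \<omega>) (\<Delta> n \<omega>))"
    and "(\<lambda>n. expectation (\<lambda>\<omega>. Y s \<omega> * main_part s (k n) \<omega> (R n \<omega>) (\<Delta> n \<omega>)) / k n) \<longlonglongrightarrow> 0"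
proof -
  let ?g = "\<lambda>\<omega>. \<Phi> s (X s \<omega>)" and ?t = "\<lambda>\<omega>. time_deriv T \<Phi> s (X s \<omega>)"
  let ?D = "\<lambda>i \<omega>. gradient (\<Phi> s) (X s \<omega>) $ i" and ?H = "\<lambda>i j \<omega>. hessian (\<Phi> s) (X s \<omega>) $ i $ j / 2"
  note dw = derivative_weights and half = bounded_adapted_half[OF derivative_weights(1)]
  let ?f1 = "\<lambda>n \<omega>. Y s \<omega> * ?g \<omega> * R n \<omega>" and ?f2 = "\<lambda>n \<omega>. Y s \<omega> * (?g \<omega> * (1 / 2)) * (R n \<omega> * R n \<omega>)"
    and ?f3 = "\<lambda>n \<omega>. k n * (Y s \<omega> * ?t \<omega>)" and ?f4 = "\<lambda>n i \<omega>. Y s \<omega> * ?D i \<omega> * \<Delta> n \<omega> $ i"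
    and ?f5 = "\<lambda>n i j \<omega>. Y s \<omega> * ?H i j \<omega> * (\<Delta> n \<omega> $ i * \<Delta> n \<omega> $ j)"
    and ?f6 = "\<lambda>n i \<omega>. Y s \<omega> * ?D i \<omega> * (R n \<omega> * \<Delta> n \<omega> $ i)"
  note l1 = linear_limit_R[OF dw(1)]
  note l2 = quadratic_limit[OF half, of \<alpha> R \<alpha> R, OF disjI1[OF refl] disjI1[OF refl]]
  note l4 = linear_limit_\<Delta>[OF dw(3)]
  have \<Delta>_case: "(\<beta> i, \<lambda>n \<omega>. \<Delta> n \<omega> $ i) = (\<alpha>, R) \<or> (\<exists>i'. (\<beta> i, \<lambda>n \<omega>. \<Delta> n \<omega> $ i) = (\<beta> i', \<lambda>n \<omega>. \<Delta> n \<omega> $ i'))" for i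
    by blast
  have l5: "integrable M (?f5 n i j)"
    "(\<lambda>n. expectation (?f5 n i j) / k n) \<longlonglongrightarrow> expectation (\<lambda>\<omega>. Y s \<omega> * (?H i j \<omega> * (\<beta> i \<omega> \<bullet> \<beta> j \<omega>)))" for n i j
    by (rule quadratic_limit[OF dw(4) \<Delta>_case \<Delta>_case])+
  have l6: "integrable M (?f6 n i)"
    "(\<lambda>n. expectation (?f6 n i) / k n) \<longlonglongrightarrow> expectation (\<lambda>\<omega>. Y s \<omega> * (?D i \<omega> * (\<alpha> \<omega> \<bullet> \<beta> i \<omega>)))" for n i
    by (rule quadratic_limit[OF dw(3) disjI1[OF refl] \<Delta>_case])+
  have i3: "integrable M (?f3 n)" for n using bounded_adapted_weight(4)[OF dw(2)] by simp
  have expand: "Y s \<omega> * main_part s (k n) \<omega> (R n \<omega>) (\<Delta> n \<omega>) = ?f1 n \<omega> + ?f2 n \<omega> + ?f3 n \<omega> + (\<Sum>i\<in>UNIV. ?f4 n i \<omega>)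
      + (\<Sum>i\<in>UNIV. \<Sum>j\<in>UNIV. ?f5 n i j \<omega>) + (\<Sum>i\<in>UNIV. ?f6 n i \<omega>)" for n \<omega>
    unfolding main_part_expand distrib_left sum_distrib_left by (simp only: ac_simps)
  note n_sums = integral_sums[OF l1(1) l2(1) i3 l4(1) l5(1) l6(1)]
  show "integrable M (\<lambda>\<omega>. Y s \<omega> * main_part s (k n) \<omega> (R n \<omega>) (\<Delta> n \<omega>))"
    unfolding expand by (rule n_sums(1))
  have E: "expectation (\<lambda>\<omega>. Y s \<omega> * main_part s (k n) \<omega> (R n \<omega>) (\<Delta> n \<omega>)) / k n
     = expectation (?f1 n) / k n + expectation (?f2 n) / k n + expectation (\<lambda>\<omega>. Y s \<omega> * ?t \<omega>)
      + (\<Sum>i\<in>UNIV. expectation (?f4 n i) / k n) + (\<Sum>i\<in>UNIV. \<Sum>j\<in>UNIV. expectation (?f5 n i j) / k n)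
      + (\<Sum>i\<in>UNIV. expectation (?f6 n i) / k n)" for n
  proof -
    have "expectation (?f3 n) / k n = expectation (\<lambda>\<omega>. Y s \<omega> * ?t \<omega>)" using k_pos[of n] by simp
    then show ?thesis
      unfolding expand n_sums(2) add_divide_distrib sum_divide_distrib by (simp only:)
  qed
  let ?L = "expectation (\<lambda>\<omega>. Y s \<omega> * (?g \<omega> * ((norm (u s (X s \<omega>)))\<^sup>2 / (2 * \<epsilon>))))
      + expectation (\<lambda>\<omega>. Y s \<omega> * ((?g \<omega> * (1 / 2)) * (\<alpha> \<omega> \<bullet> \<alpha> \<omega>))) + expectation (\<lambda>\<omega>. Y s \<omega> * ?t \<omega>)
      + (\<Sum>i\<in>UNIV. expectation (\<lambda>\<omega>. Y s \<omega> * (?D i \<omega> * b (X s \<omega>) $ i)))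
      + (\<Sum>i\<in>UNIV. \<Sum>j\<in>UNIV. expectation (\<lambda>\<omega>. Y s \<omega> * (?H i j \<omega> * (\<beta> i \<omega> \<bullet> \<beta> j \<omega>))))
      + (\<Sum>i\<in>UNIV. expectation (\<lambda>\<omega>. Y s \<omega> * (?D i \<omega> * (\<alpha> \<omega> \<bullet> \<beta> i \<omega>))))"
  have lim: "(\<lambda>n. expectation (\<lambda>\<omega>. Y s \<omega> * main_part s (k n) \<omega> (R n \<omega>) (\<Delta> n \<omega>)) / k n) \<longlonglongrightarrow> ?L"
    unfolding E by (intro tendsto_add tendsto_sum tendsto_const l1(2) l2(2) l4(2) l5(2) l6(2))
  note w = bounded_adapted_weight(4)[OF bounded_adapted_mult]
  note L_sums = integral_sums(2)[OF w[OF dw(1) drift_weights(1)] w[OF half covariance_weights(1)]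
      bounded_adapted_weight(4)[OF dw(2)] w[OF dw(3) drift_weights(2)] w[OF dw(4) covariance_weights(3)]
      w[OF dw(3) covariance_weights(2)]]
  \<comment> \<open>The limits are put back under one expectation and \<open>Y s\<close> is factored
    out; what multiplies it vanishes for each \<open>\<omega>\<close> by
    \<open>generator_terms\<close>.\<close>
  have "?L = 0"
    unfolding L_sums[symmetric] unfolding sum_distrib_left[symmetric] unfolding distrib_left[symmetric]
    unfolding generator_terms by simp
  with lim show "(\<lambda>n. expectation (\<lambda>\<omega>. Y s \<omega> * main_part s (k n) \<omega> (R n \<omega>) (\<Delta> n \<omega>)) / k n) \<longlonglongrightarrow> 0"
    by (simp only:)
qed

section \<open>The remainder of the expansion over one step\<close>

definition residual :: "nat \<Rightarrow> 'a \<Rightarrow> real" where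
  "residual n \<omega> = (exp (R n \<omega>) * \<Phi> (s + k n) (X (s + k n) \<omega>) - \<Phi> s (X s \<omega>)
     - main_part s (k n) \<omega> (R n \<omega>) (\<Delta> n \<omega>)) / k n"

lemma X_path_tendsto: "\<omega> \<in> space M \<Longrightarrow> (\<lambda>n. \<Delta> n \<omega>) \<longlonglongrightarrow> 0"
proof -
  assume "\<omega> \<in> space M"
  then have "continuous_on {t..T} (\<lambda>s. X s \<omega>)" using X by (auto simp: strong_solution_def)
  moreover have "(\<lambda>n. s + k n) \<longlonglongrightarrow> s + 0" by (intro tendsto_intros k_lim)
  ultimately have "(\<lambda>n. X (s + k n) \<omega>) \<longlonglongrightarrow> X s \<omega>"
    using times(1,4) by (intro continuous_on_tendsto_compose[of "{t..T}" "\<lambda>s. X s \<omega>"]) auto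
  then show ?thesis unfolding \<Delta>_def by (rule LIM_zero)
qed

lemma slice_measurable_M:
  fixes f :: "real \<Rightarrow> real^'d \<Rightarrow> 'b::euclidean_space"
  assumes "continuous_on ({0..T} \<times> UNIV) (\<lambda>(s, y). f s y)" "r \<in> {t..T}"
  shows "(\<lambda>\<omega>. f r (X r \<omega>)) \<in> borel_measurable M"
  using slice_measurable[OF assms] by (rule measurable_F_M)

lemma residual_measurable: "residual n \<in> borel_measurable M"
proof -
  have w: "w \<in> borel_measurable M" if "bounded_adapted w" for w
    using that by (auto simp: bounded_adapted_def intro: measurable_F_M)
  note [measurable] = w[OF derivative_weights(1)] w[OF derivative_weights(2)]
    w[OF derivative_weights(3)] w[OF derivative_weights(4)] slice_measurable_M[OF deriv_cont(4) times(4)]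
  show ?thesis unfolding residual_def[abs_def] main_part_expand by measurable
qed

text \<open>The residual is at most \<open>V n\<close> times an error \<open>E n\<close> that is
  uniformly bounded and tends to 0 on each path, since the derivatives of \<Phi> and the paths of X
  are continuous. The weight \<open>V n\<close> is bounded in L2, as
  \<open>remainder_tendsto_0\<close> demands.\<close>

lemma residual_limit:
  shows "integrable M (\<lambda>\<omega>. Y s \<omega> * residual n \<omega>)"
    and "(\<lambda>n. expectation (\<lambda>\<omega>. Y s \<omega> * residual n \<omega>)) \<longlonglongrightarrow> 0"
proof -
  define N where "N = real CARD('d)"
  define V where "V n \<omega> = exp (2 * (\<bar>R n \<omega>\<bar> / sqrt (k n)) + 2 * (\<Sum>i\<in>UNIV. \<bar>\<Delta> n \<omega> $ i\<bar> / sqrt (k n)))" for n \<omega>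
  obtain K\<^sub>V where V: "\<And>n. square_integrable M (V n)" "\<And>n. expectation (\<lambda>\<omega>. (V n \<omega>)\<^sup>2) \<le> K\<^sub>V"
    using diffusive_weight_bound[of \<alpha> R \<beta> "\<lambda>i n \<omega>. \<Delta> n \<omega> $ i", OF diffusive_R diffusive_\<Delta>] unfolding V_def by blast
  obtain K where K: "0 \<le> K" "\<And>\<tau> y. \<tau> \<in> {s..T} \<Longrightarrow> \<bar>\<Phi> \<tau> y\<bar> \<le> K"
    "\<And>\<tau> y. \<tau> \<in> {s..T} \<Longrightarrow> \<bar>time_deriv T \<Phi> \<tau> y\<bar> \<le> K"
    "\<And>\<tau> y. \<tau> \<in> {s..T} \<Longrightarrow> norm (gradient (\<Phi> \<tau>) y) \<le> K" "\<And>\<tau> y. \<tau> \<in> {s..T} \<Longrightarrow> norm (hessian (\<Phi> \<tau>) y) \<le> K"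
    using deriv_bounds[OF times(3,2)] by blast
  have "\<exists>\<theta>\<in>{s..s + k n}. \<exists>\<theta>'\<in>{0..1}. \<bar>residual n \<omega>\<bar> \<le> V n \<omega> * (14 * N * K * sqrt (k n)
      + \<bar>time_deriv T \<Phi> \<theta> (X s \<omega> + \<Delta> n \<omega>) - time_deriv T \<Phi> s (X s \<omega>)\<bar>
      + N * norm (hessian (\<Phi> s) (X s \<omega> + \<theta>' *\<^sub>R \<Delta> n \<omega>) - hessian (\<Phi> s) (X s \<omega>)))" for n \<omega>
  proof -
    have eq: "k n * \<bar>residual n \<omega>\<bar> = \<bar>exp (R n \<omega>) * \<Phi> (s + k n) (X s \<omega> + \<Delta> n \<omega>) - \<Phi> s (X s \<omega>)
      - main_part s (k n) \<omega> (R n \<omega>) (\<Delta> n \<omega>)\<bar>"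
      using k_pos[of n] by (simp add: residual_def \<Delta>_def abs_divide)
    have "\<exists>\<theta>\<in>{s..s + k n}. \<exists>\<theta>'\<in>{0..1}. k n * \<bar>residual n \<omega>\<bar> \<le> k n * V n \<omega> * (14 * N * K * sqrt (k n)
      + \<bar>time_deriv T \<Phi> \<theta> (X s \<omega> + \<Delta> n \<omega>) - time_deriv T \<Phi> s (X s \<omega>)\<bar>
      + N * norm (hessian (\<Phi> s) (X s \<omega> + \<theta>' *\<^sub>R \<Delta> n \<omega>) - hessian (\<Phi> s) (X s \<omega>)))"
      unfolding eq main_part_def Let_def V_def N_def
      by (rule weighted_expansion_error[OF C12 less_imp_le[OF times(3)] order_refl k_pos k_le_1 k_le K(2-5)])
    then show ?thesis using k_pos[of n] by (simp add: mult.assoc)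
  qed
  \<comment> \<open>The intermediate points are chosen for each \<open>n\<close> and
    \<open>\<omega>\<close>, with no claim of measurability. \<open>E\<close> therefore appears only
    in pointwise bounds, and what is integrated is the residual and \<open>V n\<close>.\<close>
  then obtain \<theta> \<theta>' where \<theta>: "\<And>n \<omega>. \<theta> n \<omega> \<in> {s..s + k n}" "\<And>n \<omega>. \<theta>' n \<omega> \<in> {0..1}"
    and res: "\<And>n \<omega>. \<bar>residual n \<omega>\<bar> \<le> V n \<omega> * (14 * N * K * sqrt (k n)
      + \<bar>time_deriv T \<Phi> (\<theta> n \<omega>) (X s \<omega> + \<Delta> n \<omega>) - time_deriv T \<Phi> s (X s \<omega>)\<bar>
      + N * norm (hessian (\<Phi> s) (X s \<omega> + \<theta>' n \<omega> *\<^sub>R \<Delta> n \<omega>) - hessian (\<Phi> s) (X s \<omega>)))"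
    by metis
  define E where "E n \<omega> = 14 * N * K * sqrt (k n)
      + \<bar>time_deriv T \<Phi> (\<theta> n \<omega>) (X s \<omega> + \<Delta> n \<omega>) - time_deriv T \<Phi> s (X s \<omega>)\<bar>
      + N * norm (hessian (\<Phi> s) (X s \<omega> + \<theta>' n \<omega> *\<^sub>R \<Delta> n \<omega>) - hessian (\<Phi> s) (X s \<omega>))" for n \<omega>
  have sT: "s \<in> {s..T}" "\<theta> n \<omega> \<in> {s..T}" "\<theta> n \<omega> \<in> {0..T}" for n \<omega>
    using times(2,3) \<theta>(1)[of n \<omega>] k_le[of n] by auto
  have Vpos: "0 < V n \<omega>" for n \<omega> by (simp add: V_def)
  have E_bound: "E n \<omega> \<le> 14 * N * K + 2 * K + N * (2 * K)" for n \<omega>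
  proof -
    have "sqrt (k n) \<le> 1" using k_le_1[of n] by simp
    then have "14 * N * K * sqrt (k n) \<le> 14 * N * K * 1"
      using K(1) by (intro mult_left_mono) (auto simp: N_def)
    moreover have "\<bar>time_deriv T \<Phi> (\<theta> n \<omega>) (X s \<omega> + \<Delta> n \<omega>) - time_deriv T \<Phi> s (X s \<omega>)\<bar> \<le> 2 * K"
      using K(3)[OF sT(2)[of n \<omega>], of "X s \<omega> + \<Delta> n \<omega>"] K(3)[OF sT(1), of "X s \<omega>"] by linarith
    moreover have "norm (hessian (\<Phi> s) (X s \<omega> + \<theta>' n \<omega> *\<^sub>R \<Delta> n \<omega>) - hessian (\<Phi> s) (X s \<omega>)) \<le> 2 * K"
      using K(5)[OF sT(1), of "X s \<omega> + \<theta>' n \<omega> *\<^sub>R \<Delta> n \<omega>"] K(5)[OF sT(1), of "X s \<omega>"]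
      by (intro order_trans[OF norm_triangle_ineq4]) linarith
    then have "N * norm (hessian (\<Phi> s) (X s \<omega> + \<theta>' n \<omega> *\<^sub>R \<Delta> n \<omega>) - hessian (\<Phi> s) (X s \<omega>)) \<le> N * (2 * K)"
      by (intro mult_left_mono) (auto simp: N_def)
    ultimately show ?thesis unfolding E_def by linarith
  qed
  have E_lim: "(\<lambda>n. E n \<omega>) \<longlonglongrightarrow> 0" if \<omega>: "\<omega> \<in> space M" for \<omega>
  proof -
    have \<theta>_lim: "(\<lambda>n. \<theta> n \<omega>) \<longlonglongrightarrow> s"
    proof (rule tendsto_sandwich[of "\<lambda>_. s" _ _ "\<lambda>n. s + k n"])
      have "(\<lambda>n. s + k n) \<longlonglongrightarrow> s + 0" by (intro tendsto_intros k_lim)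
      then show "(\<lambda>n. s + k n) \<longlonglongrightarrow> s" by simp
    qed (use \<theta>(1) in auto)
    have X1: "(\<lambda>n. X s \<omega> + \<Delta> n \<omega>) \<longlonglongrightarrow> X s \<omega> + 0" by (intro tendsto_intros X_path_tendsto \<omega>)
    have "(\<lambda>n. \<theta>' n \<omega> *\<^sub>R \<Delta> n \<omega>) \<longlonglongrightarrow> 0"
    proof (rule Lim_null_comparison)
      show "(\<lambda>n. norm (\<Delta> n \<omega>)) \<longlonglongrightarrow> 0" using X_path_tendsto[OF \<omega>] by (rule tendsto_norm_zero)
      show "eventually (\<lambda>n. norm (\<theta>' n \<omega> *\<^sub>R \<Delta> n \<omega>) \<le> norm (\<Delta> n \<omega>)) sequentially"
        using \<theta>(2)[of _ \<omega>] by (auto simp: mult_left_le_one_le)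
    qed
    then have X2: "(\<lambda>n. X s \<omega> + \<theta>' n \<omega> *\<^sub>R \<Delta> n \<omega>) \<longlonglongrightarrow> X s \<omega> + 0" by (intro tendsto_intros)
    have comp: "(\<lambda>n. f (p n) (q n)) \<longlonglongrightarrow> f s y"
      if f: "continuous_on ({0..T} \<times> UNIV) (\<lambda>(s, y). f s y)" and p: "p \<longlonglongrightarrow> s" "\<And>n. p n \<in> {0..T}" and q: "q \<longlonglongrightarrow> y"
      for f :: "real \<Rightarrow> real^'d \<Rightarrow> 'b::topological_space" and p q y
    proof -
      have "(\<lambda>n. (\<lambda>(s, y). f s y) (p n, q n)) \<longlonglongrightarrow> (\<lambda>(s, y). f s y) (s, y)"
        by (rule continuous_on_tendsto_compose[OF f tendsto_Pair[OF p(1) q]]) (use p(2) times(5) in auto)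
      then show ?thesis by simp
    qed
    have "(\<lambda>n. time_deriv T \<Phi> (\<theta> n \<omega>) (X s \<omega> + \<Delta> n \<omega>)) \<longlonglongrightarrow> time_deriv T \<Phi> s (X s \<omega>)"
      using comp[of "time_deriv T \<Phi>", OF deriv_cont(1) \<theta>_lim sT(3) X1] by simp
    moreover have "(\<lambda>n. hessian (\<Phi> s) (X s \<omega> + \<theta>' n \<omega> *\<^sub>R \<Delta> n \<omega>)) \<longlonglongrightarrow> hessian (\<Phi> s) (X s \<omega>)"
      using comp[of "\<lambda>s. hessian (\<Phi> s)" "\<lambda>_. s", OF deriv_cont(3) tendsto_const times(5) X2] by simp
    ultimately have "(\<lambda>n. E n \<omega>) \<longlonglongrightarrow> 14 * N * K * sqrt 0 + \<bar>time_deriv T \<Phi> s (X s \<omega>) - time_deriv T \<Phi> s (X s \<omega>)\<bar>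
        + N * norm (hessian (\<Phi> s) (X s \<omega>) - hessian (\<Phi> s) (X s \<omega>))"
      unfolding E_def by (intro tendsto_intros k_lim)
    then show ?thesis by simp
  qed
  have res': "\<bar>residual n \<omega>\<bar> \<le> V n \<omega> * E n \<omega>" for n \<omega> using res unfolding E_def .
  have si: "square_integrable M (Y s)"
    using weight(2)[OF times(1), of "\<lambda>_. 1" 1] by simp
  have le: "\<bar>residual n \<omega>\<bar> \<le> (14 * N * K + 2 * K + N * (2 * K)) * V n \<omega>" for n \<omega>
  proof -
    have "V n \<omega> * E n \<omega> \<le> V n \<omega> * (14 * N * K + 2 * K + N * (2 * K))"
      using Vpos[of n \<omega>] by (intro mult_left_mono E_bound) simp
    with res'[of n \<omega>] show ?thesis by (simp only: mult.commute[of "V n \<omega>"])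
  qed
  have lim: "(\<lambda>n. residual n \<omega> / V n \<omega>) \<longlonglongrightarrow> 0" if \<omega>: "\<omega> \<in> space M" for \<omega>
  proof (rule Lim_null_comparison[OF _ E_lim[OF \<omega>]], rule always_eventually, rule allI)
    fix n
    have "\<bar>residual n \<omega>\<bar> / V n \<omega> \<le> E n \<omega>"
      using res'[of n \<omega>] Vpos[of n \<omega>] by (simp only: pos_divide_le_eq mult.commute)
    then show "norm (residual n \<omega> / V n \<omega>) \<le> E n \<omega>" using Vpos[of n \<omega>] by (simp add: abs_divide)
  qed
  show "integrable M (\<lambda>\<omega>. Y s \<omega> * residual n \<omega>)" "(\<lambda>n. expectation (\<lambda>\<omega>. Y s \<omega> * residual n \<omega>)) \<longlonglongrightarrow> 0"
    by (rule remainder_tendsto_0[OF si residual_measurable V Vpos le lim]; assumption)+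
qed

text \<open>Almost everywhere the new value is the old one plus \<open>Y s\<close> times the main
  part plus \<open>k n\<close> times \<open>Y s\<close> times the residual; after division by
  \<open>k n\<close> both contributions have limit 0.\<close>

lemma one_step_limit:
  "(\<lambda>n. (expectation (\<lambda>\<omega>. Y (s + k n) \<omega> * \<Phi> (s + k n) (X (s + k n) \<omega>))
     - expectation (\<lambda>\<omega>. Y s \<omega> * \<Phi> s (X s \<omega>))) / k n) \<longlonglongrightarrow> 0"
proof -
  have "(expectation (\<lambda>\<omega>. Y (s + k n) \<omega> * \<Phi> (s + k n) (X (s + k n) \<omega>)) - expectation (\<lambda>\<omega>. Y s \<omega> * \<Phi> s (X s \<omega>))) / k n
     = expectation (\<lambda>\<omega>. Y s \<omega> * residual n \<omega>) + expectation (\<lambda>\<omega>. Y s \<omega> * main_part s (k n) \<omega> (R n \<omega>) (\<Delta> n \<omega>)) / k n" for n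
  proof -
    let ?m = "\<lambda>\<omega>. Y s \<omega> * main_part s (k n) \<omega> (R n \<omega>) (\<Delta> n \<omega>)"
      and ?r = "\<lambda>\<omega>. k n * (Y s \<omega> * residual n \<omega>)" and ?p = "\<lambda>\<omega>. Y s \<omega> * \<Phi> s (X s \<omega>)"
    note [measurable] = Y_measurable[OF times(1)] Y_measurable[OF times(4)[of n]]
      slice_measurable_M[OF deriv_cont(4) times(4)[of n]] slice_measurable_M[OF deriv_cont(4) times(1)]
    have int: "integrable M ?m" "integrable M ?r" "integrable M ?p"
      using main_part_limit(1) residual_limit(1) bounded_adapted_weight(4)[OF derivative_weights(1)] by auto
    have split: "Y s \<omega> * exp (R n \<omega>) * \<Phi> (s + k n) (X (s + k n) \<omega>) = ?p \<omega> + ?m \<omega> + ?r \<omega>" for \<omega>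
    proof -
      have "k n * residual n \<omega> = exp (R n \<omega>) * \<Phi> (s + k n) (X (s + k n) \<omega>) - \<Phi> s (X s \<omega>)
         - main_part s (k n) \<omega> (R n \<omega>) (\<Delta> n \<omega>)"
        using k_pos[of n] by (simp add: residual_def)
      then have "exp (R n \<omega>) * \<Phi> (s + k n) (X (s + k n) \<omega>)
          = \<Phi> s (X s \<omega>) + main_part s (k n) \<omega> (R n \<omega>) (\<Delta> n \<omega>) + k n * residual n \<omega>"
        by linarith
      then have "Y s \<omega> * (exp (R n \<omega>) * \<Phi> (s + k n) (X (s + k n) \<omega>)) = ?p \<omega> + ?m \<omega> + Y s \<omega> * (k n * residual n \<omega>)"
        by (simp only: distrib_left)
      then show ?thesis by (simp only: mult.assoc mult.left_commute[of "k n"])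
    qed
    have "expectation (\<lambda>\<omega>. Y (s + k n) \<omega> * \<Phi> (s + k n) (X (s + k n) \<omega>)) = expectation (\<lambda>\<omega>. ?p \<omega> + ?m \<omega> + ?r \<omega>)"
    proof (rule integral_cong_AE)
      show "AE \<omega> in M. Y (s + k n) \<omega> * \<Phi> (s + k n) (X (s + k n) \<omega>) = ?p \<omega> + ?m \<omega> + ?r \<omega>"
        using Y_step[of n] by eventually_elim (simp only: split)
      show "(\<lambda>\<omega>. ?p \<omega> + ?m \<omega> + ?r \<omega>) \<in> borel_measurable M"
        using int by (intro borel_measurable_add) auto
    qed measurable
    also have "\<dots> = expectation ?p + expectation ?m + expectation ?r"
      by (simp only: Bochner_Integration.integral_add Bochner_Integration.integrable_add int)
    finally show ?thesis using k_pos[of n] by (simp add: add_divide_distrib)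
  qed
  moreover have "(\<lambda>n. expectation (\<lambda>\<omega>. Y s \<omega> * residual n \<omega>)
      + expectation (\<lambda>\<omega>. Y s \<omega> * main_part s (k n) \<omega> (R n \<omega>) (\<Delta> n \<omega>)) / k n) \<longlonglongrightarrow> 0 + 0"
    by (intro tendsto_add residual_limit(2) main_part_limit(2))
  ultimately show ?thesis by simp
qed

end


section \<open>The weighted expectation is constant\<close>

text \<open>For any slope e > 0, the set of s with |f s - f c| \<le> e (s - c) is closed, so it
  contains its supremum m. If m < b, every later point would have a difference quotient from m of
  absolute value above e, against the right derivative 0 at m. The start c > a keeps m inside the
  interval; continuity then lets c tend to a.\<close>

lemma constant_if_right_derivative_zero:
  fixes f :: "real \<Rightarrow> real"
  assumes ab: "a \<le> b" and cont: "continuous_on {a..b} f"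
    and der: "\<And>s k. a < s \<Longrightarrow> s < b \<Longrightarrow> (\<And>n. 0 < k n) \<Longrightarrow> (\<And>n. s + k n \<le> b) \<Longrightarrow> (\<And>n. k n \<le> 1) \<Longrightarrow> k \<longlonglongrightarrow> 0
      \<Longrightarrow> (\<lambda>n::nat. (f (s + k n) - f s) / k n) \<longlonglongrightarrow> 0"
  shows "f b = f a"
proof (cases "a = b")
  case False
  with ab have "a < b" by simp
  have bound: "\<bar>f b - f c\<bar> \<le> e * (b - c)" if c: "a < c" "c < b" and e: "0 < e" for c e
  proof -
    define S where "S = {s\<in>{c..b}. \<bar>f s - f c\<bar> \<le> e * (s - c)}"
    have contc: "continuous_on {c..b} f" using c by (intro continuous_on_subset[OF cont]) auto
    have "closed S"
      unfolding S_def by (intro continuous_on_closed_Collect_le continuous_intros contc)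
    moreover have S: "c \<in> S" "bdd_above S" using c by (auto simp: S_def intro!: bdd_aboveI[of _ b])
    ultimately have m: "Sup S \<in> S" by (intro closed_contains_Sup) auto
    define m where "m = Sup S"
    have mS: "m \<in> {c..b}" "\<bar>f m - f c\<bar> \<le> e * (m - c)" using m by (auto simp: S_def m_def)
    have "m = b"
    proof (rule ccontr)
      assume "m \<noteq> b"
      then have mb: "m < b" using mS by simp
      have far: "e * (s - m) < \<bar>f s - f m\<bar>" if s: "m < s" "s \<le> b" for s
      proof (rule ccontr)
        assume "\<not> ?thesis"
        then have "\<bar>f s - f c\<bar> \<le> e * (s - m) + e * (m - c)" using mS(2) by linarith
        then have "s \<in> S" using s mS(1) by (simp add: S_def algebra_simps)
        then have "s \<le> m" unfolding m_def using S(2) by (rule cSup_upper)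
        then show False using s by simp
      qed
      \<comment> \<open>The minimum secures both \<open>k n \<le> 1\<close> and
        \<open>m + k n \<le> b\<close>.\<close>
      define k where "k n = min 1 (b - m) * inverse (real (Suc n))" for n
      have kpos: "0 < k n" for n using mb by (simp add: k_def)
      have "inverse (real (Suc n)) \<le> 1" for n by (simp add: inverse_le_1_iff)
      then have "k n \<le> min 1 (b - m) * 1" for n
        unfolding k_def using mb by (intro mult_left_mono) auto
      then have kle: "m + k n \<le> b" "k n \<le> 1" for n by (simp_all add: le_diff_eq algebra_simps)
      have "(\<lambda>n. min 1 (b - m) * inverse (real (Suc n))) \<longlonglongrightarrow> min 1 (b - m) * 0"
        by (intro tendsto_intros LIMSEQ_inverse_real_of_nat)
      then have "k \<longlonglongrightarrow> 0" unfolding k_def by simp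
      then have "(\<lambda>n. (f (m + k n) - f m) / k n) \<longlonglongrightarrow> 0"
        using c mS(1) mb by (intro der kpos kle) auto
      then have "eventually (\<lambda>n. dist ((f (m + k n) - f m) / k n) 0 < e) sequentially"
        using e by (rule tendstoD)
      then obtain n where "\<bar>(f (m + k n) - f m) / k n\<bar> < e" by (auto simp: eventually_sequentially)
      then have "\<bar>f (m + k n) - f m\<bar> < e * k n" using kpos[of n] by (simp add: abs_divide pos_divide_less_eq)
      with far[of "m + k n"] kpos[of n] kle(1)[of n] show False by simp
    qed
    with mS show ?thesis by simp
  qed
  have eq: "f b = f c" if c: "a < c" "c < b" for c
  proof (rule ccontr)
    assume "f b \<noteq> f c"
    \<comment> \<open>With this slope the bound says that |f b - f c| is at most half of
      itself.\<close>
    then have "0 < \<bar>f b - f c\<bar> / (2 * (b - c))" using c by simp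
    moreover have "v / (2 * d) * d = v / 2" if "0 < d" for v d :: real using that by simp
    ultimately have "\<bar>f b - f c\<bar> \<le> \<bar>f b - f c\<bar> / 2" using bound[OF c] c by (metis diff_gt_0_iff_gt)
    with \<open>f b \<noteq> f c\<close> show False by simp
  qed
  \<comment> \<open>The shift to \<open>Suc (Suc n)\<close> keeps the points strictly below
    \<open>b\<close>, already for n = 0.\<close>
  have "(\<lambda>n. a + (b - a) * inverse (real (Suc (Suc n)))) \<longlonglongrightarrow> a + (b - a) * 0"
    by (intro tendsto_intros LIMSEQ_Suc[OF LIMSEQ_inverse_real_of_nat])
  moreover have in_ab: "a + (b - a) * inverse (real (Suc (Suc n))) \<in> {a<..<b}" for n
  proof -
    have "(b - a) * inverse (real (Suc (Suc n))) < (b - a) * 1"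
      using \<open>a < b\<close> by (intro mult_strict_left_mono) (simp_all add: inverse_less_1_iff)
    then show ?thesis using \<open>a < b\<close> by (simp add: algebra_simps)
  qed
  ultimately have "(\<lambda>n. f (a + (b - a) * inverse (real (Suc (Suc n))))) \<longlonglongrightarrow> f a"
    using ab by (intro continuous_on_tendsto_compose[OF cont]) (auto simp: less_imp_le)
  moreover have "f b = f (a + (b - a) * inverse (real (Suc (Suc n))))" for n
    using in_ab[of n] by (intro eq) auto
  ultimately have "(\<lambda>n::nat. f b) \<longlonglongrightarrow> f a" by (simp only:)
  then show ?thesis by (simp add: LIMSEQ_const_iff)
qed simp

text \<open>Follows from 1 - exp (q - p) \<le> p - q; adding both exponentials makes the bound
  symmetric. It turns mean square control of log Y into L1 control of Y.\<close>

lemma exp_diff_abs_le: "\<bar>exp p - exp q\<bar> \<le> \<bar>p - q\<bar> * (exp p + exp q)" for p q :: real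
proof -
  have *: "exp p - exp q \<le> (p - q) * (exp p + exp q)" if "q \<le> p" for p q :: real
  proof -
    have "exp p * (1 - exp (q - p)) \<le> exp p * (p - q)"
      using exp_ge_add_one_self[of "q - p"] by (intro mult_left_mono) (linarith | simp)+
    moreover have "exp p * (1 - exp (q - p)) = exp p - exp q" by (simp add: right_diff_distrib exp_diff)
    moreover have "0 \<le> (p - q) * exp q" using that by simp
    moreover have "(p - q) * (exp p + exp q) = exp p * (p - q) + (p - q) * exp q"
      by (simp only: distrib_left mult.commute)
    ultimately show ?thesis by linarith
  qed
  from *[of p q] *[of q p] show ?thesis by (cases "q \<le> p") (auto simp: add.commute)
qed

section \<open>Time continuity of the weighted expectation\<close>

context feynman_kac
begin

definition log_Y :: "real \<Rightarrow> 'a \<Rightarrow> real" where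
  "log_Y s \<omega> = A\<^sub>u s \<omega> / (2 * \<epsilon>) - J\<^sub>u s \<omega> / sqrt \<epsilon>"

lemma J\<^sub>u_measurable: "s \<in> {t..T} \<Longrightarrow> J\<^sub>u s \<in> borel_measurable M"
  using has_ito_J\<^sub>u[of s] by (simp add: has_ito_integral_def)

lemma log_Y_measurable: "s \<in> {t..T} \<Longrightarrow> log_Y s \<in> borel_measurable M"
  unfolding log_Y_def[abs_def] using measurable_F_M[OF A\<^sub>u_measurable_F] J\<^sub>u_measurable by auto

text \<open>The drift contributes the square of the time difference, reduced to first order by a
  factor T; the stochastic part contributes 4 C^2 / \<epsilon> per unit of time. Both factors 2 in
  \<open>c\<close> come from the squared triangle inequality.\<close>

lemma log_Y_increment:
  assumes s: "s \<in> {t..T}" "s' \<in> {t..T}"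
  defines "c \<equiv> 2 * ((C\<^sup>2 / (2 * \<epsilon>))\<^sup>2 * T) + 2 * (1 / \<epsilon> * (4 * C\<^sup>2))"
  shows "mean_square M (\<lambda>\<omega>. log_Y s' \<omega> - log_Y s \<omega>) \<le> ennreal (c * \<bar>s' - s\<bar>)"
proof -
  have less: "mean_square M (\<lambda>\<omega>. log_Y s' \<omega> - log_Y s \<omega>) \<le> ennreal (c * (s' - s))"
    if s: "t \<le> s" "s < s'" "s' \<le> T" for s s'
  proof -
    have in_tT: "s \<in> {t..T}" "s' \<in> {t..T}" using s by auto
    obtain J where J: "has_ito_integral M W s s' (\<lambda>r \<omega>. u r (X r \<omega>)) J" "AE \<omega> in M. J\<^sub>u s' \<omega> = J\<^sub>u s \<omega> + J \<omega>"
      by (rule increment_representation[OF s]) blast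
    have Jm [measurable]: "J \<in> borel_measurable M" using J(1) by (simp add: has_ito_integral_def)
    note [measurable] = measurable_F_M[OF A\<^sub>u_measurable_F[OF in_tT(1)]] measurable_F_M[OF A\<^sub>u_measurable_F[OF in_tT(2)]]
    have tame: "tame s s' C (\<lambda>r \<omega>. u r (X r \<omega>))" using s by (intro tame_subinterval[OF tame_u]) auto
    let ?a = "\<lambda>\<omega>. (A\<^sub>u s' \<omega> - A\<^sub>u s \<omega>) / (2 * \<epsilon>)" and ?j = "\<lambda>\<omega>. J \<omega> / sqrt \<epsilon>"
    have "mean_square M (\<lambda>\<omega>. log_Y s' \<omega> - log_Y s \<omega>) = mean_square M (\<lambda>\<omega>. ?a \<omega> - ?j \<omega>)"
    proof (rule mean_square_cong_AE, use J(2) in eventually_elim)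
      case (elim \<omega>)
      then show ?case by (simp add: log_Y_def add_divide_distrib diff_divide_distrib)
    qed
    also have "\<dots> \<le> 2 * mean_square M ?a + 2 * mean_square M ?j"
      by (rule mean_square_diff_le; measurable)
    also have "\<dots> \<le> 2 * ennreal ((C\<^sup>2 / (2 * \<epsilon>))\<^sup>2 * T * (s' - s)) + 2 * ennreal (1 / \<epsilon> * (4 * C\<^sup>2) * (s' - s))"
    proof (intro add_mono mult_left_mono)
      have "mean_square M ?a \<le> (\<integral>\<^sup>+\<omega>. ennreal ((C\<^sup>2 / (2 * \<epsilon>))\<^sup>2 * T * (s' - s)) \<partial>M)"
        unfolding mean_square_def
      proof (rule nn_integral_mono, rule ennreal_leI)
        fix \<omega> assume \<omega>: "\<omega> \<in> space M"
        have path: "continuous_on {t..s'} (\<lambda>r. (norm (u r (X r \<omega>)))\<^sup>2)"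
          using s by (intro continuous_on_subset[OF norm_u_path[OF \<omega>]]) auto
        have "A\<^sub>u s' \<omega> - A\<^sub>u s \<omega> = (LBINT r:{s..s'}. (norm (u r (X r \<omega>)))\<^sup>2)"
          unfolding A\<^sub>u_def using s by (subst LBINT_combine[of t s s', OF _ _ path]) auto
        also have "norm \<dots> \<le> C\<^sup>2 * (s' - s)"
        proof (rule norm_LBINT_le)
          show "continuous_on {s..s'} (\<lambda>r. (norm (u r (X r \<omega>)))\<^sup>2)"
            using s by (intro continuous_on_subset[OF path]) auto
          show "norm ((norm (u r (X r \<omega>)))\<^sup>2) \<le> C\<^sup>2" if "r \<in> {s..s'}" for r
            using that s by (intro norm_u_bound) auto
        qed (use s in simp)
        finally have "\<bar>?a \<omega>\<bar> \<le> C\<^sup>2 / (2 * \<epsilon>) * (s' - s)"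
          using \<epsilon> by (simp add: abs_divide divide_right_mono)
        then have "\<bar>?a \<omega>\<bar>\<^sup>2 \<le> (C\<^sup>2 / (2 * \<epsilon>) * (s' - s))\<^sup>2" by (intro power_mono) auto
        also have "\<dots> = (C\<^sup>2 / (2 * \<epsilon>))\<^sup>2 * ((s' - s) * (s' - s))" by (simp only: power_mult_distrib power2_eq_square[of "s' - s"])
        also have "\<dots> \<le> (C\<^sup>2 / (2 * \<epsilon>))\<^sup>2 * (T * (s' - s))"
          using s t by (intro mult_left_mono mult_right_mono) auto
        finally show "(norm (?a \<omega>))\<^sup>2 \<le> (C\<^sup>2 / (2 * \<epsilon>))\<^sup>2 * T * (s' - s)" by (simp add: mult.assoc)
      qed
      then show "mean_square M ?a \<le> ennreal ((C\<^sup>2 / (2 * \<epsilon>))\<^sup>2 * T * (s' - s))" by (simp add: emeasure_space_1)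
      have "mean_square M ?j = ennreal (1 / \<epsilon>) * mean_square M J"
        using \<epsilon> by (subst mean_square_divide) auto
      also have "\<dots> \<le> ennreal (1 / \<epsilon>) * ennreal (4 * (C\<^sup>2 * (s' - s)))"
        by (intro mult_left_mono ito_mean_square_le[OF tame J(1)]) auto
      also have "\<dots> = ennreal (1 / \<epsilon> * (4 * C\<^sup>2) * (s' - s))"
        using \<epsilon> s by (simp add: ennreal_mult[symmetric] mult.assoc)
      finally show "mean_square M ?j \<le> ennreal (1 / \<epsilon> * (4 * C\<^sup>2) * (s' - s))" .
    qed auto
    also have "\<dots> = ennreal (2 * ((C\<^sup>2 / (2 * \<epsilon>))\<^sup>2 * T * (s' - s)) + 2 * (1 / \<epsilon> * (4 * C\<^sup>2) * (s' - s)))"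
    proof -
      have "2 * ennreal v + 2 * ennreal w = ennreal (2 * v + 2 * w)" if "0 \<le> v" "0 \<le> w" for v w
        using that by (simp add: ennreal_mult ennreal_plus)
      then show ?thesis using s t \<epsilon> by simp
    qed
    also have "2 * ((C\<^sup>2 / (2 * \<epsilon>))\<^sup>2 * T * (s' - s)) + 2 * (1 / \<epsilon> * (4 * C\<^sup>2) * (s' - s)) = c * (s' - s)"
      by (simp only: c_def distrib_right mult.assoc)
    finally show ?thesis .
  qed
  consider "s < s'" | "s = s'" | "s' < s" by linarith
  then show ?thesis
  proof cases
    case 1
    with less[of s s'] s show ?thesis by simp
  next
    case 3
    with less[of s' s] s show ?thesis by (subst mean_square_commute) simp
  qed (simp add: mean_square_def)
qed

lemma Y_exp_log_Y: "Y s \<omega> = exp (log_Y s \<omega>)"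
  by (simp add: Y_def log_Y_def)

text \<open>This takes the place of path continuity of \<open>Y\<close>. The difference is bounded
  by the increment of log Y, which tends to 0 in L2, times a sum of two values of \<open>Y\<close>,
  which is bounded in L2; Cauchy-Schwarz finishes.\<close>

lemma Y_mean_continuous:
  assumes s: "s \<in> {t..T}" and p: "\<And>n. p n \<in> {t..T}" "p \<longlonglongrightarrow> s"
  shows "(\<lambda>n. expectation (\<lambda>\<omega>. \<bar>Y (p n) \<omega> - Y s \<omega>\<bar>)) \<longlonglongrightarrow> 0"
proof -
  define c where "c = 2 * ((C\<^sup>2 / (2 * \<epsilon>))\<^sup>2 * T) + 2 * (1 / \<epsilon> * (4 * C\<^sup>2))"
  note [measurable] = log_Y_measurable[OF s] log_Y_measurable[OF p(1)] Y_measurable[OF s] Y_measurable[OF p(1)]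
  let ?f = "\<lambda>n \<omega>. \<bar>log_Y (p n) \<omega> - log_Y s \<omega>\<bar>" and ?g = "\<lambda>n \<omega>. Y (p n) \<omega> + Y s \<omega>"
  have c: "0 \<le> c" using t \<epsilon> by (simp add: c_def)
  have ms: "mean_square M (?f n) \<le> ennreal (c * \<bar>p n - s\<bar>)" for n
    using log_Y_increment[OF s p(1)] by (simp add: mean_square_def c_def)
  have f: "square_integrable M (?f n)" for n
    using le_less_trans[OF ms[of n], of \<infinity>] by (simp add: square_integrable_iff_mean_square)
  have f_le: "expectation (\<lambda>\<omega>. (?f n \<omega>)\<^sup>2) \<le> c * \<bar>p n - s\<bar>" for n
    using ms[of n] c unfolding mean_square_eq_integral[OF f] by (subst (asm) ennreal_le_iff) auto
  have f_lim: "(\<lambda>n. expectation (\<lambda>\<omega>. (?f n \<omega>)\<^sup>2)) \<longlonglongrightarrow> 0"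
  proof (rule Lim_null_comparison)
    have "(\<lambda>n. c * \<bar>p n - s\<bar>) \<longlonglongrightarrow> c * \<bar>s - s\<bar>" by (intro tendsto_intros p(2))
    then show "(\<lambda>n. c * \<bar>p n - s\<bar>) \<longlonglongrightarrow> 0" by simp
    show "eventually (\<lambda>n. norm (expectation (\<lambda>\<omega>. (?f n \<omega>)\<^sup>2)) \<le> c * \<bar>p n - s\<bar>) sequentially"
      using f_le by simp
  qed
  obtain K where K: "\<And>s. s \<in> {t..T} \<Longrightarrow> integrable M (\<lambda>\<omega>. (Y s \<omega>)^2)" "\<And>s. s \<in> {t..T} \<Longrightarrow> expectation (\<lambda>\<omega>. (Y s \<omega>)^2) \<le> K"
    using Y_power_integral[of 2] by blast
  have Ysi: "square_integrable M (Y s)" if "s \<in> {t..T}" for s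
    using K(1)[OF that] Y_measurable[OF that] by (simp add: square_integrable_def)
  have g: "square_integrable M (?g n)" for n using Ysi[OF s] Ysi[OF p(1)] by (rule square_integrable_add[rotated])
  have g_le: "expectation (\<lambda>\<omega>. (?g n \<omega>)\<^sup>2) \<le> 2 * K + 2 * K" for n
  proof -
    have "expectation (\<lambda>\<omega>. (?g n \<omega>)\<^sup>2) \<le> expectation (\<lambda>\<omega>. 2 * (Y (p n) \<omega>)\<^sup>2 + 2 * (Y s \<omega>)\<^sup>2)"
    proof (rule integral_mono)
      show "integrable M (\<lambda>\<omega>. (?g n \<omega>)\<^sup>2)" using g[of n] by (simp add: square_integrable_def)
      show "integrable M (\<lambda>\<omega>. 2 * (Y (p n) \<omega>)\<^sup>2 + 2 * (Y s \<omega>)\<^sup>2)" using K(1)[OF s] K(1)[OF p(1)] by simp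
      show "(?g n \<omega>)\<^sup>2 \<le> 2 * (Y (p n) \<omega>)\<^sup>2 + 2 * (Y s \<omega>)\<^sup>2" for \<omega>
        using norm_add_square_le[of "Y (p n) \<omega>" "Y s \<omega>"] by simp
    qed
    also have "\<dots> \<le> 2 * K + 2 * K" using K(1)[OF s] K(1)[OF p(1)] K(2)[OF s] K(2)[OF p(1), of n] by simp
    finally show ?thesis .
  qed
  show ?thesis
  proof (rule Lim_null_comparison[OF _ integral_mult_tendsto_0[OF f g f_lim g_le]], rule always_eventually, rule allI)
    fix n
    have "expectation (\<lambda>\<omega>. \<bar>Y (p n) \<omega> - Y s \<omega>\<bar>) \<le> expectation (\<lambda>\<omega>. ?f n \<omega> * ?g n \<omega>)"
    proof (rule integral_mono)
      show "integrable M (\<lambda>\<omega>. \<bar>Y (p n) \<omega> - Y s \<omega>\<bar>)"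
        by (intro integrable_abs Bochner_Integration.integrable_diff square_integrable_integrable Ysi s p)
      show "integrable M (\<lambda>\<omega>. ?f n \<omega> * ?g n \<omega>)" using integrable_inner[OF f g, of n n] by simp
      show "\<bar>Y (p n) \<omega> - Y s \<omega>\<bar> \<le> ?f n \<omega> * ?g n \<omega>" for \<omega>
        unfolding Y_exp_log_Y by (rule exp_diff_abs_le)
    qed
    then show "norm (expectation (\<lambda>\<omega>. \<bar>Y (p n) \<omega> - Y s \<omega>\<bar>)) \<le> expectation (\<lambda>\<omega>. ?f n \<omega> * ?g n \<omega>)" by simp
  qed
qed

definition mean_value :: "real \<Rightarrow> real" where
  "mean_value s = expectation (\<lambda>\<omega>. Y s \<omega> * \<Phi> s (X s \<omega>))"

lemma \<Phi>_measurable: "s \<in> {t..T} \<Longrightarrow> (\<lambda>\<omega>. \<Phi> s (X s \<omega>)) \<in> borel_measurable M"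
  using slice_measurable[OF deriv_cont(4)] by (rule measurable_F_M)

lemma Y_integrable: "s \<in> {t..T} \<Longrightarrow> integrable M (Y s)"
  using weight(4)[of s "\<lambda>_. 1" 1] by simp

text \<open>The difference is (Y(p) - Y(s)) \<Phi>(p, X(p)) + Y(s) (\<Phi>(p, X(p)) - \<Phi>(s,
  X(s))). The first part uses L1 continuity of \<open>Y\<close> and the bound of \<Phi>, the second
  domination and continuity of the paths of X. Derivatives of \<Phi> do not enter, so this reaches
  both end points, even t = 0.\<close>

lemma mean_value_continuous: "continuous_on {t..T} mean_value"
  unfolding continuous_on_sequentially comp_def
proof (intro allI ballI impI, elim conjE)
  fix s p assume s: "s \<in> {t..T}" and p: "\<forall>n. p n \<in> {t..T}" "p \<longlonglongrightarrow> s"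
  have pn: "p n \<in> {t..T}" for n using p(1) by blast
  have sub: "{t..T} \<subseteq> {0..T}" using t by auto
  note [measurable] = Y_measurable[OF s] Y_measurable[OF pn] \<Phi>_measurable[OF s] \<Phi>_measurable[OF pn]
  have bd: "\<bar>\<Phi> r y\<bar> \<le> B\<^sub>\<Phi>" if "r \<in> {t..T}" for r y using that sub by (intro \<Phi>_bound) auto
  let ?d = "\<lambda>n \<omega>. \<Phi> (p n) (X (p n) \<omega>) - \<Phi> s (X s \<omega>)"
  have i1: "integrable M (\<lambda>\<omega>. (Y (p n) \<omega> - Y s \<omega>) * \<Phi> (p n) (X (p n) \<omega>))" for n
  proof (rule Bochner_Integration.integrable_bound)
    show "integrable M (\<lambda>\<omega>. (Y (p n) \<omega> - Y s \<omega>) * B\<^sub>\<Phi>)" using Y_integrable[OF s] Y_integrable[OF pn] by simp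
    show "AE \<omega> in M. norm ((Y (p n) \<omega> - Y s \<omega>) * \<Phi> (p n) (X (p n) \<omega>)) \<le> norm ((Y (p n) \<omega> - Y s \<omega>) * B\<^sub>\<Phi>)"
      using bd[OF pn] by (intro AE_I2) (auto simp: abs_mult intro!: mult_left_mono order_trans[OF bd[OF pn] abs_ge_self])
  qed measurable
  have i2: "integrable M (\<lambda>\<omega>. Y s \<omega> * ?d n \<omega>)" for n
  proof (rule Bochner_Integration.integrable_bound)
    show "integrable M (\<lambda>\<omega>. Y s \<omega> * (2 * B\<^sub>\<Phi>))" using Y_integrable[OF s] by simp
    show "AE \<omega> in M. norm (Y s \<omega> * ?d n \<omega>) \<le> norm (Y s \<omega> * (2 * B\<^sub>\<Phi>))"
    proof (rule AE_I2)
      fix \<omega>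
      have "\<bar>?d n \<omega>\<bar> \<le> \<bar>2 * B\<^sub>\<Phi>\<bar>" using bd[OF pn, of n "X (p n) \<omega>"] bd[OF s, of "X s \<omega>"] by linarith
      then show "norm (Y s \<omega> * ?d n \<omega>) \<le> norm (Y s \<omega> * (2 * B\<^sub>\<Phi>))"
        unfolding real_norm_def abs_mult[of "Y s \<omega>"] by (intro mult_left_mono) auto
    qed
  qed measurable
  have i3: "integrable M (\<lambda>\<omega>. Y r \<omega> * \<Phi> r (X r \<omega>))" if r: "r \<in> {t..T}" for r
    by (rule weight(4)[OF r slice_measurable[OF deriv_cont(4) r] bd[OF r]])
  have "mean_value (p n) - mean_value s = expectation (\<lambda>\<omega>. (Y (p n) \<omega> - Y s \<omega>) * \<Phi> (p n) (X (p n) \<omega>)) + expectation (\<lambda>\<omega>. Y s \<omega> * ?d n \<omega>)" for n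
    unfolding mean_value_def
    by (subst Bochner_Integration.integral_diff[symmetric, OF i3[OF pn] i3[OF s]],
        subst Bochner_Integration.integral_add[symmetric, OF i1 i2], simp add: algebra_simps)
  moreover have "(\<lambda>n. expectation (\<lambda>\<omega>. (Y (p n) \<omega> - Y s \<omega>) * \<Phi> (p n) (X (p n) \<omega>))) \<longlonglongrightarrow> 0"
  proof (rule Lim_null_comparison)
    have "(\<lambda>n. expectation (\<lambda>\<omega>. \<bar>Y (p n) \<omega> - Y s \<omega>\<bar>) * B\<^sub>\<Phi>) \<longlonglongrightarrow> 0 * B\<^sub>\<Phi>"
      by (intro tendsto_mult tendsto_const Y_mean_continuous s pn p(2))
    then show "(\<lambda>n. expectation (\<lambda>\<omega>. \<bar>Y (p n) \<omega> - Y s \<omega>\<bar> * B\<^sub>\<Phi>)) \<longlonglongrightarrow> 0" by simp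
    have "norm (expectation (\<lambda>\<omega>. (Y (p n) \<omega> - Y s \<omega>) * \<Phi> (p n) (X (p n) \<omega>))) \<le> expectation (\<lambda>\<omega>. \<bar>Y (p n) \<omega> - Y s \<omega>\<bar> * B\<^sub>\<Phi>)" for n
    proof -
      have "norm (expectation (\<lambda>\<omega>. (Y (p n) \<omega> - Y s \<omega>) * \<Phi> (p n) (X (p n) \<omega>)))
        \<le> expectation (\<lambda>\<omega>. norm ((Y (p n) \<omega> - Y s \<omega>) * \<Phi> (p n) (X (p n) \<omega>)))"
        by (rule integral_norm_bound)
      also have "\<dots> \<le> expectation (\<lambda>\<omega>. \<bar>Y (p n) \<omega> - Y s \<omega>\<bar> * B\<^sub>\<Phi>)"
      proof (rule integral_mono)
        show "integrable M (\<lambda>\<omega>. norm ((Y (p n) \<omega> - Y s \<omega>) * \<Phi> (p n) (X (p n) \<omega>)))"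
          using i1 by (rule integrable_norm)
        show "integrable M (\<lambda>\<omega>. \<bar>Y (p n) \<omega> - Y s \<omega>\<bar> * B\<^sub>\<Phi>)"
          using Y_integrable[OF s] Y_integrable[OF pn] by simp
        show "norm ((Y (p n) \<omega> - Y s \<omega>) * \<Phi> (p n) (X (p n) \<omega>)) \<le> \<bar>Y (p n) \<omega> - Y s \<omega>\<bar> * B\<^sub>\<Phi>" for \<omega>
          unfolding real_norm_def abs_mult by (intro mult_left_mono bd pn) auto
      qed
      finally show ?thesis .
    qed
    then show "eventually (\<lambda>n. norm (expectation (\<lambda>\<omega>. (Y (p n) \<omega> - Y s \<omega>) * \<Phi> (p n) (X (p n) \<omega>)))
        \<le> expectation (\<lambda>\<omega>. \<bar>Y (p n) \<omega> - Y s \<omega>\<bar> * B\<^sub>\<Phi>)) sequentially" by simp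
  qed
  moreover have "(\<lambda>n. expectation (\<lambda>\<omega>. Y s \<omega> * ?d n \<omega>)) \<longlonglongrightarrow> expectation (\<lambda>\<omega>. 0)"
  proof (rule integral_dominated_convergence[where w="\<lambda>\<omega>. Y s \<omega> * (2 * B\<^sub>\<Phi>)"])
    show "integrable M (\<lambda>\<omega>. Y s \<omega> * (2 * B\<^sub>\<Phi>))" using Y_integrable[OF s] by simp
    show "AE \<omega> in M. (\<lambda>n. Y s \<omega> * ?d n \<omega>) \<longlonglongrightarrow> 0"
    proof (rule AE_I2)
      fix \<omega> assume \<omega>: "\<omega> \<in> space M"
      have "(\<lambda>n. \<Phi> (p n) (X (p n) \<omega>)) \<longlonglongrightarrow> \<Phi> s (X s \<omega>)"
        using continuous_on_tendsto_compose[OF path_continuous[OF deriv_cont(4) \<omega>] p(2) s] pn by simp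
      then have "(\<lambda>n. Y s \<omega> * ?d n \<omega>) \<longlonglongrightarrow> Y s \<omega> * (\<Phi> s (X s \<omega>) - \<Phi> s (X s \<omega>))"
        by (intro tendsto_intros)
      then show "(\<lambda>n. Y s \<omega> * ?d n \<omega>) \<longlonglongrightarrow> 0" by simp
    qed
    show "AE \<omega> in M. norm (Y s \<omega> * ?d n \<omega>) \<le> Y s \<omega> * (2 * B\<^sub>\<Phi>)" for n
    proof (rule AE_I2)
      fix \<omega>
      have "\<bar>?d n \<omega>\<bar> \<le> 2 * B\<^sub>\<Phi>" using bd[OF pn, of n "X (p n) \<omega>"] bd[OF s, of "X s \<omega>"] by linarith
      then show "norm (Y s \<omega> * ?d n \<omega>) \<le> Y s \<omega> * (2 * B\<^sub>\<Phi>)"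
        using Y_pos[of s \<omega>] by (simp add: abs_mult)
    qed
  qed measurable
  ultimately have "(\<lambda>n. mean_value (p n) - mean_value s) \<longlonglongrightarrow> 0 + expectation (\<lambda>\<omega>. 0)"
    by (simp only: tendsto_add)
  then show "(\<lambda>n. mean_value (p n)) \<longlonglongrightarrow> mean_value s" by (simp add: LIM_zero_iff)
qed

text \<open>The stochastic integrals over [s, s + k n] are chosen for every \<open>n\<close> at
  once, which provides the data of \<open>one_step\<close>.\<close>

lemma mean_value_right_derivative:
  assumes s: "t < s" "s < T" and k: "\<And>n. 0 < k n" "\<And>n. s + k n \<le> T" "\<And>n. k n \<le> 1" "k \<longlonglongrightarrow> 0"
  shows "(\<lambda>n. (mean_value (s + k n) - mean_value s) / k n) \<longlonglongrightarrow> 0"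
proof -
  define Q where "Q n V J \<longleftrightarrow> (\<forall>i. has_ito_integral M W s (s + k n) (\<lambda>r \<omega>. \<sigma> (X r \<omega>) $ i) (V i)) \<and>
    has_ito_integral M W s (s + k n) (\<lambda>r \<omega>. u r (X r \<omega>)) J \<and>
    (\<forall>i. AE \<omega> in M. (X (s + k n) \<omega> - X s \<omega>) $ i = sqrt \<epsilon> * V i \<omega> + (LBINT r:{s..s + k n}. b (X r \<omega>)) $ i) \<and>
    (AE \<omega> in M. J\<^sub>u (s + k n) \<omega> = J\<^sub>u s \<omega> + J \<omega>)" for n V J
  have "\<exists>V J. Q n V J" for n
  proof -
    have "t \<le> s" "s < s + k n" "s + k n \<le> T" using s k(1,2)[of n] by auto
    then show ?thesis unfolding Q_def by (rule increment_representation) blast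
  qed
  then obtain V J where "\<And>n. Q n (V n) (J n)" by metis
  note VJ = this[unfolded Q_def]
  interpret one_step M W T \<epsilon> b \<sigma> u \<Phi> t x X C B\<^sub>\<Phi> s k V J
    using VJ by unfold_locales (use s t k in auto)
  show ?thesis unfolding mean_value_def by (rule one_step_limit)
qed

text \<open>Over an interval of length 0 the mean square bound forces the stochastic integral to
  vanish almost everywhere, so the initial weight is 1.\<close>

lemma mean_value_initial: "mean_value t = \<Phi> t x"
proof -
  have t_in: "t \<in> {t..T}" using t by simp
  note [measurable] = Y_measurable[OF t_in] \<Phi>_measurable[OF t_in]
  have tame: "tame t t C (\<lambda>s \<omega>. u s (X s \<omega>))" using t by (intro tame_subinterval[OF tame_u]) auto
  have "mean_square M (J\<^sub>u t) = 0"
    using ito_mean_square_le[OF tame has_ito_J\<^sub>u[OF t_in]] by simp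
  then have J0: "AE \<omega> in M. J\<^sub>u t \<omega> = 0" by (rule mean_square_eq_0_AE[OF J\<^sub>u_measurable[OF t_in]])
  have A0: "A\<^sub>u t \<omega> = 0" for \<omega>
  proof -
    have "continuous_on {t..t} (\<lambda>r. (norm (u r (X r \<omega>)))\<^sup>2)" by simp
    from LBINT_eq_integral[OF this] show ?thesis by (simp add: A\<^sub>u_def)
  qed
  have X0: "AE \<omega> in M. X t \<omega> = x" using X by (simp add: strong_solution_def)
  have "mean_value t = expectation (\<lambda>\<omega>. \<Phi> t x)"
    unfolding mean_value_def
  proof (rule integral_cong_AE)
    show "AE \<omega> in M. Y t \<omega> * \<Phi> t (X t \<omega>) = \<Phi> t x"
      using J0 X0 by eventually_elim (simp add: Y_def A0)
  qed measurable
  then show ?thesis by (simp add: prob_space)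
qed

theorem feynman_kac: "expectation (\<lambda>\<omega>. Y T \<omega> * \<Phi> T (X T \<omega>)) = \<Phi> t x"
proof -
  have "mean_value T = mean_value t"
    by (rule constant_if_right_derivative_zero[OF t(2) mean_value_continuous mean_value_right_derivative])
  then show ?thesis by (simp add: mean_value_initial) (simp add: mean_value_def)
qed

section \<open>The second moment\<close>

text \<open>The new measure has density 1 / Y(T) with respect to the old one, so the old one has
  density Y(T) with respect to the new. One of the two factors Y(T) in the second moment is used up
  in returning to the original measure.\<close>

lemma second_moment_eq:
  assumes h: "h \<in> borel_measurable borel"
  shows "second_moment M W \<epsilon> T h u t X = expectation (\<lambda>\<omega>. Y T \<omega> * exp (- (2 / \<epsilon>) * h (X T \<omega>)))"
proof -
  have T_in: "T \<in> {t..T}" using t by simp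
  let ?D = "tilted_density M W \<epsilon> T u t X"
  have D: "?D \<omega> = inverse (Y T \<omega>)" for \<omega>
    unfolding tilted_density_def Y_def A\<^sub>u_def exp_minus[symmetric] by simp
  note [measurable] = Y_measurable[OF T_in] h
  have [measurable]: "?D \<in> borel_measurable M" unfolding D by measurable
  have [measurable]: "X T \<in> borel_measurable M"
    using X T_in by (auto simp: strong_solution_def intro: measurable_F_M)
  define P where "P = tilted_measure M W \<epsilon> T u t X"
  have P: "P = density M (\<lambda>\<omega>. ennreal (?D \<omega>))" by (simp add: P_def tilted_measure_def)
  \<comment> \<open>Sigma-finiteness, needed for uniqueness of the Radon-Nikodym derivative, follows
    from finiteness of the density.\<close>
  interpret P: sigma_finite_measure P
    unfolding P by (rule sigma_finite_iff_density_finite[THEN iffD2]) auto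
  have YM: "Y T \<in> borel_measurable P" unfolding P by simp
  have "density P (\<lambda>\<omega>. ennreal (Y T \<omega>)) = density M (\<lambda>\<omega>. ennreal (?D \<omega>) * ennreal (Y T \<omega>))"
    unfolding P by (rule density_density_eq) auto
  also have "\<dots> = density M (\<lambda>\<omega>. 1)"
  proof (intro density_cong AE_I2)
    fix \<omega>
    have "ennreal (inverse (Y T \<omega>)) * ennreal (Y T \<omega>) = ennreal (inverse (Y T \<omega>) * Y T \<omega>)"
      using Y_pos[of T \<omega>] by (intro ennreal_mult[symmetric]) auto
    also have "inverse (Y T \<omega>) * Y T \<omega> = 1" using Y_pos[of T \<omega>] by simp
    finally show "ennreal (?D \<omega>) * ennreal (Y T \<omega>) = 1" by (simp add: D)
  qed auto
  finally have "density P (\<lambda>\<omega>. ennreal (Y T \<omega>)) = M" by (simp add: density_1)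
  then have "AE \<omega> in P. ennreal (Y T \<omega>) = RN_deriv P M \<omega>"
    using YM by (intro P.RN_deriv_unique) auto
  then have RN: "AE \<omega> in P. enn2real (RN_deriv P M \<omega>) = Y T \<omega>"
    by eventually_elim (metis Y_pos enn2real_ennreal less_imp_le)
  have "second_moment M W \<epsilon> T h u t X = (\<integral>\<omega>. exp (- (2 / \<epsilon>) * h (X T \<omega>)) * (enn2real (RN_deriv P M \<omega>))\<^sup>2 \<partial>P)"
    by (simp add: second_moment_def P_def Let_def)
  also have "\<dots> = (\<integral>\<omega>. exp (- (2 / \<epsilon>) * h (X T \<omega>)) * (Y T \<omega>)\<^sup>2 \<partial>P)"
  proof (rule integral_cong_AE)
    have [measurable]: "X T \<in> borel_measurable P" "Y T \<in> borel_measurable P" unfolding P by simp_all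
    show "(\<lambda>\<omega>. exp (- (2 / \<epsilon>) * h (X T \<omega>)) * (Y T \<omega>)\<^sup>2) \<in> borel_measurable P" by measurable
    show "(\<lambda>\<omega>. exp (- (2 / \<epsilon>) * h (X T \<omega>)) * (enn2real (RN_deriv P M \<omega>))\<^sup>2) \<in> borel_measurable P" by measurable
    show "AE \<omega> in P. exp (- (2 / \<epsilon>) * h (X T \<omega>)) * (enn2real (RN_deriv P M \<omega>))\<^sup>2 = exp (- (2 / \<epsilon>) * h (X T \<omega>)) * (Y T \<omega>)\<^sup>2"
      using RN by eventually_elim simp
  qed
  also have "\<dots> = expectation (\<lambda>\<omega>. ?D \<omega> *\<^sub>R (exp (- (2 / \<epsilon>) * h (X T \<omega>)) * (Y T \<omega>)\<^sup>2))"
    unfolding P by (rule integral_density) (auto simp: D less_imp_le[OF Y_pos])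
  also have "\<dots> = expectation (\<lambda>\<omega>. Y T \<omega> * exp (- (2 / \<epsilon>) * h (X T \<omega>)))"
    using Y_pos[of T] by (intro Bochner_Integration.integral_cong refl)
      (simp add: D power2_eq_square less_imp_neq[symmetric])
  finally show ?thesis .
qed

end

theorem theorem3p1:
  fixes T \<epsilon> :: real
    and b :: "real^'d \<Rightarrow> real^'d"
    and \<sigma> :: "real^'d \<Rightarrow> real^'d^'d"
    and h :: "real^'d \<Rightarrow> real"
    and u :: "real \<Rightarrow> real^'d \<Rightarrow> real^'d"
    and \<Phi> :: "real \<Rightarrow> real^'d \<Rightarrow> real"
    and M :: "'a measure"
    and W :: "real \<Rightarrow> 'a \<Rightarrow> real^'d"
  assumes "T > 0" and "\<epsilon> > 0"
    and "bounded (range b)" and "\<exists>L. L-lipschitz_on UNIV b"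
    and "bounded (range \<sigma>)" and "\<exists>L. L-lipschitz_on UNIV \<sigma>"
    and "\<exists>c>0. \<forall>x v. v \<bullet> ((\<sigma> x ** transpose (\<sigma> x)) *v v) \<ge> c * (norm v)\<^sup>2"
    and "\<forall>x. invertible (\<sigma> x)" and "bounded (range (\<lambda>x. matrix_inv (\<sigma> x)))"
    and "continuous_on UNIV h" and "bounded (range h)"
    and "bounded ((\<lambda>(t, x). u t x) ` ({0..T} \<times> UNIV))"
    and "\<forall>x. continuous_on {0..T} (\<lambda>t. u t x)"
    and "\<exists>L. \<forall>t\<in>{0..T}. L-lipschitz_on UNIV (u t)"
    and "bounded_classical_solution b \<sigma> \<epsilon> T h u \<Phi>"
    and "\<forall>\<Psi>. bounded_classical_solution b \<sigma> \<epsilon> T h u \<Psi> \<longrightarrow> (\<forall>t\<in>{0..T}. \<forall>x. \<Psi> t x = \<Phi> t x)"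
    and "\<forall>\<delta>. 0 < \<delta> \<and> \<delta> < T \<longrightarrow> derivatives_bounded_continuous_on T ({\<delta>..T} \<times> UNIV) \<Phi>"
    and "wiener_process M W"
  shows "\<forall>t\<in>{0..T}. \<forall>x X. strong_solution M W b \<sigma> \<epsilon> T t x X \<longrightarrow>
           \<Phi> t x = second_moment M W \<epsilon> T h u t X"
proof (intro ballI allI impI)
  fix t x X assume t: "t \<in> {0..T}" and X: "strong_solution M W b \<sigma> \<epsilon> T t x X"
  obtain C\<^sub>b C\<^sub>\<sigma> where C: "\<And>y. norm (b y) \<le> C\<^sub>b" "\<And>y. norm (\<sigma> y) \<le> C\<^sub>\<sigma>"
    using assms(3,5) unfolding bounded_iff by auto
  have bounded_image: "\<exists>K. \<forall>s\<in>{0..T}. \<forall>y. norm (f s y) \<le> K"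
    if "bounded ((\<lambda>(s, y). f s y) ` ({0..T} \<times> UNIV))" for f :: "real \<Rightarrow> real^'d \<Rightarrow> 'b::real_normed_vector"
    using that unfolding bounded_iff by fastforce
  obtain C\<^sub>u where Cu: "\<And>s y. s \<in> {0..T} \<Longrightarrow> norm (u s y) \<le> C\<^sub>u"
    using bounded_image[OF assms(12)] by blast
  obtain B where B: "\<And>s y. s \<in> {0..T} \<Longrightarrow> \<bar>\<Phi> s y\<bar> \<le> B"
    using assms(15) bounded_image[of \<Phi>] unfolding bounded_classical_solution_def by (metis real_norm_def)
  define K where "K = \<bar>C\<^sub>b\<bar> + \<bar>C\<^sub>\<sigma>\<bar> + \<bar>C\<^sub>u\<bar>"
  have K: "0 \<le> K" "C\<^sub>b \<le> K" "C\<^sub>\<sigma> \<le> K" "C\<^sub>u \<le> K" by (auto simp: K_def)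
  obtain L where L: "\<And>s. s \<in> {0..T} \<Longrightarrow> L-lipschitz_on UNIV (u s)" using assms(14) by blast
  \<comment> \<open>Continuity in time and in space separately becomes joint continuity because the
    Lipschitz constant \<open>L\<close> is the same at all times.\<close>
  have u_cont: "continuous_on ({0..T} \<times> UNIV) (\<lambda>(s, y). u s y)"
    unfolding continuous_on_sequentially comp_def
  proof (intro allI ballI impI, elim conjE)
    fix p :: "nat \<Rightarrow> real \<times> (real^'d)" and a
    assume a: "a \<in> {0..T} \<times> UNIV" and p: "\<forall>n. p n \<in> {0..T} \<times> UNIV" "p \<longlonglongrightarrow> a"
    have pn: "fst (p n) \<in> {0..T}" for n using p(1) by (auto simp: mem_Times_iff)
    have lim: "(\<lambda>n. fst (p n)) \<longlonglongrightarrow> fst a" "(\<lambda>n. snd (p n)) \<longlonglongrightarrow> snd a"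
      using p(2) by (auto intro: tendsto_fst tendsto_snd)
    have "(\<lambda>n. u (fst (p n)) (snd a)) \<longlonglongrightarrow> u (fst a) (snd a)"
      using continuous_on_tendsto_compose[OF assms(13)[rule_format] lim(1)] a pn by (auto simp: mem_Times_iff)
    moreover have "(\<lambda>n. u (fst (p n)) (snd (p n)) - u (fst (p n)) (snd a)) \<longlonglongrightarrow> 0"
    proof (rule Lim_null_comparison)
      have "(\<lambda>n. L * dist (snd (p n)) (snd a)) \<longlonglongrightarrow> L * dist (snd a) (snd a)"
        by (intro tendsto_intros lim)
      then show "(\<lambda>n. L * dist (snd (p n)) (snd a)) \<longlonglongrightarrow> 0" by simp
      show "eventually (\<lambda>n. norm (u (fst (p n)) (snd (p n)) - u (fst (p n)) (snd a)) \<le> L * dist (snd (p n)) (snd a)) sequentially"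
        using lipschitz_onD[OF L[OF pn]] by (auto simp: dist_norm)
    qed
    ultimately have "(\<lambda>n. (u (fst (p n)) (snd (p n)) - u (fst (p n)) (snd a)) + u (fst (p n)) (snd a)) \<longlonglongrightarrow> 0 + u (fst a) (snd a)"
      by (intro tendsto_add)
    then show "(\<lambda>n. case p n of (s, y) \<Rightarrow> u s y) \<longlonglongrightarrow> (case a of (s, y) \<Rightarrow> u s y)"
      by (simp add: case_prod_beta)
  qed
  interpret feynman_kac M W T \<epsilon> b \<sigma> u \<Phi> t x X K B
  proof unfold_locales
    show "wiener_process M W" by (rule assms(18))
    show "0 \<le> t" "t \<le> T" "0 < \<epsilon>" "0 \<le> K" using t assms(2) K by auto
    show "norm (b y) \<le> K" "norm (\<sigma> y) \<le> K" for y using C[of y] K by linarith+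
    show "continuous_on UNIV b" "continuous_on UNIV \<sigma>"
      using assms(4,6) by (auto intro: lipschitz_on_continuous_on)
    show "norm (u s y) \<le> K" if "s \<in> {0..T}" for s y using Cu[OF that, of y] K by linarith
    show "continuous_on ({0..T} \<times> UNIV) (\<lambda>(s, y). u s y)" by (rule u_cont)
    show "C12 T \<Phi>" using assms(15) by (simp add: bounded_classical_solution_def)
    show "\<bar>\<Phi> s y\<bar> \<le> B" if "s \<in> {0..T}" for s y using B[OF that] .
    show "time_deriv T \<Phi> s y + generator b \<sigma> \<epsilon> u s (\<Phi> s) y + 1 / \<epsilon> * (norm (u s y))\<^sup>2 * \<Phi> s y = 0"
      if "s \<in> {0..<T}" for s y
      using assms(15) that unfolding bounded_classical_solution_def by blast
    show "derivatives_bounded_continuous_on T ({\<delta>..T} \<times> UNIV) \<Phi>" if "0 < \<delta>" "\<delta> < T" for \<delta>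
      using assms(17) that by blast
    show "strong_solution M W b \<sigma> \<epsilon> T t x X" by (rule X)
  qed
  have "\<Phi> T y = exp (- (2 / \<epsilon>) * h y)" for y
    using assms(15) unfolding bounded_classical_solution_def by blast
  moreover have "h \<in> borel_measurable borel"
    using assms(10) by (rule borel_measurable_continuous_onI)
  ultimately show "\<Phi> t x = second_moment M W \<epsilon> T h u t X"
    using feynman_kac second_moment_eq by (simp only:)
qed

end
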